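(* Let $(\mathbf{c},\mathbf{d},\mathbf{B})$ be a datum. Then the constants $D(\mathbf{c},\mathbf{d},\mathbf{B})$ and $D(\mathbf{d},\mathbf{c},\mathbf{B}^* )$ can be computed by considering only centered gaussian functions, i.e. $$D(\mathbf{c},\mathbf{d},\mathbf{B})=D_g(\mathbf{c},\mathbf{d},\mathbf{B})\quad\text{and}\quad D(\mathbf{d},\mathbf{c},\mathbf{B}^* )=D_g(\mathbf{d},\mathbf{c},\mathbf{B}^* ).$$ Moreover, $$D(\mathbf{c},\mathbf{d},\mathbf{B})=D(\mathbf{d},\mathbf{c},\mathbf{B}^* ).$$ (All quantities take values in $(-\infty,+\infty]$.)
   Context: Let $E_1,\dots,E_k$ and $E^1,\dots,E^m$ be Euclidean spaces (finite-dimensional real Hilbert spaces with Lebesgue measure). Let $\mathbf{B}=(B_{ij})_{1\le i\le k,1\le j\le m}$ with each $B_{ij}:E_i\to E^j$ linear, and let $\mathbf{B}^*=(B_{ij}^* )$ be the collection of adjoints $B_{ij}^*:E^j\to E_i$. Let $\mathbf{c}=(c_i)_{1\le i\le k}$ and $\mathbf{d}=(d_j)_{1\le j\le m}$ be positive real numbers with $\sum_{i=1}^k c_i\dim(E_i)=\sum_{j=1}^m d_j\dim(E^j)$. The triple $(\mathbf{c},\mathbf{d},\mathbf{B})$ is called a datum. $D(\mathbf{c},\mathbf{d},\mathbf{B})$ denotes the smallest constant $D\in(-\infty,+\infty]$ such that $$\prod_{i=1}^k\Big(\int_{E_i}f_i\Big)^{c_i}\le e^{D}\prod_{j=1}^m\Big(\int_{E^j}g_j\Big)^{d_j}$$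 for all measurable $f_i:E_i\to[0,\infty)$, $g_j:E^j\to[0,\infty)$ satisfying $$\prod_{i=1}^k f_i^{c_i}(x_i)\le\prod_{j=1}^m g_j^{d_j}\Big(\sum_{i=1}^k c_iB_{ij}x_i\Big)\qquad\forall x_i\in E_i,\ 1\le i\le k.$$ A centered gaussian function on a Euclidean space $E$ is a function of the form $x\mapsto\exp(-\tfrac12\langle A^{-1}x,x\rangle)$ with $A$ self-adjoint positive-definite on $E$. $D_g(\mathbf{c},\mathbf{d},\mathbf{B})$ denotes the smallest constant $D$ in the same statement when the $f_i$ and $g_j$ are required to be centered gaussian functions. $D(\mathbf{d},\mathbf{c},\mathbf{B}^* )$ and $D_g(\mathbf{d},\mathbf{c},\mathbf{B}^* )$ are the same quantities for the dual datum: $D(\mathbf{d},\mathbf{c},\mathbf{B}^* )$ is the smallest $D$ such that $\prod_{j}(\int_{E^j}g_j)^{d_j}\le e^{D}\prod_i(\int_{E_i}f_i)^{c_i}$ for all measurable $f_i:E_i\to[0,\infty)$, $g_j:E^j\to[0,\infty)$ satisfying $\prod_{j}g_j^{d_j}(y_j)\le\prod_i f_i^{c_i}\big(\sum_{j}d_jB_{ij}^*y_j\big)$ for all $y_j\in E^j$, $1\le j\le m$; and $D_g(\mathbf{d},\mathbf{c},\mathbf{B}^* )$ is the same with all functions required to be centered gaussian functions. *)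

theory Defs
  imports "HOL-Analysis.Analysis"
begin

text \<open>
  A Euclidean space of arbitrary finite dimension (possibly \<open>0\<close>) is a linear subspace of a type of
  class \<^class>\<open>euclidean_space\<close>, with the inherited inner product. Every finite family of
  Euclidean spaces embeds isometrically in this way into one such type, namely into its direct sum.
\<close>

definition orthonormal_basis_of :: "'a::euclidean_space set \<Rightarrow> 'a set \<Rightarrow> bool" where
  "orthonormal_basis_of S b \<longleftrightarrow>
     b \<subseteq> S \<and> pairwise orthogonal b \<and> (\<forall>v\<in>b. norm v = 1) \<and> span b = S"

lemma orthonormal_basis_of_exists:
  fixes S :: "'a::euclidean_space set"
  assumes "subspace S"
  shows "\<exists>b. orthonormal_basis_of S b"
  using orthonormal_basis_subspace[OF assms] unfolding orthonormal_basis_of_def by metis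

text \<open>
  Lebesgue measure on a subspace is the image of the product Lebesgue measure under the linear
  isometry given by an orthonormal basis (it does not depend on the basis), and is then completed,
  so that measurability with respect to it is Lebesgue measurability.
  On \<open>{0}\<close> it is the unit point mass.
\<close>

definition lborel_on :: "'a::euclidean_space set \<Rightarrow> 'a measure" where
  "lborel_on S =
     (let b = (SOME b. orthonormal_basis_of S b)
      in distr (\<Pi>\<^sub>M v\<in>b. (lborel :: real measure)) (restrict_space borel S)
           (\<lambda>t. \<Sum>v\<in>b. t v *\<^sub>R v))"

definition lebesgue_measure_on :: "'a::euclidean_space set \<Rightarrow> 'a measure" where
  "lebesgue_measure_on S = completion (lborel_on S)"

lemma space_lebesgue_measure_on [simp]: "space (lebesgue_measure_on S) = S"
  by (simp add: lebesgue_measure_on_def lborel_on_def Let_def space_restrict_space)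

text \<open>
  The adjoint of a linear map from \<open>S\<close> to another subspace. Since \<open>S\<close> may be a proper subspace,
  this is in general not the \<^const>\<open>adjoint\<close> on the ambient types, but its orthogonal
  projection to \<open>S\<close>.
\<close>

definition adjoint_on ::
  "'a::euclidean_space set \<Rightarrow> ('a \<Rightarrow> 'b::euclidean_space) \<Rightarrow> 'b \<Rightarrow> 'a" where
  "adjoint_on S B y = (THE z. z \<in> S \<and> (\<forall>x\<in>S. B x \<bullet> y = x \<bullet> z))"

lemma adjoint_on_works:
  fixes B :: "'a::euclidean_space \<Rightarrow> 'b::euclidean_space"
  assumes S: "subspace S" and B: "linear B"
  shows "adjoint_on S B y \<in> S \<and> (\<forall>x\<in>S. B x \<bullet> y = x \<bullet> adjoint_on S B y)"
proof -
  obtain z w where z: "z \<in> span S" and w: "\<And>v. v \<in> span S \<Longrightarrow> orthogonal w v"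
    and eq: "adjoint B y = z + w"
    by (rule orthogonal_subspace_decomp_exists[of S "adjoint B y"]) blast
  have span: "span S = S"
    using S by (simp add: span_eq_iff)
  have char: "z \<in> S \<and> (\<forall>x\<in>S. B x \<bullet> y = x \<bullet> z)"
  proof (intro conjI ballI)
    show "z \<in> S" using z span by simp
    fix x assume "x \<in> S"
    then have "w \<bullet> x = 0" using w[of x] span by (simp add: orthogonal_def)
    then show "B x \<bullet> y = x \<bullet> z"
      using adjoint_works[OF B, of x y] eq by (simp add: inner_add_right inner_commute)
  qed
  have uniq: "z' = z" if z': "z' \<in> S \<and> (\<forall>x\<in>S. B x \<bullet> y = x \<bullet> z')" for z'
  proof -
    have "z' - z \<in> S" using z' char S by (simp add: subspace_diff)
    then have "(z' - z) \<bullet> z' = (z' - z) \<bullet> z" using z' char by metis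
    then have "(z' - z) \<bullet> (z' - z) = 0" by (simp add: inner_diff_right)
    then show ?thesis by simp
  qed
  show ?thesis
    unfolding adjoint_on_def by (rule theI2[where a = z]) (use char uniq in blast)+
qed

text \<open>
  A linear map between subspaces is given as the restriction of a linear map of the ambient types;
  every linear map between subspaces has such an extension, and all notions below depend on the
  restriction only.
\<close>

definition brascamp_lieb_datum ::
  "nat \<Rightarrow> (nat \<Rightarrow> real) \<Rightarrow> (nat \<Rightarrow> 'a::euclidean_space set) \<Rightarrow>
   nat \<Rightarrow> (nat \<Rightarrow> real) \<Rightarrow> (nat \<Rightarrow> 'b::euclidean_space set) \<Rightarrow>
   (nat \<Rightarrow> nat \<Rightarrow> 'a \<Rightarrow> 'b) \<Rightarrow> bool" where
  "brascamp_lieb_datum k c E m d F B \<longleftrightarrow>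
     (\<forall>i\<in>{1..k}. subspace (E i) \<and> 0 < c i) \<and>
     (\<forall>j\<in>{1..m}. subspace (F j) \<and> 0 < d j) \<and>
     (\<forall>i\<in>{1..k}. \<forall>j\<in>{1..m}. linear (B i j) \<and> B i j ` E i \<subseteq> F j) \<and>
     (\<Sum>i=1..k. c i * real (dim (E i))) = (\<Sum>j=1..m. d j * real (dim (F j)))"

definition dual_maps ::
  "(nat \<Rightarrow> 'a::euclidean_space set) \<Rightarrow> (nat \<Rightarrow> nat \<Rightarrow> 'a \<Rightarrow> 'b::euclidean_space) \<Rightarrow>
   nat \<Rightarrow> nat \<Rightarrow> 'b \<Rightarrow> 'a" where
  "dual_maps E B = (\<lambda>j i. adjoint_on (E i) (B i j))"

text \<open>For positive exponents; in particular \<open>\<infinity>\<close> to the power \<open>a\<close> is \<open>\<infinity>\<close>.\<close>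

definition ennreal_powr :: "ennreal \<Rightarrow> real \<Rightarrow> ennreal" where
  "ennreal_powr x a = (if x = \<infinity> then \<infinity> else ennreal (enn2real x powr a))"

definition nonneg_measurable_on :: "'a::euclidean_space set \<Rightarrow> ('a \<Rightarrow> real) \<Rightarrow> bool" where
  "nonneg_measurable_on S f \<longleftrightarrow>
     f \<in> borel_measurable (lebesgue_measure_on S) \<and> (\<forall>x\<in>S. 0 \<le> f x)"

definition centered_gaussian_on :: "'a::euclidean_space set \<Rightarrow> ('a \<Rightarrow> real) \<Rightarrow> bool" where
  "centered_gaussian_on S f \<longleftrightarrow>
     (\<exists>A. linear A \<and> A ` S \<subseteq> S \<and>
          (\<forall>x\<in>S. \<forall>y\<in>S. A x \<bullet> y = x \<bullet> A y) \<and>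
          (\<forall>x\<in>S. x \<noteq> 0 \<longrightarrow> 0 < A x \<bullet> x) \<and>
          (\<forall>x\<in>S. f x = exp (- (1/2) * (inv_into S A x \<bullet> x))))"

text \<open>
  The smallest constant for functions \<open>f i\<close> on \<open>E i\<close> in the class \<open>P (E i)\<close> and \<open>g j\<close> on \<open>F j\<close>
  in the class \<open>Q (F j)\<close>. Only real constants are compared, so the value is \<open>\<infinity>\<close> exactly if no real
  constant is admissible. Products of integrals use the convention \<open>0 * \<infinity> = 0\<close>.
\<close>

definition brascamp_lieb_const ::
  "('a::euclidean_space set \<Rightarrow> ('a \<Rightarrow> real) \<Rightarrow> bool) \<Rightarrow>
   ('b::euclidean_space set \<Rightarrow> ('b \<Rightarrow> real) \<Rightarrow> bool) \<Rightarrow>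
   nat \<Rightarrow> (nat \<Rightarrow> real) \<Rightarrow> (nat \<Rightarrow> 'a set) \<Rightarrow>
   nat \<Rightarrow> (nat \<Rightarrow> real) \<Rightarrow> (nat \<Rightarrow> 'b set) \<Rightarrow>
   (nat \<Rightarrow> nat \<Rightarrow> 'a \<Rightarrow> 'b) \<Rightarrow> ereal" where
  "brascamp_lieb_const P Q k c E m d F B =
     Inf {ereal D | D :: real. \<forall>f g.
       (\<forall>i\<in>{1..k}. P (E i) (f i)) \<longrightarrow>
       (\<forall>j\<in>{1..m}. Q (F j) (g j)) \<longrightarrow>
       (\<forall>x. (\<forall>i\<in>{1..k}. x i \<in> E i) \<longrightarrow>
          (\<Prod>i=1..k. f i (x i) powr c i)
            \<le> (\<Prod>j=1..m. g j (\<Sum>i=1..k. c i *\<^sub>R B i j (x i)) powr d j)) \<longrightarrow>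
       (\<Prod>i=1..k. ennreal_powr (\<integral>\<^sup>+ x. ennreal (f i x) \<partial>lebesgue_measure_on (E i)) (c i))
         \<le> ennreal (exp D) *
           (\<Prod>j=1..m. ennreal_powr (\<integral>\<^sup>+ y. ennreal (g j y) \<partial>lebesgue_measure_on (F j)) (d j))}"

definition bl_D ::
  "nat \<Rightarrow> (nat \<Rightarrow> real) \<Rightarrow> (nat \<Rightarrow> 'a::euclidean_space set) \<Rightarrow>
   nat \<Rightarrow> (nat \<Rightarrow> real) \<Rightarrow> (nat \<Rightarrow> 'b::euclidean_space set) \<Rightarrow>
   (nat \<Rightarrow> nat \<Rightarrow> 'a \<Rightarrow> 'b) \<Rightarrow> ereal" where
  "bl_D = brascamp_lieb_const nonneg_measurable_on nonneg_measurable_on"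

definition bl_Dg ::
  "nat \<Rightarrow> (nat \<Rightarrow> real) \<Rightarrow> (nat \<Rightarrow> 'a::euclidean_space set) \<Rightarrow>
   nat \<Rightarrow> (nat \<Rightarrow> real) \<Rightarrow> (nat \<Rightarrow> 'b::euclidean_space set) \<Rightarrow>
   (nat \<Rightarrow> nat \<Rightarrow> 'a \<Rightarrow> 'b) \<Rightarrow> ereal" where
  "bl_Dg = brascamp_lieb_const centered_gaussian_on centered_gaussian_on"

end

theory Submission
  imports Defs "HOL-Probability.Distributions"
begin

text \<open>
  Write \<open>Q\<close> for the quadratic form \<open>x \<mapsto> \<Sum>\<^sub>i c\<^sub>i P\<^sub>i(x\<^sub>i) - \<Sum>\<^sub>j d\<^sub>j R\<^sub>j(M\<^sub>j x)\<close> with \<open>M\<^sub>j x = \<Sum>\<^sub>i c\<^sub>i B\<^sub>i\<^sub>j x\<^sub>i\<close>. Centered gaussians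
  with forms \<open>P\<^sub>i\<close>, \<open>R\<^sub>j\<close> are admissible iff \<open>Q \<ge> 0\<close>, and they force \<open>\<Phi>(P, R) \<le> D\<close>, where \<open>\<Phi>\<close> is the
  logarithm of the quotient of the two products of gaussian integrals.

  Conversely, maximize \<open>\<Phi>\<close> together with a small logarithmic barrier. The stationarity condition yields
  finitely many vectors \<open>\<xi>\<^sub>l\<close> such that \<open>\<Sum>\<^sub>l \<xi>\<^sub>l \<otimes> \<xi>\<^sub>l\<close> dominates each \<open>P\<^sub>i\<^sup>-\<^sup>1\<close>, its image under \<open>M\<^sub>j\<close> is dominated
  by \<open>R\<^sub>j\<^sup>-\<^sup>1\<close>, and \<open>\<Sum>\<^sub>l Q(\<xi>\<^sub>l)\<close> is small. Let \<open>f\<^sub>i\<close> and \<open>g\<^sub>j\<close> evolve by the heat flows with covariances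
  \<open>t P\<^sub>i\<^sup>-\<^sup>1\<close> and \<open>t R\<^sub>j\<^sup>-\<^sup>1\<close>. Differentiating twice along the \<open>\<xi>\<^sub>l\<close> at a spatial minimum shows that the minimum of
  \<open>\<Sum>\<^sub>j d\<^sub>j ln g\<^sub>j(t, M\<^sub>j x) - \<Sum>\<^sub>i c\<^sub>i ln f\<^sub>i(t, x\<^sub>i)\<close> almost does not decrease. At small times it is at
  least about \<open>-\<Phi>(P, R)\<close> by the hypothesis on \<open>f\<close> and \<open>g\<close>, and at large times and \<open>x = 0\<close> it compares
  the total masses.

  The two data are related by inverting the forms: \<open>Q \<ge> 0\<close> for \<open>(P, R)\<close> gives the dual condition for
  \<open>(R\<^sup>-\<^sup>1, P\<^sup>-\<^sup>1)\<close> by the Cauchy--Schwarz inequality, and \<open>\<Phi>\<close> takes the same value because of the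
  homogeneity condition on the dimensions.
\<close>

text \<open>No determinant and no spectral theorem enters. The Gaussian integrals
  \<open>Zg S P\<close> and \<open>ZQ P R\<close> take the place of inverse square roots of
  determinants, of a form on one subspace and of \<open>Q\<close> on the product of the
  \<open>E i\<close>; up to a constant the barrier is \<mu> times the logarithm of the determinant
  of \<open>Q\<close>. How these integrals change is computed only for dilations and rank-one
  updates, where translation invariance and Fubini suffice.

  Rank-one updates also give stationarity: lowering \<open>P i\<close> along \<open>P i y\<close>,
  or \<open>R j\<close> along \<open>R j y\<close>, yields one scalar inequality for every
  \<open>y\<close>, and these are the two covariance comparisons. The \<xi> are
  \<open>sqrt (2 * \<mu>)\<close> times a \<open>Q\<close>-orthonormal basis, so their tensor sum is
  2\<mu> times the inverse of \<open>Q\<close>. Forms are only lowered because the maximization runs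
  over forms bounded by the identity, which supplies compactness; the heat flow needs just the
  one-sided comparisons.

  The maximizers may degenerate as \<mu> tends to 0. The starting time of the flow shrinks with
  them, so the defect has to beat the logarithm of that time.\<close>

abbreviation lbPi :: "'i set \<Rightarrow> ('i \<Rightarrow> real) measure" where
  "lbPi I \<equiv> PiM I (\<lambda>_. lborel)"

section \<open>Integration over finite products of the line\<close>

interpretation lborel_product: product_sigma_finite "\<lambda>_::'i. lborel :: real measure"
  by standard

text \<open>Induction splits off one coordinate, where the substitution rule on the line contributes
  a factor \<open>1/s\<close>. Translations and dilations are the only changes of variables on
  subspaces in the whole argument; general linear ones, with their determinants, never
  occur.\<close>

lemma nn_integral_PiM_affine:
  fixes F :: "('i \<Rightarrow> real) \<Rightarrow> ennreal"
  assumes "finite I" and s: "s > 0" and "F \<in> borel_measurable (lbPi I)"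
  shows "(\<integral>\<^sup>+t. F (\<lambda>i\<in>I. a i + s * t i) \<partial>lbPi I) = ennreal ((1/s) ^ card I) * (\<integral>\<^sup>+t. F t \<partial>lbPi I)"
  using assms(1,3)
proof (induction I arbitrary: F rule: finite_induct)
  case empty
  show ?case
    by (simp add: PiM_empty nn_integral_count_space_finite restrict_def)
next
  case (insert i I)
  note [measurable] = insert.prems
  let ?A = "\<lambda>J t. \<lambda>j\<in>J. a j + s * t j"
  have meas: "?A J \<in> lbPi J \<rightarrow>\<^sub>M lbPi J" for J
    by measurable
  have mF: "(\<lambda>t. F (?A (insert i I) t)) \<in> borel_measurable (lbPi (insert i I))"
    by (rule measurable_compose[OF meas insert.prems])
  have mG: "(\<lambda>x. \<integral>\<^sup>+y. F (x(i := y)) \<partial>lborel) \<in> borel_measurable (lbPi I)"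
    by measurable
  have "(\<integral>\<^sup>+t. F (?A (insert i I) t) \<partial>lbPi (insert i I))
      = (\<integral>\<^sup>+x. \<integral>\<^sup>+y. F (?A (insert i I) (x(i := y))) \<partial>lborel \<partial>lbPi I)"
    by (rule lborel_product.product_nn_integral_insert[OF insert.hyps mF])
  also have "\<dots> = (\<integral>\<^sup>+x. \<integral>\<^sup>+y. F ((?A I x)(i := a i + s * y)) \<partial>lborel \<partial>lbPi I)"
  proof (intro nn_integral_cong arg_cong[where f = F])
    fix x y
    show "?A (insert i I) (x(i := y)) = (?A I x)(i := a i + s * y)"
      using insert.hyps by (auto simp: fun_eq_iff restrict_def)
  qed
  also have "\<dots> = (\<integral>\<^sup>+x. ennreal (1/s) * (\<integral>\<^sup>+y. F ((?A I x)(i := y)) \<partial>lborel) \<partial>lbPi I)"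
  proof (intro nn_integral_cong)
    fix x assume x: "x \<in> space (lbPi I)"
    have "?A I x \<in> space (lbPi I)" by (simp add: space_PiM)
    then have "(\<lambda>y. (?A I x)(i := y)) \<in> lborel \<rightarrow>\<^sub>M lbPi (insert i I)"
      by (rule measurable_component_update) (use insert.hyps in auto)
    then have m: "(\<lambda>y. F ((?A I x)(i := y))) \<in> borel_measurable borel"
      using insert.prems measurable_compose measurable_lborel2 by blast
    have "ennreal (1/s) * (\<integral>\<^sup>+y. F ((?A I x)(i := y)) \<partial>lborel)
        = ennreal (1/s) * (ennreal s * (\<integral>\<^sup>+y. F ((?A I x)(i := a i + s * y)) \<partial>lborel))"
      using nn_integral_real_affine[OF m, of s "a i"] s by simp
    also have "\<dots> = (\<integral>\<^sup>+y. F ((?A I x)(i := a i + s * y)) \<partial>lborel)"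
      using s by (simp add: mult.assoc[symmetric] ennreal_mult'[symmetric])
    finally show "(\<integral>\<^sup>+y. F ((?A I x)(i := a i + s * y)) \<partial>lborel) = ennreal (1/s) * (\<integral>\<^sup>+y. F ((?A I x)(i := y)) \<partial>lborel)" ..
  qed
  also have "\<dots> = ennreal (1/s) * (\<integral>\<^sup>+x. (\<integral>\<^sup>+y. F ((?A I x)(i := y)) \<partial>lborel) \<partial>lbPi I)"
    by (intro nn_integral_cmult measurable_compose[OF meas[of I] mG])
  also have "(\<integral>\<^sup>+x. (\<integral>\<^sup>+y. F ((?A I x)(i := y)) \<partial>lborel) \<partial>lbPi I)
     = ennreal ((1/s) ^ card I) * (\<integral>\<^sup>+x. (\<integral>\<^sup>+y. F (x(i := y)) \<partial>lborel) \<partial>lbPi I)"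
    by (rule insert.IH[OF mG])
  also have "(\<integral>\<^sup>+x. (\<integral>\<^sup>+y. F (x(i := y)) \<partial>lborel) \<partial>lbPi I) = (\<integral>\<^sup>+t. F t \<partial>lbPi (insert i I))"
    using insert.hyps by (intro lborel_product.product_nn_integral_insert[symmetric]) auto
  also have "ennreal (1/s) * (ennreal ((1/s) ^ card I) * (\<integral>\<^sup>+t. F t \<partial>lbPi (insert i I)))
      = ennreal ((1/s) ^ card (insert i I)) * (\<integral>\<^sup>+t. F t \<partial>lbPi (insert i I))"
    using insert.hyps s by (simp add: mult.assoc[symmetric] ennreal_mult'[symmetric])
  finally show ?case .
qed

lemma nn_integral_gaussian_real:
  fixes a :: real
  assumes "a > 0"
  shows "(\<integral>\<^sup>+r. ennreal (exp (- (a * r\<^sup>2) / 2)) \<partial>lborel) = ennreal (sqrt (2 * pi / a))"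
proof -
  have "(\<integral>\<^sup>+r. ennreal (normal_density 0 (1 / sqrt a) r) \<partial>lborel) = 1"
    by (subst nn_integral_eq_integral) (use assms in auto)
  moreover have "exp (- (a * r\<^sup>2) / 2) = sqrt (2 * pi / a) * normal_density 0 (1 / sqrt a) r" for r
    using assms by (simp add: normal_density_def field_simps real_sqrt_mult real_sqrt_divide)
  ultimately show ?thesis
    using assms by (simp add: ennreal_mult nn_integral_cmult)
qed

subsection \<open>Lebesgue measure on a subspace\<close>

text \<open>The same choice of basis as inside \<open>lborel_on\<close>, so that
  \<open>lborel_on S\<close> is by mere unfolding the image of the product measure under
  \<open>emb S\<close>.\<close>

definition onb :: "'a::euclidean_space set \<Rightarrow> 'a set" where
  "onb S = (SOME b. orthonormal_basis_of S b)"

definition emb :: "'a::euclidean_space set \<Rightarrow> ('a \<Rightarrow> real) \<Rightarrow> 'a" where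
  "emb S t = (\<Sum>v\<in>onb S. t v *\<^sub>R v)"

lemma onb:
  assumes "subspace S"
  shows onb_subset: "onb S \<subseteq> S"
    and onb_orthogonal: "\<And>v w. v \<in> onb S \<Longrightarrow> w \<in> onb S \<Longrightarrow> v \<bullet> w = (if v = w then 1 else 0)"
    and onb_span: "span (onb S) = S"
    and onb_finite: "finite (onb S)"
    and card_onb: "card (onb S) = dim S"
proof -
  have b: "orthonormal_basis_of S (onb S)"
    unfolding onb_def by (rule someI_ex) (rule orthonormal_basis_of_exists[OF assms])
  then show "onb S \<subseteq> S" "span (onb S) = S"
    by (auto simp: orthonormal_basis_of_def)
  show ort: "v \<bullet> w = (if v = w then 1 else 0)" if "v \<in> onb S" "w \<in> onb S" for v w
    using b that by (auto simp: orthonormal_basis_of_def pairwise_def orthogonal_def norm_eq_1)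
  have ind: "independent (onb S)"
    using b by (intro pairwise_orthogonal_independent) (auto simp: orthonormal_basis_of_def)
  then show "finite (onb S)" by (rule independent_imp_finite)
  show "card (onb S) = dim S"
    using dim_eq_card_independent[OF ind] dim_span[of "onb S"] \<open>span (onb S) = S\<close> by simp
qed

lemma emb_in: "subspace S \<Longrightarrow> emb S t \<in> S"
  unfolding emb_def using onb_subset[of S] by (intro subspace_sum subspace_scale) auto

lemma emb_inner_onb: "subspace S \<Longrightarrow> v \<in> onb S \<Longrightarrow> emb S t \<bullet> v = t v"
  unfolding emb_def
  by (simp add: inner_sum_left onb_orthogonal onb_finite if_distrib[of "(*) _"] cong: if_cong)

lemma emb_inner:
  assumes S: "subspace S"
  shows "emb S t \<bullet> emb S u = (\<Sum>v\<in>onb S. t v * u v)"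
proof -
  have "emb S t \<bullet> emb S u = (\<Sum>v\<in>onb S. u v * (emb S t \<bullet> v))"
    by (subst (2) emb_def) (simp add: inner_sum_right)
  also have "\<dots> = (\<Sum>v\<in>onb S. t v * u v)"
    by (rule sum.cong) (simp_all add: emb_inner_onb[OF S])
  finally show ?thesis .
qed

lemma emb_coords:
  assumes S: "subspace S" and x: "x \<in> S"
  shows "emb S (\<lambda>v. x \<bullet> v) = x"
proof -
  let ?d = "x - emb S (\<lambda>v. x \<bullet> v)"
  have dS: "?d \<in> span (onb S)"
    using x emb_in[OF S] S by (simp add: onb_span subspace_diff)
  have "?d \<bullet> v = 0" if "v \<in> onb S" for v
    using that by (simp add: inner_diff_left emb_inner_onb[OF S])
  then have "orthogonal ?d ?d"
    by (intro orthogonal_to_span[OF dS]) (simp add: orthogonal_def)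
  then show ?thesis by (simp add: orthogonal_def)
qed

lemma emb_cong: "(\<And>v. v \<in> onb S \<Longrightarrow> t v = u v) \<Longrightarrow> emb S t = emb S u"
  unfolding emb_def by (rule sum.cong) auto

lemma emb_add: "emb S (\<lambda>v. t v + u v) = emb S t + emb S u"
  and emb_scale: "emb S (\<lambda>v. r * t v) = r *\<^sub>R emb S t"
  by (simp_all add: emb_def scaleR_add_left sum.distrib scaleR_sum_right)

lemma lborel_on_distr: "lborel_on S = distr (lbPi (onb S)) (restrict_space borel S) (emb S)"
  unfolding lborel_on_def Let_def onb_def[symmetric] emb_def[abs_def] ..

lemma space_lborel_on [simp]: "space (lborel_on S) = S"
  by (simp add: lborel_on_distr space_restrict_space)

lemma sets_lborel_on [measurable_cong]: "sets (lborel_on S) = sets (restrict_space borel S)"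
  by (simp add: lborel_on_distr)

lemma emb_measurable_borel [measurable]: "emb S \<in> lbPi (onb S) \<rightarrow>\<^sub>M borel"
  unfolding emb_def[abs_def] by measurable

lemma emb_measurable: "subspace S \<Longrightarrow> emb S \<in> lbPi (onb S) \<rightarrow>\<^sub>M restrict_space borel S"
  by (rule measurable_restrict_space2) (auto simp: emb_in)

lemma measurable_lborel_on_cong:
  "borel_measurable (lborel_on S) = borel_measurable (restrict_space borel S)"
  by (rule measurable_cong_sets) (auto simp: sets_lborel_on)

lemma borel_measurable_lborel_on [measurable (raw)]:
  "f \<in> borel_measurable borel \<Longrightarrow> f \<in> borel_measurable (lborel_on S)"
  by (simp add: measurable_lborel_on_cong measurable_restrict_space1)

lemma nn_integral_lborel_on:
  assumes "subspace S" "f \<in> borel_measurable (lborel_on S)"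
  shows "(\<integral>\<^sup>+x. f x \<partial>lborel_on S) = (\<integral>\<^sup>+t. f (emb S t) \<partial>lbPi (onb S))"
  using assms unfolding lborel_on_distr
  by (intro nn_integral_distr emb_measurable) simp_all

lemma measurable_affine_on:
  assumes "subspace S" "a \<in> S" "f \<in> borel_measurable (lborel_on S)"
  shows "(\<lambda>x. f (a + s *\<^sub>R x)) \<in> borel_measurable (lborel_on S)"
proof -
  have "(\<lambda>x. a + s *\<^sub>R x) \<in> restrict_space borel S \<rightarrow>\<^sub>M restrict_space borel S"
    using assms by (intro measurable_restrict_space3) (auto intro: subspace_add subspace_scale)
  then show ?thesis
    using assms(3) unfolding measurable_lborel_on_cong by (rule measurable_compose)
qed

lemma nn_integral_lborel_on_affine:
  assumes S: "subspace S" and a: "a \<in> S" and s: "s > 0" and f: "f \<in> borel_measurable (lborel_on S)"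
  shows "(\<integral>\<^sup>+x. f (a + s *\<^sub>R x) \<partial>lborel_on S) = ennreal ((1/s) ^ dim S) * (\<integral>\<^sup>+x. f x \<partial>lborel_on S)"
proof -
  let ?b = "onb S"
  have "(\<integral>\<^sup>+x. f (a + s *\<^sub>R x) \<partial>lborel_on S) = (\<integral>\<^sup>+t. f (a + s *\<^sub>R emb S t) \<partial>lbPi ?b)"
    by (rule nn_integral_lborel_on[OF S measurable_affine_on[OF S a f]])
  also have "\<dots> = (\<integral>\<^sup>+t. f (emb S (\<lambda>v\<in>?b. a \<bullet> v + s * t v)) \<partial>lbPi ?b)"
  proof (intro nn_integral_cong arg_cong[where f = f])
    fix t
    have "emb S (\<lambda>v\<in>?b. a \<bullet> v + s * t v) = emb S (\<lambda>v. a \<bullet> v + s * t v)"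
      by (rule emb_cong) simp
    then show "a + s *\<^sub>R emb S t = emb S (\<lambda>v\<in>?b. a \<bullet> v + s * t v)"
      by (simp add: emb_add emb_scale emb_coords[OF S a])
  qed
  also have "\<dots> = ennreal ((1/s) ^ card ?b) * (\<integral>\<^sup>+t. f (emb S t) \<partial>lbPi ?b)"
    using f s onb_finite[OF S]
    by (intro nn_integral_PiM_affine[of ?b s "\<lambda>t. f (emb S t)"] measurable_compose[OF emb_measurable[OF S]])
       (simp_all add: measurable_lborel_on_cong)
  also have "(\<integral>\<^sup>+t. f (emb S t) \<partial>lbPi ?b) = (\<integral>\<^sup>+x. f x \<partial>lborel_on S)"
    by (rule nn_integral_lborel_on[OF S f, symmetric])
  finally show ?thesis by (simp add: card_onb[OF S])
qed

lemma nn_integral_lbPi_gaussian: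
  assumes "finite I" "a > 0"
  shows "(\<integral>\<^sup>+t. ennreal (exp (- (a * (\<Sum>i\<in>I. (t i)\<^sup>2)) / 2)) \<partial>lbPi I) = ennreal (sqrt (2 * pi / a) ^ card I)"
proof -
  have "exp (- (a * (\<Sum>i\<in>I. (t i)\<^sup>2)) / 2) = (\<Prod>i\<in>I. exp (- (a * (t i)\<^sup>2) / 2))" for t
    using assms(1) by (simp add: exp_sum[symmetric] sum_distrib_left sum_negf[symmetric] sum_divide_distrib)
  then have "(\<integral>\<^sup>+t. ennreal (exp (- (a * (\<Sum>i\<in>I. (t i)\<^sup>2)) / 2)) \<partial>lbPi I)
     = (\<integral>\<^sup>+t. (\<Prod>i\<in>I. ennreal (exp (- (a * (t i)\<^sup>2) / 2))) \<partial>lbPi I)"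
    by (simp add: prod_ennreal)
  also have "\<dots> = (\<Prod>i\<in>I. \<integral>\<^sup>+r. ennreal (exp (- (a * r\<^sup>2) / 2)) \<partial>lborel)"
    by (rule lborel_product.product_nn_integral_prod) (use assms in auto)
  also have "\<dots> = ennreal (sqrt (2 * pi / a) ^ card I)"
    by (subst nn_integral_gaussian_real[OF assms(2)]) (use assms(2) in \<open>simp add: ennreal_power\<close>)
  finally show ?thesis .
qed

lemma nn_integral_lborel_on_gaussian:
  assumes S: "subspace S" and a: "a > 0"
  shows "(\<integral>\<^sup>+x. ennreal (exp (- (a * (x \<bullet> x)) / 2)) \<partial>lborel_on S) = ennreal (sqrt (2 * pi / a) ^ dim S)"
proof -
  have "(\<integral>\<^sup>+x. ennreal (exp (- (a * (x \<bullet> x)) / 2)) \<partial>lborel_on S)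
      = (\<integral>\<^sup>+t. ennreal (exp (- (a * (\<Sum>v\<in>onb S. (t v)\<^sup>2)) / 2)) \<partial>lbPi (onb S))"
    by (subst nn_integral_lborel_on[OF S]) (simp_all add: emb_inner[OF S] power2_eq_square)
  also have "\<dots> = ennreal (sqrt (2 * pi / a) ^ dim S)"
    by (subst nn_integral_lbPi_gaussian[OF onb_finite[OF S] a]) (simp add: card_onb[OF S])
  finally show ?thesis .
qed

text \<open>The indicator of a ball lies below a multiple of a Gaussian whose integral is known, so
  no volume of a ball has to be computed. Sigma-finiteness is what Fubini requires in
  \<open>gint_rank_one_down\<close>.\<close>

lemma sigma_finite_lborel_on:
  assumes S: "subspace S"
  shows "sigma_finite_measure (lborel_on S)"
proof
  let ?A = "\<lambda>n::nat. {x \<in> S. norm x \<le> n}"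
  have A: "?A n \<in> sets (lborel_on S)" for n
  proof -
    have "?A n = {x. norm x \<le> n} \<inter> S" by auto
    moreover have "{x. norm x \<le> n} \<in> sets (borel :: 'a measure)" by measurable
    ultimately show ?thesis
      unfolding sets_lborel_on sets_restrict_space by blast
  qed
  have "emeasure (lborel_on S) (?A n) \<noteq> \<infinity>" for n
  proof -
    have "emeasure (lborel_on S) (?A n) = (\<integral>\<^sup>+x. indicator (?A n) x \<partial>lborel_on S)"
      using A by simp
    also have "\<dots> \<le> (\<integral>\<^sup>+x. ennreal (exp (real n ^ 2 / 2)) * ennreal (exp (- (1 * (x \<bullet> x)) / 2)) \<partial>lborel_on S)"
    proof (intro nn_integral_mono)
      fix x assume "x \<in> space (lborel_on S)"
      show "indicator (?A n) x \<le> ennreal (exp (real n ^ 2 / 2)) * ennreal (exp (- (1 * (x \<bullet> x)) / 2))"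
      proof (cases "x \<in> ?A n")
        case True
        then have "(norm x)\<^sup>2 \<le> (real n)\<^sup>2" by (intro power_mono) auto
        then have "1 \<le> exp (real n ^ 2 / 2) * exp (- (1 * (x \<bullet> x)) / 2)"
          by (simp add: exp_add[symmetric] dot_square_norm)
        then show ?thesis using True by (simp add: ennreal_mult[symmetric] del: ennreal_1 flip: ennreal_1)
      qed auto
    qed
    also have "\<dots> = ennreal (exp (real n ^ 2 / 2)) * (\<integral>\<^sup>+x. ennreal (exp (- (1 * (x \<bullet> x)) / 2)) \<partial>lborel_on S)"
      by (rule nn_integral_cmult) simp
    also have "\<dots> < \<infinity>"
      by (subst nn_integral_lborel_on_gaussian[OF S]) (auto simp: ennreal_mult_less_top)
    finally show ?thesis by simp
  qed
  moreover have "(\<Union>n. ?A n) = S"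
    using real_arch_simple by auto
  ultimately show "\<exists>A. countable A \<and> A \<subseteq> sets (lborel_on S) \<and> \<Union> A = space (lborel_on S) \<and> (\<forall>a\<in>A. emeasure (lborel_on S) a \<noteq> \<infinity>)"
    using A by (intro exI[of _ "range ?A"]) auto
qed

subsection \<open>Gaussian integrals\<close>

text \<open>Kept for an arbitrary measure because it serves twice: on a single subspace with
  \<open>lborel_on\<close>, and on the product of all \<open>E i\<close> with the coordinate measure
  \<open>lbPi IX\<close>.\<close>

definition gint :: "'v measure \<Rightarrow> ('v \<Rightarrow> real) \<Rightarrow> ennreal" where
  "gint M q = (\<integral>\<^sup>+x. ennreal (exp (- (q x) / 2)) \<partial>M)"

text \<open>The factor \<open>exp (s * (l x)\<^sup>2 / 2)\<close> is a Gaussian average over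
  \<open>r\<close> of exponentials linear in \<open>l x\<close>. After the integrals are exchanged,
  the linear term is absorbed by a translation. This is what \<open>inv\<close> expresses: shifting
  by \<open>r\<close> times a fixed vector adds \<open>2 * r * l x\<close> and the constant
  \<open>r\<^sup>2 * \<kappa>\<close> to \<open>q x\<close>.\<close>

lemma gint_rank_one_down:
  assumes "sigma_finite_measure M"
    and q [measurable]: "q \<in> borel_measurable M" and l [measurable]: "l \<in> borel_measurable M"
    and inv: "\<And>r. gint M (\<lambda>x. q x + 2 * r * l x + r\<^sup>2 * \<kappa>) = gint M q"
    and s: "0 \<le> s" "s * \<kappa> < 1"
  shows "gint M (\<lambda>x. q x - s * (l x)\<^sup>2) = ennreal (1 / sqrt (1 - s * \<kappa>)) * gint M q"
proof -
  interpret M: sigma_finite_measure M by fact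
  interpret pair_sigma_finite lborel M ..
  \<comment> \<open>By completing the square, \<open>?G\<close> is a Gaussian in \<open>r\<close>
    centered at \<open>- sqrt s * l x\<close> for fixed \<open>x\<close>, and a multiple of a
    translate of the original integrand for fixed \<open>r\<close>.\<close>
  let ?G = "\<lambda>r x. ennreal (exp (- ((1 - s * \<kappa>) * r\<^sup>2) / 2)) * ennreal (exp (- (q x + 2 * (sqrt s * r) * l x + (sqrt s * r)\<^sup>2 * \<kappa>) / 2))"
  have G: "?G r x = ennreal (exp (- (q x - s * (l x)\<^sup>2) / 2)) * ennreal (exp (- (1 * (sqrt s * l x + 1 * r)\<^sup>2) / 2))" for r x
    using s by (simp add: ennreal_mult[symmetric] exp_add[symmetric] power2_eq_square algebra_simps)
      (simp add: field_simps)
  have 1: "(\<integral>\<^sup>+r. ?G r x \<partial>lborel) = ennreal (exp (- (q x - s * (l x)\<^sup>2) / 2)) * ennreal (sqrt (2 * pi))" for x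
  proof -
    have "(\<integral>\<^sup>+r. ?G r x \<partial>lborel)
       = ennreal (exp (- (q x - s * (l x)\<^sup>2) / 2)) * (\<integral>\<^sup>+r. ennreal (exp (- (1 * (sqrt s * l x + 1 * r)\<^sup>2) / 2)) \<partial>lborel)"
      unfolding G by (rule nn_integral_cmult) measurable
    also have "(\<integral>\<^sup>+r. ennreal (exp (- (1 * (sqrt s * l x + 1 * r)\<^sup>2) / 2)) \<partial>lborel)
       = (\<integral>\<^sup>+r. ennreal (exp (- (1 * r\<^sup>2) / 2)) \<partial>lborel)"
      using nn_integral_real_affine[of "\<lambda>r. ennreal (exp (- (1 * r\<^sup>2) / 2))" 1 "sqrt s * l x"] by simp
    also have "\<dots> = ennreal (sqrt (2 * pi / 1))"
      by (rule nn_integral_gaussian_real) simp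
    finally show ?thesis by simp
  qed
  have 2: "(\<integral>\<^sup>+x. ?G r x \<partial>M) = ennreal (exp (- ((1 - s * \<kappa>) * r\<^sup>2) / 2)) * gint M q" for r
  proof -
    have "(\<integral>\<^sup>+x. ?G r x \<partial>M) = ennreal (exp (- ((1 - s * \<kappa>) * r\<^sup>2) / 2)) *
        gint M (\<lambda>x. q x + 2 * (sqrt s * r) * l x + (sqrt s * r)\<^sup>2 * \<kappa>)"
      unfolding gint_def by (rule nn_integral_cmult) measurable
    then show ?thesis by (simp only: inv)
  qed
  have "ennreal (sqrt (2 * pi)) * gint M (\<lambda>x. q x - s * (l x)\<^sup>2)
      = (\<integral>\<^sup>+x. ennreal (exp (- (q x - s * (l x)\<^sup>2) / 2)) * ennreal (sqrt (2 * pi)) \<partial>M)"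
    unfolding gint_def by (subst mult.commute, rule nn_integral_multc[symmetric]) measurable
  also have "\<dots> = (\<integral>\<^sup>+x. (\<integral>\<^sup>+r. ?G r x \<partial>lborel) \<partial>M)"
    by (simp only: 1)
  also have "\<dots> = (\<integral>\<^sup>+r. (\<integral>\<^sup>+x. ?G r x \<partial>M) \<partial>lborel)"
    by (rule Fubini') measurable
  also have "\<dots> = (\<integral>\<^sup>+r. ennreal (exp (- ((1 - s * \<kappa>) * r\<^sup>2) / 2)) * gint M q \<partial>lborel)"
    by (simp only: 2)
  also have "\<dots> = (\<integral>\<^sup>+r. ennreal (exp (- ((1 - s * \<kappa>) * r\<^sup>2) / 2)) \<partial>lborel) * gint M q"
    by (rule nn_integral_multc) measurable
  also have "(\<integral>\<^sup>+r. ennreal (exp (- ((1 - s * \<kappa>) * r\<^sup>2) / 2)) \<partial>lborel) = ennreal (sqrt (2 * pi / (1 - s * \<kappa>)))"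
    by (rule nn_integral_gaussian_real) (use s in simp)
  also have "\<dots> = ennreal (sqrt (2 * pi)) * ennreal (1 / sqrt (1 - s * \<kappa>))"
    using s by (simp add: ennreal_mult[symmetric] real_sqrt_divide)
  finally have "ennreal (sqrt (2 * pi)) * gint M (\<lambda>x. q x - s * (l x)\<^sup>2)
     = ennreal (sqrt (2 * pi)) * (ennreal (1 / sqrt (1 - s * \<kappa>)) * gint M q)"
    by (simp add: mult.assoc)
  then show ?thesis
    by (subst (asm) ennreal_mult_cancel_left) auto
qed

text \<open>For negative \<open>s\<close> this is the previous lemma. For nonnegative
  \<open>s\<close> that lemma is used backwards: it removes the added square again from the enlarged
  form. \<open>T r\<close> stands for the translation by \<open>r\<close> times a fixed vector;
  leaving it abstract covers both \<open>lborel_on\<close> and \<open>lbPi\<close>.\<close>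

lemma gint_rank_one:
  assumes sf: "sigma_finite_measure M"
    and q [measurable]: "q \<in> borel_measurable M" and l [measurable]: "l \<in> borel_measurable M"
    and T: "\<And>r F. F \<in> borel_measurable M \<Longrightarrow> (\<integral>\<^sup>+x. F (T r x) \<partial>M) = (\<integral>\<^sup>+x. F x \<partial>M)"
    and qT: "\<And>r x. x \<in> space M \<Longrightarrow> q (T r x) = q x + 2 * r * l x + r\<^sup>2 * \<kappa>"
    and lT: "\<And>r x. x \<in> space M \<Longrightarrow> l (T r x) = l x + r * \<kappa>"
    and \<kappa>: "\<kappa> \<ge> 0" and s: "1 + s * \<kappa> > 0"
  shows "gint M (\<lambda>x. q x + s * (l x)\<^sup>2) = ennreal (1 / sqrt (1 + s * \<kappa>)) * gint M q"
proof (cases "s \<ge> 0")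
  case False
  have "gint M (\<lambda>x. q x + 2 * r * l x + r\<^sup>2 * \<kappa>) = gint M q" for r
  proof -
    have "gint M q = (\<integral>\<^sup>+x. ennreal (exp (- q (T r x) / 2)) \<partial>M)"
      unfolding gint_def by (rule T[symmetric]) measurable
    also have "\<dots> = gint M (\<lambda>x. q x + 2 * r * l x + r\<^sup>2 * \<kappa>)"
      unfolding gint_def by (intro nn_integral_cong) (simp add: qT)
    finally show ?thesis ..
  qed
  from gint_rank_one_down[OF sf q l this, of "-s"] False s show ?thesis by simp
next
  case True
  \<comment> \<open>The functional belonging to the enlarged form is \<open>1 + s * \<kappa>\<close>
    times \<open>l\<close>. Translating by \<open>r * \<beta>\<close> instead of \<open>r\<close>
    therefore restores the linear part \<open>2 * r * l x\<close>, and the quadratic constant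
    becomes \<open>\<beta> * \<kappa>\<close>.\<close>
  define \<beta> where "\<beta> = 1 / (1 + s * \<kappa>)"
  have [measurable]: "(\<lambda>x. q x + s * (l x)\<^sup>2) \<in> borel_measurable M" by measurable
  have b: "\<beta> * (1 + s * \<kappa>) = 1" using s by (simp add: \<beta>_def)
  have inv: "gint M (\<lambda>x. (q x + s * (l x)\<^sup>2) + 2 * r * l x + r\<^sup>2 * (\<beta> * \<kappa>)) = gint M (\<lambda>x. q x + s * (l x)\<^sup>2)" for r
    unfolding gint_def
  proof (subst (2) T[symmetric, of _ "r * \<beta>"], measurable, intro nn_integral_cong)
    fix x assume x: "x \<in> space M"
    have "q (T (r * \<beta>) x) + s * (l (T (r * \<beta>) x))\<^sup>2
        = q x + s * (l x)\<^sup>2 + 2 * r * (\<beta> * (1 + s * \<kappa>)) * l x + r\<^sup>2 * \<beta> * (\<beta> * (1 + s * \<kappa>)) * \<kappa>"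
      by (simp add: qT[OF x] lT[OF x] power2_eq_square algebra_simps)
    then have "q (T (r * \<beta>) x) + s * (l (T (r * \<beta>) x))\<^sup>2 = q x + s * (l x)\<^sup>2 + 2 * r * l x + r\<^sup>2 * (\<beta> * \<kappa>)"
      unfolding b by simp
    then show "ennreal (exp (- (q x + s * (l x)\<^sup>2 + 2 * r * l x + r\<^sup>2 * (\<beta> * \<kappa>)) / 2)) =
        ennreal (exp (- (q (T (r * \<beta>) x) + s * (l (T (r * \<beta>) x))\<^sup>2) / 2))"
      by simp
  qed
  have e: "1 - s * (\<beta> * \<kappa>) = \<beta>"
    using s by (simp add: \<beta>_def field_simps)
  have \<beta>: "\<beta> > 0" using s by (simp add: \<beta>_def)
  have "gint M (\<lambda>x. (q x + s * (l x)\<^sup>2) - s * (l x)\<^sup>2) = ennreal (1 / sqrt (1 - s * (\<beta> * \<kappa>))) * gint M (\<lambda>x. q x + s * (l x)\<^sup>2)"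
    by (rule gint_rank_one_down[OF sf _ l inv True]) (use \<beta> e in simp_all)
  then have "ennreal (sqrt \<beta>) * gint M q = ennreal (sqrt \<beta>) * ennreal (1 / sqrt \<beta>) * gint M (\<lambda>x. q x + s * (l x)\<^sup>2)"
    unfolding e by (simp add: mult.assoc)
  also have "ennreal (sqrt \<beta>) * ennreal (1 / sqrt \<beta>) = 1"
    using \<beta> by (simp add: ennreal_mult[symmetric])
  finally show ?thesis by (simp add: \<beta>_def real_sqrt_divide)
qed

section \<open>Gram-Schmidt for forms on coordinate spaces\<close>

text \<open>A vector of \<open>\<real>\<^sup>I\<close> is any function; its values outside \<open>I\<close> are irrelevant.\<close>

definition sym_form :: "'i set \<Rightarrow> (('i \<Rightarrow> real) \<Rightarrow> ('i \<Rightarrow> real) \<Rightarrow> real) \<Rightarrow> bool" where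
  "sym_form I q \<longleftrightarrow> (\<forall>x y. q x y = q y x) \<and>
     (\<forall>a x y z. q (\<lambda>u. a * x u + y u) z = a * q x z + q y z) \<and>
     (\<forall>x x' z. (\<forall>u\<in>I. x u = x' u) \<longrightarrow> q x z = q x' z)"

lemma sym_formD:
  assumes "sym_form I q"
  shows sym_form_commute: "q x y = q y x"
    and sym_form_lin: "q (\<lambda>u. a * x u + y u) z = a * q x z + q y z"
    and sym_form_cong: "(\<And>u. u \<in> I \<Longrightarrow> x u = x' u) \<Longrightarrow> q x z = q x' z"
  using assms unfolding sym_form_def by auto

lemma sym_form_zero: "sym_form I q \<Longrightarrow> q (\<lambda>u. 0) z = 0"
  using sym_form_lin[of I q 1 "\<lambda>u. 0" "\<lambda>u. 0" z] by simp

lemma sym_form_sum: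
  assumes q: "sym_form I q" and "finite L"
  shows "q (\<lambda>u. \<Sum>l\<in>L. a l * \<eta> l u) z = (\<Sum>l\<in>L. a l * q (\<eta> l) z)"
  using assms(2)
  by (induction L) (simp_all add: sym_form_zero[OF q] sym_form_lin[OF q])

text \<open>The expansion says that the sum of the tensor squares of the \<open>\<eta> l\<close>
  inverts \<open>q\<close>; all inverse forms below are produced in this way. Coordinates and basis
  vectors share the index set, which fixes the number of vectors.\<close>

lemma gram_schmidt:
  assumes "finite I" "sym_form I q"
    and "\<And>x. \<exists>u\<in>I. x u \<noteq> 0 \<Longrightarrow> 0 < q x x"
  shows "\<exists>\<eta>. (\<forall>l\<in>I. \<forall>l'\<in>I. q (\<eta> l) (\<eta> l') = (if l = l' then 1 else 0)) \<and>
             (\<forall>x. \<forall>u\<in>I. x u = (\<Sum>l\<in>I. q x (\<eta> l) * \<eta> l u))"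
  using assms
proof (induction I arbitrary: q rule: finite_induct)
  case empty
  then show ?case by auto
next
  case (insert w I)
  note q = insert.prems(1)
  \<comment> \<open>Cutting vectors off outside \<open>I\<close> turns the form on the larger index
    set into one on \<open>I\<close>, to which the induction hypothesis applies.\<close>
  define r where "r x = (\<lambda>u. if u \<in> I then x u else 0)" for x :: "'a \<Rightarrow> real"
  have r_lin: "r (\<lambda>u. a * x u + y u) = (\<lambda>u. a * r x u + r y u)" for a x y
    by (auto simp: r_def fun_eq_iff)
  have q': "sym_form I (\<lambda>x y. q (r x) (r y))"
    unfolding sym_form_def r_lin sym_form_lin[OF q]
  proof (intro conjI allI impI refl)
    fix x y show "q (r x) (r y) = q (r y) (r x)" by (rule sym_form_commute[OF q])
  next
    fix x x' z :: "'a \<Rightarrow> real" assume "\<forall>u\<in>I. x u = x' u"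
    then have "r x = r x'" by (auto simp: r_def fun_eq_iff)
    then show "q (r x) (r z) = q (r x') (r z)" by simp
  qed
  have "0 < q (r x) (r x)" if "\<exists>u\<in>I. x u \<noteq> 0" for x
    by (rule insert.prems(2)) (use that in \<open>auto simp: r_def\<close>)
  from insert.IH[OF q' this] obtain \<eta>0 where
    o0: "\<And>l l'. l \<in> I \<Longrightarrow> l' \<in> I \<Longrightarrow> q (r (\<eta>0 l)) (r (\<eta>0 l')) = (if l = l' then 1 else 0)" and
    s0: "\<And>x u. u \<in> I \<Longrightarrow> x u = (\<Sum>l\<in>I. q (r x) (r (\<eta>0 l)) * \<eta>0 l u)"
    by blast
  define \<eta>1 where "\<eta>1 l = r (\<eta>0 l)" for l
  define ew :: "'a \<Rightarrow> real" where "ew = (\<lambda>u. if u = w then 1 else 0)"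
  \<comment> \<open>The unit vector of the new coordinate minus its \<open>q\<close>-projection onto
    the old basis. Its coordinate at \<open>w\<close> stays 1 because the old vectors vanish
    there.\<close>
  define e where "e = (\<lambda>u. (-1) * (\<Sum>l\<in>I. q ew (\<eta>1 l) * \<eta>1 l u) + ew u)"
  have e_w: "e w = 1" using insert.hyps by (simp add: e_def \<eta>1_def r_def ew_def)
  have eo: "q e (\<eta>1 l) = 0" if "l \<in> I" for l
  proof -
    have "q e (\<eta>1 l) = - (\<Sum>l'\<in>I. q ew (\<eta>1 l') * q (\<eta>1 l') (\<eta>1 l)) + q ew (\<eta>1 l)"
      unfolding e_def by (simp add: sym_form_lin[OF q, of "-1", simplified] sym_form_sum[OF q insert.hyps(1)])
    also have "(\<Sum>l'\<in>I. q ew (\<eta>1 l') * q (\<eta>1 l') (\<eta>1 l)) = (\<Sum>l'\<in>I. if l' = l then q ew (\<eta>1 l) else 0)"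
      by (rule sum.cong) (auto simp: \<eta>1_def o0 that)
    finally show ?thesis using that insert.hyps by simp
  qed
  define N where "N = q e e"
  have N: "N > 0" unfolding N_def by (rule insert.prems(2)) (use e_w in auto)
  define \<eta> where "\<eta> l = (if l = w then (\<lambda>u. (1 / sqrt N) * e u + 0) else \<eta>1 l)" for l
  have qew: "q (\<eta> w) z = q e z / sqrt N" for z
    unfolding \<eta>_def if_P[OF refl] sym_form_lin[OF q] sym_form_zero[OF q] by simp
  have \<eta>I: "\<eta> l = \<eta>1 l" if "l \<in> I" for l using that insert.hyps by (auto simp: \<eta>_def)
  have "q (\<eta> l) (\<eta> l') = (if l = l' then 1 else 0)" if "l \<in> insert w I" "l' \<in> insert w I" for l l'
  proof -
    have ww: "q (\<eta> w) (\<eta> w) = 1"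
      using N by (simp add: qew sym_form_commute[OF q, of e "\<eta> w"] N_def[symmetric])
    have wI: "q (\<eta> w) (\<eta> l) = 0" if "l \<in> I" for l
      using that by (simp add: qew \<eta>I eo)
    show ?thesis
      using that insert.hyps ww wI sym_form_commute[OF q]
      by (cases "l = w"; cases "l' = w") (auto simp: \<eta>I o0 \<eta>1_def)
  qed
  moreover have "x u = (\<Sum>l\<in>insert w I. q x (\<eta> l) * \<eta> l u)" if u: "u \<in> insert w I" for x u
  proof -
    \<comment> \<open>Subtracting \<open>x w\<close> times \<open>e\<close> clears the coordinate
      \<open>w\<close> without changing the products with the old basis, so the old expansion
      applies to \<open>x'\<close>.\<close>
    define x' where "x' = (\<lambda>u. (- x w) * e u + x u)"
    have x'w: "x' w = 0" by (simp add: x'_def e_w)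
    have rx': "q (r x') z = q x' z" for z
      by (rule sym_form_cong[OF q]) (auto simp: r_def x'w)
    have qx': "q x' (\<eta>1 l) = q x (\<eta>1 l)" if "l \<in> I" for l
      unfolding x'_def sym_form_lin[OF q] by (simp add: eo that)
    have sI: "x' u = (\<Sum>l\<in>I. q x (\<eta>1 l) * \<eta>1 l u)" if "u \<in> insert w I" for u
    proof (cases "u = w")
      case True
      then show ?thesis using insert.hyps by (simp add: x'w \<eta>1_def r_def)
    next
      case False
      with that have "u \<in> I" by simp
      then have "r y u = y u" for y by (simp add: r_def)
      moreover have "x' u = (\<Sum>l\<in>I. q (r x') (r (\<eta>0 l)) * \<eta>0 l u)"
        by (rule s0) fact
      ultimately have "x' u = (\<Sum>l\<in>I. q x' (\<eta>1 l) * \<eta>1 l u)"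
        by (simp add: rx' \<eta>1_def)
      then show ?thesis by (simp add: qx')
    qed
    have "q x' e = q (\<lambda>u. \<Sum>l\<in>I. q x (\<eta>1 l) * \<eta>1 l u) e"
      by (rule sym_form_cong[OF q]) (rule sI)
    also have "\<dots> = 0"
      using sym_form_commute[OF q] by (simp add: sym_form_sum[OF q insert.hyps(1)] sym_form_commute[OF q, of _ e] eo)
    finally have "q x e = x w * N"
      unfolding x'_def sym_form_lin[OF q] N_def by simp
    then have qw: "q x (\<eta> w) * \<eta> w u = x w * e u"
      using N by (simp add: sym_form_commute[OF q, of x "\<eta> w"] qew sym_form_commute[OF q, of e x])
        (simp add: \<eta>_def)
    have "(\<Sum>l\<in>insert w I. q x (\<eta> l) * \<eta> l u) = x w * e u + (\<Sum>l\<in>I. q x (\<eta>1 l) * \<eta>1 l u)"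
      using insert.hyps by (simp add: qw \<eta>I)
    also have "\<dots> = x u" using sI[OF u] by (simp add: x'_def)
    finally show ?thesis ..
  qed
  ultimately show ?case by blast
qed

section \<open>Positive definite forms on a subspace and their Gaussian integrals\<close>

definition selfadj :: "('a::euclidean_space \<Rightarrow>\<^sub>L 'a) \<Rightarrow> bool" where
  "selfadj P \<longleftrightarrow> (\<forall>x y. P x \<bullet> y = x \<bullet> P y)"

text \<open>Symmetry refers to the ambient space, positivity only to \<open>S\<close>, and
  \<open>P\<close> may map \<open>S\<close> out of itself: only the values of the form on
  \<open>S\<close> matter. Where an operator on \<open>S\<close> is wanted, as for inverses,
  \<open>compress\<close> supplies it.\<close>

definition posdef_on :: "'a::euclidean_space set \<Rightarrow> ('a \<Rightarrow>\<^sub>L 'a) \<Rightarrow> bool" where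
  "posdef_on S P \<longleftrightarrow> selfadj P \<and> (\<forall>x\<in>S. x \<noteq> 0 \<longrightarrow> 0 < P x \<bullet> x)"

lemma selfadjD: "selfadj P \<Longrightarrow> P x \<bullet> y = P y \<bullet> x"
  unfolding selfadj_def by (metis inner_commute)

lemma posdef_onD: "posdef_on S P \<Longrightarrow> selfadj P" "posdef_on S P \<Longrightarrow> x \<in> S \<Longrightarrow> x \<noteq> 0 \<Longrightarrow> 0 < P x \<bullet> x"
  by (auto simp: posdef_on_def)

lemma posdef_on_nonneg: "posdef_on S P \<Longrightarrow> x \<in> S \<Longrightarrow> 0 \<le> P x \<bullet> x"
  by (cases "x = 0") (auto dest: posdef_onD(2)[of S P x])

lemma blinfun_form_bound: "P x \<bullet> x \<le> norm P * (x \<bullet> x)" for P :: "'a::euclidean_space \<Rightarrow>\<^sub>L 'a"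
proof -
  have "P x \<bullet> x \<le> norm (P x) * norm x" by (rule norm_cauchy_schwarz)
  also have "\<dots> \<le> norm P * norm x * norm x" by (intro mult_right_mono norm_blinfun) auto
  finally show ?thesis by (simp add: dot_square_norm power2_eq_square)
qed

text \<open>The form attains its minimum on the unit sphere of \<open>S\<close>. That sphere is
  empty when \<open>S\<close> is the zero space, which is therefore treated apart.\<close>

lemma posdef_on_lower_bound:
  assumes S: "subspace S" and P: "posdef_on S P"
  shows "\<exists>\<mu>>0. \<forall>x\<in>S. \<mu> * (x \<bullet> x) \<le> P x \<bullet> x"
proof (cases "S \<inter> sphere 0 1 = {}")
  case True
  have "x = 0" if "x \<in> S" for x
  proof (rule ccontr)
    assume "x \<noteq> 0"
    then have "x /\<^sub>R norm x \<in> S \<inter> sphere 0 1" using that S by (auto simp: subspace_scale)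
    then show False using True by auto
  qed
  show ?thesis
  proof (intro exI[of _ 1] conjI ballI)
    fix x assume "x \<in> S"
    then have "x = 0" by fact
    then show "1 * (x \<bullet> x) \<le> P x \<bullet> x" by simp
  qed simp
next
  case False
  have "compact (S \<inter> sphere 0 1)"
    using closed_subspace[OF S] by (simp add: closed_Int_compact)
  then have "\<exists>z\<in>S \<inter> sphere 0 1. \<forall>y\<in>S \<inter> sphere 0 1. P z \<bullet> z \<le> P y \<bullet> y"
    by (rule continuous_attains_inf) (use False in \<open>simp_all add: continuous_intros\<close>)
  then obtain z where z: "z \<in> S" "norm z = 1" and min: "\<And>y. y \<in> S \<Longrightarrow> norm y = 1 \<Longrightarrow> P z \<bullet> z \<le> P y \<bullet> y"
    by auto
  show ?thesis
  proof (intro exI[of _ "P z \<bullet> z"] conjI ballI)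
    have "z \<noteq> 0" using z by auto
    then show "P z \<bullet> z > 0" by (rule posdef_onD(2)[OF P z(1)])
    fix x assume x: "x \<in> S"
    show "(P z \<bullet> z) * (x \<bullet> x) \<le> P x \<bullet> x"
    proof (cases "x = 0")
      case False
      have "P z \<bullet> z \<le> P (x /\<^sub>R norm x) \<bullet> (x /\<^sub>R norm x)"
        using x False S by (intro min) (auto simp: subspace_scale)
      also have "\<dots> = (P x \<bullet> x) / (norm x)\<^sup>2"
        by (simp add: blinfun.scaleR_right power2_eq_square divide_inverse)
      finally show ?thesis using False by (simp add: field_simps dot_square_norm)
    qed simp
  qed
qed

lemma borel_measurable_blinfun_apply [measurable (raw)]:
  fixes P :: "'a::euclidean_space \<Rightarrow>\<^sub>L 'b::euclidean_space"
  assumes "f \<in> borel_measurable M"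
  shows "(\<lambda>x. P (f x)) \<in> borel_measurable M"
  by (rule measurable_compose[OF assms borel_measurable_continuous_onI]) (intro continuous_intros)

lemma borel_measurable_id_lborel_on [measurable (raw)]: "(\<lambda>x. x) \<in> borel_measurable (lborel_on S)"
  by (rule borel_measurable_lborel_on) simp

text \<open>Up to a factor depending on the dimension, the inverse square root of the determinant of
  the form on \<open>S\<close>.\<close>

definition Zg :: "'a::euclidean_space set \<Rightarrow> ('a \<Rightarrow>\<^sub>L 'a) \<Rightarrow> real" where
  "Zg S P = enn2real (gint (lborel_on S) (\<lambda>x. P x \<bullet> x))"

lemma gint_mono: "(\<And>x. x \<in> space M \<Longrightarrow> q x \<le> q' x) \<Longrightarrow> gint M q' \<le> gint M q"
  unfolding gint_def by (intro nn_integral_mono) simp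

lemma gint_cong: "(\<And>x. x \<in> space M \<Longrightarrow> q x = q' x) \<Longrightarrow> gint M q = gint M q'"
  unfolding gint_def by (intro nn_integral_cong) simp

lemma gint_scalar: "subspace S \<Longrightarrow> a > 0 \<Longrightarrow> gint (lborel_on S) (\<lambda>x. a * (x \<bullet> x)) = ennreal (sqrt (2 * pi / a) ^ dim S)"
  unfolding gint_def by (rule nn_integral_lborel_on_gaussian)

lemma gint_form_upper:
  assumes "subspace S" "\<mu> > 0" "\<And>x. x \<in> S \<Longrightarrow> \<mu> * (x \<bullet> x) \<le> q x"
  shows "gint (lborel_on S) q \<le> ennreal (sqrt (2 * pi / \<mu>) ^ dim S)"
  using gint_mono[of "lborel_on S" "\<lambda>x. \<mu> * (x \<bullet> x)" q] assms by (simp add: gint_scalar)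

lemma gint_form_lower:
  assumes "subspace S" "\<mu> > 0" "\<And>x. x \<in> S \<Longrightarrow> q x \<le> \<mu> * (x \<bullet> x)"
  shows "ennreal (sqrt (2 * pi / \<mu>) ^ dim S) \<le> gint (lborel_on S) q"
  using gint_mono[of "lborel_on S" q "\<lambda>x. \<mu> * (x \<bullet> x)"] assms by (simp add: gint_scalar)

lemma gint_eq_Zg:
  assumes S: "subspace S" and P: "posdef_on S P"
  shows gint_Zg: "gint (lborel_on S) (\<lambda>x. P x \<bullet> x) = ennreal (Zg S P)" and Zg_pos: "0 < Zg S P"
proof -
  obtain \<mu> where "\<mu> > 0" "\<And>x. x \<in> S \<Longrightarrow> \<mu> * (x \<bullet> x) \<le> P x \<bullet> x"
    using posdef_on_lower_bound[OF S P] by blast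
  then have "gint (lborel_on S) (\<lambda>x. P x \<bullet> x) \<le> ennreal (sqrt (2 * pi / \<mu>) ^ dim S)"
    by (rule gint_form_upper[OF S])
  then have "gint (lborel_on S) (\<lambda>x. P x \<bullet> x) < top"
    by (rule order.strict_trans1) simp
  then show eq: "gint (lborel_on S) (\<lambda>x. P x \<bullet> x) = ennreal (Zg S P)"
    unfolding Zg_def by (simp add: ennreal_enn2real_if)
  have "ennreal (sqrt (2 * pi / (norm P + 1)) ^ dim S) \<le> gint (lborel_on S) (\<lambda>x. P x \<bullet> x)"
  proof (rule gint_form_lower[OF S])
    show "P x \<bullet> x \<le> (norm P + 1) * (x \<bullet> x)" for x
      using blinfun_form_bound[of P x] inner_ge_zero[of x] unfolding distrib_right by linarith
  qed (simp add: add_nonneg_pos)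
  moreover have "0 < sqrt (2 * pi / (norm P + 1)) ^ dim S"
    by (simp add: add_nonneg_pos)
  ultimately show "0 < Zg S P"
    unfolding eq by (metis ennreal_le_iff2 less_le_trans not_le)
qed

lemma Zg_upper:
  assumes "subspace S" "posdef_on S P" "\<mu> > 0" "\<And>x. x \<in> S \<Longrightarrow> \<mu> * (x \<bullet> x) \<le> P x \<bullet> x"
  shows "Zg S P \<le> sqrt (2 * pi / \<mu>) ^ dim S"
  using gint_form_upper[of S \<mu> "\<lambda>x. P x \<bullet> x"] assms by (simp add: gint_Zg)

lemma Zg_lower:
  assumes "subspace S" "posdef_on S P" "\<mu> > 0" "\<And>x. x \<in> S \<Longrightarrow> P x \<bullet> x \<le> \<mu> * (x \<bullet> x)"
  shows "sqrt (2 * pi / \<mu>) ^ dim S \<le> Zg S P"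
  using gint_form_lower[of S \<mu> "\<lambda>x. P x \<bullet> x"] less_imp_le[OF Zg_pos[of S P]] assms by (simp add: gint_Zg)

lemma Zg_cong:
  fixes P P' :: "'a::euclidean_space \<Rightarrow>\<^sub>L 'a"
  shows "(\<And>x. x \<in> S \<Longrightarrow> P x \<bullet> x = P' x \<bullet> x) \<Longrightarrow> Zg S P = Zg S P'"
  unfolding Zg_def by (intro arg_cong[where f = enn2real] gint_cong) simp

lemma Zg_scalar:
  assumes "subspace S" "a > 0"
  shows "Zg S (a *\<^sub>R id_blinfun) = sqrt (2 * pi / a) ^ dim S"
  unfolding Zg_def using assms by (simp add: scaleR_blinfun.rep_eq id_blinfun.rep_eq gint_scalar)

lemma gint_form_scale:
  assumes S: "subspace S" and P: "posdef_on S P" and t: "t > 0"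
  shows "gint (lborel_on S) (\<lambda>x. (P x \<bullet> x) / t) = ennreal (sqrt t ^ dim S * Zg S P)"
proof -
  have "P ((1 / sqrt t) *\<^sub>R x) \<bullet> ((1 / sqrt t) *\<^sub>R x) = (P x \<bullet> x) / t" for x
    using t by (simp add: blinfun.scaleR_right)
  then have "gint (lborel_on S) (\<lambda>x. (P x \<bullet> x) / t)
    = (\<integral>\<^sup>+x. ennreal (exp (- (P (0 + (1 / sqrt t) *\<^sub>R x) \<bullet> (0 + (1 / sqrt t) *\<^sub>R x)) / 2)) \<partial>lborel_on S)"
    unfolding gint_def by simp
  also have "\<dots> = ennreal ((1 / (1 / sqrt t)) ^ dim S) * gint (lborel_on S) (\<lambda>x. P x \<bullet> x)"
    unfolding gint_def by (rule nn_integral_lborel_on_affine[OF S subspace_0[OF S]]) (use t in simp, measurable)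
  finally show ?thesis
    using t Zg_pos[OF S P] by (simp add: gint_Zg[OF S P] ennreal_mult)
qed

lift_definition rk1 :: "'a::euclidean_space \<Rightarrow> 'a \<Rightarrow>\<^sub>L 'a" is "\<lambda>b x. (b \<bullet> x) *\<^sub>R b"
  by (intro bounded_linear_intros)

lemma rk1_form: "(P + s *\<^sub>R rk1 b) x \<bullet> y = P x \<bullet> y + s * (b \<bullet> x) * (b \<bullet> y)"
  by (simp add: blinfun.add_left blinfun.scaleR_left rk1.rep_eq inner_add_left)

lemma selfadj_rk1: "selfadj P \<Longrightarrow> selfadj (P + s *\<^sub>R rk1 b)"
  unfolding selfadj_def rk1_form
  by (simp add: blinfun.add_left blinfun.scaleR_left rk1.rep_eq inner_add_right inner_commute)

lemma gint_form_rank_one: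
  assumes S: "subspace S" and P: "posdef_on S P" and p: "p \<in> S" and s: "1 + s * (P p \<bullet> p) > 0"
  shows "gint (lborel_on S) (\<lambda>x. P x \<bullet> x + s * (P p \<bullet> x)\<^sup>2) = ennreal (1 / sqrt (1 + s * (P p \<bullet> p))) * ennreal (Zg S P)"
proof -
  have c: "P x \<bullet> p = P p \<bullet> x" for x by (rule selfadjD) (use P posdef_onD in blast)
  have 1: "(\<integral>\<^sup>+x. F (r *\<^sub>R p + x) \<partial>lborel_on S) = (\<integral>\<^sup>+x. F x \<partial>lborel_on S)"
    if "F \<in> borel_measurable (lborel_on S)" for F r
    using nn_integral_lborel_on_affine[OF S _ _ that, of "r *\<^sub>R p" 1] S p by (simp add: subspace_scale)
  have 2: "P (r *\<^sub>R p + x) \<bullet> (r *\<^sub>R p + x) = P x \<bullet> x + 2 * r * (P p \<bullet> x) + r\<^sup>2 * (P p \<bullet> p)" for r x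
    by (simp add: blinfun.add_right blinfun.scaleR_right inner_add_left inner_add_right c[of x] power2_eq_square algebra_simps)
  have 3: "P p \<bullet> (r *\<^sub>R p + x) = P p \<bullet> x + r * (P p \<bullet> p)" for r x
  proof -
    have "P p \<bullet> (r *\<^sub>R p + x) = P p \<bullet> (r *\<^sub>R p) + P p \<bullet> x" by (rule inner_add_right)
    also have "P p \<bullet> (r *\<^sub>R p) = r * (P p \<bullet> p)" by (rule inner_scaleR_right)
    finally show ?thesis by linarith
  qed
  have q: "(\<lambda>x. P x \<bullet> x) \<in> borel_measurable (lborel_on S)" and l: "(\<lambda>x. P p \<bullet> x) \<in> borel_measurable (lborel_on S)"
    by measurable
  show ?thesis
    unfolding gint_Zg[OF S P, symmetric]
    by (rule gint_rank_one[OF sigma_finite_lborel_on[OF S] q l 1 2 3 posdef_on_nonneg[OF P p] s])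
qed

lemma posdef_cauchy_schwarz:
  assumes S: "subspace S" and P: "posdef_on S P" and p: "p \<in> S" and x: "x \<in> S"
  shows "(P p \<bullet> x)\<^sup>2 \<le> (P p \<bullet> p) * (P x \<bullet> x)"
proof (cases "x = 0")
  case False
  then have Px: "0 < P x \<bullet> x" by (rule posdef_onD(2)[OF P x])
  let ?\<alpha> = "(P p \<bullet> x) / (P x \<bullet> x)"
  have "0 \<le> P (p - ?\<alpha> *\<^sub>R x) \<bullet> (p - ?\<alpha> *\<^sub>R x)"
    by (rule posdef_on_nonneg[OF P]) (use x p S in \<open>simp add: subspace_diff subspace_scale\<close>)
  also have "\<dots> = (P p \<bullet> p) - 2 * ?\<alpha> * (P p \<bullet> x) + ?\<alpha>\<^sup>2 * (P x \<bullet> x)"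
    by (simp add: blinfun.diff_right blinfun.scaleR_right inner_diff_left inner_diff_right
        selfadjD[OF posdef_onD(1)[OF P], of x p] power2_eq_square)
  also have "\<dots> = (P p \<bullet> p) - (P p \<bullet> x)\<^sup>2 / (P x \<bullet> x)"
    using Px by (simp add: power2_eq_square field_simps)
  finally show ?thesis using Px by (simp add: field_simps)
qed simp

text \<open>The matrix determinant lemma, with \<open>p\<close> in the role of the inverse of
  \<open>P\<close> applied to \<open>b\<close>. The vector \<open>b\<close> only has to represent
  the functional of \<open>P p\<close> on \<open>S\<close>, since \<open>P p\<close> itself may
  leave \<open>S\<close>. For negative \<open>s\<close>, Cauchy-Schwarz and the sign condition keep
  the new form positive.\<close>

lemma Zg_rank_one:
  assumes S: "subspace S" and P: "posdef_on S P" and p: "p \<in> S" and s: "1 + s * (P p \<bullet> p) > 0"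
    and b: "\<And>x. x \<in> S \<Longrightarrow> P p \<bullet> x = b \<bullet> x"
  shows "posdef_on S (P + s *\<^sub>R rk1 b)" "Zg S (P + s *\<^sub>R rk1 b) = Zg S P / sqrt (1 + s * (b \<bullet> p))"
proof -
  have sa: "selfadj P" by (rule posdef_onD[OF P])
  show pd: "posdef_on S (P + s *\<^sub>R rk1 b)"
    unfolding posdef_on_def
  proof (intro conjI ballI impI)
    show "selfadj (P + s *\<^sub>R rk1 b)" by (rule selfadj_rk1[OF sa])
    fix x assume x: "x \<in> S" "x \<noteq> 0"
    have Px: "0 < P x \<bullet> x" by (rule posdef_onD(2)[OF P x])
    have "(P p \<bullet> x)\<^sup>2 \<le> (P p \<bullet> p) * (P x \<bullet> x)"
      by (rule posdef_cauchy_schwarz[OF S P p x(1)])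
    then have le: "(b \<bullet> x)\<^sup>2 \<le> (P p \<bullet> p) * (P x \<bullet> x)" by (simp add: b x)
    have "0 < P x \<bullet> x + s * (b \<bullet> x)\<^sup>2"
    proof (cases "s \<ge> 0")
      case True then show ?thesis using Px by (simp add: add_pos_nonneg)
    next
      case False
      then have "s * ((P p \<bullet> p) * (P x \<bullet> x)) \<le> s * (b \<bullet> x)\<^sup>2"
        using le by (intro mult_left_mono_neg) auto
      moreover have "0 < (P x \<bullet> x) * (1 + s * (P p \<bullet> p))" using s Px by simp
      ultimately show ?thesis by (simp add: algebra_simps)
    qed
    then show "0 < (P + s *\<^sub>R rk1 b) x \<bullet> x"
      unfolding rk1_form by (simp add: power2_eq_square mult.assoc)
  qed
  have "ennreal (Zg S (P + s *\<^sub>R rk1 b)) = gint (lborel_on S) (\<lambda>x. P x \<bullet> x + s * (P p \<bullet> x)\<^sup>2)"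
    unfolding gint_Zg[OF S pd, symmetric]
    by (rule gint_cong) (simp add: rk1_form b power2_eq_square mult.assoc)
  also have "\<dots> = ennreal (1 / sqrt (1 + s * (P p \<bullet> p))) * ennreal (Zg S P)"
    by (rule gint_form_rank_one[OF S P p s])
  also have "\<dots> = ennreal (Zg S P / sqrt (1 + s * (b \<bullet> p)))"
    using s Zg_pos[OF S P] by (simp add: ennreal_mult[symmetric] b[OF p])
  finally show "Zg S (P + s *\<^sub>R rk1 b) = Zg S P / sqrt (1 + s * (b \<bullet> p))"
    using Zg_pos[OF S pd] Zg_pos[OF S P] s by (simp add: b[OF p])
qed

text \<open>Gram-Schmidt in the coordinates of \<open>onb S\<close>, which also serves as the set of
  labels. By the expansion, the sum of the tensor squares of the \<open>a l\<close> is the inverse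
  form.\<close>

lemma posdef_orthonormal_basis:
  assumes S: "subspace S" and P: "posdef_on S P"
  shows "\<exists>a. (\<forall>l\<in>onb S. a l \<in> S) \<and> (\<forall>x\<in>S. x = (\<Sum>l\<in>onb S. (P x \<bullet> a l) *\<^sub>R a l))"
proof -
  define q where "q t u = P (emb S t) \<bullet> emb S u" for t u
  have q: "sym_form (onb S) q"
    unfolding sym_form_def
  proof (intro conjI allI impI)
    show "q x y = q y x" for x y unfolding q_def by (rule selfadjD[OF posdef_onD(1)[OF P]])
    show "q (\<lambda>u. a * x u + y u) z = a * q x z + q y z" for a x y z
      by (simp add: q_def emb_add emb_scale blinfun.add_right blinfun.scaleR_right inner_add_left)
    show "q x z = q x' z" if "\<forall>u\<in>onb S. x u = x' u" for x x' z
      using emb_cong[of S x x'] that by (simp add: q_def)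
  qed
  have "0 < q x x" if "\<exists>u\<in>onb S. x u \<noteq> 0" for x
    unfolding q_def
  proof (rule posdef_onD(2)[OF P emb_in[OF S]])
    from that obtain u where "u \<in> onb S" "x u \<noteq> 0" by blast
    then show "emb S x \<noteq> 0" using emb_inner_onb[OF S, of u x] by auto
  qed
  from gram_schmidt[OF onb_finite[OF S] q this] obtain \<eta> where
    \<eta>: "\<And>x u. u \<in> onb S \<Longrightarrow> x u = (\<Sum>l\<in>onb S. q x (\<eta> l) * \<eta> l u)" by blast
  have "x = (\<Sum>l\<in>onb S. (P x \<bullet> emb S (\<eta> l)) *\<^sub>R emb S (\<eta> l))" if x: "x \<in> S" for x
  proof -
    let ?t = "\<lambda>v. x \<bullet> v"
    have "x = emb S ?t" by (rule emb_coords[OF S x, symmetric])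
    also have "\<dots> = emb S (\<lambda>u. \<Sum>l\<in>onb S. q ?t (\<eta> l) * \<eta> l u)"
      by (rule emb_cong) (rule \<eta>)
    also have "\<dots> = (\<Sum>l\<in>onb S. q ?t (\<eta> l) *\<^sub>R emb S (\<eta> l))"
      unfolding emb_def scaleR_sum_right scaleR_sum_left by (subst sum.swap) simp
    also have "\<dots> = (\<Sum>l\<in>onb S. (P x \<bullet> emb S (\<eta> l)) *\<^sub>R emb S (\<eta> l))"
      unfolding q_def emb_coords[OF S x] ..
    finally show ?thesis .
  qed
  then show ?thesis by (intro exI[of _ "\<lambda>l. emb S (\<eta> l)"]) (simp add: emb_in[OF S])
qed

section \<open>Inverse forms\<close>

definition inverse_on :: "'a::euclidean_space set \<Rightarrow> ('a \<Rightarrow>\<^sub>L 'a) \<Rightarrow> ('a \<Rightarrow>\<^sub>L 'a) \<Rightarrow> bool" where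
  "inverse_on S P A \<longleftrightarrow> (\<forall>x\<in>S. P x \<in> S \<and> A x \<in> S \<and> A (P x) = x \<and> P (A x) = x)"

lemma inverse_on_posdef:
  assumes "inverse_on S P A" "posdef_on S P" "selfadj A"
  shows "posdef_on S A"
  unfolding posdef_on_def
proof (intro conjI ballI impI)
  fix x assume x: "x \<in> S" "x \<noteq> 0"
  then have "A x \<in> S" "P (A x) = x" using assms(1) by (auto simp: inverse_on_def)
  moreover then have "A x \<noteq> 0" using x by auto
  ultimately show "0 < A x \<bullet> x"
    using posdef_onD(2)[OF assms(2), of "A x"] by (simp add: inner_commute)
qed (fact assms)

text \<open>The inverse is the sum of the rank-one operators of a basis adapted to \<open>P\<close>.
  The expansion gives \<open>A (P x) = x\<close> at once. The other composition follows by testing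
  \<open>P (A x) - x\<close> against itself, using that both operators are symmetric and preserve
  \<open>S\<close>.\<close>

lemma posdef_inverse:
  assumes S: "subspace S" and P: "posdef_on S P" and PS: "\<And>x. x \<in> S \<Longrightarrow> P x \<in> S"
  shows "\<exists>A. inverse_on S P A \<and> posdef_on S A"
proof -
  obtain a where aS: "\<And>l. l \<in> onb S \<Longrightarrow> a l \<in> S"
    and a: "\<And>x. x \<in> S \<Longrightarrow> x = (\<Sum>l\<in>onb S. (P x \<bullet> a l) *\<^sub>R a l)"
    using posdef_orthonormal_basis[OF S P] by blast
  define A where "A = (\<Sum>l\<in>onb S. rk1 (a l))"
  have A: "A x = (\<Sum>l\<in>onb S. (a l \<bullet> x) *\<^sub>R a l)" for x
    by (simp add: A_def blinfun.sum_left rk1.rep_eq)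
  have sa: "selfadj A"
    unfolding selfadj_def A by (simp add: inner_sum_left inner_sum_right inner_commute mult.commute)
  have AS: "A x \<in> S" for x
    unfolding A by (intro subspace_sum[OF S] subspace_scale[OF S] aS)
  have AP: "A (P x) = x" if "x \<in> S" for x
    using a[OF that] by (simp add: A inner_commute)
  have PA: "P (A x) = x" if x: "x \<in> S" for x
  proof -
    let ?d = "P (A x) - x"
    have dS: "?d \<in> S" using PS AS x S by (simp add: subspace_diff)
    have "P (A x) \<bullet> ?d = A x \<bullet> P ?d" using P by (simp add: posdef_on_def selfadj_def)
    also have "\<dots> = x \<bullet> A (P ?d)" using sa by (simp add: selfadj_def)
    also have "\<dots> = x \<bullet> ?d" by (simp add: AP[OF dS])
    finally have "?d \<bullet> ?d = 0" by (simp add: inner_diff_left)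
    then show ?thesis by simp
  qed
  have "inverse_on S P A" using PS AS AP PA by (simp add: inverse_on_def)
  then show ?thesis using inverse_on_posdef[OF _ P sa] by blast
qed

text \<open>This replaces the multiplicativity of determinants. It is explicit for a scalar form,
  and \<open>P\<close> is built up from a scalar form by rank-one additions, each of which changes
  the two integrals by mutually inverse factors.\<close>

lemma Zg_inverse:
  assumes S: "subspace S" and P: "posdef_on S P" and A: "posdef_on S A" and inv: "inverse_on S P A"
  shows "Zg S P * Zg S A = (2 * pi) ^ dim S"
proof -
  have PS: "P x \<in> S" if "x \<in> S" for x using inv that by (simp add: inverse_on_def)
  obtain \<mu> where \<mu>: "\<mu> > 0" "\<And>x. x \<in> S \<Longrightarrow> \<mu> * (x \<bullet> x) \<le> P x \<bullet> x"
    using posdef_on_lower_bound[OF S P] by blast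
  \<comment> \<open>Half of the lower bound, so that
    \<open>P - \<epsilon> *\<^sub>R id_blinfun\<close> is still positive definite on
    \<open>S\<close> and can be split into rank-one forms.\<close>
  define \<epsilon> where "\<epsilon> = \<mu> / 2"
  have \<epsilon>: "\<epsilon> > 0" using \<mu> by (simp add: \<epsilon>_def)
  let ?P0 = "P - \<epsilon> *\<^sub>R id_blinfun"
  have P0: "?P0 x = P x - \<epsilon> *\<^sub>R x" for x
    by (simp add: blinfun.diff_left blinfun.scaleR_left)
  have P0S: "?P0 x \<in> S" if "x \<in> S" for x using PS that S by (simp add: P0 subspace_diff subspace_scale)
  have "posdef_on S ?P0"
    unfolding posdef_on_def selfadj_def P0
  proof (intro conjI ballI impI allI)
    show "(P x - \<epsilon> *\<^sub>R x) \<bullet> y = x \<bullet> (P y - \<epsilon> *\<^sub>R y)" for x y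
      using P by (simp add: posdef_on_def selfadj_def inner_diff_left inner_diff_right)
    fix x assume x: "x \<in> S" "x \<noteq> 0"
    then have "0 < \<epsilon> * (x \<bullet> x)" using \<epsilon> by simp
    moreover have "\<mu> * (x \<bullet> x) = 2 * (\<epsilon> * (x \<bullet> x))" by (simp add: \<epsilon>_def)
    ultimately have "\<epsilon> * (x \<bullet> x) < P x \<bullet> x"
      using \<mu>(2)[OF x(1)] by linarith
    then show "0 < (P x - \<epsilon> *\<^sub>R x) \<bullet> x" by (simp add: inner_diff_left)
  qed
  from posdef_orthonormal_basis[OF S this] obtain a where aS: "\<And>l. l \<in> onb S \<Longrightarrow> a l \<in> S"
    and a: "\<And>x. x \<in> S \<Longrightarrow> x = (\<Sum>l\<in>onb S. (?P0 x \<bullet> a l) *\<^sub>R a l)" by blast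
  \<comment> \<open>Applying \<open>?P0\<close> to the expansion of \<open>x\<close> exhibits
    \<open>?P0\<close> on \<open>S\<close> as the sum of the \<open>rk1 (v l)\<close>.\<close>
  define v where "v l = ?P0 (a l)" for l
  have vS: "v l \<in> S" if "l \<in> onb S" for l using that P0S aS by (simp add: v_def)
  define PL where "PL L = \<epsilon> *\<^sub>R id_blinfun + (\<Sum>l\<in>L. rk1 (v l))" for L
  have step: "\<exists>A. inverse_on S (PL L) A \<and> posdef_on S A \<and> posdef_on S (PL L) \<and> Zg S (PL L) * Zg S A = (2 * pi) ^ dim S"
    if "finite L" "L \<subseteq> onb S" for L
    using that
  proof (induction L rule: finite_induct)
    case empty
    have "posdef_on S (b *\<^sub>R id_blinfun)" if "b > 0" for b
      using that by (simp add: posdef_on_def selfadj_def blinfun.scaleR_left)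
    moreover have "inverse_on S (\<epsilon> *\<^sub>R id_blinfun) ((1/\<epsilon>) *\<^sub>R id_blinfun)"
      using \<epsilon> S by (simp add: inverse_on_def blinfun.scaleR_left subspace_scale)
    moreover have "sqrt (2 * pi / \<epsilon>) * sqrt (2 * pi / (1/\<epsilon>)) = 2 * pi"
      using \<epsilon> by (subst real_sqrt_mult[symmetric]) (simp add: real_sqrt_unique power2_eq_square)
    then have "sqrt (2 * pi / \<epsilon>) ^ dim S * sqrt (2 * pi / (1/\<epsilon>)) ^ dim S = (2 * pi) ^ dim S"
      by (simp only: power_mult_distrib[symmetric])
    ultimately show ?case
      using \<epsilon> by (intro exI[of _ "(1/\<epsilon>) *\<^sub>R id_blinfun"]) (simp add: PL_def Zg_scalar[OF S])
  next
    case (insert l L)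
    then obtain A where A: "inverse_on S (PL L) A" "posdef_on S A" "posdef_on S (PL L)"
      and Z: "Zg S (PL L) * Zg S A = (2 * pi) ^ dim S" by auto
    have v: "v l \<in> S" using insert vS by auto
    define p where "p = A (v l)"
    define \<kappa> where "\<kappa> = v l \<bullet> p"
    have p: "p \<in> S" "PL L p = v l" using A(1) v by (auto simp: inverse_on_def p_def)
    have \<kappa>: "\<kappa> \<ge> 0" using posdef_on_nonneg[OF A(2) v] by (simp add: \<kappa>_def p_def inner_commute)
    have PL: "PL (insert l L) = PL L + 1 *\<^sub>R rk1 (v l)"
      using insert by (simp add: PL_def add.commute add.left_commute)
    \<comment> \<open>The Sherman-Morrison formula for the inverse after a rank-one
      addition.\<close>
    define A' where "A' = A + (- (1 / (1 + \<kappa>))) *\<^sub>R rk1 p"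
    have P1: "posdef_on S (PL (insert l L))" "Zg S (PL (insert l L)) = Zg S (PL L) / sqrt (1 + \<kappa>)"
      using Zg_rank_one[OF S A(3) p(1), of 1 "v l"] \<kappa> p(2) unfolding PL \<kappa>_def by auto
    have e: "1 - 1 / (1 + \<kappa>) * \<kappa> = 1 / (1 + \<kappa>)" using \<kappa> by (simp add: field_simps)
    have A1: "posdef_on S A'" "Zg S A' = Zg S A / sqrt (1 / (1 + \<kappa>))"
      using Zg_rank_one[OF S A(2) v, of "- (1 / (1 + \<kappa>))" p] \<kappa> e
      unfolding A'_def \<kappa>_def p_def[symmetric] by (auto simp: inner_commute)
    have inv': "inverse_on S (PL (insert l L)) A'"
      unfolding inverse_on_def
    proof (intro ballI conjI)
      fix x assume x: "x \<in> S"
      have PLi: "PL (insert l L) y = PL L y + (v l \<bullet> y) *\<^sub>R v l" for y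
        unfolding PL by (simp add: blinfun.add_left rk1.rep_eq)
      have A'y: "A' y = A y - ((p \<bullet> y) / (1 + \<kappa>)) *\<^sub>R p" for y
        unfolding A'_def by (simp add: blinfun.add_left blinfun.diff_left blinfun.minus_left blinfun.scaleR_left rk1.rep_eq)
      have AL: "PL L x \<in> S" "A x \<in> S" "A (PL L x) = x" "PL L (A x) = x"
        using A(1) x by (auto simp: inverse_on_def)
      show "PL (insert l L) x \<in> S" unfolding PLi using AL v S by (simp add: subspace_add subspace_scale)
      show "A' x \<in> S" unfolding A'y using AL p S by (simp add: subspace_diff subspace_scale)
      have pP: "p \<bullet> PL L x = v l \<bullet> x"
        using posdef_onD(1)[OF A(3)] p(2) by (metis selfadj_def)
      have vA: "v l \<bullet> A x = p \<bullet> x"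
        using posdef_onD(1)[OF A(2)] by (metis selfadj_def p_def)
      have \<kappa>': "p \<bullet> v l = \<kappa>" by (simp add: \<kappa>_def inner_commute)
      have "A' (PL (insert l L) x) = x + ((v l \<bullet> x) - (v l \<bullet> x + (v l \<bullet> x) * \<kappa>) / (1 + \<kappa>)) *\<^sub>R p"
        unfolding PLi A'y
        by (simp add: blinfun.add_right blinfun.scaleR_right AL(3) p_def[symmetric] inner_add_right pP \<kappa>' scaleR_left_diff_distrib)
      also have "(v l \<bullet> x) - (v l \<bullet> x + (v l \<bullet> x) * \<kappa>) / (1 + \<kappa>) = 0"
        using \<kappa> by (simp add: field_simps)
      finally show "A' (PL (insert l L) x) = x" by simp
      have "PL (insert l L) (A' x) = x + (p \<bullet> x - (p \<bullet> x) / (1 + \<kappa>) - ((p \<bullet> x) / (1 + \<kappa>)) * \<kappa>) *\<^sub>R v l"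
        unfolding PLi A'y
        by (simp add: blinfun.diff_right blinfun.scaleR_right AL(4) p(2) inner_diff_right vA \<kappa>_def[symmetric] scaleR_left_diff_distrib)
      also have "p \<bullet> x - (p \<bullet> x) / (1 + \<kappa>) - ((p \<bullet> x) / (1 + \<kappa>)) * \<kappa> = 0"
        using \<kappa> by (simp add: field_simps)
      finally show "PL (insert l L) (A' x) = x" by simp
    qed
    have "Zg S (PL (insert l L)) * Zg S A' = (2 * pi) ^ dim S"
      unfolding P1 A1 using \<kappa> by (simp add: real_sqrt_divide Z)
    then show ?case using inv' P1(1) A1(1) by blast
  qed
  from step[OF onb_finite[OF S] order_refl] obtain A1 where A1: "inverse_on S (PL (onb S)) A1"
    "Zg S (PL (onb S)) * Zg S A1 = (2 * pi) ^ dim S" by blast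
  have PLP: "PL (onb S) x = P x" if x: "x \<in> S" for x
  proof -
    have "?P0 x = ?P0 (\<Sum>l\<in>onb S. (?P0 x \<bullet> a l) *\<^sub>R a l)" using a[OF x] by simp
    also have "\<dots> = (\<Sum>l\<in>onb S. (?P0 x \<bullet> a l) *\<^sub>R v l)"
      by (simp only: blinfun.sum_right blinfun.scaleR_right v_def)
    also have "\<dots> = (\<Sum>l\<in>onb S. (v l \<bullet> x) *\<^sub>R v l)"
    proof (rule sum.cong)
      fix l
      have "?P0 x \<bullet> a l = ?P0 (a l) \<bullet> x"
        using posdef_onD(1)[OF \<open>posdef_on S ?P0\<close>] by (rule selfadjD)
      then show "(?P0 x \<bullet> a l) *\<^sub>R v l = (v l \<bullet> x) *\<^sub>R v l" by (simp add: v_def)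
    qed simp
    finally show ?thesis
      by (simp add: PL_def P0 blinfun.add_left blinfun.sum_left blinfun.scaleR_left rk1.rep_eq algebra_simps)
  qed
  have "A1 x = A x" if "x \<in> S" for x
    using A1(1) inv PLP that unfolding inverse_on_def by metis
  then have "Zg S A1 = Zg S A" by (intro Zg_cong) simp
  moreover have "Zg S (PL (onb S)) = Zg S P" by (intro Zg_cong) (simp add: PLP)
  ultimately show ?thesis using A1(2) by simp
qed

subsection \<open>Heat flows\<close>

text \<open>The mean value theorem bounds the difference quotients by \<open>K\<close>, and a
  constant is integrable over a finite measure; dominated convergence along sequences does the
  rest.\<close>

lemma leibniz_finite_measure:
  fixes F F' :: "real \<Rightarrow> 'b \<Rightarrow> real"
  assumes "finite_measure N" and s0: "s0 \<in> {a<..<b}"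
    and F: "\<And>s. s \<in> {a<..<b} \<Longrightarrow> integrable N (F s)"
    and F'm: "F' s0 \<in> borel_measurable N"
    and deriv: "\<And>s y. s \<in> {a<..<b} \<Longrightarrow> y \<in> space N \<Longrightarrow> ((\<lambda>s. F s y) has_real_derivative F' s y) (at s)"
    and bd: "\<And>s y. s \<in> {a<..<b} \<Longrightarrow> y \<in> space N \<Longrightarrow> \<bar>F' s y\<bar> \<le> K"
  shows "((\<lambda>s. \<integral>y. F s y \<partial>N) has_real_derivative (\<integral>y. F' s0 y \<partial>N)) (at s0)"
proof -
  interpret finite_measure N by fact
  have "((\<lambda>s. ((\<integral>y. F s y \<partial>N) - (\<integral>y. F s0 y \<partial>N)) / (s - s0)) \<longlongrightarrow> (\<integral>y. F' s0 y \<partial>N)) (at s0 within {a<..<b})"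
    unfolding tendsto_at_iff_sequentially
  proof (intro allI impI)
    fix X :: "nat \<Rightarrow> real"
    assume X: "\<forall>i. X i \<in> {a<..<b} - {s0}" and lim: "X \<longlonglongrightarrow> s0"
    have "(\<lambda>n. \<integral>y. (F (X n) y - F s0 y) / (X n - s0) \<partial>N) \<longlonglongrightarrow> (\<integral>y. F' s0 y \<partial>N)"
    proof (rule integral_dominated_convergence[where w = "\<lambda>_. K"])
      show "AE y in N. (\<lambda>n. (F (X n) y - F s0 y) / (X n - s0)) \<longlonglongrightarrow> F' s0 y"
      proof (rule AE_I2)
        fix y assume "y \<in> space N"
        then have "((\<lambda>s. (F s y - F s0 y) / (s - s0)) \<longlongrightarrow> F' s0 y) (at s0)"
          using deriv[OF s0] unfolding has_field_derivative_iff by blast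
        then show "(\<lambda>n. (F (X n) y - F s0 y) / (X n - s0)) \<longlonglongrightarrow> F' s0 y"
          unfolding tendsto_at_iff_sequentially using X lim by (auto simp: o_def)
      qed
      fix n
      have Xn: "X n \<in> {a<..<b}" "X n \<noteq> s0" using X by auto
      show "AE y in N. norm ((F (X n) y - F s0 y) / (X n - s0)) \<le> K"
      proof (rule AE_I2)
        fix y assume y: "y \<in> space N"
        let ?l = "min (X n) s0" and ?u = "max (X n) s0"
        have "?l < ?u" using Xn by auto
        moreover have "DERIV (\<lambda>s. F s y) s :> F' s y" if "?l \<le> s" "s \<le> ?u" for s
          using that Xn s0 by (intro deriv y) auto
        ultimately obtain z where z: "?l < z" "z < ?u" "F ?u y - F ?l y = (?u - ?l) * F' z y"
          using MVT2[of ?l ?u "\<lambda>s. F s y" "\<lambda>s. F' s y"] by auto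
        then have "(F (X n) y - F s0 y) / (X n - s0) = F' z y"
          using Xn(2) by (auto simp: min_def max_def field_simps split: if_splits)
        moreover have "z \<in> {a<..<b}" using z Xn s0 by auto
        ultimately show "norm ((F (X n) y - F s0 y) / (X n - s0)) \<le> K"
          using bd[OF _ y, of z] by simp
      qed
      show "(\<lambda>y. (F (X n) y - F s0 y) / (X n - s0)) \<in> borel_measurable N"
        using borel_measurable_integrable[OF F[OF Xn(1)]] borel_measurable_integrable[OF F[OF s0]] by measurable
    qed (use F'm in auto)
    moreover have eq: "(\<integral>y. (F (X n) y - F s0 y) / (X n - s0) \<partial>N) = ((\<integral>y. F (X n) y \<partial>N) - (\<integral>y. F s0 y \<partial>N)) / (X n - s0)" for n
    proof -
      have Xn: "X n \<in> {a<..<b}" using X by auto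
      show ?thesis by (simp add: Bochner_Integration.integral_diff[OF F[OF Xn] F[OF s0]])
    qed
    ultimately show "((\<lambda>s. ((\<integral>y. F s y \<partial>N) - (\<integral>y. F s0 y \<partial>N)) / (s - s0)) \<circ> X) \<longlonglongrightarrow> (\<integral>y. F' s0 y \<partial>N)"
      by (simp only: o_def eq)
  qed
  moreover have "at s0 within {a<..<b} = at s0" using s0 by (intro at_within_open) auto
  ultimately show ?thesis unfolding has_field_derivative_iff by simp
qed

lemma second_derivative_nonneg:
  fixes \<phi> \<phi>1 :: "real \<Rightarrow> real"
  assumes d1: "\<And>s. (\<phi> has_real_derivative \<phi>1 s) (at s)" and d2: "(\<phi>1 has_real_derivative D) (at 0)"
    and min: "\<And>s. \<phi> 0 \<le> \<phi> s"
  shows "\<phi>1 0 = 0" "0 \<le> D"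
proof -
  show z: "\<phi>1 0 = 0"
    using DERIV_local_min[OF d1[of 0], of 1] min by simp
  show "0 \<le> D"
  proof (rule ccontr)
    assume "\<not> 0 \<le> D"
    then obtain e where e: "e > 0" "\<And>h. 0 < h \<Longrightarrow> h < e \<Longrightarrow> \<phi>1 (0 + h) < \<phi>1 0"
      using DERIV_neg_dec_right[OF d2] by auto
    have "\<phi> (e/2) < \<phi> 0"
    proof (rule DERIV_neg_imp_decreasing_open[of 0 "e/2"])
      show "\<exists>y. DERIV \<phi> x :> y \<and> y < 0" if "0 < x" "x < e/2" for x
        using d1[of x] e(2)[of x] that z e(1) by auto
      show "continuous_on {0..e/2} \<phi>"
        by (rule continuous_at_imp_continuous_on) (use d1 DERIV_isCont in blast)
    qed (use e in auto)
    then show False using min[of "e/2"] by simp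
  qed
qed

text \<open>With \<open>r\<close> the value of a form, this bounds the kernel times its polynomial
  factors uniformly, so that constants can dominate whenever the heat flow is differentiated under
  the integral.\<close>

lemma mult_exp_neg_le: "r * exp (- r / (2 * t)) \<le> 2 * t" if "t > 0" for r t :: real
proof -
  have "r / (2 * t) \<le> exp (r / (2 * t))" using exp_ge_add_one_self[of "r / (2 * t)"] by linarith
  then have "r \<le> 2 * t * exp (r / (2 * t))" using that by (simp add: field_simps)
  then have "r * exp (- r / (2 * t)) \<le> 2 * t * exp (r / (2 * t)) * exp (- r / (2 * t))"
    by (rule mult_right_mono) simp
  also have "\<dots> = 2 * t" by (simp add: mult.assoc exp_add[symmetric])
  finally show ?thesis .
qed

text \<open>The kernel is not normalized. The omitted factor is
  \<open>sqrt t ^ dim S * Zg S P\<close>: its powers of \<open>t\<close> cancel between the two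
  sides of the inequality by the dimension condition, and its \<open>Zg\<close> part is what
  produces \<open>Phi\<close> at small times.\<close>

definition heat :: "('a::euclidean_space \<Rightarrow>\<^sub>L 'a) \<Rightarrow> 'a measure \<Rightarrow> real \<Rightarrow> 'a \<Rightarrow> real" where
  "heat P N t x = (\<integral>y. exp (- (P (x - y) \<bullet> (x - y)) / (2 * t)) \<partial>N)"

lemma abs_le_add_of_sq_le:
  fixes a b c :: real
  assumes "a\<^sup>2 \<le> b * c" "0 \<le> b" "0 \<le> c"
  shows "\<bar>a\<bar> \<le> b + c"
proof (rule power2_le_imp_le)
  have "0 \<le> b\<^sup>2 + c\<^sup>2 + b * c" using assms by simp
  then show "\<bar>a\<bar>\<^sup>2 \<le> (b + c)\<^sup>2"
    using assms(1) by (simp add: power2_eq_square algebra_simps)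
qed (use assms in simp)

text \<open>The initial datum is a finite measure rather than a density, so that constants are
  integrable. Positive mass makes the flow positive and its logarithm meaningful.\<close>

locale heat_flow = finite_measure N
  for N :: "'a::euclidean_space measure" +
  fixes S :: "'a set" and P :: "'a \<Rightarrow>\<^sub>L 'a"
  assumes S: "subspace S" and P: "posdef_on S P"
    and sets_N: "sets N = sets (restrict_space borel S)" and N_pos: "0 < measure N S"
begin

lemma space_N: "space N = S"
  using sets_eq_imp_space_eq[OF sets_N] by (simp add: space_restrict_space)

lemma borel_measurable_N [measurable (raw)]: "f \<in> borel_measurable borel \<Longrightarrow> f \<in> borel_measurable N"
  using measurable_restrict_space1[of f borel borel S] measurable_cong_sets[OF sets_N refl] by blast

abbreviation "K t x y \<equiv> exp (- (P (x - y) \<bullet> (x - y)) / (2 * t))"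

lemma sadj: "P x \<bullet> y = P y \<bullet> x" by (rule selfadjD[OF posdef_onD(1)[OF P]])

lemma diff_in: "x \<in> S \<Longrightarrow> y \<in> space N \<Longrightarrow> x - y \<in> S"
  by (simp add: space_N S subspace_diff)

lemma form_nonneg: "x \<in> S \<Longrightarrow> y \<in> space N \<Longrightarrow> 0 \<le> P (x - y) \<bullet> (x - y)"
  by (intro posdef_on_nonneg[OF P] diff_in)

lemma K_le_1: "x \<in> S \<Longrightarrow> y \<in> space N \<Longrightarrow> t > 0 \<Longrightarrow> K t x y \<le> 1"
  using form_nonneg by simp

lemma measurable_form [measurable]:
  "(\<lambda>y. P (x - y) \<bullet> (x - y)) \<in> borel_measurable N" "(\<lambda>y. P (x - y) \<bullet> z) \<in> borel_measurable N"
  by (intro borel_measurable_N; measurable)+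

lemma integrable_K: "x \<in> S \<Longrightarrow> t > 0 \<Longrightarrow> integrable N (K t x)"
  by (rule integrable_const_bound[of _ 1]) (auto intro!: AE_I2 simp: form_nonneg)

lemma heat_pos:
  assumes "x \<in> S" "t > 0"
  shows "0 < heat P N t x"
proof -
  have "emeasure N (space N) \<noteq> 0"
    using N_pos by (simp add: space_N emeasure_eq_measure)
  then have "(\<integral>y. 0 \<partial>N) < (\<integral>y. K t x y \<partial>N)"
    by (intro integral_less_AE_space integrable_K assms) auto
  then show ?thesis by (simp add: heat_def)
qed

lemma form_K_bound:
  assumes "x \<in> S" "y \<in> space N" "t > 0"
  shows "P (x - y) \<bullet> (x - y) * K t x y \<le> 2 * t"
  by (rule mult_exp_neg_le[OF assms(3)])

lemma lin_sq_bound: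
  assumes "x \<in> S" "y \<in> space N" "\<xi> \<in> S"
  shows "(P (x - y) \<bullet> \<xi>)\<^sup>2 \<le> (P (x - y) \<bullet> (x - y)) * (P \<xi> \<bullet> \<xi>)"
  by (intro posdef_cauchy_schwarz[OF S P] diff_in assms)

lemma lin_bound:
  assumes "x \<in> S" "y \<in> space N" "\<xi> \<in> S"
  shows "\<bar>P (x - y) \<bullet> \<xi>\<bar> \<le> P (x - y) \<bullet> (x - y) + P \<xi> \<bullet> \<xi>"
  by (intro abs_le_add_of_sq_le lin_sq_bound form_nonneg posdef_on_nonneg[OF P] assms)

lemma lin_K_bound:
  assumes "x \<in> S" "y \<in> space N" "\<xi> \<in> S" "t > 0"
  shows "\<bar>(P (x - y) \<bullet> \<xi>) * K t x y\<bar> \<le> 2 * t + P \<xi> \<bullet> \<xi>"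
proof -
  have "\<bar>(P (x - y) \<bullet> \<xi>) * K t x y\<bar> \<le> (P (x - y) \<bullet> (x - y) + P \<xi> \<bullet> \<xi>) * K t x y"
    using lin_bound[OF assms(1-3)] by (simp add: abs_mult mult_right_mono)
  also have "\<dots> \<le> 2 * t + (P \<xi> \<bullet> \<xi>) * 1"
    unfolding distrib_right using posdef_on_nonneg[OF P assms(3)]
    by (intro add_mono form_K_bound mult_left_mono K_le_1 assms) auto
  finally show ?thesis by simp
qed

lemma lin_sq_K_bound:
  assumes "x \<in> S" "y \<in> space N" "\<xi> \<in> S" "t > 0"
  shows "(P (x - y) \<bullet> \<xi>)\<^sup>2 * K t x y \<le> 2 * t * (P \<xi> \<bullet> \<xi>)"
proof -
  have "(P (x - y) \<bullet> \<xi>)\<^sup>2 * K t x y \<le> ((P (x - y) \<bullet> (x - y)) * (P \<xi> \<bullet> \<xi>)) * K t x y"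
    by (intro mult_right_mono lin_sq_bound assms) auto
  also have "\<dots> = (P (x - y) \<bullet> (x - y) * K t x y) * (P \<xi> \<bullet> \<xi>)" by simp
  also have "\<dots> \<le> 2 * t * (P \<xi> \<bullet> \<xi>)"
    by (intro mult_right_mono form_K_bound posdef_on_nonneg[OF P] assms)
  finally show ?thesis .
qed

lemma integrable_form_K: "x \<in> S \<Longrightarrow> t > 0 \<Longrightarrow> integrable N (\<lambda>y. P (x - y) \<bullet> (x - y) * K t x y)"
  by (rule integrable_const_bound[of _ "2 * t"], rule AE_I2, unfold real_norm_def,
      subst abs_of_nonneg, simp add: form_nonneg, rule form_K_bound, measurable)

lemma integrable_lin_K: "x \<in> S \<Longrightarrow> \<xi> \<in> S \<Longrightarrow> t > 0 \<Longrightarrow> integrable N (\<lambda>y. (P (x - y) \<bullet> \<xi>) * K t x y)"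
  by (rule integrable_const_bound[of _ "2 * t + P \<xi> \<bullet> \<xi>"])
    (rule AE_I2, unfold real_norm_def, rule lin_K_bound, measurable)

lemma integrable_lin_sq_K: "x \<in> S \<Longrightarrow> \<xi> \<in> S \<Longrightarrow> t > 0 \<Longrightarrow> integrable N (\<lambda>y. (P (x - y) \<bullet> \<xi>)\<^sup>2 * K t x y)"
  by (rule integrable_const_bound[of _ "2 * t * (P \<xi> \<bullet> \<xi>)"])
    (rule AE_I2, unfold real_norm_def, subst abs_of_nonneg, simp, rule lin_sq_K_bound, measurable)

lemma heat_dt:
  assumes x: "x \<in> S" and t: "t > 0"
  shows "((\<lambda>t. heat P N t x) has_real_derivative (\<integral>y. P (x - y) \<bullet> (x - y) * K t x y \<partial>N) / (2 * t\<^sup>2)) (at t)"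
proof -
  have "((\<lambda>t. \<integral>y. K t x y \<partial>N) has_real_derivative (\<integral>y. P (x - y) \<bullet> (x - y) * K t x y / (2 * t\<^sup>2) \<partial>N)) (at t)"
  \<comment> \<open>This interval stays away from time 0, so that one constant bounds the
    derivative.\<close>
  proof (rule leibniz_finite_measure[of N t "t/2" "2 * t" _ _ "2 * (2 * t) / (2 * (t/2)\<^sup>2)"])
    show "finite_measure N" by unfold_locales
    fix s assume s: "s \<in> {t/2<..<2 * t}"
    then have s0: "s > 0" using t by auto
    show "integrable N (K s x)" by (rule integrable_K[OF x s0])
    fix y assume y: "y \<in> space N"
    show "((\<lambda>s. K s x y) has_real_derivative P (x - y) \<bullet> (x - y) * K s x y / (2 * s\<^sup>2)) (at s)"
      using s0 by (auto intro!: derivative_eq_intros simp: field_simps power2_eq_square)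
    have "P (x - y) \<bullet> (x - y) * K s x y \<le> 2 * (2 * t)"
      using form_K_bound[OF x y s0] s by auto
    moreover have "2 * (t/2)\<^sup>2 \<le> 2 * s\<^sup>2" using s t by (intro mult_left_mono power_mono) auto
    moreover have "0 < 2 * (t/2)\<^sup>2" using t by simp
    ultimately have "P (x - y) \<bullet> (x - y) * K s x y / (2 * s\<^sup>2) \<le> 2 * (2 * t) / (2 * (t/2)\<^sup>2)"
      using t by (intro frac_le) auto
    then show "\<bar>P (x - y) \<bullet> (x - y) * K s x y / (2 * s\<^sup>2)\<bar> \<le> 2 * (2 * t) / (2 * (t/2)\<^sup>2)"
      using form_nonneg[OF x y] by (subst abs_of_nonneg) simp_all
  qed (use t in auto)
  then show ?thesis unfolding heat_def by simp
qed

lemma line_in: "x \<in> S \<Longrightarrow> \<xi> \<in> S \<Longrightarrow> x + s *\<^sub>R \<xi> \<in> S"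
  using S by (simp add: subspace_add subspace_scale)

lemma form_line_deriv:
  "((\<lambda>s. P (x + s *\<^sub>R \<xi> - y) \<bullet> (x + s *\<^sub>R \<xi> - y)) has_real_derivative 2 * (P (x + s *\<^sub>R \<xi> - y) \<bullet> \<xi>)) (at s)"
proof -
  have z: "P (z + s *\<^sub>R \<xi>) \<bullet> (z + s *\<^sub>R \<xi>) = P z \<bullet> z + 2 * s * (P z \<bullet> \<xi>) + s\<^sup>2 * (P \<xi> \<bullet> \<xi>)" for z s
    by (simp add: blinfun.add_right blinfun.scaleR_right inner_add_left inner_add_right sadj[of \<xi> z] power2_eq_square algebra_simps)
  have "x + s *\<^sub>R \<xi> - y = (x - y) + s *\<^sub>R \<xi>" for s by simp
  then have "P (x + s *\<^sub>R \<xi> - y) \<bullet> (x + s *\<^sub>R \<xi> - y) = P (x - y) \<bullet> (x - y) + 2 * s * (P (x - y) \<bullet> \<xi>) + s\<^sup>2 * (P \<xi> \<bullet> \<xi>)" for s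
    by (simp only: z)
  moreover have "2 * (P (x + s *\<^sub>R \<xi> - y) \<bullet> \<xi>) = 2 * (P (x - y) \<bullet> \<xi>) + 2 * s * (P \<xi> \<bullet> \<xi>)"
    by (simp add: blinfun.add_right blinfun.diff_right blinfun.scaleR_right inner_add_left inner_diff_left algebra_simps)
  ultimately show ?thesis
    by (auto intro!: derivative_eq_intros)
qed

lemma lin_line_deriv:
  "((\<lambda>s. P (x + s *\<^sub>R \<xi> - y) \<bullet> \<xi>) has_real_derivative P \<xi> \<bullet> \<xi>) (at s)"
proof -
  have "P (x + s *\<^sub>R \<xi> - y) \<bullet> \<xi> = P (x - y) \<bullet> \<xi> + s * (P \<xi> \<bullet> \<xi>)" for s
    by (simp add: blinfun.add_right blinfun.diff_right blinfun.scaleR_right inner_add_left inner_diff_left algebra_simps)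
  then show ?thesis by (auto intro!: derivative_eq_intros)
qed

lemma K_line_deriv:
  assumes "t > 0"
  shows "((\<lambda>s. K t (x + s *\<^sub>R \<xi>) y) has_real_derivative - ((P (x + s *\<^sub>R \<xi> - y) \<bullet> \<xi>) * K t (x + s *\<^sub>R \<xi>) y) / t) (at s)"
  using assms by (auto intro!: derivative_eq_intros form_line_deriv simp: field_simps)

lemma heat_ds:
  assumes x: "x \<in> S" and \<xi>: "\<xi> \<in> S" and t: "t > 0"
  shows "((\<lambda>s. heat P N t (x + s *\<^sub>R \<xi>)) has_real_derivative
    - (\<integral>y. (P (x + s *\<^sub>R \<xi> - y) \<bullet> \<xi>) * K t (x + s *\<^sub>R \<xi>) y \<partial>N) / t) (at s)"
proof -
  have "((\<lambda>s. \<integral>y. K t (x + s *\<^sub>R \<xi>) y \<partial>N) has_real_derivative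
      (\<integral>y. - ((P (x + s *\<^sub>R \<xi> - y) \<bullet> \<xi>) * K t (x + s *\<^sub>R \<xi>) y) / t \<partial>N)) (at s)"
  proof (rule leibniz_finite_measure[of N s "s - 1" "s + 1" _ _ "(2 * t + P \<xi> \<bullet> \<xi>) / t"])
    show "finite_measure N" by unfold_locales
    fix r show "integrable N (K t (x + r *\<^sub>R \<xi>))" by (rule integrable_K[OF line_in[OF x \<xi>] t])
    fix y assume y: "y \<in> space N"
    show "((\<lambda>s. K t (x + s *\<^sub>R \<xi>) y) has_real_derivative - ((P (x + r *\<^sub>R \<xi> - y) \<bullet> \<xi>) * K t (x + r *\<^sub>R \<xi>) y) / t) (at r)"
      by (rule K_line_deriv[OF t])
    show "\<bar>- ((P (x + r *\<^sub>R \<xi> - y) \<bullet> \<xi>) * K t (x + r *\<^sub>R \<xi>) y) / t\<bar> \<le> (2 * t + P \<xi> \<bullet> \<xi>) / t"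
      using lin_K_bound[OF line_in[OF x \<xi>] y \<xi> t, of r] t
      by (simp only: abs_divide abs_minus_cancel) (simp add: divide_right_mono)
  qed auto
  then show ?thesis unfolding heat_def by simp
qed

lemma heat_ds2:
  assumes x: "x \<in> S" and \<xi>: "\<xi> \<in> S" and t: "t > 0"
  shows "((\<lambda>s. - (\<integral>y. (P (x + s *\<^sub>R \<xi> - y) \<bullet> \<xi>) * K t (x + s *\<^sub>R \<xi>) y \<partial>N) / t) has_real_derivative
    (\<integral>y. (P (x - y) \<bullet> \<xi>)\<^sup>2 * K t x y \<partial>N) / t\<^sup>2 - (P \<xi> \<bullet> \<xi>) * heat P N t x / t) (at 0)"
proof -
  let ?F' = "\<lambda>s y. (P \<xi> \<bullet> \<xi>) * K t (x + s *\<^sub>R \<xi>) y - (P (x + s *\<^sub>R \<xi> - y) \<bullet> \<xi>)\<^sup>2 * K t (x + s *\<^sub>R \<xi>) y / t"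
  have nn: "P \<xi> \<bullet> \<xi> \<ge> 0" by (rule posdef_on_nonneg[OF P \<xi>])
  have "((\<lambda>s. \<integral>y. (P (x + s *\<^sub>R \<xi> - y) \<bullet> \<xi>) * K t (x + s *\<^sub>R \<xi>) y \<partial>N) has_real_derivative
      (\<integral>y. ?F' 0 y \<partial>N)) (at 0)"
  proof (rule leibniz_finite_measure[of N 0 "- 1" "1" _ _ "3 * (P \<xi> \<bullet> \<xi>)"])
    show "finite_measure N" by unfold_locales
    fix r :: real
    show "integrable N (\<lambda>y. (P (x + r *\<^sub>R \<xi> - y) \<bullet> \<xi>) * K t (x + r *\<^sub>R \<xi>) y)"
      by (rule integrable_lin_K[OF line_in[OF x \<xi>] \<xi> t])
    fix y assume y: "y \<in> space N"
    have "((\<lambda>s. (P (x + s *\<^sub>R \<xi> - y) \<bullet> \<xi>) * K t (x + s *\<^sub>R \<xi>) y) has_real_derivative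
       (P (x + r *\<^sub>R \<xi> - y) \<bullet> \<xi>) * (- ((P (x + r *\<^sub>R \<xi> - y) \<bullet> \<xi>) * K t (x + r *\<^sub>R \<xi>) y) / t) + (P \<xi> \<bullet> \<xi>) * K t (x + r *\<^sub>R \<xi>) y) (at r)"
      by (rule DERIV_mult'[OF lin_line_deriv K_line_deriv[OF t]])
    then show "((\<lambda>s. (P (x + s *\<^sub>R \<xi> - y) \<bullet> \<xi>) * K t (x + s *\<^sub>R \<xi>) y) has_real_derivative ?F' r y) (at r)"
      by (rule DERIV_cong) (simp add: power2_eq_square)
    have "(P (x + r *\<^sub>R \<xi> - y) \<bullet> \<xi>)\<^sup>2 * K t (x + r *\<^sub>R \<xi>) y \<le> 2 * t * (P \<xi> \<bullet> \<xi>)"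
      by (rule lin_sq_K_bound[OF line_in[OF x \<xi>] y \<xi> t])
    then have "(P (x + r *\<^sub>R \<xi> - y) \<bullet> \<xi>)\<^sup>2 * K t (x + r *\<^sub>R \<xi>) y / t \<le> 2 * (P \<xi> \<bullet> \<xi>)"
      using t by (simp add: field_simps)
    moreover have "(P \<xi> \<bullet> \<xi>) * K t (x + r *\<^sub>R \<xi>) y \<le> (P \<xi> \<bullet> \<xi>) * 1"
      by (intro mult_left_mono K_le_1 line_in x \<xi> y t nn)
    moreover have "0 \<le> (P (x + r *\<^sub>R \<xi> - y) \<bullet> \<xi>)\<^sup>2 * K t (x + r *\<^sub>R \<xi>) y / t" "0 \<le> (P \<xi> \<bullet> \<xi>) * K t (x + r *\<^sub>R \<xi>) y"
      using t nn by auto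
    ultimately show "\<bar>?F' r y\<bar> \<le> 3 * (P \<xi> \<bullet> \<xi>)" unfolding abs_le_iff by (intro conjI; linarith)
  qed auto
  then have d: "((\<lambda>s. - (\<integral>y. (P (x + s *\<^sub>R \<xi> - y) \<bullet> \<xi>) * K t (x + s *\<^sub>R \<xi>) y \<partial>N) / t) has_real_derivative
      - (\<integral>y. ?F' 0 y \<partial>N) / t) (at 0)"
    using t by (intro DERIV_cdivide DERIV_minus)
  have i: "(\<integral>y. ?F' 0 y \<partial>N) = (P \<xi> \<bullet> \<xi>) * heat P N t x - (\<integral>y. (P (x - y) \<bullet> \<xi>)\<^sup>2 * K t x y \<partial>N) / t"
    using integrable_K[OF x t] integrable_lin_sq_K[OF x \<xi> t] by (simp add: heat_def)
  show ?thesis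
    by (rule DERIV_cong[OF d], unfold i) (use t in \<open>simp add: diff_divide_distrib power2_eq_square\<close>)
qed

lemma continuous_on_heat: "continuous_on ({0<..} \<times> S) (\<lambda>(t, x). heat P N t x)"
  unfolding continuous_on_sequentially
proof (intro ballI allI impI)
  fix u :: "nat \<Rightarrow> real \<times> 'a" and a
  assume "a \<in> {0<..} \<times> S" "(\<forall>n. u n \<in> {0<..} \<times> S) \<and> u \<longlonglongrightarrow> a"
  moreover obtain t x where a: "a = (t, x)" by (cases a)
  ultimately have t: "t > 0" and x: "x \<in> S" and u: "\<And>n. fst (u n) > 0" "\<And>n. snd (u n) \<in> S"
    and l1: "(\<lambda>n. fst (u n)) \<longlonglongrightarrow> t" and l2: "(\<lambda>n. snd (u n)) \<longlonglongrightarrow> x"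
    by (auto simp: mem_Times_iff dest: tendsto_fst tendsto_snd)
  have "(\<lambda>n. heat P N (fst (u n)) (snd (u n))) \<longlonglongrightarrow> heat P N t x"
    unfolding heat_def
  proof (rule integral_dominated_convergence[where w = "\<lambda>_. 1"])
    show "AE y in N. (\<lambda>n. K (fst (u n)) (snd (u n)) y) \<longlonglongrightarrow> K t x y"
      using t by (intro AE_I2 tendsto_intros l1 l2) auto
    show "AE y in N. norm (K (fst (u n)) (snd (u n)) y) \<le> 1" for n
      using K_le_1[OF u(2) _ u(1)] by (intro AE_I2) simp
  qed auto
  then show "((\<lambda>(t, x). heat P N t x) \<circ> u) \<longlonglongrightarrow> (\<lambda>(t, x). heat P N t x) a"
    by (simp add: a o_def case_prod_beta)
qed

text \<open>
  The logarithmic derivatives of the heat flow are the moments of the probability measure with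
  density proportional to the kernel: \<open>mn\<close> is the mean of \<open>x - y\<close>, and \<open>vr\<close>, \<open>vd \<xi>\<close> are its
  variance and its variance in direction \<open>\<xi>\<close>.
\<close>

lemma log_heat_derivs:
  assumes x: "x \<in> S" and t: "t > 0"
  shows "\<exists>mn\<in>S. \<exists>vr vd.
    ((\<lambda>t. ln (heat P N t x)) has_real_derivative (P mn \<bullet> mn + vr) / (2 * t\<^sup>2)) (at t) \<and>
    (\<forall>\<xi>\<in>S. \<exists>G. (\<forall>s. ((\<lambda>s. ln (heat P N t (x + s *\<^sub>R \<xi>))) has_real_derivative G s) (at s)) \<and>
        G 0 = - (P mn \<bullet> \<xi>) / t \<and> (G has_real_derivative (vd \<xi> / t\<^sup>2 - (P \<xi> \<bullet> \<xi>) / t)) (at 0)) \<and>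
    (\<forall>(L :: 'l set) \<eta>. finite L \<longrightarrow> (\<forall>l\<in>L. \<eta> l \<in> S) \<longrightarrow> (\<forall>y\<in>S. P y \<bullet> y \<le> (\<Sum>l\<in>L. (P y \<bullet> \<eta> l)\<^sup>2)) \<longrightarrow>
        vr \<le> (\<Sum>l\<in>L. vd (\<eta> l))) \<and>
    (\<forall>(L :: 'l set) \<eta>. finite L \<longrightarrow> (\<forall>l\<in>L. \<eta> l \<in> S) \<longrightarrow> (\<forall>y\<in>S. (\<Sum>l\<in>L. (P y \<bullet> \<eta> l)\<^sup>2) \<le> P y \<bullet> y) \<longrightarrow>
        (\<Sum>l\<in>L. vd (\<eta> l)) \<le> vr)"
proof -
  define U where "U = heat P N t x"
  have U: "U > 0" unfolding U_def by (rule heat_pos[OF x t])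
  obtain a where aS: "\<And>l. l \<in> onb S \<Longrightarrow> a l \<in> S"
    and a: "\<And>y. y \<in> S \<Longrightarrow> y = (\<Sum>l\<in>onb S. (P y \<bullet> a l) *\<^sub>R a l)"
    using posdef_orthonormal_basis[OF S P] by blast
  \<comment> \<open>The mean given by its coordinates in a basis adapted to \<open>P\<close>;
    pairing it with \<open>P \<xi>\<close> recovers the scalar mean in every direction
    \<xi>.\<close>
  define mn where "mn = (\<Sum>l\<in>onb S. ((\<integral>y. (P (x - y) \<bullet> a l) * K t x y \<partial>N) / U) *\<^sub>R a l)"
  define vr where "vr = (\<integral>y. (P (x - y - mn) \<bullet> (x - y - mn)) * K t x y \<partial>N) / U"
  define vd where "vd \<xi> = (\<integral>y. (P (x - y - mn) \<bullet> \<xi>)\<^sup>2 * K t x y \<partial>N) / U" for \<xi>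
  have mnS: "mn \<in> S" unfolding mn_def using aS by (intro subspace_sum[OF S] subspace_scale[OF S]) auto
  have mean: "(\<integral>y. (P (x - y) \<bullet> \<xi>) * K t x y \<partial>N) = U * (P mn \<bullet> \<xi>)" if \<xi>: "\<xi> \<in> S" for \<xi>
  proof -
    have "(\<integral>y. (P (x - y) \<bullet> \<xi>) * K t x y \<partial>N) = (\<integral>y. (\<Sum>l\<in>onb S. (P \<xi> \<bullet> a l) * ((P (x - y) \<bullet> a l) * K t x y)) \<partial>N)"
    proof (rule Bochner_Integration.integral_cong)
      fix y
      have "P (x - y) \<bullet> \<xi> = (\<Sum>l\<in>onb S. (P \<xi> \<bullet> a l) * (P (x - y) \<bullet> a l))"
        by (subst a[OF \<xi>]) (simp add: inner_sum_right)
      then show "(P (x - y) \<bullet> \<xi>) * K t x y = (\<Sum>l\<in>onb S. (P \<xi> \<bullet> a l) * ((P (x - y) \<bullet> a l) * K t x y))"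
        by (simp only: sum_distrib_right mult.assoc)
    qed simp
    also have "\<dots> = (\<Sum>l\<in>onb S. (P \<xi> \<bullet> a l) * (\<integral>y. (P (x - y) \<bullet> a l) * K t x y \<partial>N))"
      using integrable_lin_K[OF x aS t] by (subst Bochner_Integration.integral_sum) auto
    also have "\<dots> = U * (mn \<bullet> P \<xi>)"
      unfolding mn_def inner_sum_left sum_distrib_left using U by (intro sum.cong) (simp_all add: inner_commute)
    also have "mn \<bullet> P \<xi> = P mn \<bullet> \<xi>"
      using sadj[of mn \<xi>] by (simp add: inner_commute)
    finally show ?thesis .
  qed
  have exp_form: "P (z - mn) \<bullet> (z - mn) = P z \<bullet> z - 2 * (P z \<bullet> mn) + P mn \<bullet> mn" for z
    by (simp add: blinfun.diff_right inner_diff_left inner_diff_right sadj[of mn z])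
  have vr: "(\<integral>y. P (x - y) \<bullet> (x - y) * K t x y \<partial>N) = U * (P mn \<bullet> mn + vr)"
  proof -
    have "(\<integral>y. (P (x - y - mn) \<bullet> (x - y - mn)) * K t x y \<partial>N)
      = (\<integral>y. P (x - y) \<bullet> (x - y) * K t x y - 2 * ((P (x - y) \<bullet> mn) * K t x y) + (P mn \<bullet> mn) * K t x y \<partial>N)"
      unfolding exp_form by (intro Bochner_Integration.integral_cong) (simp_all add: algebra_simps)
    also have "\<dots> = (\<integral>y. P (x - y) \<bullet> (x - y) * K t x y \<partial>N) - 2 * (\<integral>y. (P (x - y) \<bullet> mn) * K t x y \<partial>N) + (P mn \<bullet> mn) * U"
      using integrable_form_K[OF x t] integrable_lin_K[OF x mnS t] integrable_K[OF x t]
      by (simp add: U_def heat_def)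
    also have "\<dots> = (\<integral>y. P (x - y) \<bullet> (x - y) * K t x y \<partial>N) - U * (P mn \<bullet> mn)"
      unfolding mean[OF mnS] by simp
    also have "(\<integral>y. (P (x - y - mn) \<bullet> (x - y - mn)) * K t x y \<partial>N) = U * vr"
      using U by (simp add: vr_def)
    finally show ?thesis unfolding distrib_left by linarith
  qed
  have int_dev: "integrable N (\<lambda>y. (P (x - y - mn) \<bullet> \<xi>)\<^sup>2 * K t x y)"
    and vd: "(\<integral>y. (P (x - y) \<bullet> \<xi>)\<^sup>2 * K t x y \<partial>N) = U * ((P mn \<bullet> \<xi>)\<^sup>2 + vd \<xi>)" if \<xi>: "\<xi> \<in> S" for \<xi>
  proof -
    have e: "(\<lambda>y. (P (x - y - mn) \<bullet> \<xi>)\<^sup>2 * K t x y)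
      = (\<lambda>y. (P (x - y) \<bullet> \<xi>)\<^sup>2 * K t x y - 2 * (P mn \<bullet> \<xi>) * ((P (x - y) \<bullet> \<xi>) * K t x y) + (P mn \<bullet> \<xi>)\<^sup>2 * K t x y)"
      unfolding blinfun.diff_right[of P "x - _"] inner_diff_left by (simp add: power2_eq_square algebra_simps)
    note int = integrable_lin_sq_K[OF x \<xi> t] integrable_lin_K[OF x \<xi> t] integrable_K[OF x t]
    show "integrable N (\<lambda>y. (P (x - y - mn) \<bullet> \<xi>)\<^sup>2 * K t x y)"
      unfolding e using int by auto
    have "(\<integral>y. (P (x - y - mn) \<bullet> \<xi>)\<^sup>2 * K t x y \<partial>N)
       = (\<integral>y. (P (x - y) \<bullet> \<xi>)\<^sup>2 * K t x y \<partial>N) - 2 * (P mn \<bullet> \<xi>) * (\<integral>y. (P (x - y) \<bullet> \<xi>) * K t x y \<partial>N) + (P mn \<bullet> \<xi>)\<^sup>2 * U"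
      unfolding e using int by (simp add: U_def heat_def)
    also have "\<dots> = (\<integral>y. (P (x - y) \<bullet> \<xi>)\<^sup>2 * K t x y \<partial>N) - U * (P mn \<bullet> \<xi>)\<^sup>2"
      unfolding mean[OF \<xi>] by (simp add: power2_eq_square)
    also have "(\<integral>y. (P (x - y - mn) \<bullet> \<xi>)\<^sup>2 * K t x y \<partial>N) = U * vd \<xi>"
      using U by (simp add: vd_def)
    finally show "(\<integral>y. (P (x - y) \<bullet> \<xi>)\<^sup>2 * K t x y \<partial>N) = U * ((P mn \<bullet> \<xi>)\<^sup>2 + vd \<xi>)"
      unfolding distrib_left by linarith
  qed
  have int_form: "integrable N (\<lambda>y. (P (x - y - mn) \<bullet> (x - y - mn)) * K t x y)"
  proof -
    have e: "(\<lambda>y. (P (x - y - mn) \<bullet> (x - y - mn)) * K t x y)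
      = (\<lambda>y. P (x - y) \<bullet> (x - y) * K t x y - 2 * ((P (x - y) \<bullet> mn) * K t x y) + (P mn \<bullet> mn) * K t x y)"
      unfolding exp_form by (simp add: algebra_simps)
    show ?thesis unfolding e
      using integrable_form_K[OF x t] integrable_lin_K[OF x mnS t] integrable_K[OF x t] by auto
  qed
  have sum_vd: "(\<Sum>l\<in>L. vd (\<eta> l)) = (\<integral>y. (\<Sum>l\<in>L. (P (x - y - mn) \<bullet> \<eta> l)\<^sup>2) * K t x y \<partial>N) / U"
    and int_sum: "integrable N (\<lambda>y. (\<Sum>l\<in>L. (P (x - y - mn) \<bullet> \<eta> l)\<^sup>2) * K t x y)"
    if "\<forall>l\<in>L. \<eta> l \<in> S" for L :: "'l set" and \<eta>
    using int_dev that unfolding vd_def sum_distrib_right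
    by (auto simp: sum_divide_distrib[symmetric] Bochner_Integration.integral_sum)
  have dev_in: "x - y - mn \<in> S" if "y \<in> space N" for y
    using diff_in[OF x that] mnS S by (simp add: subspace_diff)
  have 1: "((\<lambda>t. ln (heat P N t x)) has_real_derivative (P mn \<bullet> mn + vr) / (2 * t\<^sup>2)) (at t)"
    using heat_dt[OF x t] U unfolding vr by (auto intro!: derivative_eq_intros simp: U_def[symmetric])
  have 2: "\<exists>G. (\<forall>s. ((\<lambda>s. ln (heat P N t (x + s *\<^sub>R \<xi>))) has_real_derivative G s) (at s)) \<and>
        G 0 = - (P mn \<bullet> \<xi>) / t \<and> (G has_real_derivative (vd \<xi> / t\<^sup>2 - (P \<xi> \<bullet> \<xi>) / t)) (at 0)" if \<xi>: "\<xi> \<in> S" for \<xi>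
  proof -
    define D1 where "D1 s = - (\<integral>y. (P (x + s *\<^sub>R \<xi> - y) \<bullet> \<xi>) * K t (x + s *\<^sub>R \<xi>) y \<partial>N) / t" for s
    define H where "H s = heat P N t (x + s *\<^sub>R \<xi>)" for s
    have Hpos: "H s > 0" for s unfolding H_def by (rule heat_pos[OF line_in[OF x \<xi>] t])
    have H1: "(H has_real_derivative D1 s) (at s)" for s
      unfolding H_def D1_def by (rule heat_ds[OF x \<xi> t])
    have H0: "H 0 = U" by (simp add: H_def U_def)
    have D10: "D1 0 = - U * (P mn \<bullet> \<xi>) / t" using mean[OF \<xi>] by (simp add: D1_def)
    have H2: "(D1 has_real_derivative U * ((P mn \<bullet> \<xi>)\<^sup>2 + vd \<xi>) / t\<^sup>2 - (P \<xi> \<bullet> \<xi>) * U / t) (at 0)"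
      using heat_ds2[OF x \<xi> t] unfolding vd[OF \<xi>] U_def[symmetric] D1_def[abs_def] .
    show ?thesis
    proof (intro exI[of _ "\<lambda>s. D1 s / H s"] conjI allI)
      show "((\<lambda>s. ln (heat P N t (x + s *\<^sub>R \<xi>))) has_real_derivative D1 s / H s) (at s)" for s
        unfolding H_def[symmetric] using Hpos[of s] by (auto intro!: derivative_eq_intros H1)
      show "D1 0 / H 0 = - (P mn \<bullet> \<xi>) / t" using U by (simp add: D10 H0)
      \<comment> \<open>In the quotient rule the square of \<open>D1 0\<close> cancels the squared
        mean inside the second moment, and only the directional variance is left.\<close>
      have "((\<lambda>s. D1 s / H s) has_real_derivative
         ((U * ((P mn \<bullet> \<xi>)\<^sup>2 + vd \<xi>) / t\<^sup>2 - (P \<xi> \<bullet> \<xi>) * U / t) * H 0 - D1 0 * D1 0) / (H 0 * H 0)) (at 0)"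
        using Hpos[of 0] by (intro DERIV_divide H2 H1) simp
      then show "((\<lambda>s. D1 s / H s) has_real_derivative (vd \<xi> / t\<^sup>2 - (P \<xi> \<bullet> \<xi>) / t)) (at 0)"
        by (rule DERIV_cong) (use U t in \<open>simp add: H0 D10 field_simps power2_eq_square\<close>)
    qed
  qed
  \<comment> \<open>The comparison of forms holds at each vector \<open>x - y - mn\<close> and is
    integrated against the kernel.\<close>
  have 3: "vr \<le> (\<Sum>l\<in>L. vd (\<eta> l))"
    if "\<forall>l\<in>L. \<eta> l \<in> S" "\<forall>y\<in>S. P y \<bullet> y \<le> (\<Sum>l\<in>L. (P y \<bullet> \<eta> l)\<^sup>2)" for L :: "'l set" and \<eta>
    unfolding sum_vd[OF that(1)] vr_def using U that(2) dev_in
    by (intro divide_right_mono integral_mono int_form int_sum that(1) mult_right_mono) auto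
  have 4: "(\<Sum>l\<in>L. vd (\<eta> l)) \<le> vr"
    if "\<forall>l\<in>L. \<eta> l \<in> S" "\<forall>y\<in>S. (\<Sum>l\<in>L. (P y \<bullet> \<eta> l)\<^sup>2) \<le> P y \<bullet> y" for L :: "'l set" and \<eta>
    unfolding sum_vd[OF that(1)] vr_def using U that(2) dev_in
    by (intro divide_right_mono integral_mono int_form int_sum that(1) mult_right_mono) auto
  show ?thesis
  proof (intro bexI[OF _ mnS] exI[of _ vr] exI[of _ vd] conjI ballI allI impI)
    fix L :: "'l set" and \<eta>
    assume S: "\<forall>l\<in>L. \<eta> l \<in> S"
    show "vr \<le> (\<Sum>l\<in>L. vd (\<eta> l))" if "\<forall>y\<in>S. P y \<bullet> y \<le> (\<Sum>l\<in>L. (P y \<bullet> \<eta> l)\<^sup>2)"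
      by (rule 3[OF S that])
    show "(\<Sum>l\<in>L. vd (\<eta> l)) \<le> vr" if "\<forall>y\<in>S. (\<Sum>l\<in>L. (P y \<bullet> \<eta> l)\<^sup>2) \<le> P y \<bullet> y"
      by (rule 4[OF S that])
  qed (use 1 2 in blast)+
qed

end

subsection \<open>The minimum principle\<close>

definition bl_map :: "nat \<Rightarrow> (nat \<Rightarrow> real) \<Rightarrow> (nat \<Rightarrow> nat \<Rightarrow> 'a::euclidean_space \<Rightarrow> 'b::euclidean_space) \<Rightarrow> nat \<Rightarrow> (nat \<Rightarrow> 'a) \<Rightarrow> 'b" where
  "bl_map k c B j x = (\<Sum>i=1..k. c i *\<^sub>R B i j (x i))"

text \<open>Polarized, so that Gram-Schmidt, Cauchy-Schwarz and dual vectors become available for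
  \<open>Q\<close>; Gaussians see only the diagonal.\<close>

definition bl_form :: "nat \<Rightarrow> (nat \<Rightarrow> real) \<Rightarrow> nat \<Rightarrow> (nat \<Rightarrow> real) \<Rightarrow> (nat \<Rightarrow> nat \<Rightarrow> 'a::euclidean_space \<Rightarrow> 'b::euclidean_space) \<Rightarrow>
    (nat \<Rightarrow> 'a \<Rightarrow>\<^sub>L 'a) \<Rightarrow> (nat \<Rightarrow> 'b \<Rightarrow>\<^sub>L 'b) \<Rightarrow> (nat \<Rightarrow> 'a) \<Rightarrow> (nat \<Rightarrow> 'a) \<Rightarrow> real" where
  "bl_form k c m d B P R x y = (\<Sum>i=1..k. c i * (P i (x i) \<bullet> y i)) - (\<Sum>j=1..m. d j * (R j (bl_map k c B j x) \<bullet> bl_map k c B j y))"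

locale bl_datum =
  fixes k :: nat and c :: "nat \<Rightarrow> real" and E :: "nat \<Rightarrow> 'a::euclidean_space set"
    and m :: nat and d :: "nat \<Rightarrow> real" and F :: "nat \<Rightarrow> 'b::euclidean_space set"
    and B :: "nat \<Rightarrow> nat \<Rightarrow> 'a \<Rightarrow> 'b"
  assumes datum: "brascamp_lieb_datum k c E m d F B"
begin

abbreviation "M \<equiv> bl_map k c B"
abbreviation "Q \<equiv> bl_form k c m d B"

lemma E_subspace: "i \<in> {1..k} \<Longrightarrow> subspace (E i)" and c_pos: "i \<in> {1..k} \<Longrightarrow> 0 < c i"
  and F_subspace: "j \<in> {1..m} \<Longrightarrow> subspace (F j)" and d_pos: "j \<in> {1..m} \<Longrightarrow> 0 < d j"
  and B_linear: "i \<in> {1..k} \<Longrightarrow> j \<in> {1..m} \<Longrightarrow> linear (B i j)"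
  and B_in: "i \<in> {1..k} \<Longrightarrow> j \<in> {1..m} \<Longrightarrow> x \<in> E i \<Longrightarrow> B i j x \<in> F j"
  and dims: "(\<Sum>i=1..k. c i * real (dim (E i))) = (\<Sum>j=1..m. d j * real (dim (F j)))"
  using datum by (auto simp: brascamp_lieb_datum_def image_subset_iff)

text \<open>Points of the product are functions on all of \<open>nat\<close>; coordinates outside
  \<open>{1..k}\<close> are left free, and the congruence lemmas for \<open>M\<close>,
  \<open>Q\<close> and \<open>h\<close> make them irrelevant.\<close>

definition XE :: "(nat \<Rightarrow> 'a) set" where "XE = {x. \<forall>i\<in>{1..k}. x i \<in> E i}"

lemma XE_D: "x \<in> XE \<Longrightarrow> i \<in> {1..k} \<Longrightarrow> x i \<in> E i"
  by (auto simp: XE_def)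

lemma M_in: "x \<in> XE \<Longrightarrow> j \<in> {1..m} \<Longrightarrow> M j x \<in> F j"
  unfolding bl_map_def by (intro subspace_sum subspace_scale F_subspace B_in XE_D)

lemma M_cong: "(\<And>i. i \<in> {1..k} \<Longrightarrow> x i = y i) \<Longrightarrow> M j x = M j y"
  unfolding bl_map_def by (intro sum.cong) auto

lemma M_add: "j \<in> {1..m} \<Longrightarrow> M j (\<lambda>i. x i + y i) = M j x + M j y"
  by (simp add: bl_map_def linear_add[OF B_linear] scaleR_add_right sum.distrib)

lemma M_scale: "j \<in> {1..m} \<Longrightarrow> M j (\<lambda>i. s *\<^sub>R x i) = s *\<^sub>R M j x"
  by (simp add: bl_map_def linear_scale[OF B_linear] scaleR_sum_right mult.commute)

lemma M_lin: "j \<in> {1..m} \<Longrightarrow> M j (\<lambda>i. x i + s *\<^sub>R y i) = M j x + s *\<^sub>R M j y"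
  using M_add[of j x "\<lambda>i. s *\<^sub>R y i"] M_scale[of j s y] by simp

lemma M_bound: "\<exists>C>0. \<forall>j\<in>{1..m}. \<forall>x. norm (M j x) \<le> C * (\<Sum>i=1..k. norm (x i))"
proof -
  define C where "C = 1 + (\<Sum>j=1..m. \<Sum>i=1..k. \<bar>c i\<bar> * onorm (B i j))"
  have on: "0 \<le> onorm (B i j)" if "i \<in> {1..k}" "j \<in> {1..m}" for i j
    using B_linear[OF that] by (intro onorm_pos_le) (simp add: linear_conv_bounded_linear)
  have nn: "0 \<le> \<bar>c i\<bar> * onorm (B i j)" if "i \<in> {1..k}" "j \<in> {1..m}" for i j
    using on[OF that] by simp
  have C: "\<bar>c i\<bar> * onorm (B i j) \<le> C" if ij: "i \<in> {1..k}" "j \<in> {1..m}" for i j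
  proof -
    have "\<bar>c i\<bar> * onorm (B i j) \<le> (\<Sum>i=1..k. \<bar>c i\<bar> * onorm (B i j))"
      using ij nn by (intro member_le_sum) auto
    also have "\<dots> \<le> (\<Sum>j=1..m. \<Sum>i=1..k. \<bar>c i\<bar> * onorm (B i j))"
      by (rule member_le_sum[of j "{1..m}" "\<lambda>j. \<Sum>i=1..k. \<bar>c i\<bar> * onorm (B i j)"])
        (use ij nn in \<open>auto intro!: sum_nonneg\<close>)
    finally show ?thesis by (simp add: C_def)
  qed
  have "norm (M j x) \<le> C * (\<Sum>i=1..k. norm (x i))" if j: "j \<in> {1..m}" for j x
  proof -
    have "norm (M j x) \<le> (\<Sum>i=1..k. norm (c i *\<^sub>R B i j (x i)))"
      unfolding bl_map_def by (rule norm_sum)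
    also have "\<dots> \<le> (\<Sum>i=1..k. C * norm (x i))"
    proof (rule sum_mono)
      fix i assume i: "i \<in> {1..k}"
      have "norm (B i j (x i)) \<le> onorm (B i j) * norm (x i)"
        using B_linear[OF i j] by (intro onorm) (simp add: linear_conv_bounded_linear)
      then have "\<bar>c i\<bar> * norm (B i j (x i)) \<le> (\<bar>c i\<bar> * onorm (B i j)) * norm (x i)"
        by (simp add: mult_left_mono mult.assoc)
      also have "\<dots> \<le> C * norm (x i)"
        using C[OF i j] by (rule mult_right_mono) simp
      finally show "norm (c i *\<^sub>R B i j (x i)) \<le> C * norm (x i)" by simp
    qed
    finally show ?thesis by (simp add: sum_distrib_left)
  qed
  moreover have "C > 0" unfolding C_def
    using nn by (intro add_pos_nonneg sum_nonneg) auto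
  ultimately show ?thesis by blast
qed

lemma M_continuous:
  assumes j: "j \<in> {1..m}"
  shows "continuous_on UNIV (M j)"
  unfolding bl_map_def
proof (intro continuous_on_sum continuous_on_scaleR continuous_on_const)
  fix i assume i: "i \<in> {1..k}"
  have "continuous_on UNIV (B i j)"
    using B_linear[OF i j] linear_continuous_on linear_conv_bounded_linear by blast
  then show "continuous_on UNIV (\<lambda>x. B i j (x i))"
    by (rule continuous_on_compose2[of UNIV]) (auto intro: continuous_on_product_coordinates)
qed

end

text \<open>Tychonoff's theorem over a full index type. In its uses the coordinates outside the
  relevant range are pinned to single points, which keeps sets of tuples compact.\<close>

lemma compact_coordinates:
  fixes K :: "'i \<Rightarrow> 'a::topological_space set"
  assumes "\<And>i. compact (K i)"
  shows "compact {x. \<forall>i. x i \<in> K i}"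
proof -
  have "compactin (product_topology (\<lambda>_. euclidean) UNIV) (PiE UNIV K)"
    unfolding compactin_PiE using assms by (simp add: compactin_euclidean_iff)
  moreover have "PiE UNIV K = {x. \<forall>i. x i \<in> K i}" by (auto simp: PiE_def)
  ultimately show ?thesis
    by (simp only: euclidean_product_topology compactin_euclidean_iff)
qed

context heat_flow
begin

text \<open>The bound on the support limits the cross term \<open>P x \<bullet> y\<close> to linear
  growth in \<open>norm x\<close>, so the Gaussian decay of the kernel survives up to a term of
  lower order.\<close>

lemma heat_upper:
  assumes x: "x \<in> S" and t: "t > 0" and supp: "AE y in N. norm y \<le> r"
  shows "heat P N t x \<le> exp (- (P x \<bullet> x - 2 * norm P * \<bar>r\<bar> * norm x) / (2 * t)) * measure N S"
proof -
  have "heat P N t x \<le> (\<integral>y. exp (- (P x \<bullet> x - 2 * norm P * \<bar>r\<bar> * norm x) / (2 * t)) \<partial>N)"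
    unfolding heat_def
  proof (rule integral_mono_AE[OF integrable_K[OF x t]])
    have "AE y in N. y \<in> space N \<and> norm y \<le> r" using supp by auto
    then show "AE y in N. K t x y \<le> exp (- (P x \<bullet> x - 2 * norm P * \<bar>r\<bar> * norm x) / (2 * t))"
    proof eventually_elim
      case (elim y)
      have "P x \<bullet> y \<le> norm (P x) * norm y" by (rule norm_cauchy_schwarz)
      also have "\<dots> \<le> (norm P * norm x) * \<bar>r\<bar>"
        using elim by (intro mult_mono norm_blinfun) auto
      finally have "2 * (P x \<bullet> y) \<le> 2 * norm P * \<bar>r\<bar> * norm x" by (simp add: mult_ac)
      moreover have "0 \<le> P y \<bullet> y" using elim by (intro posdef_on_nonneg[OF P]) (simp add: space_N)
      moreover have "P (x - y) \<bullet> (x - y) = P x \<bullet> x - 2 * (P x \<bullet> y) + P y \<bullet> y"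
        by (simp add: blinfun.diff_right inner_diff_left inner_diff_right sadj[of y x])
      ultimately have "P x \<bullet> x - 2 * norm P * \<bar>r\<bar> * norm x \<le> P (x - y) \<bullet> (x - y)" by linarith
      then have "- (P (x - y) \<bullet> (x - y)) / (2 * t) \<le> - (P x \<bullet> x - 2 * norm P * \<bar>r\<bar> * norm x) / (2 * t)"
        using t by (intro divide_right_mono) auto
      then show ?case by (simp only: exp_le_cancel_iff)
    qed
  qed simp
  then show ?thesis by (simp add: space_N mult.commute)
qed

text \<open>Some ball carries positive mass, and the kernel is bounded below on it. No condition on
  the support is made, because the measures on the \<open>F j\<close> will have a Gaussian
  tail.\<close>

lemma heat_lower:
  "\<exists>r\<ge>0. \<exists>a>0. \<forall>x\<in>S. \<forall>t>0. a * exp (- (P x \<bullet> x + 2 * norm P * r * norm x + norm P * r\<^sup>2) / (2 * t)) \<le> heat P N t x"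
proof -
  let ?A = "\<lambda>n::nat. {y \<in> space N. norm y \<le> n}"
  have A: "?A n \<in> sets N" for n by measurable
  have "\<exists>n. emeasure N (?A n) \<noteq> 0"
  proof (rule ccontr)
    assume "\<not> ?thesis"
    then have "emeasure N (\<Union>n. ?A n) = 0"
      using A by (intro emeasure_UN_eq_0) auto
    moreover have "(\<Union>n. ?A n) = S"
      using real_arch_simple by (auto simp: space_N)
    ultimately show False using N_pos by (simp add: measure_def)
  qed
  then obtain n where n: "emeasure N (?A n) \<noteq> 0" by blast
  define a where "a = measure N (?A n)"
  have a: "a > 0" using n by (simp add: a_def emeasure_eq_measure zero_less_measure_iff)
  show ?thesis
  proof (rule exI[of _ "real n"], intro conjI, simp, rule exI[of _ a], intro conjI a ballI allI impI)
    fix x and t :: real assume x: "x \<in> S" and t: "0 < t"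
    let ?e = "exp (- (P x \<bullet> x + 2 * norm P * n * norm x + norm P * (real n)\<^sup>2) / (2 * t))"
    have "a * ?e = (\<integral>y. indicator (?A n) y * ?e \<partial>N)"
      using A by (simp add: a_def)
    also have "\<dots> \<le> heat P N t x"
      unfolding heat_def
    proof (rule integral_mono)
      show "integrable N (\<lambda>y. indicator (?A n) y * ?e)"
        using A by (intro integrable_mult_left integrable_real_indicator) (auto simp: less_top[symmetric])
      show "integrable N (K t x)" by (rule integrable_K[OF x t])
      fix y assume y: "y \<in> space N"
      show "indicator (?A n) y * ?e \<le> K t x y"
      proof (cases "norm y \<le> n")
        case True
        have "- (P x \<bullet> y) \<le> norm (P x) * norm y" using norm_cauchy_schwarz[of "- P x" y] by simp
        also have "\<dots> \<le> (norm P * norm x) * real n"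
          using True by (intro mult_mono norm_blinfun) auto
        finally have "- 2 * (P x \<bullet> y) \<le> 2 * ((norm P * norm x) * real n)" by linarith
        also have "\<dots> = 2 * norm P * n * norm x" by simp
        finally have "- 2 * (P x \<bullet> y) \<le> 2 * norm P * n * norm x" .
        moreover have "y \<bullet> y \<le> (real n)\<^sup>2"
          using power_mono[OF True norm_ge_zero, of 2] by (simp add: dot_square_norm)
        then have "norm P * (y \<bullet> y) \<le> norm P * (real n)\<^sup>2" by (intro mult_left_mono) auto
        then have "P y \<bullet> y \<le> norm P * (real n)\<^sup>2"
          using blinfun_form_bound[of P y] by linarith
        moreover have "P (x - y) \<bullet> (x - y) = P x \<bullet> x - 2 * (P x \<bullet> y) + P y \<bullet> y"
          by (simp add: blinfun.diff_right inner_diff_left inner_diff_right sadj[of y x])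
        ultimately have "P (x - y) \<bullet> (x - y) \<le> P x \<bullet> x + 2 * norm P * n * norm x + norm P * (real n)\<^sup>2" by linarith
        then have "- (P x \<bullet> x + 2 * norm P * n * norm x + norm P * (real n)\<^sup>2) / (2 * t) \<le> - (P (x - y) \<bullet> (x - y)) / (2 * t)"
          using t by (intro divide_right_mono) auto
        then have "?e \<le> K t x y" by (simp only: exp_le_cancel_iff)
        then show ?thesis using True y by simp
      qed simp
    qed
    finally show "a * ?e \<le> heat P N t x" .
  qed
qed

end

text \<open>Strict positivity of \<open>Q\<close> and bounded supports on the side of the
  \<open>E i\<close> are what makes \<open>h\<close> coercive in space; the measures on the
  \<open>F j\<close> may spread out.\<close>

locale bl_heat = bl_datum k c E m d F B
  for k c and E :: "nat \<Rightarrow> 'a::euclidean_space set" and m d and F :: "nat \<Rightarrow> 'b::euclidean_space set" and B +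
  fixes P :: "nat \<Rightarrow> 'a \<Rightarrow>\<^sub>L 'a" and R :: "nat \<Rightarrow> 'b \<Rightarrow>\<^sub>L 'b" and N :: "nat \<Rightarrow> 'a measure" and N' :: "nat \<Rightarrow> 'b measure"
    and q0 r0 :: real
  assumes heat_E: "i \<in> {1..k} \<Longrightarrow> heat_flow (N i) (E i) (P i)"
    and heat_F: "j \<in> {1..m} \<Longrightarrow> heat_flow (N' j) (F j) (R j)"
    and q0: "0 < q0" and Q_lower: "x \<in> XE \<Longrightarrow> q0 * (\<Sum>i=1..k. x i \<bullet> x i) \<le> Q P R x x"
    and N_supp: "i \<in> {1..k} \<Longrightarrow> AE y in N i. norm y \<le> r0"
begin

definition h :: "real \<Rightarrow> (nat \<Rightarrow> 'a) \<Rightarrow> real" where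
  "h t x = (\<Sum>j=1..m. d j * ln (heat (R j) (N' j) t (M j x))) - (\<Sum>i=1..k. c i * ln (heat (P i) (N i) t (x i)))"

lemma h_cong:
  assumes "\<And>i. i \<in> {1..k} \<Longrightarrow> x i = y i"
  shows "h t x = h t y"
proof -
  have "M j x = M j y" for j by (rule M_cong) (rule assms)
  moreover have "(\<Sum>i=1..k. c i * ln (heat (P i) (N i) t (x i))) = (\<Sum>i=1..k. c i * ln (heat (P i) (N i) t (y i)))"
    by (rule sum.cong) (simp_all add: assms)
  ultimately show ?thesis unfolding h_def by simp
qed

text \<open>Only \<open>t\<close>-derivatives and directional second derivatives at a spatial minimum enter.\<close>

lemma h_deriv_at_min:
  fixes \<xi> :: "'l \<Rightarrow> nat \<Rightarrow> 'a"
  assumes t: "t > 0" and x: "x \<in> XE" and L: "finite L" and \<xi>: "\<And>l. l \<in> L \<Longrightarrow> \<xi> l \<in> XE"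
    and KE: "\<And>i y. i \<in> {1..k} \<Longrightarrow> y \<in> E i \<Longrightarrow> P i y \<bullet> y \<le> (\<Sum>l\<in>L. (P i y \<bullet> \<xi> l i)\<^sup>2)"
    and KF: "\<And>j y. j \<in> {1..m} \<Longrightarrow> y \<in> F j \<Longrightarrow> (\<Sum>l\<in>L. (R j y \<bullet> M j (\<xi> l))\<^sup>2) \<le> R j y \<bullet> y"
    and min: "\<And>y. y \<in> XE \<Longrightarrow> h t x \<le> h t y"
  shows "\<exists>D. ((\<lambda>t. h t x) has_real_derivative D) (at t) \<and> D \<ge> - (\<Sum>l\<in>L. Q P R (\<xi> l) (\<xi> l)) / (2 * t)"
proof -
  define GE where "GE i mn vr vd \<longleftrightarrow> mn \<in> E i \<and>
    ((\<lambda>t. ln (heat (P i) (N i) t (x i))) has_real_derivative (P i mn \<bullet> mn + vr) / (2 * t\<^sup>2)) (at t) \<and>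
    (\<forall>\<xi>\<in>E i. \<exists>G. (\<forall>s. ((\<lambda>s. ln (heat (P i) (N i) t (x i + s *\<^sub>R \<xi>))) has_real_derivative G s) (at s)) \<and>
        G 0 = - (P i mn \<bullet> \<xi>) / t \<and> (G has_real_derivative (vd \<xi> / t\<^sup>2 - (P i \<xi> \<bullet> \<xi>) / t)) (at 0)) \<and>
    vr \<le> (\<Sum>l\<in>L. vd (\<xi> l i))" for i mn vr vd
  have "\<forall>i\<in>{1..k}. \<exists>mn vr vd. GE i mn vr vd"
  proof
    fix i assume i: "i \<in> {1..k}"
    from heat_flow.log_heat_derivs[OF heat_E[OF i] XE_D[OF x i] t, where 'l = 'l] obtain mn vr vd where
      f1: "mn \<in> E i" and
      f2: "((\<lambda>t. ln (heat (P i) (N i) t (x i))) has_real_derivative (P i mn \<bullet> mn + vr) / (2 * t\<^sup>2)) (at t)" and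
      f3: "\<forall>\<xi>\<in>E i. \<exists>G. (\<forall>s. ((\<lambda>s. ln (heat (P i) (N i) t (x i + s *\<^sub>R \<xi>))) has_real_derivative G s) (at s)) \<and>
        G 0 = - (P i mn \<bullet> \<xi>) / t \<and> (G has_real_derivative (vd \<xi> / t\<^sup>2 - (P i \<xi> \<bullet> \<xi>) / t)) (at 0)" and
      f4: "\<forall>(L :: 'l set) \<eta>. finite L \<longrightarrow> (\<forall>l\<in>L. \<eta> l \<in> E i) \<longrightarrow> (\<forall>y\<in>E i. P i y \<bullet> y \<le> (\<Sum>l\<in>L. (P i y \<bullet> \<eta> l)\<^sup>2)) \<longrightarrow>
        vr \<le> (\<Sum>l\<in>L. vd (\<eta> l))"
      by (elim bexE exE conjE) (rule that)
    have "vr \<le> (\<Sum>l\<in>L. vd (\<xi> l i))"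
      by (rule f4[rule_format, of L "\<lambda>l. \<xi> l i"]) (use L XE_D[OF \<xi> i] KE[OF i] in auto)
    with f1 f2 f3 have "GE i mn vr vd" unfolding GE_def by (intro conjI)
    then show "\<exists>mn vr vd. GE i mn vr vd" by (intro exI)
  qed
  then obtain a va wa where GE: "\<And>i. i \<in> {1..k} \<Longrightarrow> GE i (a i) (va i) (wa i)" by metis
  define GF where "GF j mn vr vd \<longleftrightarrow> mn \<in> F j \<and>
    ((\<lambda>t. ln (heat (R j) (N' j) t (M j x))) has_real_derivative (R j mn \<bullet> mn + vr) / (2 * t\<^sup>2)) (at t) \<and>
    (\<forall>\<xi>\<in>F j. \<exists>G. (\<forall>s. ((\<lambda>s. ln (heat (R j) (N' j) t (M j x + s *\<^sub>R \<xi>))) has_real_derivative G s) (at s)) \<and>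
        G 0 = - (R j mn \<bullet> \<xi>) / t \<and> (G has_real_derivative (vd \<xi> / t\<^sup>2 - (R j \<xi> \<bullet> \<xi>) / t)) (at 0)) \<and>
    (\<Sum>l\<in>L. vd (M j (\<xi> l))) \<le> vr" for j mn vr vd
  have "\<forall>j\<in>{1..m}. \<exists>mn vr vd. GF j mn vr vd"
  proof
    fix j assume j: "j \<in> {1..m}"
    from heat_flow.log_heat_derivs[OF heat_F[OF j] M_in[OF x j] t, where 'l = 'l] obtain mn vr vd where
      f1: "mn \<in> F j" and
      f2: "((\<lambda>t. ln (heat (R j) (N' j) t (M j x))) has_real_derivative (R j mn \<bullet> mn + vr) / (2 * t\<^sup>2)) (at t)" and
      f3: "\<forall>\<xi>\<in>F j. \<exists>G. (\<forall>s. ((\<lambda>s. ln (heat (R j) (N' j) t (M j x + s *\<^sub>R \<xi>))) has_real_derivative G s) (at s)) \<and>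
        G 0 = - (R j mn \<bullet> \<xi>) / t \<and> (G has_real_derivative (vd \<xi> / t\<^sup>2 - (R j \<xi> \<bullet> \<xi>) / t)) (at 0)" and
      f4: "\<forall>(L :: 'l set) \<eta>. finite L \<longrightarrow> (\<forall>l\<in>L. \<eta> l \<in> F j) \<longrightarrow> (\<forall>y\<in>F j. (\<Sum>l\<in>L. (R j y \<bullet> \<eta> l)\<^sup>2) \<le> R j y \<bullet> y) \<longrightarrow>
        (\<Sum>l\<in>L. vd (\<eta> l)) \<le> vr"
      by (elim bexE exE conjE) (rule that)
    have "(\<Sum>l\<in>L. vd (M j (\<xi> l))) \<le> vr"
      by (rule f4[rule_format, of L "\<lambda>l. M j (\<xi> l)"]) (use L M_in[OF \<xi> j] KF[OF j] in auto)
    with f1 f2 f3 have "GF j mn vr vd" unfolding GF_def by (intro conjI)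
    then show "\<exists>mn vr vd. GF j mn vr vd" by (intro exI)
  qed
  then obtain b vb wb where GF: "\<And>j. j \<in> {1..m} \<Longrightarrow> GF j (b j) (vb j) (wb j)" by metis
  have aX: "a \<in> XE" using GE by (auto simp: GE_def XE_def)
  \<comment> \<open>Vanishing first and nonnegative second derivative at the minimum, along the line
    through \<open>x\<close> in direction \<eta>; there the argument \<open>M j x\<close> moves in
    direction \<open>M j \<eta>\<close>.\<close>
  have first: "(\<Sum>j=1..m. d j * (R j (b j) \<bullet> M j \<eta>)) = (\<Sum>i=1..k. c i * (P i (a i) \<bullet> \<eta> i))" (is ?first)
    and second: "0 \<le> Q P R \<eta> \<eta> / t + ((\<Sum>j=1..m. d j * wb j (M j \<eta>)) - (\<Sum>i=1..k. c i * wa i (\<eta> i))) / t\<^sup>2" (is ?second)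
    if \<eta>: "\<eta> \<in> XE" for \<eta>
  proof -
    have "\<exists>G. (\<forall>s. ((\<lambda>s. ln (heat (P i) (N i) t (x i + s *\<^sub>R \<eta> i))) has_real_derivative G s) (at s)) \<and>
        G 0 = - (P i (a i) \<bullet> \<eta> i) / t \<and> (G has_real_derivative (wa i (\<eta> i) / t\<^sup>2 - (P i (\<eta> i) \<bullet> \<eta> i) / t)) (at 0)" if "i \<in> {1..k}" for i
      using GE[OF that] XE_D[OF \<eta> that] unfolding GE_def by blast
    then obtain G where G: "\<And>i s. i \<in> {1..k} \<Longrightarrow> ((\<lambda>s. ln (heat (P i) (N i) t (x i + s *\<^sub>R \<eta> i))) has_real_derivative G i s) (at s)"
      "\<And>i. i \<in> {1..k} \<Longrightarrow> G i 0 = - (P i (a i) \<bullet> \<eta> i) / t"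
      "\<And>i. i \<in> {1..k} \<Longrightarrow> (G i has_real_derivative (wa i (\<eta> i) / t\<^sup>2 - (P i (\<eta> i) \<bullet> \<eta> i) / t)) (at 0)" by metis
    have "\<exists>G. (\<forall>s. ((\<lambda>s. ln (heat (R j) (N' j) t (M j x + s *\<^sub>R M j \<eta>))) has_real_derivative G s) (at s)) \<and>
        G 0 = - (R j (b j) \<bullet> M j \<eta>) / t \<and> (G has_real_derivative (wb j (M j \<eta>) / t\<^sup>2 - (R j (M j \<eta>) \<bullet> M j \<eta>) / t)) (at 0)" if "j \<in> {1..m}" for j
      using GF[OF that] M_in[OF \<eta> that] unfolding GF_def by blast
    then obtain H where H: "\<And>j s. j \<in> {1..m} \<Longrightarrow> ((\<lambda>s. ln (heat (R j) (N' j) t (M j x + s *\<^sub>R M j \<eta>))) has_real_derivative H j s) (at s)"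
      "\<And>j. j \<in> {1..m} \<Longrightarrow> H j 0 = - (R j (b j) \<bullet> M j \<eta>) / t"
      "\<And>j. j \<in> {1..m} \<Longrightarrow> (H j has_real_derivative (wb j (M j \<eta>) / t\<^sup>2 - (R j (M j \<eta>) \<bullet> M j \<eta>) / t)) (at 0)" by metis
    define \<phi> where "\<phi> s = h t (\<lambda>i. x i + s *\<^sub>R \<eta> i)" for s
    define \<phi>1 where "\<phi>1 s = (\<Sum>j=1..m. d j * H j s) - (\<Sum>i=1..k. c i * G i s)" for s
    have \<phi>_eq: "\<phi> s = (\<Sum>j=1..m. d j * ln (heat (R j) (N' j) t (M j x + s *\<^sub>R M j \<eta>))) - (\<Sum>i=1..k. c i * ln (heat (P i) (N i) t (x i + s *\<^sub>R \<eta> i)))" for s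
    proof -
      have "(\<Sum>j=1..m. d j * ln (heat (R j) (N' j) t (M j (\<lambda>i. x i + s *\<^sub>R \<eta> i)))) = (\<Sum>j=1..m. d j * ln (heat (R j) (N' j) t (M j x + s *\<^sub>R M j \<eta>)))"
        by (rule sum.cong) (simp_all add: M_lin)
      then show ?thesis unfolding \<phi>_def h_def by simp
    qed
    have d1: "(\<phi> has_real_derivative \<phi>1 s) (at s)" for s
      unfolding \<phi>_eq[abs_def] \<phi>1_def
      by (intro DERIV_diff DERIV_sum DERIV_cmult H G)
    have d2: "(\<phi>1 has_real_derivative (\<Sum>j=1..m. d j * (wb j (M j \<eta>) / t\<^sup>2 - (R j (M j \<eta>) \<bullet> M j \<eta>) / t))
        - (\<Sum>i=1..k. c i * (wa i (\<eta> i) / t\<^sup>2 - (P i (\<eta> i) \<bullet> \<eta> i) / t))) (at 0)"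
      unfolding \<phi>1_def[abs_def]
      by (intro DERIV_diff DERIV_sum DERIV_cmult H G)
    have m: "\<phi> 0 \<le> \<phi> s" for s
    proof -
      have "(\<lambda>i. x i + s *\<^sub>R \<eta> i) \<in> XE"
        unfolding XE_def mem_Collect_eq
        by (intro ballI subspace_add subspace_scale E_subspace XE_D[OF x] XE_D[OF \<eta>])
      from min[OF this] show ?thesis by (simp add: \<phi>_def)
    qed
    have "\<phi>1 0 = ((\<Sum>i=1..k. c i * (P i (a i) \<bullet> \<eta> i)) - (\<Sum>j=1..m. d j * (R j (b j) \<bullet> M j \<eta>))) / t"
    proof -
      have "(\<Sum>j=1..m. d j * H j 0) = (\<Sum>j=1..m. - (d j * (R j (b j) \<bullet> M j \<eta>)) / t)"
        by (rule sum.cong) (simp_all add: H(2))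
      moreover have "(\<Sum>i=1..k. c i * G i 0) = (\<Sum>i=1..k. - (c i * (P i (a i) \<bullet> \<eta> i)) / t)"
        by (rule sum.cong) (simp_all add: G(2))
      ultimately show ?thesis
        unfolding \<phi>1_def by (simp add: sum_negf sum_divide_distrib[symmetric] diff_divide_distrib)
    qed
    then show ?first using second_derivative_nonneg(1)[OF d1 d2 m] t by simp
    have "(\<Sum>j=1..m. d j * (wb j (M j \<eta>) / t\<^sup>2 - (R j (M j \<eta>) \<bullet> M j \<eta>) / t)) = (\<Sum>j=1..m. d j * wb j (M j \<eta>)) / t\<^sup>2 - (\<Sum>j=1..m. d j * (R j (M j \<eta>) \<bullet> M j \<eta>)) / t"
      by (simp add: right_diff_distrib sum_subtractf sum_divide_distrib)
    moreover have "(\<Sum>i=1..k. c i * (wa i (\<eta> i) / t\<^sup>2 - (P i (\<eta> i) \<bullet> \<eta> i) / t)) = (\<Sum>i=1..k. c i * wa i (\<eta> i)) / t\<^sup>2 - (\<Sum>i=1..k. c i * (P i (\<eta> i) \<bullet> \<eta> i)) / t"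
      by (simp add: right_diff_distrib sum_subtractf sum_divide_distrib)
    ultimately show ?second
      using second_derivative_nonneg(2)[OF d1 d2 m] by (simp add: bl_form_def diff_divide_distrib)
  qed
  define X where "X = (\<Sum>i=1..k. c i * (P i (a i) \<bullet> a i))"
  define Y where "Y = (\<Sum>j=1..m. d j * (R j (b j) \<bullet> b j))"
  define Va where "Va = (\<Sum>i=1..k. c i * va i)"
  define Vb where "Vb = (\<Sum>j=1..m. d j * vb j)"
  define \<delta> where "\<delta> = (\<Sum>l\<in>L. Q P R (\<xi> l) (\<xi> l))"
  \<comment> \<open>Testing \<open>first\<close> with the tuple of means \<open>a\<close> itself
    turns the cross term into \<open>X\<close>. Expanding the nonnegative weighted sum of the forms
    \<open>R j\<close> at \<open>b j - M j a\<close> gives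
    \<open>X + Q P R a a \<le> Y\<close>.\<close>
  have "X \<le> Y"
  proof -
    have sadj: "R j x \<bullet> y = R j y \<bullet> x" and psd: "x \<in> F j \<Longrightarrow> 0 \<le> R j x \<bullet> x" if "j \<in> {1..m}" for j x y
    proof -
      interpret heat_flow "N' j" "F j" "R j" by (rule heat_F[OF that])
      show "R j x \<bullet> y = R j y \<bullet> x" by (rule sadj)
      show "x \<in> F j \<Longrightarrow> 0 \<le> R j x \<bullet> x" by (rule posdef_on_nonneg[OF P])
    qed
    have "0 \<le> (\<Sum>j=1..m. d j * (R j (b j - M j a) \<bullet> (b j - M j a)))"
      using GF by (intro sum_nonneg mult_nonneg_nonneg psd subspace_diff F_subspace M_in aX less_imp_le[OF d_pos])
        (auto simp: GF_def)
    also have "\<dots> = (\<Sum>j=1..m. d j * (R j (b j) \<bullet> b j) - 2 * (d j * (R j (b j) \<bullet> M j a)) + d j * (R j (M j a) \<bullet> M j a))"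
      by (intro sum.cong) (simp_all add: blinfun.diff_right inner_diff_left inner_diff_right sadj[of _ "M _ a" "b _"] algebra_simps)
    also have "\<dots> = Y - 2 * X + (\<Sum>j=1..m. d j * (R j (M j a) \<bullet> M j a))"
      using first[OF aX] by (simp add: Y_def X_def sum.distrib sum_subtractf sum_distrib_left[symmetric])
    also have "(\<Sum>j=1..m. d j * (R j (M j a) \<bullet> M j a)) = X - Q P R a a"
      by (simp add: bl_form_def X_def)
    finally have "X \<le> Y - Q P R a a" by linarith
    moreover have "0 \<le> Q P R a a"
      using Q_lower[OF aX] q0 by (meson order_trans mult_nonneg_nonneg less_imp_le sum_nonneg inner_ge_zero)
    ultimately show ?thesis by linarith
  qed
  \<comment> \<open>Summing the second-order condition over the \<xi> compares total variances:
    \<open>KE\<close> bounds the sum of the \<open>wa\<close> from below by \<open>va\<close>, and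
    \<open>KF\<close> bounds the sum of the \<open>wb\<close> from above by \<open>vb\<close>, which
    are the directions needed.\<close>
  have "0 \<le> (\<Sum>l\<in>L. Q P R (\<xi> l) (\<xi> l) / t + ((\<Sum>j=1..m. d j * wb j (M j (\<xi> l))) - (\<Sum>i=1..k. c i * wa i (\<xi> l i))) / t\<^sup>2)"
    by (intro sum_nonneg second \<xi>)
  also have "\<dots> = \<delta> / t + ((\<Sum>j=1..m. d j * (\<Sum>l\<in>L. wb j (M j (\<xi> l)))) - (\<Sum>i=1..k. c i * (\<Sum>l\<in>L. wa i (\<xi> l i)))) / t\<^sup>2"
  proof -
    have "(\<Sum>l\<in>L. \<Sum>j=1..m. d j * wb j (M j (\<xi> l))) = (\<Sum>j=1..m. d j * (\<Sum>l\<in>L. wb j (M j (\<xi> l))))"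
      unfolding sum_distrib_left by (rule sum.swap)
    moreover have "(\<Sum>l\<in>L. \<Sum>i=1..k. c i * wa i (\<xi> l i)) = (\<Sum>i=1..k. c i * (\<Sum>l\<in>L. wa i (\<xi> l i)))"
      unfolding sum_distrib_left by (rule sum.swap)
    ultimately show ?thesis
      by (simp add: \<delta>_def sum.distrib sum_divide_distrib[symmetric] sum_subtractf)
  qed
  also have "\<dots> \<le> \<delta> / t + (Vb - Va) / t\<^sup>2"
    unfolding Vb_def Va_def using GE GF c_pos d_pos
    by (intro add_left_mono divide_right_mono diff_mono sum_mono mult_left_mono) (auto simp: GE_def GF_def less_imp_le)
  finally have "0 \<le> t * (\<delta> / t + (Vb - Va) / t\<^sup>2)" using t by (intro mult_nonneg_nonneg) auto
  also have "\<dots> = \<delta> + (Vb - Va) / t" using t by (simp add: field_simps power2_eq_square)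
  finally have V: "- \<delta> \<le> (Vb - Va) / t" by simp
  \<comment> \<open>The time derivative splits into a contribution of the means,
    \<open>Y - X\<close>, and one of the variances, \<open>Vb - Va\<close>; both have now been
    bounded below.\<close>
  define D where "D = (\<Sum>j=1..m. d j * ((R j (b j) \<bullet> b j + vb j) / (2 * t\<^sup>2))) - (\<Sum>i=1..k. c i * ((P i (a i) \<bullet> a i + va i) / (2 * t\<^sup>2)))"
  have "((\<lambda>t. h t x) has_real_derivative D) (at t)"
    unfolding h_def D_def using GE GF
    by (intro DERIV_diff DERIV_sum DERIV_cmult) (auto simp: GE_def GF_def)
  moreover have "D \<ge> - \<delta> / (2 * t)"
  proof -
    have "D = ((Y + Vb) - (X + Va)) / (2 * t\<^sup>2)"
      by (simp add: D_def X_def Y_def Va_def Vb_def distrib_left sum.distrib sum_divide_distrib[symmetric] diff_divide_distrib)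
    also have "\<dots> \<ge> (Vb - Va) / (2 * t\<^sup>2)"
      using \<open>X \<le> Y\<close> t by (intro divide_right_mono) auto
    also have "(Vb - Va) / (2 * t\<^sup>2) = ((Vb - Va) / t) / (2 * t)" using t by (simp add: power2_eq_square)
    also have "\<dots> \<ge> - \<delta> / (2 * t)" using V t by (intro divide_right_mono) auto
    finally show ?thesis .
  qed
  ultimately show ?thesis unfolding \<delta>_def by blast
qed

lemma continuous_on_h: "continuous_on ({0<..} \<times> XE) (\<lambda>p. h (fst p) (snd p))"
  unfolding h_def
proof (intro continuous_on_diff continuous_on_sum continuous_on_mult continuous_on_const continuous_on_ln ballI)
  fix j assume j: "j \<in> {1..m}"
  note hf = heat_F[OF j]
  have "continuous_on ({0<..} \<times> XE) (\<lambda>p. (fst p, M j (snd p)))"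
    by (intro continuous_on_Pair continuous_on_fst continuous_on_id
        continuous_on_compose2[OF M_continuous[OF j] continuous_on_snd[OF continuous_on_id]]) auto
  then have "continuous_on ({0<..} \<times> XE) (\<lambda>p. (\<lambda>(t, x). heat (R j) (N' j) t x) (fst p, M j (snd p)))"
    by (rule continuous_on_compose2[OF heat_flow.continuous_on_heat[OF hf]]) (use M_in j in auto)
  then show "continuous_on ({0<..} \<times> XE) (\<lambda>p. heat (R j) (N' j) (fst p) (M j (snd p)))" by simp
  show "heat (R j) (N' j) (fst p) (M j (snd p)) \<noteq> 0" if "p \<in> {0<..} \<times> XE" for p
    using heat_flow.heat_pos[OF hf M_in[of "snd p", OF _ j], of "fst p"] that by auto
next
  fix i assume i: "i \<in> {1..k}"
  note hf = heat_E[OF i]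
  have "continuous_on ({0<..} \<times> XE) (\<lambda>p. (fst p, snd p i))"
    by (intro continuous_on_Pair continuous_on_fst continuous_on_id
        continuous_on_compose2[OF continuous_on_product_coordinates continuous_on_snd[OF continuous_on_id]]) auto
  then have "continuous_on ({0<..} \<times> XE) (\<lambda>p. (\<lambda>(t, x). heat (P i) (N i) t x) (fst p, snd p i))"
    by (rule continuous_on_compose2[OF heat_flow.continuous_on_heat[OF hf]]) (use i in \<open>auto simp: XE_def\<close>)
  then show "continuous_on ({0<..} \<times> XE) (\<lambda>p. heat (P i) (N i) (fst p) (snd p i))" by simp
  show "heat (P i) (N i) (fst p) (snd p i) \<noteq> 0" if "p \<in> {0<..} \<times> XE" for p
    using heat_flow.heat_pos[OF hf XE_D[of "snd p", OF _ i], of "fst p"] that by auto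
qed

text \<open>In the Gaussian bounds for the flows the quadratic terms combine to
  \<open>Q P R x x / (2 * t)\<close>, while the radii \<open>r0\<close> and \<open>r j\<close>
  contribute only linear growth and constants. Positivity of \<open>Q\<close> therefore wins far
  out, uniformly up to time \<open>T\<close>.\<close>

lemma h_coercive:
  assumes "0 < T"
  shows "\<exists>\<rho>. \<forall>t x. 0 < t \<longrightarrow> t \<le> T \<longrightarrow> x \<in> XE \<longrightarrow> \<rho> \<le> (\<Sum>i=1..k. norm (x i)) \<longrightarrow> b \<le> h t x"
proof -
  have "\<forall>j\<in>{1..m}. \<exists>r a. 0 \<le> r \<and> 0 < a \<and> (\<forall>x\<in>F j. \<forall>t>0. a * exp (- (R j x \<bullet> x + 2 * norm (R j) * r * norm x + norm (R j) * r\<^sup>2) / (2 * t)) \<le> heat (R j) (N' j) t x)"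
    using heat_flow.heat_lower[OF heat_F] by blast
  then obtain r a where r: "\<And>j. j \<in> {1..m} \<Longrightarrow> 0 \<le> r j" and a: "\<And>j. j \<in> {1..m} \<Longrightarrow> 0 < a j" and
    V: "\<And>j x t. j \<in> {1..m} \<Longrightarrow> x \<in> F j \<Longrightarrow> 0 < t \<Longrightarrow>
      a j * exp (- (R j x \<bullet> x + 2 * norm (R j) * r j * norm x + norm (R j) * (r j)\<^sup>2) / (2 * t)) \<le> heat (R j) (N' j) t x"
    by metis
  obtain C where C: "C > 0" "\<And>j x. j \<in> {1..m} \<Longrightarrow> norm (M j x) \<le> C * (\<Sum>i=1..k. norm (x i))"
    using M_bound by blast
  define G1 where "G1 = (\<Sum>j=1..m. d j * (2 * norm (R j) * r j * C))"
  define G2 where "G2 = (\<Sum>j=1..m. d j * (norm (R j) * (r j)\<^sup>2))"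
  define G3 where "G3 = (\<Sum>i=1..k. c i * (2 * norm (P i) * \<bar>r0\<bar>))"
  define K0 where "K0 = (\<Sum>j=1..m. d j * ln (a j)) - (\<Sum>i=1..k. c i * ln (measure (N i) (E i)))"
  have G: "0 \<le> G1" "0 \<le> G2" "0 \<le> G3"
    unfolding G1_def G2_def G3_def using r C d_pos c_pos
    by (auto intro!: sum_nonneg mult_nonneg_nonneg simp: less_imp_le)
  have low: "(Q P R x x - ((G1 + G3) * (\<Sum>i=1..k. norm (x i)) + G2)) / (2 * t) + K0 \<le> h t x"
    if x: "x \<in> XE" and t: "0 < t" for x t
  proof -
    let ?\<sigma> = "\<Sum>i=1..k. norm (x i)"
    have "(\<Sum>j=1..m. d j * (ln (a j) - (R j (M j x) \<bullet> M j x + 2 * norm (R j) * r j * C * ?\<sigma> + norm (R j) * (r j)\<^sup>2) / (2 * t)))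
      \<le> (\<Sum>j=1..m. d j * ln (heat (R j) (N' j) t (M j x)))"
    proof (intro sum_mono mult_left_mono less_imp_le[OF d_pos])
      fix j assume j: "j \<in> {1..m}"
      let ?e = "(R j (M j x) \<bullet> M j x + 2 * norm (R j) * r j * norm (M j x) + norm (R j) * (r j)\<^sup>2) / (2 * t)"
      have "2 * norm (R j) * r j * norm (M j x) \<le> 2 * norm (R j) * r j * (C * ?\<sigma>)"
        using r[OF j] C(2)[OF j] by (intro mult_left_mono) auto
      then have "?e \<le> (R j (M j x) \<bullet> M j x + 2 * norm (R j) * r j * C * ?\<sigma> + norm (R j) * (r j)\<^sup>2) / (2 * t)"
        using t by (intro divide_right_mono) (auto simp: mult.assoc)
      moreover have "ln (a j * exp (- ?e)) \<le> ln (heat (R j) (N' j) t (M j x))"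
      proof (rule ln_mono)
        show "a j * exp (- ?e) \<le> heat (R j) (N' j) t (M j x)"
          using V[OF j M_in[OF x j] t] by (simp only: minus_divide_left)
        show "0 < a j * exp (- ?e)" using a[OF j] by simp
      qed
      moreover have "ln (a j * exp (- ?e)) = ln (a j) - ?e" using a[OF j] by (simp add: ln_mult)
      ultimately show "ln (a j) - (R j (M j x) \<bullet> M j x + 2 * norm (R j) * r j * C * ?\<sigma> + norm (R j) * (r j)\<^sup>2) / (2 * t) \<le> ln (heat (R j) (N' j) t (M j x))"
        by linarith
    qed
    moreover have "(\<Sum>i=1..k. c i * ln (heat (P i) (N i) t (x i))) \<le> (\<Sum>i=1..k. c i * (ln (measure (N i) (E i)) - (P i (x i) \<bullet> x i - 2 * norm (P i) * \<bar>r0\<bar> * ?\<sigma>) / (2 * t)))"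
    proof (intro sum_mono mult_left_mono less_imp_le[OF c_pos])
      fix i assume i: "i \<in> {1..k}"
      note hf = heat_E[OF i]
      let ?e = "(P i (x i) \<bullet> x i - 2 * norm (P i) * \<bar>r0\<bar> * norm (x i)) / (2 * t)"
      have "norm (x i) \<le> ?\<sigma>" using i by (intro member_le_sum) auto
      then have "2 * norm (P i) * \<bar>r0\<bar> * norm (x i) \<le> 2 * norm (P i) * \<bar>r0\<bar> * ?\<sigma>"
        by (intro mult_left_mono) auto
      then have "(P i (x i) \<bullet> x i - 2 * norm (P i) * \<bar>r0\<bar> * ?\<sigma>) / (2 * t) \<le> ?e"
        using t by (intro divide_right_mono) auto
      moreover have "ln (heat (P i) (N i) t (x i)) \<le> ln (exp (- ?e) * measure (N i) (E i))"
      proof (rule ln_mono)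
        show "heat (P i) (N i) t (x i) \<le> exp (- ?e) * measure (N i) (E i)"
          using heat_flow.heat_upper[OF hf XE_D[OF x i] t N_supp[OF i]] by (simp only: minus_divide_left)
        show "0 < heat (P i) (N i) t (x i)" by (rule heat_flow.heat_pos[OF hf XE_D[OF x i] t])
      qed
      moreover have "ln (exp (- ?e) * measure (N i) (E i)) = ln (measure (N i) (E i)) - ?e"
        using heat_flow.N_pos[OF hf] by (simp add: ln_mult)
      ultimately show "ln (heat (P i) (N i) t (x i)) \<le> ln (measure (N i) (E i)) - (P i (x i) \<bullet> x i - 2 * norm (P i) * \<bar>r0\<bar> * ?\<sigma>) / (2 * t)"
        by linarith
    qed
    moreover have "(\<Sum>j=1..m. d j * (ln (a j) - (R j (M j x) \<bullet> M j x + 2 * norm (R j) * r j * C * ?\<sigma> + norm (R j) * (r j)\<^sup>2) / (2 * t)))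
      = (\<Sum>j=1..m. d j * ln (a j)) - ((\<Sum>j=1..m. d j * (R j (M j x) \<bullet> M j x)) + G1 * ?\<sigma> + G2) / (2 * t)"
      by (simp add: G1_def G2_def right_diff_distrib sum_subtractf distrib_left sum.distrib sum_divide_distrib add_divide_distrib sum_distrib_right mult.assoc)
    moreover have "(\<Sum>i=1..k. c i * (ln (measure (N i) (E i)) - (P i (x i) \<bullet> x i - 2 * norm (P i) * \<bar>r0\<bar> * ?\<sigma>) / (2 * t)))
      = (\<Sum>i=1..k. c i * ln (measure (N i) (E i))) - ((\<Sum>i=1..k. c i * (P i (x i) \<bullet> x i)) - G3 * ?\<sigma>) / (2 * t)"
      by (simp add: G3_def right_diff_distrib sum_subtractf sum_divide_distrib diff_divide_distrib sum_distrib_right mult.assoc)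
    ultimately have "((\<Sum>j=1..m. d j * ln (a j)) - ((\<Sum>j=1..m. d j * (R j (M j x) \<bullet> M j x)) + G1 * ?\<sigma> + G2) / (2 * t))
       - ((\<Sum>i=1..k. c i * ln (measure (N i) (E i))) - ((\<Sum>i=1..k. c i * (P i (x i) \<bullet> x i)) - G3 * ?\<sigma>) / (2 * t)) \<le> h t x"
      unfolding h_def by linarith
    then show ?thesis
      by (simp add: K0_def bl_form_def diff_divide_distrib add_divide_distrib distrib_right)
  qed
  \<comment> \<open>A numerator of size \<open>\<bar>2 * T * (b - K0)\<bar>\<close> still leaves at
    least \<open>b - K0\<close> after division by \<open>2 * t\<close> with
    \<open>t \<le> T\<close>; \<open>G2\<close> is added because the numerator contains it with a
    minus sign.\<close>
  define L where "L = \<bar>2 * T * (b - K0)\<bar> + G2"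
  define q where "q = q0 / (real k + 1)"
  have q: "q > 0" using q0 by (simp add: q_def)
  define \<rho> where "\<rho> = max 1 ((G1 + G3 + L) / q)"
  have "b \<le> h t x" if t: "0 < t" "t \<le> T" and x: "x \<in> XE" and \<rho>: "\<rho> \<le> (\<Sum>i=1..k. norm (x i))" for t x
  proof -
    let ?\<sigma> = "\<Sum>i=1..k. norm (x i)"
    have \<sigma>: "1 \<le> ?\<sigma>" "(G1 + G3 + L) / q \<le> ?\<sigma>" using \<rho> by (auto simp: \<rho>_def)
    have "?\<sigma>\<^sup>2 \<le> real k * (\<Sum>i=1..k. x i \<bullet> x i)"
      using sum_squared_le_sum_of_squares[of "\<lambda>i. norm (x i)" "{1..k}"] by (simp add: dot_square_norm mult.commute)
    also have "\<dots> \<le> (real k + 1) * (\<Sum>i=1..k. x i \<bullet> x i)"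
      by (intro mult_right_mono sum_nonneg) auto
    finally have "q * ?\<sigma>\<^sup>2 \<le> q * ((real k + 1) * (\<Sum>i=1..k. x i \<bullet> x i))"
      using q by (intro mult_left_mono) auto
    also have "\<dots> = q0 * (\<Sum>i=1..k. x i \<bullet> x i)"
      by (simp add: q_def)
    also have "\<dots> \<le> Q P R x x" by (rule Q_lower[OF x])
    finally have Qx: "q * ?\<sigma>\<^sup>2 \<le> Q P R x x" .
    have L0: "0 \<le> L" using G by (simp add: L_def)
    have "(G1 + G3 + L) \<le> q * ?\<sigma>" using \<sigma>(2) q by (simp add: field_simps)
    then have "(G1 + G3 + L) * ?\<sigma> \<le> q * ?\<sigma> * ?\<sigma>" using \<sigma>(1) by (intro mult_right_mono) auto
    moreover have "L * 1 \<le> L * ?\<sigma>" using L0 \<sigma>(1) by (intro mult_left_mono)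
    ultimately have "L \<le> Q P R x x - (G1 + G3) * ?\<sigma>"
      using Qx unfolding power2_eq_square distrib_right mult.assoc by linarith
    then have W: "\<bar>2 * T * (b - K0)\<bar> \<le> Q P R x x - ((G1 + G3) * ?\<sigma> + G2)" by (simp add: L_def)
    have "b - K0 \<le> \<bar>2 * T * (b - K0)\<bar> / (2 * T)" using assms by (simp add: abs_mult)
    also have "\<dots> \<le> \<bar>2 * T * (b - K0)\<bar> / (2 * t)" using t by (intro divide_left_mono) auto
    also have "\<dots> \<le> (Q P R x x - ((G1 + G3) * ?\<sigma> + G2)) / (2 * t)" using W t by (intro divide_right_mono) auto
    finally show ?thesis using low[OF x t(1)] by linarith
  qed
  then show ?thesis by blast
qed

text \<open>A parabolic minimum principle. \<open>h\<close> is corrected by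
  \<open>\<delta> / 2 * ln t\<close>, which compensates the possible decrease of its minimum, and by
  a small \<open>\<theta> * t\<close>, which makes the inequality strict. A value below the initial
  level would force a minimum at a time after \<open>t0\<close>, global in space by coercivity.
  There the time derivative is positive, so slightly earlier values would be smaller still.\<close>

lemma h_comparison:
  fixes \<xi> :: "'l \<Rightarrow> nat \<Rightarrow> 'a"
  assumes t0: "0 < t0" "t0 \<le> T" and L: "finite L" and \<xi>: "\<And>l. l \<in> L \<Longrightarrow> \<xi> l \<in> XE"
    and KE: "\<And>i y. i \<in> {1..k} \<Longrightarrow> y \<in> E i \<Longrightarrow> P i y \<bullet> y \<le> (\<Sum>l\<in>L. (P i y \<bullet> \<xi> l i)\<^sup>2)"
    and KF: "\<And>j y. j \<in> {1..m} \<Longrightarrow> y \<in> F j \<Longrightarrow> (\<Sum>l\<in>L. (R j y \<bullet> M j (\<xi> l))\<^sup>2) \<le> R j y \<bullet> y"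
    and init: "\<And>x. x \<in> XE \<Longrightarrow> - \<epsilon> \<le> h t0 x"
    and x: "x \<in> XE"
  shows "- \<epsilon> - (\<Sum>l\<in>L. Q P R (\<xi> l) (\<xi> l)) / 2 * ln (T / t0) \<le> h T x"
proof -
  define \<delta> where "\<delta> = (\<Sum>l\<in>L. Q P R (\<xi> l) (\<xi> l))"
  have T: "T > 0" using t0 by simp
  have *: "- \<epsilon> + \<delta> / 2 * ln t0 + \<theta> * t0 \<le> h T x + \<delta> / 2 * ln T + \<theta> * T" if \<theta>: "\<theta> > 0" for \<theta>
  proof (rule ccontr)
    define H where "H t x = h t x + (\<delta> / 2 * ln t + \<theta> * t)" for t x
    define \<beta> where "\<beta> = - \<epsilon> + \<delta> / 2 * ln t0 + \<theta> * t0"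
    assume "\<not> ?thesis"
    then have Hx: "H T x < \<beta>" by (simp add: H_def \<beta>_def)
    have "continuous_on {t0..T} (\<lambda>t. \<delta> / 2 * ln t + \<theta> * t)"
      using t0 by (intro continuous_intros) auto
    then have "bounded ((\<lambda>t. \<delta> / 2 * ln t + \<theta> * t) ` {t0..T})"
      by (intro compact_imp_bounded compact_continuous_image) auto
    then obtain b where "\<forall>z\<in>(\<lambda>t. \<delta> / 2 * ln t + \<theta> * t) ` {t0..T}. norm z \<le> b"
      unfolding bounded_iff ..
    then have b: "\<bar>\<delta> / 2 * ln t + \<theta> * t\<bar> \<le> b" if "t \<in> {t0..T}" for t
      using that by (metis imageI real_norm_def)
    obtain \<rho>0 where \<rho>0: "\<And>t x. 0 < t \<Longrightarrow> t \<le> T \<Longrightarrow> x \<in> XE \<Longrightarrow> \<rho>0 \<le> (\<Sum>i=1..k. norm (x i)) \<Longrightarrow> \<beta> + b \<le> h t x"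
      using h_coercive[OF T, of "\<beta> + b"] by blast
    define \<rho> where "\<rho> = max \<rho>0 (\<Sum>i=1..k. norm (x i))"
    have out: "\<beta> \<le> H t y" if "t \<in> {t0..T}" "y \<in> XE" "\<rho> \<le> (\<Sum>i=1..k. norm (y i))" for t y
      using \<rho>0[of t y] b[of t] that t0 by (auto simp: H_def \<rho>_def)
    \<comment> \<open>The coordinates outside \<open>{1..k}\<close> are frozen at those of
      \<open>x\<close>, so that \<open>Y\<close> is compact and contains \<open>x\<close>.\<close>
    define Y where "Y = {y. \<forall>i. y i \<in> (if i \<in> {1..k} then E i \<inter> cball 0 \<rho> else {x i})}"
    have "compact Y"
      unfolding Y_def using closed_subspace[OF E_subspace]
      by (intro compact_coordinates) (auto simp: closed_Int_compact)
    moreover have YX: "Y \<subseteq> XE" by (auto simp: Y_def XE_def split: if_splits)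
    moreover have xY: "x \<in> Y"
    proof -
      have "norm (x i) \<le> \<rho>" if "i \<in> {1..k}" for i
      proof -
        have "norm (x i) \<le> (\<Sum>i=1..k. norm (x i))" using that by (intro member_le_sum) auto
        then show ?thesis by (simp add: \<rho>_def)
      qed
      then show ?thesis using XE_D[OF x] by (auto simp: Y_def)
    qed
    moreover have "{t0..T} \<times> Y \<noteq> {}" using xY t0 by auto
    moreover have "continuous_on ({t0..T} \<times> Y) (\<lambda>p. H (fst p) (snd p))"
      unfolding H_def
    proof (intro continuous_on_add continuous_on_subset[OF continuous_on_h])
      show "{t0..T} \<times> Y \<subseteq> {0<..} \<times> XE" using t0 YX by auto
    qed (use t0 in \<open>auto intro!: continuous_intros\<close>)
    ultimately have "\<exists>p\<in>{t0..T} \<times> Y. \<forall>q\<in>{t0..T} \<times> Y. H (fst p) (snd p) \<le> H (fst q) (snd q)"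
      by (intro continuous_attains_inf compact_Times compact_Icc)
    then obtain p where p: "p \<in> {t0..T} \<times> Y" "\<And>q. q \<in> {t0..T} \<times> Y \<Longrightarrow> H (fst p) (snd p) \<le> H (fst q) (snd q)"
      by blast
    define t y where "t = fst p" and "y = snd p"
    have t: "t \<in> {t0..T}" and y: "y \<in> Y" using p(1) by (auto simp: t_def y_def)
    have min: "H t y \<le> H t' y'" if "t' \<in> {t0..T}" "y' \<in> Y" for t' y'
      using p(2)[of "(t', y')"] that by (simp add: t_def y_def)
    have Hty: "H t y < \<beta>" using min[of T x] xY t0 Hx by simp
    have "t \<noteq> t0"
    proof
      assume "t = t0"
      then show False using Hty init[of y] y YX by (auto simp: H_def \<beta>_def)
    qed
    then have tt: "t0 < t" using t by auto
    then have tpos: "0 < t" using t0 by simp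
    have hmin: "h t y \<le> h t z" if z: "z \<in> XE" for z
    proof (cases "\<rho> \<le> (\<Sum>i=1..k. norm (z i))")
      case True
      then show ?thesis using out[OF t z] Hty by (simp add: H_def)
    next
      case False
      define z' where "z' i = (if i \<in> {1..k} then z i else x i)" for i
      have "norm (z i) \<le> \<rho>" if "i \<in> {1..k}" for i
      proof -
        have "norm (z i) \<le> (\<Sum>i=1..k. norm (z i))" using that by (intro member_le_sum) auto
        then show ?thesis using False by simp
      qed
      then have "z' \<in> Y" using XE_D[OF z] by (auto simp: Y_def z'_def)
      from min[OF t this] have "h t y \<le> h t z'" by (simp add: H_def)
      also have "h t z' = h t z" by (rule h_cong) (simp add: z'_def)
      finally show ?thesis .
    qed
    obtain D where D: "((\<lambda>t. h t y) has_real_derivative D) (at t)" "D \<ge> - \<delta> / (2 * t)"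
      using h_deriv_at_min[OF tpos _ L \<xi> KE KF hmin] y YX unfolding \<delta>_def by blast
    have "((\<lambda>t. H t y) has_real_derivative D + (\<delta> / 2 * (1 / t) + \<theta>)) (at t)"
      unfolding H_def using tpos by (auto intro!: derivative_eq_intros D(1))
    moreover have "D + (\<delta> / 2 * (1 / t) + \<theta>) > 0" using D(2) \<theta> by simp
    ultimately obtain e where e: "e > 0" "\<And>s. 0 < s \<Longrightarrow> s < e \<Longrightarrow> H (t - s) y < H t y"
      using DERIV_pos_inc_left by blast
    define s where "s = min (e / 2) (t - t0)"
    have "0 < s" "s < e" "t - s \<in> {t0..T}" using e(1) tt t by (auto simp: s_def min_def)
    then show False using e(2)[of s] min[of "t - s" y] y by auto
  qed
  have "- \<epsilon> + \<delta> / 2 * ln t0 \<le> h T x + \<delta> / 2 * ln T"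
  proof (rule field_le_epsilon)
    fix e :: real assume e: "e > 0"
    define \<theta> where "\<theta> = e / (T + 1)"
    have "\<theta> > 0" "\<theta> * T \<le> e" using e T by (auto simp: \<theta>_def field_simps)
    moreover have "0 \<le> \<theta> * t0" using \<open>\<theta> > 0\<close> t0 by simp
    ultimately show "- \<epsilon> + \<delta> / 2 * ln t0 \<le> h T x + \<delta> / 2 * ln T + e"
      using *[of \<theta>] by linarith
  qed
  then show ?thesis
    using t0 T by (simp add: \<delta>_def[symmetric] ln_div right_diff_distrib)
qed

end

subsection \<open>Approximately stationary gaussians\<close>

context bl_datum
begin

text \<open>The product of the \<open>E i\<close> has no type of its own. Functions on
  \<open>IX\<close> serve as its orthonormal coordinates, with \<open>embX\<close> and
  \<open>crd\<close> as the passages to and from tuples; \<open>card IX\<close> is its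
  dimension.\<close>

definition IX :: "(nat \<times> 'a) set" where "IX = Sigma {1..k} (\<lambda>i. onb (E i))"

definition embX :: "(nat \<times> 'a \<Rightarrow> real) \<Rightarrow> nat \<Rightarrow> 'a" where "embX t i = emb (E i) (\<lambda>v. t (i, v))"

definition crd :: "(nat \<Rightarrow> 'a) \<Rightarrow> nat \<times> 'a \<Rightarrow> real" where "crd x u = x (fst u) \<bullet> snd u"

definition nX :: "(nat \<Rightarrow> 'a) \<Rightarrow> real" where "nX x = (\<Sum>i=1..k. x i \<bullet> x i)"

lemma finite_IX: "finite IX"
  unfolding IX_def by (intro finite_SigmaI) (auto simp: onb_finite E_subspace)

lemma embX_in: "embX t \<in> XE"
  unfolding XE_def embX_def mem_Collect_eq by (intro ballI emb_in E_subspace)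

lemma embX_crd: "x \<in> XE \<Longrightarrow> i \<in> {1..k} \<Longrightarrow> embX (crd x) i = x i"
  unfolding embX_def crd_def by (simp add: emb_coords E_subspace XE_D)

lemma nX_embX: "nX (embX t) = (\<Sum>u\<in>IX. (t u)\<^sup>2)"
proof -
  have "nX (embX t) = (\<Sum>i=1..k. \<Sum>v\<in>onb (E i). t (i, v) * t (i, v))"
    unfolding nX_def embX_def by (rule sum.cong) (simp_all add: emb_inner E_subspace)
  also have "\<dots> = (\<Sum>u\<in>IX. (t u)\<^sup>2)"
    unfolding IX_def by (subst sum.Sigma) (auto simp: onb_finite E_subspace power2_eq_square intro!: sum.cong)
  finally show ?thesis .
qed

lemma nX_nonneg: "0 \<le> nX x"
  unfolding nX_def by (intro sum_nonneg) auto

lemma nX_pos: "i \<in> {1..k} \<Longrightarrow> x i \<noteq> 0 \<Longrightarrow> 0 < nX x"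
  unfolding nX_def by (rule sum_pos2[of _ i]) auto

lemma measurable_embX [measurable]: "i \<in> {1..k} \<Longrightarrow> (\<lambda>t. embX t i) \<in> borel_measurable (lbPi IX)"
  unfolding embX_def emb_def
  by (intro borel_measurable_sum borel_measurable_scaleR borel_measurable_const)
    (auto intro!: measurable_component_singleton simp: IX_def simp flip: measurable_lborel1)

lemma measurable_M_embX [measurable]: "j \<in> {1..m} \<Longrightarrow> (\<lambda>t. M j (embX t)) \<in> borel_measurable (lbPi IX)"
  unfolding bl_map_def
proof (intro borel_measurable_sum borel_measurable_scaleR borel_measurable_const)
  fix i assume ij: "j \<in> {1..m}" "i \<in> {1..k}"
  then have "B i j \<in> borel_measurable borel"
    using B_linear[of i j] by (intro borel_measurable_continuous_onI linear_continuous_on) (simp add: linear_conv_bounded_linear)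
  then show "(\<lambda>t. B i j (embX t i)) \<in> borel_measurable (lbPi IX)"
    using measurable_embX[OF ij(2)] by (rule measurable_compose[rotated])
qed

lemma measurable_Q_embX [measurable]:
  "(\<lambda>t. Q P R (embX t) (embX t)) \<in> borel_measurable (lbPi IX)"
  "(\<lambda>t. Q P R x (embX t)) \<in> borel_measurable (lbPi IX)"
  unfolding bl_form_def by measurable

lemma gint_nX: "a > 0 \<Longrightarrow> gint (lbPi IX) (\<lambda>t. a * nX (embX t)) = ennreal (sqrt (2 * pi / a) ^ card IX)"
  unfolding gint_def nX_embX by (rule nn_integral_lbPi_gaussian[OF finite_IX])

definition sa :: "(nat \<Rightarrow> 'a \<Rightarrow>\<^sub>L 'a) \<Rightarrow> (nat \<Rightarrow> 'b \<Rightarrow>\<^sub>L 'b) \<Rightarrow> bool" where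
  "sa P R \<longleftrightarrow> (\<forall>i\<in>{1..k}. selfadj (P i)) \<and> (\<forall>j\<in>{1..m}. selfadj (R j))"

text \<open>The condition \<open>0 < nX x\<close> stands for a nonzero point of the product;
  \<open>x \<noteq> (\<lambda>_. 0)\<close> would also look at coordinates outside
  \<open>{1..k}\<close>.\<close>

definition Qpos :: "(nat \<Rightarrow> 'a \<Rightarrow>\<^sub>L 'a) \<Rightarrow> (nat \<Rightarrow> 'b \<Rightarrow>\<^sub>L 'b) \<Rightarrow> bool" where
  "Qpos P R \<longleftrightarrow> sa P R \<and> (\<forall>x\<in>XE. 0 < nX x \<longrightarrow> 0 < Q P R x x)"

lemma Q_commute: "sa P R \<Longrightarrow> Q P R x y = Q P R y x"
  unfolding bl_form_def sa_def by (intro arg_cong2[where f = "(-)"] sum.cong) (auto intro: selfadjD)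

lemma Q_lin: "Q P R (\<lambda>i. a *\<^sub>R x i + y i) z = a * Q P R x z + Q P R y z"
proof -
  have "M j (\<lambda>i. a *\<^sub>R x i + y i) = a *\<^sub>R M j x + M j y" if "j \<in> {1..m}" for j
    using M_add[OF that, of "\<lambda>i. a *\<^sub>R x i" y] M_scale[OF that, of a x] by simp
  then have "(\<Sum>j=1..m. d j * (R j (M j (\<lambda>i. a *\<^sub>R x i + y i)) \<bullet> M j z))
     = a * (\<Sum>j=1..m. d j * (R j (M j x) \<bullet> M j z)) + (\<Sum>j=1..m. d j * (R j (M j y) \<bullet> M j z))"
    unfolding sum_distrib_left sum.distrib[symmetric]
    by (intro sum.cong) (simp_all add: blinfun.add_right blinfun.scaleR_right inner_add_left algebra_simps)
  moreover have "(\<Sum>i=1..k. c i * (P i (a *\<^sub>R x i + y i) \<bullet> z i)) = a * (\<Sum>i=1..k. c i * (P i (x i) \<bullet> z i)) + (\<Sum>i=1..k. c i * (P i (y i) \<bullet> z i))"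
    unfolding sum_distrib_left sum.distrib[symmetric]
    by (intro sum.cong) (simp_all add: blinfun.add_right blinfun.scaleR_right inner_add_left algebra_simps)
  ultimately show ?thesis unfolding bl_form_def by (simp add: algebra_simps)
qed

lemma Q_cong:
  assumes "\<And>i. i \<in> {1..k} \<Longrightarrow> x i = x' i" "\<And>i. i \<in> {1..k} \<Longrightarrow> y i = y' i"
  shows "Q P R x y = Q P R x' y'"
proof -
  have "M j x = M j x'" "M j y = M j y'" for j by (rule M_cong; simp add: assms)+
  moreover have "(\<Sum>i=1..k. c i * (P i (x i) \<bullet> y i)) = (\<Sum>i=1..k. c i * (P i (x' i) \<bullet> y' i))"
    by (rule sum.cong) (simp_all add: assms)
  ultimately show ?thesis by (simp add: bl_form_def)
qed

lemma Qpos_nonneg: "Qpos P R \<Longrightarrow> x \<in> XE \<Longrightarrow> 0 \<le> Q P R x x"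
proof (cases "0 < nX x")
  case False
  then have "x i = 0" if "i \<in> {1..k}" for i using nX_pos[of i x] that by blast
  then have "Q P R x x = Q P R (\<lambda>i. 0 *\<^sub>R x i + 0) (\<lambda>_. 0)" by (intro Q_cong) auto
  also have "\<dots> = 0" using Q_lin[of P R 1 "\<lambda>_. 0" "\<lambda>_. 0" "\<lambda>_. 0"] by simp
  finally show ?thesis by simp
qed (auto simp: Qpos_def)

lemma Q_cauchy_schwarz:
  assumes P: "Qpos P R" and x: "x \<in> XE" and y: "y \<in> XE"
  shows "(Q P R x y)\<^sup>2 \<le> Q P R x x * Q P R y y"
proof -
  have s: "sa P R" using P by (simp add: Qpos_def)
  have exp: "0 \<le> Q P R x x + 2 * a * Q P R x y + a\<^sup>2 * Q P R y y" for a
  proof -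
    have "(\<lambda>i. a *\<^sub>R y i + x i) \<in> XE"
      unfolding XE_def mem_Collect_eq by (intro ballI subspace_add subspace_scale E_subspace XE_D[OF x] XE_D[OF y])
    from Qpos_nonneg[OF P this] show ?thesis
      unfolding Q_lin Q_commute[OF s, of _ "\<lambda>i. a *\<^sub>R y i + x i"]
      by (simp add: Q_commute[OF s, of y x] power2_eq_square algebra_simps)
  qed
  show ?thesis
  proof (cases "Q P R y y = 0")
    case True
    have "Q P R x y = 0"
    proof (rule ccontr)
      assume "Q P R x y \<noteq> 0"
      define a where "a = - (Q P R x x + 1) / (2 * Q P R x y)"
      have "2 * a * Q P R x y = - (Q P R x x + 1)" using \<open>Q P R x y \<noteq> 0\<close> by (simp add: a_def)
      moreover have "a\<^sup>2 * Q P R y y = 0" using True by simp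
      ultimately show False using exp[of a] by linarith
    qed
    then show ?thesis using True by simp
  next
    case False
    then have y0: "0 < Q P R y y" using Qpos_nonneg[OF P y] by simp
    have "0 \<le> Q P R x x + 2 * (- Q P R x y / Q P R y y) * Q P R x y + (- Q P R x y / Q P R y y)\<^sup>2 * Q P R y y"
      by (rule exp)
    also have "\<dots> = Q P R x x - (Q P R x y)\<^sup>2 / Q P R y y"
      using y0 by (simp add: power2_eq_square field_simps)
    finally show ?thesis using y0 by (simp add: field_simps)
  qed
qed

lemma embX_lin: "embX (\<lambda>u. a * t u + w u) = (\<lambda>i. a *\<^sub>R embX t i + embX w i)"
  by (rule ext) (simp add: embX_def emb_add emb_scale)

lemma embX_cong: "(\<And>u. u \<in> IX \<Longrightarrow> t u = w u) \<Longrightarrow> i \<in> {1..k} \<Longrightarrow> embX t i = embX w i"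
  unfolding embX_def by (rule emb_cong) (auto simp: IX_def)

text \<open>Gram-Schmidt in the coordinates \<open>IX\<close>. By the expansion, the sum of the
  tensor squares of the \<xi> is the inverse of \<open>Q\<close>; the normalization will determine
  the defect in \<open>J_max_stationary\<close>.\<close>

lemma Q_orthonormal_basis:
  assumes P: "Qpos P R"
  shows "\<exists>\<xi>. (\<forall>l\<in>IX. \<xi> l \<in> XE \<and> Q P R (\<xi> l) (\<xi> l) = 1) \<and>
     (\<forall>x\<in>XE. \<forall>i\<in>{1..k}. x i = (\<Sum>l\<in>IX. Q P R x (\<xi> l) *\<^sub>R \<xi> l i))"
proof -
  have s: "sa P R" using P by (simp add: Qpos_def)
  define q where "q t w = Q P R (embX t) (embX w)" for t w
  have q: "sym_form IX q"
    unfolding sym_form_def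
  proof (intro conjI allI impI)
    show "q x y = q y x" for x y unfolding q_def by (rule Q_commute[OF s])
    show "q (\<lambda>u. a * x u + y u) z = a * q x z + q y z" for a x y z
      unfolding q_def embX_lin Q_lin ..
    show "q x z = q x' z" if "\<forall>u\<in>IX. x u = x' u" for x x' z
      unfolding q_def by (intro Q_cong embX_cong) (use that in auto)
  qed
  have pos: "0 < q x x" if "\<exists>u\<in>IX. x u \<noteq> 0" for x
  proof -
    from that have "0 < (\<Sum>u\<in>IX. (x u)\<^sup>2)" by (auto intro!: sum_pos2 simp: finite_IX)
    then have "0 < nX (embX x)" by (simp add: nX_embX)
    then show ?thesis using P embX_in unfolding Qpos_def q_def by blast
  qed
  obtain \<eta> where \<eta>1: "\<And>l l'. l \<in> IX \<Longrightarrow> l' \<in> IX \<Longrightarrow> q (\<eta> l) (\<eta> l') = (if l = l' then 1 else 0)"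
    and \<eta>: "\<And>x u. u \<in> IX \<Longrightarrow> x u = (\<Sum>l\<in>IX. q x (\<eta> l) * \<eta> l u)"
    using gram_schmidt[OF finite_IX q pos] by blast
  have "x i = (\<Sum>l\<in>IX. Q P R x (embX (\<eta> l)) *\<^sub>R embX (\<eta> l) i)" if x: "x \<in> XE" and i: "i \<in> {1..k}" for x i
  proof -
    have "x i = embX (crd x) i" using embX_crd[OF x i] by simp
    also have "\<dots> = embX (\<lambda>u. \<Sum>l\<in>IX. q (crd x) (\<eta> l) * \<eta> l u) i"
      by (rule embX_cong[OF _ i]) (rule \<eta>)
    also have "\<dots> = (\<Sum>l\<in>IX. q (crd x) (\<eta> l) *\<^sub>R embX (\<eta> l) i)"
      unfolding embX_def emb_def scaleR_sum_right scaleR_sum_left by (subst sum.swap) simp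
    also have "\<dots> = (\<Sum>l\<in>IX. Q P R x (embX (\<eta> l)) *\<^sub>R embX (\<eta> l) i)"
      unfolding q_def by (intro sum.cong refl arg_cong2[where f = scaleR] Q_cong) (simp_all add: embX_crd[OF x])
    finally show ?thesis .
  qed
  moreover have "Q P R (embX (\<eta> l)) (embX (\<eta> l)) = 1" if "l \<in> IX" for l
    using \<eta>1[OF that that] by (simp add: q_def)
  ultimately show ?thesis by (intro exI[of _ "\<lambda>l. embX (\<eta> l)"]) (simp add: embX_in)
qed

text \<open>Up to a factor depending on the dimension, the inverse square root of the determinant of
  \<open>Q\<close> on the product of the \<open>E i\<close>.\<close>

definition ZQ :: "(nat \<Rightarrow> 'a \<Rightarrow>\<^sub>L 'a) \<Rightarrow> (nat \<Rightarrow> 'b \<Rightarrow>\<^sub>L 'b) \<Rightarrow> real" where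
  "ZQ P R = enn2real (gint (lbPi IX) (\<lambda>t. Q P R (embX t) (embX t)))"

lemma gint_Q_rank_one:
  assumes P: "Qpos P R" and p: "p \<in> XE" and s: "1 + s * Q P R p p > 0"
  shows "gint (lbPi IX) (\<lambda>t. Q P R (embX t) (embX t) + s * (Q P R p (embX t))\<^sup>2)
    = ennreal (1 / sqrt (1 + s * Q P R p p)) * gint (lbPi IX) (\<lambda>t. Q P R (embX t) (embX t))"
proof -
  have sa: "sa P R" using P by (simp add: Qpos_def)
  interpret fin: finite_product_sigma_finite "\<lambda>_. lborel" IX by standard (rule finite_IX)
  let ?T = "\<lambda>r t. \<lambda>u\<in>IX. r * crd p u + 1 * t u"
  have T: "embX (?T r t) i = r *\<^sub>R p i + embX t i" if i: "i \<in> {1..k}" for r t i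
  proof -
    have "embX (?T r t) i = embX (\<lambda>u. r * crd p u + t u) i" by (rule embX_cong[OF _ i]) simp
    then show ?thesis unfolding embX_lin by (simp add: embX_crd[OF p i])
  qed
  have QT: "Q P R x (embX (?T r t)) = r * Q P R x p + Q P R x (embX t)" for x r t
  proof -
    have "Q P R x (embX (?T r t)) = Q P R x (\<lambda>i. r *\<^sub>R p i + embX t i)"
      by (intro Q_cong T) auto
    also have "\<dots> = Q P R (\<lambda>i. r *\<^sub>R p i + embX t i) x" by (rule Q_commute[OF sa])
    also have "\<dots> = r * Q P R p x + Q P R (embX t) x" by (rule Q_lin)
    finally show ?thesis by (simp add: Q_commute[OF sa, of p x] Q_commute[OF sa, of "embX t" x])
  qed
  show ?thesis
  proof (rule gint_rank_one[where T = ?T and \<kappa> = "Q P R p p" and l = "\<lambda>t. Q P R p (embX t)"])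
    show "sigma_finite_measure (lbPi IX)" by unfold_locales
    show "(\<integral>\<^sup>+t. F (?T r t) \<partial>lbPi IX) = (\<integral>\<^sup>+t. F t \<partial>lbPi IX)" if "F \<in> borel_measurable (lbPi IX)" for F r
      using nn_integral_PiM_affine[OF finite_IX _ that, of 1 "\<lambda>u. r * crd p u"] by simp
    show "Q P R (embX (?T r t)) (embX (?T r t)) = Q P R (embX t) (embX t) + 2 * r * Q P R p (embX t) + r\<^sup>2 * Q P R p p" for r t
    proof -
      have "Q P R (embX (?T r t)) (embX (?T r t)) = r * Q P R (embX (?T r t)) p + Q P R (embX (?T r t)) (embX t)"
        by (rule QT)
      also have "Q P R (embX (?T r t)) p = r * Q P R p p + Q P R p (embX t)"
        by (subst Q_commute[OF sa]) (rule QT)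
      also have "Q P R (embX (?T r t)) (embX t) = r * Q P R p (embX t) + Q P R (embX t) (embX t)"
        by (subst Q_commute[OF sa], subst QT) (simp only: Q_commute[OF sa, of "embX t" p])
      also have "r * (r * Q P R p p + Q P R p (embX t)) + (r * Q P R p (embX t) + Q P R (embX t) (embX t))
          = Q P R (embX t) (embX t) + 2 * r * Q P R p (embX t) + r\<^sup>2 * Q P R p p"
        by (simp add: power2_eq_square algebra_simps)
      finally show ?thesis .
    qed
    show "Q P R p (embX (?T r t)) = Q P R p (embX t) + r * Q P R p p" for r t
      by (subst QT) simp
    show "0 \<le> Q P R p p" by (rule Qpos_nonneg[OF P p])
    show "0 < 1 + s * Q P R p p" by (rule s)
  qed measurable
qed

lemma gint_Q_lower:
  assumes "a > 0" "\<And>x. x \<in> XE \<Longrightarrow> q x \<le> a * nX x"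
  shows "ennreal (sqrt (2 * pi / a) ^ card IX) \<le> gint (lbPi IX) (\<lambda>t. q (embX t))"
  unfolding gint_nX[OF assms(1), symmetric] by (rule gint_mono) (use assms embX_in in auto)

lemma gint_Q_upper:
  assumes "a > 0" "\<And>x. x \<in> XE \<Longrightarrow> a * nX x \<le> q x"
  shows "gint (lbPi IX) (\<lambda>t. q (embX t)) \<le> ennreal (sqrt (2 * pi / a) ^ card IX)"
  unfolding gint_nX[OF assms(1), symmetric] by (rule gint_mono) (use assms embX_in in auto)

end

section \<open>Lower bounds for forms in terms of Gaussian integrals\<close>

lemma sum_mult_sq_le: "(\<Sum>i\<in>A. a i * b i)\<^sup>2 \<le> (\<Sum>i\<in>A. (a i)\<^sup>2) * (\<Sum>i\<in>A. (b i)\<^sup>2)" for a b :: "'i \<Rightarrow> real"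
  by (rule Cauchy_Schwarz_ineq_sum)

text \<open>A form below the identity can be small in the direction \<open>e\<close> only if its
  Gaussian integral is large. Adding the rank-one form of the unit vector \<open>b\<close> along
  \<open>e\<close> keeps it below 2, hence the new integral above \<open>sqrt pi ^ dim S\<close>.
  The determinant lemma relates that integral to \<open>Zg S P\<close> through
  \<open>1 + b \<bullet> p\<close>, and Cauchy-Schwarz bounds the reciprocal of
  \<open>b \<bullet> p\<close> by \<open>P b \<bullet> b\<close>.\<close>

lemma Zg_lower_form:
  assumes S: "subspace S" and P: "posdef_on S P" and le: "\<And>x. x \<in> S \<Longrightarrow> P x \<bullet> x \<le> x \<bullet> x" and e: "e \<in> S"
  shows "pi ^ dim S * (e \<bullet> e) \<le> (Zg S P)\<^sup>2 * (P e \<bullet> e)"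
proof (cases "e = 0")
  case False
  obtain a where aS: "\<And>l. l \<in> onb S \<Longrightarrow> a l \<in> S"
    and a: "\<And>x. x \<in> S \<Longrightarrow> x = (\<Sum>l\<in>onb S. (P x \<bullet> a l) *\<^sub>R a l)"
    using posdef_orthonormal_basis[OF S P] by blast
  have sp: "P x \<bullet> y = P y \<bullet> x" for x y by (rule selfadjD[OF posdef_onD(1)[OF P]])
  define n where "n = norm e"
  define b where "b = e /\<^sub>R n"
  define p where "p = (\<Sum>l\<in>onb S. (b \<bullet> a l) *\<^sub>R a l)"
  have n: "n > 0" using False by (simp add: n_def)
  have b: "b \<in> S" using S e by (simp add: b_def subspace_scale)
  have bn: "b \<bullet> b = 1" using n by (simp add: b_def n_def dot_square_norm power2_eq_square)
  have p: "p \<in> S" unfolding p_def using aS by (intro subspace_sum[OF S] subspace_scale[OF S]) auto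
  have Pp: "P p \<bullet> x = b \<bullet> x" if "x \<in> S" for x
  proof -
    have "P p \<bullet> x = P x \<bullet> p" by (rule sp)
    also have "\<dots> = (\<Sum>l\<in>onb S. (P x \<bullet> a l) * (b \<bullet> a l))" by (simp add: p_def inner_sum_right mult.commute)
    also have "\<dots> = b \<bullet> (\<Sum>l\<in>onb S. (P x \<bullet> a l) *\<^sub>R a l)" by (simp add: inner_sum_right)
    finally show ?thesis using a[OF that] by simp
  qed
  have \<kappa>: "0 \<le> b \<bullet> p" using posdef_on_nonneg[OF P p] by (simp add: Pp[OF p])
  have pd: "posdef_on S (P + 1 *\<^sub>R rk1 b)" and Z: "Zg S (P + 1 *\<^sub>R rk1 b) = Zg S P / sqrt (1 + 1 * (b \<bullet> p))"
    using Zg_rank_one[OF S P p _ Pp, of 1] \<kappa> by (simp_all add: Pp[OF p])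
  have "sqrt (2 * pi / 2) ^ dim S \<le> Zg S (P + 1 *\<^sub>R rk1 b)"
  proof (rule Zg_lower[OF S pd])
    fix x assume x: "x \<in> S"
    have "(b \<bullet> x)\<^sup>2 \<le> (b \<bullet> b) * (x \<bullet> x)" by (rule Cauchy_Schwarz_ineq)
    then show "(P + 1 *\<^sub>R rk1 b) x \<bullet> x \<le> 2 * (x \<bullet> x)"
      using le[OF x] unfolding rk1_form by (simp add: bn power2_eq_square)
  qed simp
  then have "sqrt pi ^ dim S * sqrt (1 + b \<bullet> p) \<le> Zg S P"
    unfolding Z using \<kappa> by (simp add: field_simps)
  then have "(sqrt pi ^ dim S * sqrt (1 + b \<bullet> p))\<^sup>2 \<le> (Zg S P)\<^sup>2"
    using \<kappa> by (intro power_mono) auto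
  then have le1: "pi ^ dim S * (1 + b \<bullet> p) \<le> (Zg S P)\<^sup>2"
  proof -
    have "(sqrt pi ^ dim S)\<^sup>2 = ((sqrt pi)\<^sup>2) ^ dim S" by (metis power_mult mult.commute)
    moreover have "(sqrt (1 + b \<bullet> p))\<^sup>2 = 1 + b \<bullet> p" using \<kappa> by (intro real_sqrt_pow2) auto
    ultimately have "(sqrt pi ^ dim S * sqrt (1 + b \<bullet> p))\<^sup>2 = pi ^ dim S * (1 + b \<bullet> p)"
      by (simp add: power_mult_distrib)
    then show ?thesis using \<open>(sqrt pi ^ dim S * sqrt (1 + b \<bullet> p))\<^sup>2 \<le> (Zg S P)\<^sup>2\<close> by simp
  qed
  have "1 \<le> (b \<bullet> p) * (P b \<bullet> b)"
    using posdef_cauchy_schwarz[OF S P p b] by (simp add: Pp[OF b] Pp[OF p] bn)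
  also have "\<dots> \<le> (1 + b \<bullet> p) * (P b \<bullet> b)"
    using posdef_on_nonneg[OF P b] by (intro mult_right_mono) auto
  finally have "pi ^ dim S * 1 \<le> pi ^ dim S * ((1 + b \<bullet> p) * (P b \<bullet> b))"
    by (intro mult_left_mono) auto
  also have "\<dots> = (pi ^ dim S * (1 + b \<bullet> p)) * (P b \<bullet> b)" by simp
  also have "\<dots> \<le> (Zg S P)\<^sup>2 * (P b \<bullet> b)"
    using posdef_on_nonneg[OF P b] by (intro mult_right_mono le1) auto
  finally have "pi ^ dim S * n\<^sup>2 \<le> (Zg S P)\<^sup>2 * (P b \<bullet> b) * n\<^sup>2" by (intro mult_right_mono) auto
  also have "(P b \<bullet> b) * n\<^sup>2 = P e \<bullet> e" using n by (simp add: b_def blinfun.scaleR_right power2_eq_square field_simps)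
  then have "(Zg S P)\<^sup>2 * (P b \<bullet> b) * n\<^sup>2 = (Zg S P)\<^sup>2 * (P e \<bullet> e)" by (simp add: mult.assoc)
  finally show ?thesis by (simp add: n_def dot_square_norm)
qed simp

context bl_datum
begin

text \<open>An upper bound for \<open>Q\<close> on normalized forms, see \<open>Q_le\<close>; the
  summand 1 keeps it at least 1 even for \<open>k = 0\<close>, so that its logarithm is
  nonnegative.\<close>

definition cmax :: real where "cmax = 1 + (\<Sum>i=1..k. c i)"

lemma cmax: "i \<in> {1..k} \<Longrightarrow> c i \<le> cmax" "cmax \<ge> 1"
proof -
  have "0 \<le> (\<Sum>i=1..k. c i)" using c_pos by (intro sum_nonneg) (auto simp: less_imp_le)
  then show "cmax \<ge> 1" by (simp add: cmax_def)
  assume "i \<in> {1..k}"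
  then have "c i \<le> (\<Sum>i=1..k. c i)" using c_pos by (intro member_le_sum) (auto simp: less_imp_le)
  then show "c i \<le> cmax" by (simp add: cmax_def)
qed

text \<open>The bound by the identity supplies compactness, the estimate
  \<open>Zg_lower_form\<close>, and control of the flow at the origin for large times.
  \<open>Q\<close> is strictly positive, so that the barrier \<open>ZQ\<close> is finite.\<close>

definition formsD :: "(nat \<Rightarrow> 'a \<Rightarrow>\<^sub>L 'a) \<Rightarrow> (nat \<Rightarrow> 'b \<Rightarrow>\<^sub>L 'b) \<Rightarrow> bool" where
  "formsD P R \<longleftrightarrow> (\<forall>i\<in>{1..k}. posdef_on (E i) (P i) \<and> (\<forall>x\<in>E i. P i x \<bullet> x \<le> x \<bullet> x)) \<and>
     (\<forall>j\<in>{1..m}. posdef_on (F j) (R j) \<and> (\<forall>x\<in>F j. R j x \<bullet> x \<le> x \<bullet> x)) \<and> Qpos P R"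

lemma formsD_D:
  assumes "formsD P R"
  shows "i \<in> {1..k} \<Longrightarrow> posdef_on (E i) (P i)" "i \<in> {1..k} \<Longrightarrow> x \<in> E i \<Longrightarrow> P i x \<bullet> x \<le> x \<bullet> x"
    "j \<in> {1..m} \<Longrightarrow> posdef_on (F j) (R j)" "j \<in> {1..m} \<Longrightarrow> y \<in> F j \<Longrightarrow> R j y \<bullet> y \<le> y \<bullet> y"
    "Qpos P R" "sa P R"
  using assms by (auto simp: formsD_def Qpos_def)

lemma Q_le:
  assumes "formsD P R" "x \<in> XE"
  shows "Q P R x x \<le> cmax * nX x"
proof -
  have "0 \<le> (\<Sum>j=1..m. d j * (R j (M j x) \<bullet> M j x))"
    by (intro sum_nonneg mult_nonneg_nonneg less_imp_le[OF d_pos] posdef_on_nonneg[OF formsD_D(3)[OF assms(1)]] M_in assms)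
  moreover have "(\<Sum>i=1..k. c i * (P i (x i) \<bullet> x i)) \<le> (\<Sum>i=1..k. cmax * (x i \<bullet> x i))"
    by (intro sum_mono mult_mono cmax formsD_D(2)[OF assms(1)] XE_D[OF assms(2)] posdef_on_nonneg[OF formsD_D(1)[OF assms(1)]])
      (use cmax in auto)
  ultimately show ?thesis by (simp add: bl_form_def nX_def sum_distrib_left)
qed

lemma Q_lower_exists:
  assumes P: "Qpos P R"
  shows "\<exists>a>0. \<forall>x\<in>XE. a * nX x \<le> Q P R x x"
proof -
  obtain \<xi> where \<xi>: "\<And>l. l \<in> IX \<Longrightarrow> \<xi> l \<in> XE" "\<And>l. l \<in> IX \<Longrightarrow> Q P R (\<xi> l) (\<xi> l) = 1"
    and ex: "\<And>x i. x \<in> XE \<Longrightarrow> i \<in> {1..k} \<Longrightarrow> x i = (\<Sum>l\<in>IX. Q P R x (\<xi> l) *\<^sub>R \<xi> l i)"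
    using Q_orthonormal_basis[OF P] by blast
  define G where "G = (\<Sum>i=1..k. (\<Sum>l\<in>IX. norm (\<xi> l i))\<^sup>2) + 1"
  have G: "G > 0" unfolding G_def by (intro add_nonneg_pos sum_nonneg) auto
  have "nX x \<le> Q P R x x * G" if x: "x \<in> XE" for x
  proof -
    have q: "0 \<le> Q P R x x" by (rule Qpos_nonneg[OF P x])
    have "x i \<bullet> x i \<le> Q P R x x * (\<Sum>l\<in>IX. norm (\<xi> l i))\<^sup>2" if i: "i \<in> {1..k}" for i
    proof -
      have "norm (x i) = norm (\<Sum>l\<in>IX. Q P R x (\<xi> l) *\<^sub>R \<xi> l i)" using ex[OF x i] by simp
      also have "\<dots> \<le> (\<Sum>l\<in>IX. norm (Q P R x (\<xi> l) *\<^sub>R \<xi> l i))" by (rule norm_sum)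
      also have "\<dots> \<le> (\<Sum>l\<in>IX. sqrt (Q P R x x) * norm (\<xi> l i))"
      proof (rule sum_mono)
        fix l assume l: "l \<in> IX"
        have "(Q P R x (\<xi> l))\<^sup>2 \<le> Q P R x x"
          using Q_cauchy_schwarz[OF P x \<xi>(1)[OF l]] \<xi>(2)[OF l] by simp
        then have "\<bar>Q P R x (\<xi> l)\<bar> \<le> sqrt (Q P R x x)" by (metis real_sqrt_abs real_sqrt_le_iff)
        then show "norm (Q P R x (\<xi> l) *\<^sub>R \<xi> l i) \<le> sqrt (Q P R x x) * norm (\<xi> l i)"
          by (simp add: mult_right_mono)
      qed
      finally have "norm (x i) \<le> sqrt (Q P R x x) * (\<Sum>l\<in>IX. norm (\<xi> l i))" by (simp add: sum_distrib_left)
      then have "(norm (x i))\<^sup>2 \<le> (sqrt (Q P R x x) * (\<Sum>l\<in>IX. norm (\<xi> l i)))\<^sup>2" by (intro power_mono) auto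
      then show ?thesis using q by (simp add: dot_square_norm power_mult_distrib)
    qed
    then have "nX x \<le> (\<Sum>i=1..k. Q P R x x * (\<Sum>l\<in>IX. norm (\<xi> l i))\<^sup>2)"
      unfolding nX_def by (rule sum_mono)
    also have "\<dots> \<le> Q P R x x * G" using q by (simp add: G_def sum_distrib_left[symmetric] distrib_left)
    finally show ?thesis .
  qed
  then show ?thesis using G by (intro exI[of _ "1 / G"]) (auto simp: field_simps)
qed

lemma gint_eq_ZQ:
  assumes D: "formsD P R"
  shows gint_ZQ: "gint (lbPi IX) (\<lambda>t. Q P R (embX t) (embX t)) = ennreal (ZQ P R)"
    and ZQ_lower: "sqrt (2 * pi / cmax) ^ card IX \<le> ZQ P R"
    and ZQ_pos: "0 < ZQ P R"
proof -
  obtain a where a: "a > 0" "\<And>x. x \<in> XE \<Longrightarrow> a * nX x \<le> Q P R x x"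
    using Q_lower_exists[OF formsD_D(5)[OF D]] by blast
  have "gint (lbPi IX) (\<lambda>t. Q P R (embX t) (embX t)) \<le> ennreal (sqrt (2 * pi / a) ^ card IX)"
    by (rule gint_Q_upper[of a "\<lambda>x. Q P R x x"]) (use a in auto)
  then have "gint (lbPi IX) (\<lambda>t. Q P R (embX t) (embX t)) < top"
    by (rule order.strict_trans1) simp
  then show eq: "gint (lbPi IX) (\<lambda>t. Q P R (embX t) (embX t)) = ennreal (ZQ P R)"
    unfolding ZQ_def by (simp add: ennreal_enn2real_if)
  have "ennreal (sqrt (2 * pi / cmax) ^ card IX) \<le> gint (lbPi IX) (\<lambda>t. Q P R (embX t) (embX t))"
    by (rule gint_Q_lower[of cmax "\<lambda>x. Q P R x x"]) (use cmax(2) Q_le[OF D] in auto)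
  then show "sqrt (2 * pi / cmax) ^ card IX \<le> ZQ P R"
    unfolding eq by (simp add: ZQ_def)
  moreover have "0 < sqrt (2 * pi / cmax) ^ card IX" using cmax(2) by simp
  ultimately show "0 < ZQ P R" by linarith
qed

text \<open>The argument of \<open>Zg_lower_form\<close> on the product space. \<open>Q\<close> is
  below \<open>cmax\<close>, and the added rank-one form is scaled to be at most \<open>nX\<close>,
  whence the constant \<open>cmax + 1\<close>. The vector \<open>p\<close> represents the pairing
  with \<open>e\<close> with respect to \<open>Q\<close>.\<close>

lemma ZQ_lower_form:
  assumes D: "formsD P R" and e: "e \<in> XE"
  shows "(2 * pi / (cmax + 1)) ^ card IX * nX e \<le> (ZQ P R)\<^sup>2 * Q P R e e"
proof (cases "0 < nX e")
  case False
  then have "nX e = 0" using nX_nonneg[of e] by simp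
  then show ?thesis using Qpos_nonneg[OF formsD_D(5)[OF D] e] by simp
next
  case True
  note P = formsD_D(5)[OF D] and s = formsD_D(6)[OF D]
  obtain \<xi> where \<xi>: "\<And>l. l \<in> IX \<Longrightarrow> \<xi> l \<in> XE"
    and ex: "\<And>x i. x \<in> XE \<Longrightarrow> i \<in> {1..k} \<Longrightarrow> x i = (\<Sum>l\<in>IX. Q P R x (\<xi> l) *\<^sub>R \<xi> l i)"
    using Q_orthonormal_basis[OF P] by blast
  define ip where "ip x = (\<Sum>i=1..k. e i \<bullet> x i)" for x
  define p where "p = (\<lambda>i. \<Sum>l\<in>IX. ip (\<xi> l) *\<^sub>R \<xi> l i)"
  have p: "p \<in> XE" unfolding XE_def p_def mem_Collect_eq
    by (intro ballI subspace_sum subspace_scale E_subspace XE_D[OF \<xi>])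
  have Qp: "Q P R p x = ip x" if x: "x \<in> XE" for x
  proof -
    have Qsum: "Q P R (\<lambda>i. \<Sum>l\<in>L. a l *\<^sub>R \<xi> l i) x = (\<Sum>l\<in>L. a l * Q P R (\<xi> l) x)" if "finite L" for L a
      using that
    proof induction
      case empty
      show ?case using Q_lin[of P R 1 "\<lambda>_. 0" "\<lambda>_. 0" x] by simp
    next
      case (insert l L)
      then show ?case using Q_lin[of P R "a l" "\<xi> l" "\<lambda>i. \<Sum>l\<in>L. a l *\<^sub>R \<xi> l i" x] by simp
    qed
    have "Q P R p x = (\<Sum>l\<in>IX. ip (\<xi> l) * Q P R x (\<xi> l))"
      unfolding p_def Qsum[OF finite_IX] by (simp add: Q_commute[OF s, of _ x])
    also have "\<dots> = (\<Sum>i=1..k. e i \<bullet> (\<Sum>l\<in>IX. Q P R x (\<xi> l) *\<^sub>R \<xi> l i))"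
      unfolding ip_def sum_distrib_right inner_sum_right by (subst sum.swap) (simp add: mult.commute)
    also have "\<dots> = ip x" unfolding ip_def by (rule sum.cong) (use ex[OF x] in auto)
    finally show ?thesis .
  qed
  define \<kappa> where "\<kappa> = Q P R p p"
  have \<kappa>: "0 \<le> \<kappa>" unfolding \<kappa>_def by (rule Qpos_nonneg[OF P p])
  let ?s = "1 / nX e"
  have s0: "0 < ?s" using True by simp
  have pos: "0 < 1 + ?s * \<kappa>" using s0 \<kappa> by (intro add_pos_nonneg mult_nonneg_nonneg) auto
  have "ennreal (sqrt (2 * pi / (cmax + 1)) ^ card IX) \<le> gint (lbPi IX) (\<lambda>t. Q P R (embX t) (embX t) + ?s * (Q P R p (embX t))\<^sup>2)"
  proof (rule gint_Q_lower[of "cmax + 1" "\<lambda>x. Q P R x x + ?s * (Q P R p x)\<^sup>2"])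
    show "0 < cmax + 1" using cmax(2) by simp
    fix x assume x: "x \<in> XE"
    have "\<bar>ip x\<bar> \<le> (\<Sum>i=1..k. norm (e i) * norm (x i))"
      unfolding ip_def by (rule order_trans[OF sum_abs]) (intro sum_mono Cauchy_Schwarz_ineq2)
    then have "\<bar>ip x\<bar>\<^sup>2 \<le> (\<Sum>i=1..k. norm (e i) * norm (x i))\<^sup>2" by (intro power_mono) auto
    also have "\<dots> \<le> (\<Sum>i=1..k. (norm (e i))\<^sup>2) * (\<Sum>i=1..k. (norm (x i))\<^sup>2)" by (rule sum_mult_sq_le)
    finally have "(ip x)\<^sup>2 \<le> nX e * nX x" by (simp add: nX_def dot_square_norm)
    then have "?s * (Q P R p x)\<^sup>2 \<le> nX x" using True by (simp add: Qp[OF x] field_simps)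
    then show "Q P R x x + ?s * (Q P R p x)\<^sup>2 \<le> (cmax + 1) * nX x"
      using Q_le[OF D x] by (simp add: algebra_simps)
  qed
  also have "\<dots> = ennreal (1 / sqrt (1 + ?s * \<kappa>)) * ennreal (ZQ P R)"
    unfolding gint_ZQ[OF D, symmetric] \<kappa>_def by (rule gint_Q_rank_one[OF P p]) (use pos \<kappa>_def in simp)
  also have "\<dots> = ennreal (ZQ P R / sqrt (1 + ?s * \<kappa>))"
    using ZQ_pos[OF D] pos by (simp add: ennreal_mult[symmetric])
  finally have "sqrt (2 * pi / (cmax + 1)) ^ card IX \<le> ZQ P R / sqrt (1 + ?s * \<kappa>)"
    by (subst (asm) ennreal_le_iff) (use ZQ_pos[OF D] pos in auto)
  then have "sqrt (2 * pi / (cmax + 1)) ^ card IX * sqrt (1 + ?s * \<kappa>) \<le> ZQ P R"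
    using pos by (simp only: pos_le_divide_eq real_sqrt_gt_0_iff)
  then have "(sqrt (2 * pi / (cmax + 1)) ^ card IX * sqrt (1 + ?s * \<kappa>))\<^sup>2 \<le> (ZQ P R)\<^sup>2"
    using pos cmax(2) by (intro power_mono mult_nonneg_nonneg) auto
  also have "(sqrt (2 * pi / (cmax + 1)) ^ card IX * sqrt (1 + ?s * \<kappa>))\<^sup>2 = (2 * pi / (cmax + 1)) ^ card IX * (1 + ?s * \<kappa>)"
  proof -
    have "(sqrt (2 * pi / (cmax + 1)) ^ card IX)\<^sup>2 = ((sqrt (2 * pi / (cmax + 1)))\<^sup>2) ^ card IX"
      by (metis power_mult mult.commute)
    moreover have "(sqrt (2 * pi / (cmax + 1)))\<^sup>2 = 2 * pi / (cmax + 1)" using cmax(2) by (intro real_sqrt_pow2) auto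
    moreover have "(sqrt (1 + ?s * \<kappa>))\<^sup>2 = 1 + ?s * \<kappa>" using pos by (intro real_sqrt_pow2) auto
    ultimately show ?thesis by (simp only: power_mult_distrib)
  qed
  finally have le: "(2 * pi / (cmax + 1)) ^ card IX * (1 + ?s * \<kappa>) \<le> (ZQ P R)\<^sup>2" .
  have "(nX e)\<^sup>2 \<le> \<kappa> * Q P R e e"
    using Q_cauchy_schwarz[OF P p e] by (simp add: Qp[OF e] ip_def nX_def \<kappa>_def)
  then have "nX e \<le> (?s * \<kappa>) * Q P R e e"
    using True by (simp add: power2_eq_square field_simps)
  also have "\<dots> \<le> (1 + ?s * \<kappa>) * Q P R e e"
    using Qpos_nonneg[OF P e] by (intro mult_right_mono) auto
  finally have "(2 * pi / (cmax + 1)) ^ card IX * nX e \<le> (2 * pi / (cmax + 1)) ^ card IX * ((1 + ?s * \<kappa>) * Q P R e e)"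
    using cmax(2) by (intro mult_left_mono) auto
  also have "\<dots> \<le> (ZQ P R)\<^sup>2 * Q P R e e"
    unfolding mult.assoc[symmetric] by (intro mult_right_mono le Qpos_nonneg[OF P e])
  finally show ?thesis .
qed

end

section \<open>Compact sets of forms and the functional to be maximized\<close>

lemma psd_cauchy_schwarz:
  fixes P :: "'a::euclidean_space \<Rightarrow>\<^sub>L 'a"
  assumes sa: "selfadj P" and psd: "\<And>x. 0 \<le> P x \<bullet> x"
  shows "(P x \<bullet> y)\<^sup>2 \<le> (P x \<bullet> x) * (P y \<bullet> y)"
proof -
  have e: "0 \<le> P x \<bullet> x + 2 * a * (P x \<bullet> y) + a\<^sup>2 * (P y \<bullet> y)" for a
    using psd[of "x + a *\<^sub>R y"]
    by (simp add: blinfun.add_right blinfun.scaleR_right inner_add_left inner_add_right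
        selfadjD[OF sa, of y x] power2_eq_square algebra_simps)
  show ?thesis
  proof (cases "P y \<bullet> y = 0")
    case True
    have "P x \<bullet> y = 0"
    proof (rule ccontr)
      assume "P x \<bullet> y \<noteq> 0"
      define a where "a = - (P x \<bullet> x + 1) / (2 * (P x \<bullet> y))"
      have "2 * a * (P x \<bullet> y) = - (P x \<bullet> x + 1)" using \<open>P x \<bullet> y \<noteq> 0\<close> by (simp add: a_def)
      moreover have "a\<^sup>2 * (P y \<bullet> y) = 0" using True by simp
      ultimately show False using e[of a] by linarith
    qed
    then show ?thesis using True by simp
  next
    case False
    then have y0: "0 < P y \<bullet> y" using psd[of y] by simp
    have "0 \<le> P x \<bullet> x + 2 * (- (P x \<bullet> y) / (P y \<bullet> y)) * (P x \<bullet> y) + (- (P x \<bullet> y) / (P y \<bullet> y))\<^sup>2 * (P y \<bullet> y)"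
      by (rule e)
    also have "\<dots> = P x \<bullet> x - (P x \<bullet> y)\<^sup>2 / (P y \<bullet> y)"
      using y0 by (simp add: power2_eq_square field_simps)
    finally show ?thesis using y0 by (simp add: field_simps)
  qed
qed

text \<open>A form on \<open>S\<close> extended by zero to the ambient space, which singles out one
  operator for each form. The bounds hold on all ambient vectors and thereby control the operator
  norm.\<close>

definition kform :: "'a::euclidean_space set \<Rightarrow> ('a \<Rightarrow>\<^sub>L 'a) set" where
  "kform S = {P. selfadj P \<and> (\<forall>x. 0 \<le> P x \<bullet> x \<and> P x \<bullet> x \<le> x \<bullet> x) \<and> (\<forall>x. (\<forall>y\<in>S. x \<bullet> y = 0) \<longrightarrow> P x = 0)}"

lemma kformD:
  assumes "P \<in> kform S"
  shows "selfadj P" "0 \<le> P x \<bullet> x" "P x \<bullet> x \<le> x \<bullet> x" "(\<And>y. y \<in> S \<Longrightarrow> x \<bullet> y = 0) \<Longrightarrow> P x = 0"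
  using assms by (auto simp: kform_def)

definition proj_on :: "'a::euclidean_space set \<Rightarrow> 'a \<Rightarrow>\<^sub>L 'a" where
  "proj_on S = (\<Sum>v\<in>onb S. rk1 v)"

lemma proj_on_emb: "proj_on S x = emb S (\<lambda>v. x \<bullet> v)"
  by (simp add: proj_on_def emb_def blinfun.sum_left rk1.rep_eq inner_commute)

lemma proj_on_id: "subspace S \<Longrightarrow> x \<in> S \<Longrightarrow> proj_on S x = x"
  unfolding proj_on_emb by (rule emb_coords)

lemma proj_on_in: "subspace S \<Longrightarrow> proj_on S x \<in> S"
  unfolding proj_on_emb by (rule emb_in)

lemma proj_on_form: "proj_on S x \<bullet> y = (\<Sum>v\<in>onb S. (x \<bullet> v) * (y \<bullet> v))"
  unfolding proj_on_emb emb_def inner_sum_left inner_scaleR_left by (simp only: inner_commute[of _ y])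

lemma selfadj_proj_on: "selfadj (proj_on S)"
  unfolding selfadj_def inner_commute[of _ "proj_on S _"] proj_on_form by (simp add: mult.commute)

lemma proj_on_kform:
  assumes S: "subspace S" and r: "0 \<le> r" "r \<le> 1"
  shows "r *\<^sub>R proj_on S \<in> kform S"
proof -
    have bd: "proj_on S x \<bullet> x \<le> x \<bullet> x" for x
    proof -
      have "proj_on S x \<bullet> proj_on S x = proj_on S x \<bullet> x"
        unfolding proj_on_form[of S x x] unfolding proj_on_emb emb_inner[OF S] ..
      then have "0 \<le> x \<bullet> x - proj_on S x \<bullet> x"
        using inner_ge_zero[of "x - proj_on S x"] by (simp add: inner_diff_left inner_diff_right inner_commute)
      then show ?thesis by simp
    qed
    have nn: "0 \<le> proj_on S x \<bullet> x" for x unfolding proj_on_form by (intro sum_nonneg) auto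
    show "r *\<^sub>R proj_on S \<in> kform S"
      unfolding kform_def mem_Collect_eq selfadj_def blinfun.scaleR_left
    proof (intro conjI allI impI)
      show "r *\<^sub>R proj_on S x \<bullet> y = x \<bullet> r *\<^sub>R proj_on S y" for x y
        using selfadj_proj_on[of S] by (simp add: selfadj_def)
      show "0 \<le> r *\<^sub>R proj_on S x \<bullet> x" for x using nn[of x] r by simp
      show "r *\<^sub>R proj_on S x \<bullet> x \<le> x \<bullet> x" for x
      proof -
        have "r * (proj_on S x \<bullet> x) \<le> 1 * (proj_on S x \<bullet> x)" by (intro mult_right_mono nn r)
        then show ?thesis using bd[of x] by simp
      qed
      fix x assume "\<forall>y\<in>S. x \<bullet> y = 0"
      then have "proj_on S x = 0" unfolding proj_on_emb emb_def using onb_subset[OF S] by (intro sum.neutral) auto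
      then show "r *\<^sub>R proj_on S x = 0" by simp
    qed
qed

text \<open>Cauchy-Schwarz for the form, applied to \<open>x\<close> and \<open>P x\<close>, gives
  \<open>norm P \<le> 1\<close>; the defining conditions are pointwise and closed, and the space of
  operators is finite-dimensional.\<close>

lemma compact_kform: "compact (kform S)"
proof -
  have "norm P \<le> 1" if P: "P \<in> kform S" for P
  proof (rule norm_blinfun_bound)
    fix x
    have "(P x \<bullet> P x)\<^sup>2 \<le> (P x \<bullet> x) * (P (P x) \<bullet> P x)"
      by (rule psd_cauchy_schwarz) (use kformD[OF P] in auto)
    also have "\<dots> \<le> (x \<bullet> x) * (P x \<bullet> P x)"
      by (intro mult_mono) (use kformD[OF P] in auto)
    finally have "(P x \<bullet> P x) * (P x \<bullet> P x) \<le> (x \<bullet> x) * (P x \<bullet> P x)" by (simp add: power2_eq_square)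
    then have "P x \<bullet> P x \<le> x \<bullet> x"
      by (cases "P x = 0") (auto simp: mult_le_cancel_right)
    then show "norm (P x) \<le> 1 * norm x" by (simp add: norm_le)
  qed simp
  then have "bounded (kform S)" unfolding bounded_iff by blast
  moreover have "closed (kform S)"
    unfolding kform_def selfadj_def
    by (intro closed_Collect_conj closed_Collect_all closed_Collect_imp closed_Collect_le closed_Collect_eq open_Collect_const continuous_intros)
  ultimately show ?thesis by (simp add: compact_eq_bounded_closed)
qed

lemma gint_tendsto:
  assumes [measurable]: "\<And>n. q n \<in> borel_measurable M" "q0 \<in> borel_measurable M" "g \<in> borel_measurable M"
    and lim: "\<And>x. x \<in> space M \<Longrightarrow> (\<lambda>n. q n x) \<longlonglongrightarrow> q0 x"
    and le: "\<And>n x. x \<in> space M \<Longrightarrow> g x \<le> q n x" and fin: "gint M g < \<infinity>"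
  shows "(\<lambda>n. gint M (q n)) \<longlonglongrightarrow> gint M q0"
  unfolding gint_def
proof (rule nn_integral_dominated_convergence[where w = "\<lambda>x. ennreal (exp (- g x / 2))"])
  show "AE x in M. ennreal (exp (- q n x / 2)) \<le> ennreal (exp (- g x / 2))" for n
    using le by (intro AE_I2 ennreal_leI) simp
  show "AE x in M. (\<lambda>n. ennreal (exp (- q n x / 2))) \<longlonglongrightarrow> ennreal (exp (- q0 x / 2))"
    using lim by (intro AE_I2 tendsto_intros tendsto_ennrealI) auto
  show "(\<integral>\<^sup>+ x. ennreal (exp (- g x / 2)) \<partial>M) < \<infinity>"
    using fin by (simp add: gint_def)
qed measurable

lemma Zg_tendsto:
  fixes Pn :: "nat \<Rightarrow> 'a::euclidean_space \<Rightarrow>\<^sub>L 'a"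
  assumes S: "subspace S" and lim: "Pn \<longlonglongrightarrow> P" and a: "a > 0" "\<And>n x. x \<in> S \<Longrightarrow> a * (x \<bullet> x) \<le> Pn n x \<bullet> x"
  shows "(\<lambda>n. Zg S (Pn n)) \<longlonglongrightarrow> Zg S P"
proof -
  have l: "(\<lambda>n. Pn n x \<bullet> x) \<longlonglongrightarrow> P x \<bullet> x" for x
    by (intro tendsto_intros lim)
  have fin: "gint (lborel_on S) (\<lambda>x. a * (x \<bullet> x)) < \<infinity>"
    unfolding gint_scalar[OF S a(1)] by simp
  have "(\<lambda>n. gint (lborel_on S) (\<lambda>x. Pn n x \<bullet> x)) \<longlonglongrightarrow> gint (lborel_on S) (\<lambda>x. P x \<bullet> x)"
    by (rule gint_tendsto[OF _ _ _ l _ fin]) (use a(2) in auto)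
  moreover have "gint (lborel_on S) (\<lambda>x. P x \<bullet> x) < \<infinity>"
  proof -
    have "a * (x \<bullet> x) \<le> P x \<bullet> x" if "x \<in> S" for x
      by (rule LIMSEQ_le_const[OF l]) (use a(2) that in blast)
    from gint_form_upper[OF S a(1) this] show ?thesis by (rule order.strict_trans1) auto
  qed
  ultimately show ?thesis
    unfolding Zg_def by (intro tendsto_enn2real) auto
qed

text \<open>A one-sided first-order condition: the expression vanishes at \<open>s = 0\<close> and
  is nonpositive to the right of it.\<close>

lemma log_sum_deriv_nonpos:
  fixes \<alpha> \<beta> u v s0 :: real
  assumes "s0 > 0" and le: "\<And>s. 0 < s \<Longrightarrow> s < s0 \<Longrightarrow> \<alpha> * ln (1 + s * u) + \<beta> * ln (1 + s * v) \<le> 0"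
  shows "\<alpha> * u + \<beta> * v \<le> 0"
proof (rule ccontr)
  assume "\<not> ?thesis"
  moreover have "((\<lambda>s. \<alpha> * ln (1 + s * u) + \<beta> * ln (1 + s * v)) has_real_derivative \<alpha> * u + \<beta> * v) (at 0)"
    by (auto intro!: derivative_eq_intros)
  ultimately obtain e where e: "e > 0" "\<And>s. 0 < s \<Longrightarrow> s < e \<Longrightarrow>
      \<alpha> * ln (1 + 0 * u) + \<beta> * ln (1 + 0 * v) < \<alpha> * ln (1 + (0 + s) * u) + \<beta> * ln (1 + (0 + s) * v)"
    using DERIV_pos_inc_right[of "\<lambda>s. \<alpha> * ln (1 + s * u) + \<beta> * ln (1 + s * v)"] by force
  define s where "s = min e s0 / 2"
  have "0 < s" "s < e" "s < s0" using e(1) assms(1) by (auto simp: s_def min_def)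
  then show False using e(2)[of s] le[of s] by simp
qed

context bl_datum
begin

text \<open>Entries outside the index ranges are set to 0, which makes this a compact set in the
  product topology.\<close>

definition FD :: "((nat \<Rightarrow> 'a \<Rightarrow>\<^sub>L 'a) \<times> (nat \<Rightarrow> 'b \<Rightarrow>\<^sub>L 'b)) set" where
  "FD = {P. \<forall>i. P i \<in> (if i \<in> {1..k} then kform (E i) else {0})} \<times> {R. \<forall>j. R j \<in> (if j \<in> {1..m} then kform (F j) else {0})}"

lemma FD_iff: "(P, R) \<in> FD \<longleftrightarrow> (\<forall>i\<in>{1..k}. P i \<in> kform (E i)) \<and> (\<forall>i. i \<notin> {1..k} \<longrightarrow> P i = 0) \<and>
    (\<forall>j\<in>{1..m}. R j \<in> kform (F j)) \<and> (\<forall>j. j \<notin> {1..m} \<longrightarrow> R j = 0)"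
proof -
  have *: "(\<forall>i. X i \<in> (if i \<in> A then Y i else {0})) \<longleftrightarrow> (\<forall>i\<in>A. X i \<in> Y i) \<and> (\<forall>i. i \<notin> A \<longrightarrow> X i = 0)"
    for A :: "nat set" and X :: "nat \<Rightarrow> 'c::zero" and Y
    by (metis empty_iff insert_iff)
  show ?thesis unfolding FD_def mem_Times_iff fst_conv snd_conv mem_Collect_eq * conj_assoc ..
qed

lemma compact_FD: "compact FD"
  unfolding FD_def by (intro compact_Times compact_coordinates) (simp_all add: compact_kform)

text \<open>On such a set the Gaussian integrands have a common integrable majorant, so
  \<open>J\<close> is continuous there; the maximization will be confined to one of these
  sets.\<close>

definition Ca :: "real \<Rightarrow> ((nat \<Rightarrow> 'a \<Rightarrow>\<^sub>L 'a) \<times> (nat \<Rightarrow> 'b \<Rightarrow>\<^sub>L 'b)) set" where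
  "Ca a = FD \<inter> {p. (\<forall>x\<in>XE. a * nX x \<le> Q (fst p) (snd p) x x) \<and> (\<forall>j\<in>{1..m}. \<forall>y\<in>F j. a * (y \<bullet> y) \<le> snd p j y \<bullet> y)}"

lemma continuous_on_fst_coord: "continuous_on UNIV (\<lambda>p :: (nat \<Rightarrow> 'c::topological_space) \<times> 'd::topological_space. fst p i)"
  by (rule continuous_on_compose2[OF continuous_on_product_coordinates continuous_on_fst[OF continuous_on_id]]) auto

lemma continuous_on_snd_coord: "continuous_on UNIV (\<lambda>p :: 'd::topological_space \<times> (nat \<Rightarrow> 'c::topological_space). snd p i)"
  by (rule continuous_on_compose2[OF continuous_on_product_coordinates continuous_on_snd[OF continuous_on_id]]) auto

lemma continuous_on_Q: "continuous_on UNIV (\<lambda>p. Q (fst p) (snd p) x y)"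
  unfolding bl_form_def
  by (intro continuous_on_diff continuous_on_sum continuous_on_mult continuous_on_const continuous_on_inner
      bounded_bilinear.continuous_on[OF bounded_bilinear_blinfun_apply] continuous_on_fst_coord continuous_on_snd_coord)

lemma compact_Ca: "compact (Ca a)"
proof -
  have "closed {p :: (nat \<Rightarrow> 'a \<Rightarrow>\<^sub>L 'a) \<times> (nat \<Rightarrow> 'b \<Rightarrow>\<^sub>L 'b). (\<forall>x\<in>XE. a * nX x \<le> Q (fst p) (snd p) x x) \<and> (\<forall>j\<in>{1..m}. \<forall>y\<in>F j. a * (y \<bullet> y) \<le> snd p j y \<bullet> y)}"
    unfolding Ball_def
    by (intro closed_Collect_conj closed_Collect_all closed_Collect_imp open_Collect_const closed_Collect_le continuous_on_const continuous_on_Q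
        continuous_on_inner bounded_bilinear.continuous_on[OF bounded_bilinear_blinfun_apply] continuous_on_snd_coord)
  then show ?thesis unfolding Ca_def by (intro compact_Int_closed compact_FD)
qed

text \<open>Evaluate \<open>Q\<close> at a tuple concentrated in one coordinate and drop the
  nonnegative terms that are subtracted.\<close>

lemma P_lower_of_Q:
  assumes a: "\<And>x. x \<in> XE \<Longrightarrow> a * nX x \<le> Q P R x x" and R: "\<And>j y. j \<in> {1..m} \<Longrightarrow> y \<in> F j \<Longrightarrow> 0 \<le> R j y \<bullet> y"
    and i: "i \<in> {1..k}" and x: "x \<in> E i"
  shows "a * (x \<bullet> x) \<le> c i * (P i x \<bullet> x)"
proof -
  let ?x = "\<lambda>i'. if i' = i then x else 0"
  have xX: "?x \<in> XE" using x E_subspace by (auto simp: XE_def subspace_0)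
  have "nX ?x = x \<bullet> x" unfolding nX_def using i by (simp add: if_distrib[of "\<lambda>z. z \<bullet> z"] if_distrib[of "\<lambda>z. z \<bullet> _"] cong: if_cong)
  moreover have "Q P R ?x ?x \<le> (\<Sum>i'=1..k. c i' * (P i' (?x i') \<bullet> ?x i'))"
    unfolding bl_form_def using R M_in[OF xX] d_pos by (auto intro!: sum_nonneg mult_nonneg_nonneg simp: less_imp_le)
  moreover have "(\<Sum>i'=1..k. c i' * (P i' (?x i') \<bullet> ?x i')) = (\<Sum>i'=1..k. if i' = i then c i * (P i x \<bullet> x) else 0)"
    by (rule sum.cong) auto
  ultimately show ?thesis using a[OF xX] i by simp
qed

lemma Ca_formsD:
  assumes a: "a > 0" and p: "(P, R) \<in> Ca a"
  shows "formsD P R"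
proof -
  have FDp: "\<And>i. i \<in> {1..k} \<Longrightarrow> P i \<in> kform (E i)" "\<And>j. j \<in> {1..m} \<Longrightarrow> R j \<in> kform (F j)"
    and Ql: "\<And>x. x \<in> XE \<Longrightarrow> a * nX x \<le> Q P R x x"
    and Rl: "\<And>j y. j \<in> {1..m} \<Longrightarrow> y \<in> F j \<Longrightarrow> a * (y \<bullet> y) \<le> R j y \<bullet> y"
    using p by (auto simp: Ca_def FD_def split: if_splits)
  have R0: "\<And>j y. j \<in> {1..m} \<Longrightarrow> y \<in> F j \<Longrightarrow> 0 \<le> R j y \<bullet> y"
    using kformD(2)[OF FDp(2)] by blast
  have "posdef_on (E i) (P i)" if i: "i \<in> {1..k}" for i
    unfolding posdef_on_def
  proof (intro conjI ballI impI)
    show "selfadj (P i)" by (rule kformD(1)[OF FDp(1)[OF i]])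
    fix x assume x: "x \<in> E i" "x \<noteq> 0"
    have "0 < a * (x \<bullet> x)" using a x by simp
    also have "\<dots> \<le> c i * (P i x \<bullet> x)" by (rule P_lower_of_Q[OF Ql R0 i x(1)])
    finally show "0 < P i x \<bullet> x" using c_pos[OF i] by (simp add: zero_less_mult_iff)
  qed
  moreover have "posdef_on (F j) (R j)" if j: "j \<in> {1..m}" for j
    unfolding posdef_on_def
  proof (intro conjI ballI impI)
    show "selfadj (R j)" by (rule kformD(1)[OF FDp(2)[OF j]])
    fix x assume x: "x \<in> F j" "x \<noteq> 0"
    have "0 < a * (x \<bullet> x)" using a x by simp
    also have "\<dots> \<le> R j x \<bullet> x" by (rule Rl[OF j x(1)])
    finally show "0 < R j x \<bullet> x" .
  qed
  moreover have "Qpos P R"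
    unfolding Qpos_def sa_def
  proof (intro conjI ballI impI)
    fix x assume "x \<in> XE" "0 < nX x"
    then show "0 < Q P R x x" using Ql[of x] a by (meson less_le_trans mult_pos_pos)
  qed (use kformD(1) FDp in blast)+
  ultimately show ?thesis
    unfolding formsD_def using kformD(3)[OF FDp(1)] kformD(3)[OF FDp(2)] by blast
qed

definition Dom :: "((nat \<Rightarrow> 'a \<Rightarrow>\<^sub>L 'a) \<times> (nat \<Rightarrow> 'b \<Rightarrow>\<^sub>L 'b)) set" where
  "Dom = {p \<in> FD. formsD (fst p) (snd p)}"

definition Phi :: "(nat \<Rightarrow> 'a \<Rightarrow>\<^sub>L 'a) \<Rightarrow> (nat \<Rightarrow> 'b \<Rightarrow>\<^sub>L 'b) \<Rightarrow> real" where
  "Phi P R = (\<Sum>i=1..k. c i * ln (Zg (E i) (P i))) - (\<Sum>j=1..m. d j * ln (Zg (F j) (R j)))"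

text \<open>The factor 2 offsets the square root in \<open>ZQ\<close>: up to a constant, \<mu> times
  the logarithm of the determinant of \<open>Q\<close> is added to \<open>Phi\<close>, which
  penalizes degenerate \<open>Q\<close>.\<close>

definition J :: "real \<Rightarrow> (nat \<Rightarrow> 'a \<Rightarrow>\<^sub>L 'a) \<Rightarrow> (nat \<Rightarrow> 'b \<Rightarrow>\<^sub>L 'b) \<Rightarrow> real" where
  "J \<mu> P R = Phi P R - 2 * \<mu> * ln (ZQ P R)"

lemma Ca_Dom: "a > 0 \<Longrightarrow> Ca a \<subseteq> Dom"
  using Ca_formsD by (auto simp: Dom_def Ca_def)

lemma ZQ_tendsto:
  assumes a: "a > 0" and u: "\<And>n. u n \<in> Ca a" and lim: "u \<longlonglongrightarrow> p" and p: "p \<in> Ca a"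
  shows "(\<lambda>n. ZQ (fst (u n)) (snd (u n))) \<longlonglongrightarrow> ZQ (fst p) (snd p)"
proof -
  have l: "(\<lambda>n. Q (fst (u n)) (snd (u n)) x y) \<longlonglongrightarrow> Q (fst p) (snd p) x y" for x y
    using continuous_on_tendsto_compose[OF continuous_on_Q lim] by simp
  have fin: "gint (lbPi IX) (\<lambda>t. a * nX (embX t)) < \<infinity>"
    unfolding gint_nX[OF a] by simp
  have [measurable]: "(\<lambda>t. a * nX (embX t)) \<in> borel_measurable (lbPi IX)"
    unfolding nX_def by measurable
  have "(\<lambda>n. gint (lbPi IX) (\<lambda>t. Q (fst (u n)) (snd (u n)) (embX t) (embX t)))
      \<longlonglongrightarrow> gint (lbPi IX) (\<lambda>t. Q (fst p) (snd p) (embX t) (embX t))"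
    by (rule gint_tendsto[OF _ _ _ l _ fin]) (use u embX_in in \<open>auto simp: Ca_def\<close>)
  moreover have "gint (lbPi IX) (\<lambda>t. Q (fst p) (snd p) (embX t) (embX t)) < \<infinity>"
    using Ca_formsD[OF a, of "fst p" "snd p"] p by (simp add: gint_ZQ)
  ultimately show ?thesis
    unfolding ZQ_def by (intro tendsto_enn2real) auto
qed

lemma continuous_on_J:
  assumes a: "a > 0"
  shows "continuous_on (Ca a) (\<lambda>p. J \<mu> (fst p) (snd p))"
  unfolding continuous_on_sequentially
proof (intro ballI allI impI)
  fix u p assume p: "p \<in> Ca a" and u': "(\<forall>n. u n \<in> Ca a) \<and> u \<longlonglongrightarrow> p"
  then have u: "\<And>n. u n \<in> Ca a" and lim: "u \<longlonglongrightarrow> p" by auto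
  have D: "formsD (fst p) (snd p)" "\<And>n. formsD (fst (u n)) (snd (u n))"
    using Ca_formsD[OF a] p u by auto
  have kf: "\<And>j y. j \<in> {1..m} \<Longrightarrow> y \<in> F j \<Longrightarrow> 0 \<le> snd (u n) j y \<bullet> y" for n
    using posdef_on_nonneg[OF formsD_D(3)[OF D(2)]] by blast
  have "(\<lambda>n. J \<mu> (fst (u n)) (snd (u n))) \<longlonglongrightarrow> J \<mu> (fst p) (snd p)"
    unfolding J_def Phi_def
  proof (intro tendsto_diff tendsto_sum tendsto_mult tendsto_const tendsto_ln)
    show "(\<lambda>n. ZQ (fst (u n)) (snd (u n))) \<longlonglongrightarrow> ZQ (fst p) (snd p)"
      by (rule ZQ_tendsto[OF a u lim p])
    show "ZQ (fst p) (snd p) \<noteq> 0" using ZQ_pos[OF D(1)] by simp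
  next
    fix i assume i: "i \<in> {1..k}"
    have "(\<lambda>n. fst (u n) i) \<longlonglongrightarrow> fst p i"
      using continuous_on_tendsto_compose[OF continuous_on_fst_coord lim] by simp
    then show "(\<lambda>n. Zg (E i) (fst (u n) i)) \<longlonglongrightarrow> Zg (E i) (fst p i)"
    proof (rule Zg_tendsto[OF E_subspace[OF i]])
      show "0 < a / c i" using a c_pos[OF i] by simp
      fix n x assume x: "x \<in> E i"
      have "a * (x \<bullet> x) \<le> c i * (fst (u n) i x \<bullet> x)"
        by (rule P_lower_of_Q[OF _ kf i x]) (use u[of n] in \<open>auto simp: Ca_def\<close>)
      then show "a / c i * (x \<bullet> x) \<le> fst (u n) i x \<bullet> x"
        using c_pos[OF i] by (simp add: field_simps)
    qed
    show "Zg (E i) (fst p i) \<noteq> 0"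
      using Zg_pos[OF E_subspace[OF i] formsD_D(1)[OF D(1) i]] by simp
  next
    fix j assume j: "j \<in> {1..m}"
    have "(\<lambda>n. snd (u n) j) \<longlonglongrightarrow> snd p j"
      using continuous_on_tendsto_compose[OF continuous_on_snd_coord lim] by simp
    then show "(\<lambda>n. Zg (F j) (snd (u n) j)) \<longlonglongrightarrow> Zg (F j) (snd p j)"
      by (rule Zg_tendsto[OF F_subspace[OF j] _ a]) (use u j in \<open>auto simp: Ca_def\<close>)
    show "Zg (F j) (snd p j) \<noteq> 0"
      using Zg_pos[OF F_subspace[OF j] formsD_D(3)[OF D(1) j]] by simp
  qed
  then show "((\<lambda>p. J \<mu> (fst p) (snd p)) \<circ> u) \<longlonglongrightarrow> J \<mu> (fst p) (snd p)" by (simp add: o_def)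
qed

lemma ln_sqrt_power: "x > 0 \<Longrightarrow> ln (sqrt x ^ n) = real n / 2 * ln x"
  by (simp add: ln_realpow ln_sqrt)

text \<open>A bound on \<open>ln (ZQ P R)\<close> bounds \<open>Q\<close> from below, hence each
  \<open>P i\<close>, hence each \<open>Zg (E i) (P i)\<close> from above. The value of
  \<open>J\<close> then bounds the sum of the \<open>d j * ln (Zg (F j) (R j))\<close> from above,
  and \<open>Zg_lower_form\<close> bounds the \<open>R j\<close> from below. The slope
  \<open>A2\<close> is fixed before \<open>J0\<close> because it enters the choice of the
  near-maximizer that later determines \<open>J0\<close>.\<close>

lemma forms_lower_bound:
  "\<exists>A2\<ge>0. \<forall>J0. \<exists>A1\<ge>0. \<forall>\<mu> P R. 0 < \<mu> \<longrightarrow> \<mu> \<le> 1 \<longrightarrow> formsD P R \<longrightarrow> J0 \<le> J \<mu> P R \<longrightarrow>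
    (\<forall>x\<in>XE. exp (- (A1 + A2 * \<bar>ln (ZQ P R)\<bar>)) * nX x \<le> Q P R x x) \<and>
    (\<forall>i\<in>{1..k}. \<forall>x\<in>E i. exp (- (A1 + A2 * \<bar>ln (ZQ P R)\<bar>)) * (x \<bullet> x) \<le> P i x \<bullet> x) \<and>
    (\<forall>j\<in>{1..m}. \<forall>y\<in>F j. exp (- (A1 + A2 * \<bar>ln (ZQ P R)\<bar>)) * (y \<bullet> y) \<le> R j y \<bullet> y)"
proof -
  define K where "K = (2 * pi / (cmax + 1)) ^ card IX"
  have K: "K > 0" using cmax(2) by (simp add: K_def)
  define D' where "D' = (\<Sum>j=1..m. 1 / d j)"
  have D'0: "0 \<le> D'" unfolding D'_def using d_pos by (intro sum_nonneg) (auto simp: less_imp_le)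
  have D': "1 / d j \<le> D'" if "j \<in> {1..m}" for j
    unfolding D'_def using that d_pos by (intro member_le_sum) (auto simp: less_imp_le)
  define S0 where "S0 = (\<Sum>i=1..k. c i * real (dim (E i)))"
  have S0: "0 \<le> S0" unfolding S0_def using c_pos by (intro sum_nonneg mult_nonneg_nonneg) (auto simp: less_imp_le)
  define y0 where "y0 = ln (2 * pi) + \<bar>ln K\<bar> + ln cmax"
  have pi1: "1 \<le> 2 * pi" "1 \<le> pi" using pi_gt3 by auto
  have lnc: "0 \<le> ln cmax" "0 \<le> ln (2 * pi)" using cmax(2) pi1 by auto
  have y0: "0 \<le> y0" using lnc by (simp add: y0_def)
  show ?thesis
  proof (rule exI[of _ "2 + 2 * D' * (S0 + 2)"], intro conjI allI)
    show "0 \<le> 2 + 2 * D' * (S0 + 2)" using D'0 S0 by simp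
    fix J0
    let ?A1 = "\<bar>ln K\<bar> + ln cmax + 2 * D' * (S0 / 2 * y0 + \<bar>J0\<bar>)" and ?A2 = "2 + 2 * D' * (S0 + 2)"
    have parts: "0 \<le> 2 * D' * (S0 / 2 * y0 + \<bar>J0\<bar>)" using D'0 S0 y0 by simp
    show "\<exists>A1\<ge>0. \<forall>\<mu> P R. 0 < \<mu> \<longrightarrow> \<mu> \<le> 1 \<longrightarrow> formsD P R \<longrightarrow> J0 \<le> J \<mu> P R \<longrightarrow>
      (\<forall>x\<in>XE. exp (- (A1 + ?A2 * \<bar>ln (ZQ P R)\<bar>)) * nX x \<le> Q P R x x) \<and>
      (\<forall>i\<in>{1..k}. \<forall>x\<in>E i. exp (- (A1 + ?A2 * \<bar>ln (ZQ P R)\<bar>)) * (x \<bullet> x) \<le> P i x \<bullet> x) \<and>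
      (\<forall>j\<in>{1..m}. \<forall>y\<in>F j. exp (- (A1 + ?A2 * \<bar>ln (ZQ P R)\<bar>)) * (y \<bullet> y) \<le> R j y \<bullet> y)"
    proof (rule exI[of _ ?A1], rule conjI, use parts lnc in simp, intro allI impI)
      fix \<mu> P R assume \<mu>: "0 < \<mu>" "\<mu> \<le> (1::real)" and D: "formsD P R" and J0: "J0 \<le> J \<mu> P R"
      define z where "z = ln (ZQ P R)"
      have ZQz: "ZQ P R = exp z" using ZQ_pos[OF D] by (simp add: z_def)
      let ?a = "exp (- (?A1 + ?A2 * \<bar>z\<bar>))"
      have big: "0 \<le> 2 * D' * (S0 + 2) * \<bar>z\<bar>" using D'0 S0 by simp
      have Q1: "exp (ln K - 2 * z) * nX x \<le> Q P R x x" if "x \<in> XE" for x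
      proof -
        have "K * nX x \<le> (exp z)\<^sup>2 * Q P R x x"
          using ZQ_lower_form[OF D that] by (simp add: K_def ZQz)
        moreover have "exp (ln K - 2 * z) = K / (exp z)\<^sup>2"
          using K by (simp add: exp_diff exp_double)
        moreover have "K * nX x / (exp z)\<^sup>2 \<le> Q P R x x \<longleftrightarrow> K * nX x \<le> (exp z)\<^sup>2 * Q P R x x"
          by (simp add: pos_divide_le_eq mult.commute)
        ultimately show ?thesis by simp
      qed
      have le1: "?a \<le> exp (ln K - 2 * z - ln cmax)" and le2: "exp (ln K - 2 * z - ln cmax) \<le> exp (ln K - 2 * z)"
        using parts lnc big by (auto simp: abs_if algebra_simps)
      have P1: "exp (ln K - 2 * z - ln cmax) * (x \<bullet> x) \<le> P i x \<bullet> x" if i: "i \<in> {1..k}" and x: "x \<in> E i" for i x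
      proof -
        have "exp (ln K - 2 * z) * (x \<bullet> x) \<le> c i * (P i x \<bullet> x)"
          by (rule P_lower_of_Q[OF Q1 posdef_on_nonneg[OF formsD_D(3)[OF D]] i x])
        also have "\<dots> \<le> cmax * (P i x \<bullet> x)"
          by (intro mult_right_mono cmax(1) i posdef_on_nonneg[OF formsD_D(1)[OF D i] x])
        finally have "exp (ln K - 2 * z) * (x \<bullet> x) / cmax \<le> P i x \<bullet> x" using cmax(2) by (simp add: field_simps)
        moreover have "exp (ln K - 2 * z - ln cmax) = exp (ln K - 2 * z) / cmax"
          using cmax(2) by (simp add: exp_diff)
        ultimately show ?thesis by simp
      qed
      have ZP: "ln (Zg (E i) (P i)) \<le> real (dim (E i)) / 2 * (y0 + 2 * \<bar>z\<bar>)" if i: "i \<in> {1..k}" for i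
      proof -
        have "Zg (E i) (P i) \<le> sqrt (2 * pi / exp (ln K - 2 * z - ln cmax)) ^ dim (E i)"
          by (rule Zg_upper[OF E_subspace[OF i] formsD_D(1)[OF D i] _ P1[OF i]]) auto
        then have "ln (Zg (E i) (P i)) \<le> ln (sqrt (2 * pi / exp (ln K - 2 * z - ln cmax)) ^ dim (E i))"
          using Zg_pos[OF E_subspace[OF i] formsD_D(1)[OF D i]] by (intro ln_mono) auto
        also have "\<dots> = real (dim (E i)) / 2 * (ln (2 * pi) - (ln K - 2 * z - ln cmax))"
          by (subst ln_sqrt_power) (simp_all add: ln_div)
        also have "\<dots> \<le> real (dim (E i)) / 2 * (y0 + 2 * \<bar>z\<bar>)"
          by (intro mult_left_mono) (auto simp: y0_def abs_if)
        finally show ?thesis .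
      qed
      define W where "W = S0 / 2 * (y0 + 2 * \<bar>z\<bar>) + 2 * \<bar>z\<bar> + \<bar>J0\<bar>"
      have W0: "0 \<le> W" using S0 y0 by (simp add: W_def)
      have "(\<Sum>j=1..m. d j * ln (Zg (F j) (R j))) = (\<Sum>i=1..k. c i * ln (Zg (E i) (P i))) - 2 * \<mu> * z - J \<mu> P R"
        by (simp add: J_def Phi_def z_def)
      also have "\<dots> \<le> (\<Sum>i=1..k. c i * (real (dim (E i)) / 2 * (y0 + 2 * \<bar>z\<bar>))) + 2 * \<bar>z\<bar> + \<bar>J0\<bar>"
      proof -
        have "(\<Sum>i=1..k. c i * ln (Zg (E i) (P i))) \<le> (\<Sum>i=1..k. c i * (real (dim (E i)) / 2 * (y0 + 2 * \<bar>z\<bar>)))"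
          by (intro sum_mono mult_left_mono ZP less_imp_le[OF c_pos])
        moreover have "- 2 * \<mu> * z \<le> 2 * \<bar>z\<bar>"
        proof -
          have "- (\<mu> * z) \<le> \<mu> * \<bar>z\<bar>" using \<mu> by (simp add: abs_if mult_left_mono)
          also have "\<dots> \<le> 1 * \<bar>z\<bar>" using \<mu> by (intro mult_right_mono) auto
          finally show ?thesis by simp
        qed
        ultimately show ?thesis using J0 by linarith
      qed
      also have "(\<Sum>i=1..k. c i * (real (dim (E i)) / 2 * (y0 + 2 * \<bar>z\<bar>))) = S0 / 2 * (y0 + 2 * \<bar>z\<bar>)"
        unfolding S0_def sum_divide_distrib sum_distrib_right by (intro sum.cong) auto
      finally have WS: "(\<Sum>j=1..m. d j * ln (Zg (F j) (R j))) \<le> W" by (simp add: W_def)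
      \<comment> \<open>Since \<open>R j\<close> is below the identity and
        \<open>2 * pi \<ge> 1\<close>, no summand is negative, so the bound on the sum bounds each
        single summand.\<close>
      have ZR0: "0 \<le> ln (Zg (F j) (R j))" if j: "j \<in> {1..m}" for j
      proof -
        have "sqrt (2 * pi / 1) ^ dim (F j) \<le> Zg (F j) (R j)"
          by (rule Zg_lower[OF F_subspace[OF j] formsD_D(3)[OF D j]]) (use formsD_D(4)[OF D j] in auto)
        moreover have "1 \<le> sqrt (2 * pi / 1) ^ dim (F j)" using pi1 by (intro one_le_power) auto
        ultimately show ?thesis by (intro ln_ge_zero) linarith
      qed
      have R1: "?a * (y \<bullet> y) \<le> R j y \<bullet> y" if j: "j \<in> {1..m}" and y: "y \<in> F j" for j y
      proof -
        define l where "l = ln (Zg (F j) (R j))"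
        have Zl: "Zg (F j) (R j) = exp l" using Zg_pos[OF F_subspace[OF j] formsD_D(3)[OF D j]] by (simp add: l_def)
        have "d j * l \<le> (\<Sum>j=1..m. d j * ln (Zg (F j) (R j)))"
          unfolding l_def using j ZR0 d_pos by (intro member_le_sum) (auto simp: less_imp_le)
        with WS have "d j * l \<le> W" by linarith
        then have "l \<le> W * (1 / d j)" using d_pos[OF j] by (simp add: field_simps)
        also have "\<dots> \<le> W * D'" by (intro mult_left_mono D' j W0)
        finally have l: "l \<le> W * D'" .
        have "1 * (y \<bullet> y) \<le> pi ^ dim (F j) * (y \<bullet> y)" using pi1 by (intro mult_right_mono one_le_power) auto
        also have "\<dots> \<le> (exp l)\<^sup>2 * (R j y \<bullet> y)"
          unfolding Zl[symmetric] by (rule Zg_lower_form[OF F_subspace[OF j] formsD_D(3)[OF D j] formsD_D(4)[OF D j] y])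
        finally have "exp (- (2 * l)) * (y \<bullet> y) \<le> exp (- (2 * l)) * ((exp l)\<^sup>2 * (R j y \<bullet> y))"
          by (intro mult_left_mono) auto
        also have "\<dots> = R j y \<bullet> y"
          by (simp add: exp_double[symmetric] mult.assoc[symmetric] exp_add[symmetric])
        finally have "exp (- (2 * l)) * (y \<bullet> y) \<le> R j y \<bullet> y" .
        moreover have "?a \<le> exp (- (2 * l))"
        proof -
          have "2 * l \<le> 2 * D' * W" using l by (simp add: mult.commute)
          also have "\<dots> = 2 * D' * (S0 / 2 * y0 + \<bar>J0\<bar>) + 2 * D' * (S0 + 2) * \<bar>z\<bar>"
            by (simp add: W_def algebra_simps)
          also have "\<dots> \<le> ?A1 + ?A2 * \<bar>z\<bar>" using lnc by (simp add: distrib_right)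
          finally show ?thesis by simp
        qed
        ultimately show ?thesis by (meson inner_ge_zero mult_right_mono order_trans)
      qed
      have "?a * nX x \<le> Q P R x x" if "x \<in> XE" for x
        using Q1[OF that] mult_right_mono[OF order_trans[OF le1 le2] nX_nonneg[of x]] by linarith
      moreover have "?a * (x \<bullet> x) \<le> P i x \<bullet> x" if "i \<in> {1..k}" "x \<in> E i" for i x
        using P1[OF that] mult_right_mono[OF le1 inner_ge_zero[of x]] by linarith
      ultimately show "(\<forall>x\<in>XE. exp (- (?A1 + ?A2 * \<bar>ln (ZQ P R)\<bar>)) * nX x \<le> Q P R x x) \<and>
        (\<forall>i\<in>{1..k}. \<forall>x\<in>E i. exp (- (?A1 + ?A2 * \<bar>ln (ZQ P R)\<bar>)) * (x \<bullet> x) \<le> P i x \<bullet> x) \<and>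
        (\<forall>j\<in>{1..m}. \<forall>y\<in>F j. exp (- (?A1 + ?A2 * \<bar>ln (ZQ P R)\<bar>)) * (y \<bullet> y) \<le> R j y \<bullet> y)"
        using R1 unfolding z_def[symmetric] by blast
    qed
  qed
qed

text \<open>Orthogonal projections for the \<open>P i\<close> and a small multiple \<open>r\<close>
  of projections for the \<open>R j\<close>: the positive part of \<open>Q\<close> is at least
  \<open>cm * nX x\<close>, and \<open>r\<close> is so small that at most half of this is
  subtracted.\<close>

lemma Dom_nonempty: "Dom \<noteq> {}"
proof -
  obtain C where C: "C > 0" "\<And>j x. j \<in> {1..m} \<Longrightarrow> norm (M j x) \<le> C * (\<Sum>i=1..k. norm (x i))"
    using M_bound by blast
  define cm where "cm = 1 / (1 + (\<Sum>i=1..k. 1 / c i))"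
  have s0: "0 \<le> (\<Sum>i=1..k. 1 / c i)" using c_pos by (intro sum_nonneg) (auto simp: less_imp_le)
  then have cm0: "cm > 0" by (simp add: cm_def add_pos_nonneg)
  have cm: "cm \<le> c i" if i: "i \<in> {1..k}" for i
  proof -
    have "1 / c i \<le> (\<Sum>i=1..k. 1 / c i)" using c_pos i by (intro member_le_sum) (auto simp: less_imp_le)
    then have "1 / c i \<le> 1 + (\<Sum>i=1..k. 1 / c i)" by simp
    then have "1 \<le> c i * (1 + (\<Sum>i=1..k. 1 / c i))" using c_pos[OF i] by (simp add: pos_divide_le_eq mult.commute)
    then show ?thesis using s0 by (simp add: cm_def pos_divide_le_eq)
  qed
  define G where "G = 1 + (\<Sum>j=1..m. d j) * (C\<^sup>2 * real k)"
  have d0: "0 \<le> (\<Sum>j=1..m. d j)" using d_pos by (intro sum_nonneg) (auto simp: less_imp_le)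
  then have G: "G \<ge> 1" by (simp add: G_def)
  define r where "r = min 1 (cm / 2 / G)"
  have r: "0 < r" "r \<le> 1" using cm0 G by (auto simp: r_def)
  have rG: "r * G \<le> cm / 2"
  proof -
    have "r * G \<le> (cm / 2 / G) * G" using G by (intro mult_right_mono) (auto simp: r_def)
    then show ?thesis using G by simp
  qed
  define a where "a = min (cm / 2) r"
  have a: "a > 0" using cm0 r by (simp add: a_def)
  define P where "P i = (if i \<in> {1..k} then 1 *\<^sub>R proj_on (E i) else 0)" for i
  define R where "R j = (if j \<in> {1..m} then r *\<^sub>R proj_on (F j) else 0)" for j
  have "(P, R) \<in> FD"
    unfolding FD_def P_def R_def using proj_on_kform[OF E_subspace, of _ 1] proj_on_kform[OF F_subspace, of _ r] r by auto
  moreover have "a * nX x \<le> Q P R x x" if x: "x \<in> XE" for x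
  proof -
    have "(\<Sum>i=1..k. cm * (x i \<bullet> x i)) \<le> (\<Sum>i=1..k. c i * (P i (x i) \<bullet> x i))"
    proof (rule sum_mono)
      fix i assume i: "i \<in> {1..k}"
      have "P i (x i) = x i" using i proj_on_id[OF E_subspace[OF i]] XE_D[OF x i] by (simp add: P_def)
      then show "cm * (x i \<bullet> x i) \<le> c i * (P i (x i) \<bullet> x i)" using cm[OF i] by (simp add: mult_right_mono)
    qed
    moreover have "(\<Sum>j=1..m. d j * (R j (M j x) \<bullet> M j x)) \<le> (\<Sum>j=1..m. d j * (r * (C\<^sup>2 * real k * nX x)))"
    proof (intro sum_mono mult_left_mono less_imp_le[OF d_pos])
      fix j assume j: "j \<in> {1..m}"
      have "R j (M j x) = r *\<^sub>R M j x"
        using j proj_on_id[OF F_subspace[OF j]] M_in[OF x j] by (simp add: R_def blinfun.scaleR_left)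
      then have "R j (M j x) \<bullet> M j x = r * (norm (M j x))\<^sup>2" by (simp add: dot_square_norm)
      also have "\<dots> \<le> r * (C * (\<Sum>i=1..k. norm (x i)))\<^sup>2"
        using C(2)[OF j] r by (intro mult_left_mono power_mono) auto
      also have "\<dots> \<le> r * (C\<^sup>2 * real k * nX x)"
      proof -
        have "(\<Sum>i=1..k. norm (x i))\<^sup>2 \<le> real k * nX x"
          using sum_squared_le_sum_of_squares[of "\<lambda>i. norm (x i)" "{1..k}"] by (simp add: nX_def dot_square_norm mult.commute)
        then have "C\<^sup>2 * (\<Sum>i=1..k. norm (x i))\<^sup>2 \<le> C\<^sup>2 * (real k * nX x)" by (intro mult_left_mono) auto
        then show ?thesis using r by (simp add: power_mult_distrib mult.assoc)
      qed
      finally show "R j (M j x) \<bullet> M j x \<le> r * (C\<^sup>2 * real k * nX x)" .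
    qed
    moreover have "(\<Sum>j=1..m. d j * (r * (C\<^sup>2 * real k * nX x))) = r * (G - 1) * nX x"
      unfolding sum_distrib_right[symmetric] by (simp add: G_def)
    moreover have "r * (G - 1) * nX x \<le> cm / 2 * nX x"
    proof (rule mult_right_mono[OF _ nX_nonneg])
      have "r * (G - 1) \<le> r * G" using r by simp
      with rG show "r * (G - 1) \<le> cm / 2" by linarith
    qed
    moreover have "(\<Sum>i=1..k. cm * (x i \<bullet> x i)) = cm * nX x" by (simp add: nX_def sum_distrib_left)
    moreover have "a * nX x \<le> cm / 2 * nX x" by (intro mult_right_mono nX_nonneg) (simp add: a_def)
    ultimately show ?thesis unfolding bl_form_def by linarith
  qed
  moreover have "a * (y \<bullet> y) \<le> R j y \<bullet> y" if j: "j \<in> {1..m}" and y: "y \<in> F j" for j y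
  proof -
    have "R j y = r *\<^sub>R y" using j proj_on_id[OF F_subspace[OF j]] y by (simp add: R_def blinfun.scaleR_left)
    moreover have "a \<le> r" by (simp add: a_def)
    ultimately show ?thesis by (simp add: mult_right_mono)
  qed
  ultimately have "(P, R) \<in> Ca a" by (auto simp: Ca_def)
  then show ?thesis using Ca_Dom[OF a] by blast
qed

text \<open>The bound \<open>Phi P R \<le> D\<close> turns a lower bound for \<open>J\<close> into
  an upper bound for \<open>ln (ZQ P R)\<close>, and \<open>ZQ_lower\<close> bounds it from below.
  By \<open>forms_lower_bound\<close> a superlevel set of \<open>J\<close> then lies in a compact
  \<open>Ca a\<close>, where \<open>J\<close> is continuous.\<close>

lemma J_max_exists:
  assumes adm: "\<And>P R. formsD P R \<Longrightarrow> Phi P R \<le> D" and \<mu>: "0 < \<mu>" "\<mu> \<le> 1" and p0: "p0 \<in> Dom"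
  shows "\<exists>p\<in>Dom. \<forall>q\<in>Dom. J \<mu> (fst q) (snd q) \<le> J \<mu> (fst p) (snd p)"
proof -
  define J0 where "J0 = J \<mu> (fst p0) (snd p0)"
  obtain A2 A1 where A2: "0 \<le> A2" and A1: "0 \<le> A1" and low: "\<And>P R. formsD P R \<Longrightarrow> J0 \<le> J \<mu> P R \<Longrightarrow>
    (\<forall>x\<in>XE. exp (- (A1 + A2 * \<bar>ln (ZQ P R)\<bar>)) * nX x \<le> Q P R x x) \<and>
    (\<forall>j\<in>{1..m}. \<forall>y\<in>F j. exp (- (A1 + A2 * \<bar>ln (ZQ P R)\<bar>)) * (y \<bullet> y) \<le> R j y \<bullet> y)"
    using forms_lower_bound \<mu> by metis
  define L where "L = \<bar>D - J0\<bar> / (2 * \<mu>) + \<bar>ln (sqrt (2 * pi / cmax) ^ card IX)\<bar>"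
  define a where "a = exp (- (A1 + A2 * L))"
  have a: "a > 0" by (simp add: a_def)
  have sup: "q \<in> Ca a" if q: "q \<in> Dom" and J: "J0 \<le> J \<mu> (fst q) (snd q)" for q
  proof -
    have D: "formsD (fst q) (snd q)" using q by (simp add: Dom_def)
    have "\<bar>ln (ZQ (fst q) (snd q))\<bar> \<le> L"
    proof -
      have "2 * \<mu> * ln (ZQ (fst q) (snd q)) \<le> D - J0"
        using J adm[OF D] by (simp add: J_def)
      then have "ln (ZQ (fst q) (snd q)) \<le> (D - J0) / (2 * \<mu>)" using \<mu> by (simp add: field_simps)
      also have "\<dots> \<le> \<bar>D - J0\<bar> / (2 * \<mu>)" using \<mu> by (intro divide_right_mono) auto
      finally have 1: "ln (ZQ (fst q) (snd q)) \<le> L" unfolding L_def by linarith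
      have "ln (sqrt (2 * pi / cmax) ^ card IX) \<le> ln (ZQ (fst q) (snd q))"
        using ZQ_lower[OF D] cmax(2) by (intro ln_mono) auto
      moreover have "0 \<le> \<bar>D - J0\<bar> / (2 * \<mu>)" using \<mu> by simp
      ultimately have "- L \<le> ln (ZQ (fst q) (snd q))" unfolding L_def by linarith
      with 1 show ?thesis by (simp add: abs_le_iff)
    qed
    then have "A2 * \<bar>ln (ZQ (fst q) (snd q))\<bar> \<le> A2 * L" using A2 by (rule mult_left_mono)
    then have le: "a \<le> exp (- (A1 + A2 * \<bar>ln (ZQ (fst q) (snd q))\<bar>))" by (simp add: a_def)
    have "a * nX x \<le> Q (fst q) (snd q) x x" if "x \<in> XE" for x
      using low[OF D J] that mult_right_mono[OF le nX_nonneg[of x]] by fastforce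
    moreover have "a * (y \<bullet> y) \<le> snd q j y \<bullet> y" if "j \<in> {1..m}" "y \<in> F j" for j y
      using low[OF D J] that mult_right_mono[OF le inner_ge_zero[of y]] by fastforce
    ultimately show ?thesis using q by (auto simp: Ca_def Dom_def)
  qed
  have p0C: "p0 \<in> Ca a" by (rule sup[OF p0]) (simp add: J0_def)
  then have "\<exists>p\<in>Ca a. \<forall>q\<in>Ca a. J \<mu> (fst q) (snd q) \<le> J \<mu> (fst p) (snd p)"
    by (intro continuous_attains_sup compact_Ca continuous_on_J a) auto
  then obtain p where p: "p \<in> Ca a" and max: "\<And>q. q \<in> Ca a \<Longrightarrow> J \<mu> (fst q) (snd q) \<le> J \<mu> (fst p) (snd p)" by blast
  have "J \<mu> (fst q) (snd q) \<le> J \<mu> (fst p) (snd p)" if q: "q \<in> Dom" for q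
  proof (cases "J0 \<le> J \<mu> (fst q) (snd q)")
    case True
    then show ?thesis by (intro max sup q)
  next
    case False
    then show ?thesis using max[OF p0C] by (simp add: J0_def)
  qed
  then show ?thesis using p Ca_Dom[OF a] by blast
qed

section \<open>Stationarity under rank-one changes\<close>

lemma ZQ_update:
  assumes D: "formsD P R" and D': "formsD P' R'" and p: "p \<in> XE" and s: "1 + s * Q P R p p > 0"
    and upd: "\<And>x. x \<in> XE \<Longrightarrow> Q P' R' x x = Q P R x x + s * (Q P R p x)\<^sup>2"
  shows "ln (ZQ P' R') = ln (ZQ P R) - ln (1 + s * Q P R p p) / 2"
proof -
  have "ennreal (ZQ P' R') = gint (lbPi IX) (\<lambda>t. Q P R (embX t) (embX t) + s * (Q P R p (embX t))\<^sup>2)"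
    unfolding gint_ZQ[OF D', symmetric] by (rule gint_cong) (rule upd[OF embX_in])
  also have "\<dots> = ennreal (1 / sqrt (1 + s * Q P R p p)) * ennreal (ZQ P R)"
    unfolding gint_ZQ[OF D, symmetric] by (rule gint_Q_rank_one[OF formsD_D(5)[OF D] p s])
  also have "\<dots> = ennreal (ZQ P R / sqrt (1 + s * Q P R p p))"
    using ZQ_pos[OF D] s by (simp add: ennreal_mult[symmetric])
  finally have "ZQ P' R' = ZQ P R / sqrt (1 + s * Q P R p p)"
    using ZQ_pos[OF D] ZQ_pos[OF D'] s by simp
  then show ?thesis using ZQ_pos[OF D] s by (simp add: ln_div ln_sqrt)
qed

end

text \<open>In the direction \<open>P y\<close> the vector required by the determinant lemma is
  \<open>y\<close> itself, so no inverse is involved. Cauchy-Schwarz keeps the lowered form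
  nonnegative on the ambient space.\<close>

lemma kform_rank_one_down:
  fixes P :: "'a::euclidean_space \<Rightarrow>\<^sub>L 'a"
  assumes S: "subspace S" and P: "P \<in> kform S" and pd: "posdef_on S P" and y: "y \<in> S" and s: "0 < s" "s * (P y \<bullet> y) < 1"
  shows "P - s *\<^sub>R rk1 (P y) \<in> kform S" "posdef_on S (P - s *\<^sub>R rk1 (P y))"
    "ln (Zg S (P - s *\<^sub>R rk1 (P y))) = ln (Zg S P) - ln (1 - s * (P y \<bullet> y)) / 2"
    "(P - s *\<^sub>R rk1 (P y)) x \<bullet> z = P x \<bullet> z - s * (P y \<bullet> x) * (P y \<bullet> z)"
proof -
  have form: "(P - s *\<^sub>R rk1 (P y)) x \<bullet> z = P x \<bullet> z - s * (P y \<bullet> x) * (P y \<bullet> z)" for x z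
    using rk1_form[of P "- s" "P y" x z] by simp
  show "(P - s *\<^sub>R rk1 (P y)) x \<bullet> z = P x \<bullet> z - s * (P y \<bullet> x) * (P y \<bullet> z)" by (rule form)
  have Z: "posdef_on S (P + (- s) *\<^sub>R rk1 (P y))" "Zg S (P + (- s) *\<^sub>R rk1 (P y)) = Zg S P / sqrt (1 + (- s) * (P y \<bullet> y))"
    using Zg_rank_one[OF S pd y, of "- s" "P y"] s by auto
  then show pd': "posdef_on S (P - s *\<^sub>R rk1 (P y))" by simp
  show "ln (Zg S (P - s *\<^sub>R rk1 (P y))) = ln (Zg S P) - ln (1 - s * (P y \<bullet> y)) / 2"
    using Z(2) Zg_pos[OF S pd] s by (simp add: ln_div ln_sqrt)
  show "P - s *\<^sub>R rk1 (P y) \<in> kform S"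
    unfolding kform_def mem_Collect_eq form
  proof (intro conjI allI impI)
    show "selfadj (P - s *\<^sub>R rk1 (P y))" by (rule posdef_onD(1)[OF pd'])
    fix x
    have "(P y \<bullet> x)\<^sup>2 \<le> (P y \<bullet> y) * (P x \<bullet> x)"
      by (rule psd_cauchy_schwarz) (use kformD[OF P] in auto)
    then have "s * (P y \<bullet> x)\<^sup>2 \<le> s * ((P y \<bullet> y) * (P x \<bullet> x))" using s by (intro mult_left_mono) auto
    also have "\<dots> = (s * (P y \<bullet> y)) * (P x \<bullet> x)" by simp
    also have "\<dots> \<le> 1 * (P x \<bullet> x)" using s kformD(2)[OF P] by (intro mult_right_mono) auto
    finally show "0 \<le> P x \<bullet> x - s * (P y \<bullet> x) * (P y \<bullet> x)" by (simp add: power2_eq_square mult.assoc)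
    have "0 \<le> s * (P y \<bullet> x) * (P y \<bullet> x)" using s by (simp add: mult.assoc)
    then show "P x \<bullet> x - s * (P y \<bullet> x) * (P y \<bullet> x) \<le> x \<bullet> x" using kformD(3)[OF P, of x] by linarith
  next
    fix x assume "\<forall>y\<in>S. x \<bullet> y = 0"
    then have Px: "P x = 0" using kformD(4)[OF P] by blast
    have "P y \<bullet> x = P x \<bullet> y" by (rule selfadjD[OF kformD(1)[OF P]])
    then show "(P - s *\<^sub>R rk1 (P y)) x = 0"
      using Px by (simp add: blinfun.diff_left blinfun.scaleR_left rk1.rep_eq)
  qed
qed

context bl_datum
begin

text \<open>The Riesz representation of a functional with respect to \<open>Q\<close>, whose squared
  norm is read off from the expansion in the \<xi>. Linearity is asked only for combinations of the
  \<xi>, and \<open>fc\<close> transfers it to arbitrary points of \<open>XE\<close>.\<close>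

lemma Q_dual_vector:
  assumes s: "sa P R" and \<xi>: "\<And>l. l \<in> IX \<Longrightarrow> \<xi> l \<in> XE"
    and ex: "\<And>x i. x \<in> XE \<Longrightarrow> i \<in> {1..k} \<Longrightarrow> x i = (\<Sum>l\<in>IX. Q P R x (\<xi> l) *\<^sub>R \<xi> l i)"
    and f: "\<And>a L. finite L \<Longrightarrow> f (\<lambda>i. \<Sum>l\<in>L. a l *\<^sub>R \<xi> l i) = (\<Sum>l\<in>L. a l * f (\<xi> l))"
    and fc: "\<And>x y. (\<And>i. i \<in> {1..k} \<Longrightarrow> x i = y i) \<Longrightarrow> f x = f y"
  shows "\<exists>p\<in>XE. (\<forall>x\<in>XE. Q P R p x = f x) \<and> Q P R p p = (\<Sum>l\<in>IX. (f (\<xi> l))\<^sup>2)"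
proof -
  define p where "p = (\<lambda>i. \<Sum>l\<in>IX. f (\<xi> l) *\<^sub>R \<xi> l i)"
  have p: "p \<in> XE" unfolding XE_def p_def mem_Collect_eq
    by (intro ballI subspace_sum subspace_scale E_subspace XE_D[OF \<xi>])
  have Qsum: "Q P R (\<lambda>i. \<Sum>l\<in>L. a l *\<^sub>R \<xi> l i) x = (\<Sum>l\<in>L. a l * Q P R (\<xi> l) x)" if "finite L" for L a x
    using that
  proof induction
    case empty
    show ?case using Q_lin[of P R 1 "\<lambda>_. 0" "\<lambda>_. 0" x] by simp
  next
    case (insert l L)
    then show ?case using Q_lin[of P R "a l" "\<xi> l" "\<lambda>i. \<Sum>l\<in>L. a l *\<^sub>R \<xi> l i" x] by simp
  qed
  have Qp: "Q P R p x = f x" if x: "x \<in> XE" for x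
  proof -
    have "Q P R p x = (\<Sum>l\<in>IX. Q P R x (\<xi> l) * f (\<xi> l))"
      unfolding p_def Qsum[OF finite_IX] by (intro sum.cong) (simp_all add: Q_commute[OF s, of _ x])
    also have "\<dots> = f (\<lambda>i. \<Sum>l\<in>IX. Q P R x (\<xi> l) *\<^sub>R \<xi> l i)" by (rule f[OF finite_IX, symmetric])
    also have "\<dots> = f x" by (rule fc) (use ex[OF x] in auto)
    finally show ?thesis .
  qed
  moreover have "Q P R p p = (\<Sum>l\<in>IX. (f (\<xi> l))\<^sup>2)"
    unfolding Qp[OF p] unfolding p_def f[OF finite_IX] by (simp add: power2_eq_square)
  ultimately show ?thesis using p by blast
qed

lemma M_sum:
  assumes j: "j \<in> {1..m}" and "finite L"
  shows "M j (\<lambda>i. \<Sum>l\<in>L. a l *\<^sub>R \<xi> l i) = (\<Sum>l\<in>L. a l *\<^sub>R M j (\<xi> l))"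
  using assms(2)
proof induction
  case empty
  show ?case using M_scale[OF j, of 0 "\<lambda>_. 0"] by simp
next
  case (insert l L)
  then show ?case using M_add[OF j, of "\<lambda>i. a l *\<^sub>R \<xi> l i" "\<lambda>i. \<Sum>l\<in>L. a l *\<^sub>R \<xi> l i"] M_scale[OF j, of "a l" "\<xi> l"] by simp
qed

text \<open>Lowering \<open>P i\<close> by \<open>r\<close> times the rank-one form of
  \<open>P i y\<close> lowers \<open>Q\<close> by a rank-one form as well, and the change of both
  Gaussian integrals is known exactly. Comparing first orders at \<open>r = 0\<close> gives one
  inequality for each \<open>y\<close>. Lowering \<open>R j\<close> raises \<open>Q\<close>, so
  there the inequality comes out reversed.\<close>

lemma J_max_stationary:
  assumes \<mu>: "0 < \<mu>" and p: "(P, R) \<in> Dom" and max: "\<And>P' R'. (P', R') \<in> Dom \<Longrightarrow> J \<mu> P' R' \<le> J \<mu> P R"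
  shows "\<exists>\<xi>. (\<forall>l\<in>IX. \<xi> l \<in> XE \<and> Q P R (\<xi> l) (\<xi> l) = 2 * \<mu>) \<and>
     (\<forall>i\<in>{1..k}. \<forall>y\<in>E i. P i y \<bullet> y \<le> (\<Sum>l\<in>IX. (P i y \<bullet> \<xi> l i)\<^sup>2)) \<and>
     (\<forall>j\<in>{1..m}. \<forall>y\<in>F j. (\<Sum>l\<in>IX. (R j y \<bullet> M j (\<xi> l))\<^sup>2) \<le> R j y \<bullet> y)"
proof -
  have FD: "(P, R) \<in> FD" and D: "formsD P R" using p by (auto simp: Dom_def)
  have kP: "P i \<in> kform (E i)" if "i \<in> {1..k}" for i using FD that by (auto simp: FD_def split: if_splits)
  have kR: "R j \<in> kform (F j)" if "j \<in> {1..m}" for j using FD that by (auto simp: FD_def split: if_splits)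
  note Qp = formsD_D(5)[OF D] and s = formsD_D(6)[OF D]
  obtain \<eta> where \<eta>: "\<And>l. l \<in> IX \<Longrightarrow> \<eta> l \<in> XE" "\<And>l. l \<in> IX \<Longrightarrow> Q P R (\<eta> l) (\<eta> l) = 1"
    and ex: "\<And>x i. x \<in> XE \<Longrightarrow> i \<in> {1..k} \<Longrightarrow> x i = (\<Sum>l\<in>IX. Q P R x (\<eta> l) *\<^sub>R \<eta> l i)"
    using Q_orthonormal_basis[OF Qp] by blast
  have KE: "P i y \<bullet> y \<le> 2 * \<mu> * (\<Sum>l\<in>IX. (P i y \<bullet> \<eta> l i)\<^sup>2)" if i: "i \<in> {1..k}" and y: "y \<in> E i" for i y
  proof -
    have "\<exists>p\<in>XE. (\<forall>x\<in>XE. Q P R p x = P i y \<bullet> x i) \<and> Q P R p p = (\<Sum>l\<in>IX. (P i y \<bullet> \<eta> l i)\<^sup>2)"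
    proof (rule Q_dual_vector[OF s \<eta>(1) ex])
      show "P i y \<bullet> x i = P i y \<bullet> z i" if "\<And>i. i \<in> {1..k} \<Longrightarrow> x i = z i" for x z
        using that[OF i] by simp
    qed (simp_all add: inner_sum_right)
    then obtain p where pX: "p \<in> XE" and pQ: "\<And>x. x \<in> XE \<Longrightarrow> Q P R p x = P i y \<bullet> x i"
      and pp: "Q P R p p = (\<Sum>l\<in>IX. (P i y \<bullet> \<eta> l i)\<^sup>2)" by blast
    define u where "u = P i y \<bullet> y"
    define v where "v = c i * Q P R p p"
    have u0: "0 \<le> u" unfolding u_def by (rule kformD(2)[OF kP[OF i]])
    have v0: "0 \<le> v" unfolding v_def using Qpos_nonneg[OF Qp pX] c_pos[OF i] by simp
    \<comment> \<open>For \<open>r\<close> below \<open>s0\<close> both \<open>r * u\<close> and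
      \<open>r * v\<close> are less than 1, which keeps the lowered \<open>P i\<close> and the
      lowered \<open>Q\<close> positive.\<close>
    define s0 where "s0 = 1 / (1 + u + v)"
    have s0: "s0 > 0" using u0 v0 by (simp add: s0_def)
    have "c i / 2 * u \<le> \<mu> * v"
    proof -
      have *: "\<mu> * ln (1 + r * (- v)) + (- c i / 2) * ln (1 + r * (- u)) \<le> 0" if r: "0 < r" "r < s0" for r
      proof -
        have "r * (1 + u + v) < 1" using r u0 v0 by (simp add: s0_def field_simps)
        moreover have "0 \<le> r * u" "0 \<le> r * v" using r u0 v0 by auto
        ultimately have ru: "r * u < 1" and rv: "r * v < 1" using r unfolding distrib_left by linarith+
        define P' where "P' = P(i := P i - r *\<^sub>R rk1 (P i y))"
        note kd = kform_rank_one_down[OF E_subspace[OF i] kP[OF i] formsD_D(1)[OF D i] y r(1) ru[unfolded u_def]]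
        have Q': "Q P' R x x = Q P R x x + (- (r * c i)) * (Q P R p x)\<^sup>2" if x: "x \<in> XE" for x
        proof -
          have "(\<Sum>i'=1..k. c i' * (P' i' (x i') \<bullet> x i')) = (\<Sum>i'=1..k. c i' * (P i' (x i') \<bullet> x i') - (if i' = i then r * c i * (P i y \<bullet> x i)\<^sup>2 else 0))"
            by (rule sum.cong) (auto simp: P'_def kd(4) power2_eq_square right_diff_distrib)
          also have "\<dots> = (\<Sum>i'=1..k. c i' * (P i' (x i') \<bullet> x i')) - r * c i * (P i y \<bullet> x i)\<^sup>2"
            using i by (simp add: sum_subtractf)
          finally show ?thesis unfolding pQ[OF x] by (simp add: bl_form_def)
        qed
        have "Qpos P' R"
          unfolding Qpos_def
        proof (intro conjI ballI impI)
          show "sa P' R" using s posdef_onD(1)[OF kd(2)] by (auto simp: sa_def P'_def)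
          fix x assume x: "x \<in> XE" "0 < nX x"
          have Qx: "0 < Q P R x x" using Qp x by (simp add: Qpos_def)
          have "r * c i * (Q P R p x)\<^sup>2 \<le> r * c i * (Q P R p p * Q P R x x)"
            using r c_pos[OF i] Q_cauchy_schwarz[OF Qp pX x(1)] by (intro mult_left_mono) auto
          also have "\<dots> = (r * v) * Q P R x x" by (simp add: v_def)
          also have "\<dots> < 1 * Q P R x x" using rv Qx by (intro mult_strict_right_mono) auto
          finally show "0 < Q P' R x x" by (simp add: Q'[OF x(1)])
        qed
        then have D': "formsD P' R"
          unfolding formsD_def using formsD_D(1-4)[OF D] kd(2) kformD(3)[OF kd(1)] by (auto simp: P'_def)
        have FD': "(P', R) \<in> FD" using FD kd(1) i unfolding FD_iff P'_def by (metis fun_upd_apply)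
        have "(P', R) \<in> Dom" using FD' D' by (simp add: Dom_def)
        from max[OF this] have le: "J \<mu> P' R \<le> J \<mu> P R" .
        have "(\<Sum>i'=1..k. c i' * ln (Zg (E i') (P' i'))) = (\<Sum>i'=1..k. c i' * ln (Zg (E i') (P i')) - (if i' = i then c i * ln (1 - r * u) / 2 else 0))"
          by (rule sum.cong) (auto simp: P'_def kd(3) u_def right_diff_distrib)
        also have "\<dots> = (\<Sum>i'=1..k. c i' * ln (Zg (E i') (P i'))) - c i * ln (1 - r * u) / 2"
          using i by (simp add: sum_subtractf)
        finally have Phi': "Phi P' R = Phi P R - c i * ln (1 - r * u) / 2" by (simp add: Phi_def)
        have "ln (ZQ P' R) = ln (ZQ P R) - ln (1 + (- (r * c i)) * Q P R p p) / 2"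
          by (rule ZQ_update[OF D D' pX _ Q']) (use rv in \<open>simp add: v_def mult.assoc\<close>)
        then have "ln (ZQ P' R) = ln (ZQ P R) - ln (1 + r * (- v)) / 2" by (simp add: v_def mult.assoc)
        then show ?thesis using le by (simp add: J_def Phi' right_diff_distrib)
      qed
      show ?thesis using log_sum_deriv_nonpos[OF s0 *] by simp
    qed
    then have "c i * u \<le> c i * (2 * \<mu> * Q P R p p)" by (simp add: v_def mult.left_commute mult.assoc)
    then show ?thesis using c_pos[OF i] by (simp add: u_def pp)
  qed
  have KF: "2 * \<mu> * (\<Sum>l\<in>IX. (R j y \<bullet> M j (\<eta> l))\<^sup>2) \<le> R j y \<bullet> y" if j: "j \<in> {1..m}" and y: "y \<in> F j" for j y
  proof -
    have "\<exists>p\<in>XE. (\<forall>x\<in>XE. Q P R p x = R j y \<bullet> M j x) \<and> Q P R p p = (\<Sum>l\<in>IX. (R j y \<bullet> M j (\<eta> l))\<^sup>2)"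
    proof (rule Q_dual_vector[OF s \<eta>(1) ex])
      show "R j y \<bullet> M j (\<lambda>i. \<Sum>l\<in>L. a l *\<^sub>R \<eta> l i) = (\<Sum>l\<in>L. a l * (R j y \<bullet> M j (\<eta> l)))" if "finite L" for a L
        unfolding M_sum[OF j that] by (simp add: inner_sum_right)
      show "R j y \<bullet> M j x = R j y \<bullet> M j z" if "\<And>i. i \<in> {1..k} \<Longrightarrow> x i = z i" for x z
        using M_cong[of x z] that by simp
    qed
    then obtain p where pX: "p \<in> XE" and pQ: "\<And>x. x \<in> XE \<Longrightarrow> Q P R p x = R j y \<bullet> M j x"
      and pp: "Q P R p p = (\<Sum>l\<in>IX. (R j y \<bullet> M j (\<eta> l))\<^sup>2)" by blast
    define u where "u = R j y \<bullet> y"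
    define v where "v = d j * Q P R p p"
    have u0: "0 \<le> u" unfolding u_def by (rule kformD(2)[OF kR[OF j]])
    have v0: "0 \<le> v" unfolding v_def using Qpos_nonneg[OF Qp pX] d_pos[OF j] by simp
    \<comment> \<open>Here only \<open>R j\<close> has to stay positive, because \<open>Q\<close>
      increases.\<close>
    define s0 where "s0 = 1 / (1 + u)"
    have s0: "s0 > 0" using u0 by (simp add: s0_def)
    have *: "\<mu> * ln (1 + r * v) + (d j / 2) * ln (1 + r * (- u)) \<le> 0" if r: "0 < r" "r < s0" for r
    proof -
      have "r * (1 + u) < 1" using r u0 by (simp add: s0_def field_simps)
      then have ru: "r * u < 1" using r unfolding distrib_left by linarith
      define R' where "R' = R(j := R j - r *\<^sub>R rk1 (R j y))"
      note kd = kform_rank_one_down[OF F_subspace[OF j] kR[OF j] formsD_D(3)[OF D j] y r(1) ru[unfolded u_def]]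
      have Q': "Q P R' x x = Q P R x x + (r * d j) * (Q P R p x)\<^sup>2" if x: "x \<in> XE" for x
      proof -
        have "(\<Sum>j'=1..m. d j' * (R' j' (M j' x) \<bullet> M j' x)) = (\<Sum>j'=1..m. d j' * (R j' (M j' x) \<bullet> M j' x) - (if j' = j then r * d j * (R j y \<bullet> M j x)\<^sup>2 else 0))"
          by (rule sum.cong) (auto simp: R'_def kd(4) power2_eq_square right_diff_distrib)
        also have "\<dots> = (\<Sum>j'=1..m. d j' * (R j' (M j' x) \<bullet> M j' x)) - r * d j * (R j y \<bullet> M j x)\<^sup>2"
          using j by (simp add: sum_subtractf)
        finally show ?thesis unfolding pQ[OF x] by (simp add: bl_form_def)
      qed
      have "Qpos P R'"
        unfolding Qpos_def
      proof (intro conjI ballI impI)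
        show "sa P R'" using s posdef_onD(1)[OF kd(2)] by (auto simp: sa_def R'_def)
        fix x assume x: "x \<in> XE" "0 < nX x"
        have "0 < Q P R x x" using Qp x by (simp add: Qpos_def)
        moreover have "0 \<le> r * d j * (Q P R p x)\<^sup>2" using r d_pos[OF j] by simp
        ultimately show "0 < Q P R' x x" by (simp add: Q'[OF x(1)])
      qed
      then have D': "formsD P R'"
        unfolding formsD_def using formsD_D(1-4)[OF D] kd(2) kformD(3)[OF kd(1)] by (auto simp: R'_def)
      have FD': "(P, R') \<in> FD" using FD kd(1) j unfolding FD_iff R'_def by (metis fun_upd_apply)
      have "(P, R') \<in> Dom" using FD' D' by (simp add: Dom_def)
      from max[OF this] have le: "J \<mu> P R' \<le> J \<mu> P R" .
      have "(\<Sum>j'=1..m. d j' * ln (Zg (F j') (R' j'))) = (\<Sum>j'=1..m. d j' * ln (Zg (F j') (R j')) - (if j' = j then d j * ln (1 - r * u) / 2 else 0))"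
        by (rule sum.cong) (auto simp: R'_def kd(3) u_def right_diff_distrib)
      also have "\<dots> = (\<Sum>j'=1..m. d j' * ln (Zg (F j') (R j'))) - d j * ln (1 - r * u) / 2"
        using j by (simp add: sum_subtractf)
      finally have Phi': "Phi P R' = Phi P R + d j * ln (1 - r * u) / 2" by (simp add: Phi_def)
      have "ln (ZQ P R') = ln (ZQ P R) - ln (1 + (r * d j) * Q P R p p) / 2"
        by (rule ZQ_update[OF D D' pX _ Q'])
          (use r d_pos[OF j] Qpos_nonneg[OF Qp pX] in \<open>auto intro!: add_pos_nonneg\<close>)
      then have "ln (ZQ P R') = ln (ZQ P R) - ln (1 + r * v) / 2" by (simp add: v_def mult.assoc)
      then show ?thesis using le by (simp add: J_def Phi' right_diff_distrib)
    qed
    have "\<mu> * v + d j / 2 * - u \<le> 0" by (rule log_sum_deriv_nonpos[OF s0 *])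
    then have "d j * (2 * \<mu> * Q P R p p) \<le> d j * u" by (simp add: v_def mult.left_commute mult.assoc)
    then show ?thesis using d_pos[OF j] by (simp add: u_def pp)
  qed
  \<comment> \<open>The scaling absorbs the factor \<open>2 * \<mu>\<close> in \<open>KE\<close> and
    \<open>KF\<close>, at the price that each vector has \<open>Q\<close>-value
    \<open>2 * \<mu>\<close> instead of 1.\<close>
  define \<xi> where "\<xi> l i = sqrt (2 * \<mu>) *\<^sub>R \<eta> l i" for l i
  have \<xi>X: "\<xi> l \<in> XE" if "l \<in> IX" for l
    unfolding XE_def \<xi>_def mem_Collect_eq by (intro ballI subspace_scale E_subspace XE_D[OF \<eta>(1)[OF that]])
  have "Q P R (\<xi> l) (\<xi> l) = 2 * \<mu>" if l: "l \<in> IX" for l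
  proof -
    have *: "Q P R (\<xi> l) z = sqrt (2 * \<mu>) * Q P R (\<eta> l) z" for z
      using Q_lin[of P R "sqrt (2 * \<mu>)" "\<eta> l" "\<lambda>_. 0" z] Q_lin[of P R 1 "\<lambda>_. 0" "\<lambda>_. 0" z]
      by (simp add: \<xi>_def[abs_def])
    have "Q P R (\<xi> l) (\<xi> l) = sqrt (2 * \<mu>) * (sqrt (2 * \<mu>) * Q P R (\<eta> l) (\<eta> l))"
      unfolding * Q_commute[OF s, of "\<eta> l" "\<xi> l"] ..
    then show ?thesis using \<mu> \<eta>(2)[OF l] by simp
  qed
  moreover have "(\<Sum>l\<in>IX. (b \<bullet> \<xi> l i)\<^sup>2) = 2 * \<mu> * (\<Sum>l\<in>IX. (b \<bullet> \<eta> l i)\<^sup>2)" for b i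
    using \<mu> by (simp add: \<xi>_def power_mult_distrib sum_distrib_left)
  moreover have "(\<Sum>l\<in>IX. (b \<bullet> M j (\<xi> l))\<^sup>2) = 2 * \<mu> * (\<Sum>l\<in>IX. (b \<bullet> M j (\<eta> l))\<^sup>2)" if "j \<in> {1..m}" for b j
    using \<mu> by (simp add: \<xi>_def[abs_def] M_scale[OF that] power_mult_distrib sum_distrib_left)
  ultimately show ?thesis
    using \<xi>X KE KF by (intro exI[of _ \<xi>]) simp
qed

text \<open>
  Gaussian maximizers need not exist. The barrier \<open>- 2 \<mu> ln (ZQ P R)\<close> enforces approximate
  stationarity with defect of order \<open>\<mu>\<close>, while the maximizer degenerates only at a rate \<open>\<alpha>\<close>
  with \<open>\<mu> ln (1 / \<alpha>)\<close> tending to zero.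
\<close>

lemma approximate_stationary_point:
  assumes adm0: "\<forall>P R. formsD P R \<longrightarrow> Phi P R \<le> D" and \<epsilon>: "\<epsilon> > 0"
  shows "\<exists>P R \<xi> A. formsD P R \<and> 0 \<le> A \<and>
     (\<forall>x\<in>XE. exp (- A) * nX x \<le> Q P R x x) \<and>
     (\<forall>i\<in>{1..k}. \<forall>x\<in>E i. exp (- A) * (x \<bullet> x) \<le> P i x \<bullet> x) \<and>
     (\<forall>j\<in>{1..m}. \<forall>y\<in>F j. exp (- A) * (y \<bullet> y) \<le> R j y \<bullet> y) \<and>
     (\<forall>l\<in>IX. \<xi> l \<in> XE) \<and>
     (\<forall>i\<in>{1..k}. \<forall>y\<in>E i. P i y \<bullet> y \<le> (\<Sum>l\<in>IX. (P i y \<bullet> \<xi> l i)\<^sup>2)) \<and>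
     (\<forall>j\<in>{1..m}. \<forall>y\<in>F j. (\<Sum>l\<in>IX. (R j y \<bullet> M j (\<xi> l))\<^sup>2) \<le> R j y \<bullet> y) \<and>
     0 \<le> (\<Sum>l\<in>IX. Q P R (\<xi> l) (\<xi> l)) \<and> (\<Sum>l\<in>IX. Q P R (\<xi> l) (\<xi> l)) * (1 + A) \<le> \<epsilon>"
proof -
  note adm = adm0[rule_format]
  obtain A2 where A2: "0 \<le> A2" and A2': "\<And>J0. \<exists>A1\<ge>0. \<forall>\<mu> P R. 0 < \<mu> \<longrightarrow> \<mu> \<le> 1 \<longrightarrow> formsD P R \<longrightarrow> J0 \<le> J \<mu> P R \<longrightarrow>
    (\<forall>x\<in>XE. exp (- (A1 + A2 * \<bar>ln (ZQ P R)\<bar>)) * nX x \<le> Q P R x x) \<and>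
    (\<forall>i\<in>{1..k}. \<forall>x\<in>E i. exp (- (A1 + A2 * \<bar>ln (ZQ P R)\<bar>)) * (x \<bullet> x) \<le> P i x \<bullet> x) \<and>
    (\<forall>j\<in>{1..m}. \<forall>y\<in>F j. exp (- (A1 + A2 * \<bar>ln (ZQ P R)\<bar>)) * (y \<bullet> y) \<le> R j y \<bullet> y)"
    using forms_lower_bound by blast
  define n where "n = real (card IX)"
  \<comment> \<open>The accuracy to which \<open>p1\<close> will maximize \<open>Phi\<close>. It
    controls \<open>\<mu> * \<bar>z\<bar>\<close> at the maximizer of \<open>J\<close>; a small
    \<mu> alone would not, because \<open>z\<close> depends on \<mu>.\<close>
  define \<epsilon>1 where "\<epsilon>1 = \<epsilon> / (3 * (n * A2 + 1))"
  have n: "0 \<le> n" "0 \<le> n * A2" using A2 by (auto simp: n_def)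
  have \<epsilon>1: "\<epsilon>1 > 0" "n * A2 * \<epsilon>1 \<le> \<epsilon> / 3"
    using \<epsilon> n by (auto simp: \<epsilon>1_def add_nonneg_pos field_simps)
  define Ps where "Ps = (SUP p\<in>Dom. Phi (fst p) (snd p))"
  have bdd: "bdd_above ((\<lambda>p. Phi (fst p) (snd p)) ` Dom)"
    using adm by (intro bdd_aboveI[of _ D]) (auto simp: Dom_def)
  have "\<exists>p\<in>Dom. Ps - \<epsilon>1 < Phi (fst p) (snd p)"
    using less_cSUP_iff[OF Dom_nonempty bdd, of "Ps - \<epsilon>1"] \<epsilon>1 by (simp add: Ps_def)
  then obtain p1 where p1: "p1 \<in> Dom" "Ps - \<epsilon>1 < Phi (fst p1) (snd p1)" by blast
  define z1 where "z1 = \<bar>ln (ZQ (fst p1) (snd p1))\<bar>"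
  define z0 where "z0 = \<bar>ln (sqrt (2 * pi / cmax) ^ card IX)\<bar>"
  \<comment> \<open>A lower bound for \<open>J \<mu>\<close> at \<open>p1\<close> that is valid for
    every \<open>\<mu> \<le> 1\<close>, so that \<open>A1\<close> can be fixed before \<mu>.\<close>
  define J0 where "J0 = Phi (fst p1) (snd p1) - 2 * z1"
  obtain A1 where A1: "0 \<le> A1" and low: "\<And>\<mu> P R. 0 < \<mu> \<Longrightarrow> \<mu> \<le> 1 \<Longrightarrow> formsD P R \<Longrightarrow> J0 \<le> J \<mu> P R \<Longrightarrow>
    (\<forall>x\<in>XE. exp (- (A1 + A2 * \<bar>ln (ZQ P R)\<bar>)) * nX x \<le> Q P R x x) \<and>
    (\<forall>i\<in>{1..k}. \<forall>x\<in>E i. exp (- (A1 + A2 * \<bar>ln (ZQ P R)\<bar>)) * (x \<bullet> x) \<le> P i x \<bullet> x) \<and>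
    (\<forall>j\<in>{1..m}. \<forall>y\<in>F j. exp (- (A1 + A2 * \<bar>ln (ZQ P R)\<bar>)) * (y \<bullet> y) \<le> R j y \<bullet> y)"
    using A2'[of J0] by blast
  \<comment> \<open>In the final estimate \<open>\<mu> * (H - 1)\<close> collects all terms that
    vanish with \<mu>; the remaining one is \<open>n * A2 * \<epsilon>1\<close>.\<close>
  define H where "H = 1 + 2 * n * (1 + A1) + n * A2 * (2 * (z1 + z0))"
  have z: "0 \<le> z1" "0 \<le> z0" by (auto simp: z1_def z0_def)
  have parts: "0 \<le> 2 * n * (1 + A1)" "0 \<le> n * A2 * (2 * (z1 + z0))" using n A1 z by auto
  then have H: "H \<ge> 1" by (simp add: H_def)
  define \<mu> where "\<mu> = min 1 (\<epsilon> / 3 / H)"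
  have \<mu>: "0 < \<mu>" "\<mu> \<le> 1" using \<epsilon> H by (auto simp: \<mu>_def)
  have \<mu>H: "\<mu> * H \<le> \<epsilon> / 3"
  proof -
    have "\<mu> * H \<le> (\<epsilon> / 3 / H) * H" using H by (intro mult_right_mono) (auto simp: \<mu>_def)
    then show ?thesis using H by simp
  qed
  obtain q where q: "q \<in> Dom" and qmax: "\<And>q'. q' \<in> Dom \<Longrightarrow> J \<mu> (fst q') (snd q') \<le> J \<mu> (fst q) (snd q)"
    using J_max_exists[OF adm \<mu> p1(1)] by blast
  obtain P R where PR: "q = (P, R)" by (cases q)
  have D: "formsD P R" using q PR by (simp add: Dom_def)
  obtain \<xi> where \<xi>: "\<forall>l\<in>IX. \<xi> l \<in> XE \<and> Q P R (\<xi> l) (\<xi> l) = 2 * \<mu>"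
     "\<forall>i\<in>{1..k}. \<forall>y\<in>E i. P i y \<bullet> y \<le> (\<Sum>l\<in>IX. (P i y \<bullet> \<xi> l i)\<^sup>2)"
     "\<forall>j\<in>{1..m}. \<forall>y\<in>F j. (\<Sum>l\<in>IX. (R j y \<bullet> M j (\<xi> l))\<^sup>2) \<le> R j y \<bullet> y"
    using J_max_stationary[OF \<mu>(1), of P R] q qmax unfolding PR by fastforce
  define z where "z = ln (ZQ P R)"
  have \<mu>z1: "\<mu> * ln (ZQ (fst p1) (snd p1)) \<le> \<mu> * z1" using \<mu> by (intro mult_left_mono) (auto simp: z1_def)
  have J1: "Phi (fst p1) (snd p1) - 2 * (\<mu> * z1) \<le> J \<mu> P R"
    using qmax[OF p1(1)] \<mu>z1 by (simp add: PR J_def)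
  have "\<mu> * z1 \<le> 1 * z1" using \<mu> z by (intro mult_right_mono) auto
  then have "J0 \<le> J \<mu> P R" using J1 by (simp add: J0_def)
  note low' = low[OF \<mu> D this, folded z_def]
  \<comment> \<open>The maximizer of \<open>J\<close> exceeds \<open>p1\<close> in
    \<open>Phi\<close> by at most \<open>\<epsilon>1\<close>, so its barrier term cannot be much
    worse than that of \<open>p1\<close>.\<close>
  have "Phi P R \<le> Ps"
    unfolding Ps_def using cSUP_upper[OF q bdd] by (simp add: PR)
  then have up: "2 * (\<mu> * z) \<le> \<epsilon>1 + 2 * (\<mu> * z1)"
    using J1 p1(2) by (simp add: J_def z_def)
  have "- z0 \<le> z"
  proof -
    have "ln (sqrt (2 * pi / cmax) ^ card IX) \<le> z"
      unfolding z_def using ZQ_lower[OF D] cmax(2) by (intro ln_mono) auto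
    then show ?thesis by (simp add: z0_def)
  qed
  then have "\<mu> * (- z0) \<le> \<mu> * z" using \<mu> by (intro mult_left_mono) auto
  moreover have "\<mu> * \<bar>z\<bar> = \<bar>\<mu> * z\<bar>" using \<mu> by (simp add: abs_mult)
  moreover have "0 \<le> \<mu> * z0" "0 \<le> \<mu> * z1" using \<mu> z by auto
  ultimately have muz: "2 * (\<mu> * \<bar>z\<bar>) \<le> \<epsilon>1 + \<mu> * (2 * (z1 + z0))"
    using up \<epsilon>1 by (simp add: abs_if distrib_left)
  have \<delta>: "(\<Sum>l\<in>IX. Q P R (\<xi> l) (\<xi> l)) = n * (2 * \<mu>)" using \<xi>(1) by (simp add: n_def)
  have "n * (2 * \<mu>) * (1 + (A1 + A2 * \<bar>z\<bar>)) = \<mu> * (2 * n * (1 + A1)) + n * A2 * (2 * (\<mu> * \<bar>z\<bar>))"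
    by (simp add: algebra_simps)
  also have "\<dots> \<le> \<mu> * (2 * n * (1 + A1)) + n * A2 * (\<epsilon>1 + \<mu> * (2 * (z1 + z0)))"
    by (intro add_left_mono mult_left_mono muz n)
  also have "\<dots> = n * A2 * \<epsilon>1 + \<mu> * (H - 1)" by (simp add: H_def algebra_simps)
  also have "\<dots> \<le> \<epsilon> / 3 + \<mu> * H" using \<epsilon>1(2) \<mu> by (simp add: right_diff_distrib)
  also have "\<dots> \<le> \<epsilon>" using \<mu>H \<epsilon> by simp
  finally have fin: "n * (2 * \<mu>) * (1 + (A1 + A2 * \<bar>z\<bar>)) \<le> \<epsilon>" .
  show ?thesis
    by (rule exI[of _ P], rule exI[of _ R], rule exI[of _ \<xi>], rule exI[of _ "A1 + A2 * \<bar>z\<bar>"], unfold \<delta>)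
      (use D A1 A2 low' \<xi> fin n \<mu> in auto)
qed

end

subsection \<open>Small and large times\<close>

lemma kernel_mass:
  assumes S: "subspace S" and P: "posdef_on S P" and x: "x \<in> S" and t: "t > 0"
  shows "integrable (lborel_on S) (\<lambda>y. exp (- (P (x - y) \<bullet> (x - y)) / (2 * t)))" (is ?int)
    and "(\<integral>y. exp (- (P (x - y) \<bullet> (x - y)) / (2 * t)) \<partial>lborel_on S) = sqrt t ^ dim S * Zg S P" (is ?eq)
proof -
  have sym: "P (x - y) \<bullet> (x - y) = P (- x + 1 *\<^sub>R y) \<bullet> (- x + 1 *\<^sub>R y)" for y
  proof -
    have "x - y = - (- x + 1 *\<^sub>R y)" by simp
    then show ?thesis by (metis blinfun.minus_right inner_minus_left inner_minus_right minus_minus)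
  qed
  have [measurable]: "(\<lambda>y. exp (- ((P y \<bullet> y) / t) / 2)) \<in> borel_measurable (lborel_on S)" by measurable
  have "(\<integral>\<^sup>+y. ennreal (exp (- (P (x - y) \<bullet> (x - y)) / (2 * t))) \<partial>lborel_on S)
    = (\<integral>\<^sup>+y. (\<lambda>y. ennreal (exp (- ((P y \<bullet> y) / t) / 2))) (- x + 1 *\<^sub>R y) \<partial>lborel_on S)"
    unfolding sym by (intro nn_integral_cong) (simp add: mult.commute)
  also have "\<dots> = ennreal ((1 / 1) ^ dim S) * (\<integral>\<^sup>+y. ennreal (exp (- ((P y \<bullet> y) / t) / 2)) \<partial>lborel_on S)"
    by (rule nn_integral_lborel_on_affine[OF S]) (use x S in \<open>auto simp: subspace_neg\<close>)
  also have "\<dots> = ennreal (sqrt t ^ dim S * Zg S P)"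
    using gint_form_scale[OF S P t] by (simp add: gint_def)
  finally have *: "(\<integral>\<^sup>+y. ennreal (exp (- (P (x - y) \<bullet> (x - y)) / (2 * t))) \<partial>lborel_on S) = ennreal (sqrt t ^ dim S * Zg S P)" .
  have nn: "0 \<le> sqrt t ^ dim S * Zg S P" using Zg_pos[OF S P] t by simp
  have meas: "(\<lambda>y. exp (- (P (x - y) \<bullet> (x - y)) / (2 * t))) \<in> borel_measurable (lborel_on S)" by measurable
  show ?int by (rule integrableI_nonneg[OF meas], simp, unfold *, simp)
  show ?eq by (subst integral_eq_nn_integral[OF meas], simp, unfold *, rule enn2real_ennreal[OF nn])
qed

lemma heat_density:
  assumes S: "subspace S" and f: "f \<in> borel_measurable borel" "\<And>y. 0 \<le> f y"
  shows "heat P (density (lborel_on S) (\<lambda>y. ennreal (f y))) t x = (\<integral>y. f y * exp (- (P (x - y) \<bullet> (x - y)) / (2 * t)) \<partial>lborel_on S)"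
  unfolding heat_def using f by (subst integral_density) (auto intro!: borel_measurable_lborel_on)

text \<open>Half of the exponent pays for the distance \<open>r\<close>; the other half remains as
  the kernel at time \<open>2 * t\<close>, whose mass is larger only by the factor
  \<open>sqrt 2 ^ dim S\<close>.\<close>

lemma exp_split_bound:
  fixes p t b r :: real
  assumes "t > 0" "b * r\<^sup>2 \<le> p"
  shows "exp (- p / (2 * t)) \<le> exp (- (b * r\<^sup>2) / (4 * t)) * exp (- p / (2 * (2 * t)))"
proof -
  have "b * r\<^sup>2 / (4 * t) \<le> p / (4 * t)" using assms by (intro divide_right_mono) auto
  moreover have "p / (2 * t) = p / (4 * t) + p / (2 * (2 * t))" using assms by (simp add: field_simps)
  ultimately show ?thesis by (simp add: exp_add[symmetric])
qed

text \<open>Within distance \<open>r\<close> of \<open>x\<close> the local bound \<open>s\<close>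
  counts, farther away the global bound \<open>Nf\<close> times a small tail. Neither this estimate
  nor its lower counterpart needs continuity, only bounds for the datum on a small ball.\<close>

lemma heat_density_upper:
  assumes S: "subspace S" and P: "posdef_on S P" and low: "\<And>x. x \<in> S \<Longrightarrow> b * (x \<bullet> x) \<le> P x \<bullet> x" "b \<ge> 0"
    and f: "f \<in> borel_measurable borel" "\<And>y. 0 \<le> f y" "\<And>y. f y \<le> Nf" and x: "x \<in> S" and t: "t > 0"
    and r: "r \<ge> 0" and loc: "\<And>y. y \<in> S \<Longrightarrow> norm (y - x) < r \<Longrightarrow> f y \<le> s" and s: "s \<ge> 0"
  shows "heat P (density (lborel_on S) (\<lambda>y. ennreal (f y))) t x
     \<le> sqrt t ^ dim S * Zg S P * (s + Nf * (sqrt 2 ^ dim S * exp (- (b * r\<^sup>2) / (4 * t))))"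
proof -
  let ?K = "\<lambda>t y. exp (- (P (x - y) \<bullet> (x - y)) / (2 * t))"
  let ?e = "exp (- (b * r\<^sup>2) / (4 * t))"
  note km = kernel_mass[OF S P x]
  have t2: "2 * t > 0" using t by simp
  have Nf: "0 \<le> Nf" using f(2,3)[of 0] by linarith
  have "heat P (density (lborel_on S) (\<lambda>y. ennreal (f y))) t x = (\<integral>y. f y * ?K t y \<partial>lborel_on S)"
    by (rule heat_density[OF S f(1,2)])
  also have "\<dots> \<le> (\<integral>y. s * ?K t y + Nf * ?e * ?K (2 * t) y \<partial>lborel_on S)"
  proof (rule integral_mono)
    show "integrable (lborel_on S) (\<lambda>y. s * ?K t y + Nf * ?e * ?K (2 * t) y)"
      using km(1)[OF t] km(1)[OF t2] by auto
    show "integrable (lborel_on S) (\<lambda>y. f y * ?K t y)"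
      by (rule Bochner_Integration.integrable_bound[OF integrable_mult_right[OF km(1)[OF t], of Nf]])
        (use f Nf in \<open>auto intro!: AE_I2 mult_right_mono borel_measurable_lborel_on simp: abs_mult\<close>)
    fix y assume "y \<in> space (lborel_on S)"
    then have y: "y \<in> S" by simp
    show "f y * ?K t y \<le> s * ?K t y + Nf * ?e * ?K (2 * t) y"
    proof (cases "norm (y - x) < r")
      case True
      then have "f y * ?K t y \<le> s * ?K t y" using loc[OF y] by (intro mult_right_mono) auto
      moreover have "0 \<le> Nf * ?e * ?K (2 * t) y" using Nf by simp
      ultimately show ?thesis by linarith
    next
      case False
      then have "r\<^sup>2 \<le> (norm (x - y))\<^sup>2" using r by (intro power_mono) (auto simp: norm_minus_commute)
      then have "b * r\<^sup>2 \<le> b * ((x - y) \<bullet> (x - y))" using low(2) by (intro mult_left_mono) (auto simp: dot_square_norm)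
      also have "\<dots> \<le> P (x - y) \<bullet> (x - y)" using x y S by (intro low(1)) (simp add: subspace_diff)
      finally have "?K t y \<le> ?e * ?K (2 * t) y" by (rule exp_split_bound[OF t])
      then have "f y * ?K t y \<le> Nf * (?e * ?K (2 * t) y)" using f Nf by (intro mult_mono) auto
      moreover have "0 \<le> s * ?K t y" using s by simp
      ultimately show ?thesis by (simp add: mult.assoc)
    qed
  qed
  also have "\<dots> = s * (sqrt t ^ dim S * Zg S P) + Nf * ?e * (sqrt (2 * t) ^ dim S * Zg S P)"
    using km[OF t] km[OF t2] by simp
  also have "\<dots> = sqrt t ^ dim S * Zg S P * (s + Nf * (sqrt 2 ^ dim S * ?e))"
    by (simp add: real_sqrt_mult power_mult_distrib algebra_simps)
  finally show ?thesis .
qed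

lemma heat_density_lower:
  assumes S: "subspace S" and P: "posdef_on S P" and low: "\<And>x. x \<in> S \<Longrightarrow> b * (x \<bullet> x) \<le> P x \<bullet> x" "b \<ge> 0"
    and g: "g \<in> borel_measurable borel" "\<And>y. 0 \<le> g y" "\<And>y. g y \<le> Ng" and x: "x \<in> S" and t: "t > 0"
    and r: "r \<ge> 0" and loc: "\<And>y. y \<in> S \<Longrightarrow> norm (y - x) < r \<Longrightarrow> s \<le> g y" and s: "s \<ge> 0"
  shows "sqrt t ^ dim S * Zg S P * (s * (1 - sqrt 2 ^ dim S * exp (- (b * r\<^sup>2) / (4 * t))))
     \<le> heat P (density (lborel_on S) (\<lambda>y. ennreal (g y))) t x"
proof -
  let ?K = "\<lambda>t y. exp (- (P (x - y) \<bullet> (x - y)) / (2 * t))"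
  let ?e = "exp (- (b * r\<^sup>2) / (4 * t))"
  note km = kernel_mass[OF S P x]
  have t2: "2 * t > 0" using t by simp
  have Ng: "0 \<le> Ng" using g(2,3)[of 0] by linarith
  have "sqrt t ^ dim S * Zg S P * (s * (1 - sqrt 2 ^ dim S * ?e)) = s * (sqrt t ^ dim S * Zg S P) - s * ?e * (sqrt (2 * t) ^ dim S * Zg S P)"
    by (simp add: real_sqrt_mult power_mult_distrib algebra_simps)
  also have "\<dots> = (\<integral>y. s * ?K t y - s * ?e * ?K (2 * t) y \<partial>lborel_on S)"
    using km[OF t] km[OF t2] by simp
  also have "\<dots> \<le> (\<integral>y. g y * ?K t y \<partial>lborel_on S)"
  proof (rule integral_mono)
    show "integrable (lborel_on S) (\<lambda>y. s * ?K t y - s * ?e * ?K (2 * t) y)"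
      using km(1)[OF t] km(1)[OF t2] by auto
    show "integrable (lborel_on S) (\<lambda>y. g y * ?K t y)"
      by (rule Bochner_Integration.integrable_bound[OF integrable_mult_right[OF km(1)[OF t], of Ng]])
        (use g Ng in \<open>auto intro!: AE_I2 mult_right_mono borel_measurable_lborel_on simp: abs_mult\<close>)
    fix y assume "y \<in> space (lborel_on S)"
    then have y: "y \<in> S" by simp
    show "s * ?K t y - s * ?e * ?K (2 * t) y \<le> g y * ?K t y"
    proof (cases "norm (y - x) < r")
      case True
      then have "s * ?K t y \<le> g y * ?K t y" using loc[OF y] by (intro mult_right_mono) auto
      moreover have "0 \<le> s * ?e * ?K (2 * t) y" using s by simp
      ultimately show ?thesis by linarith
    next
      case False
      then have "r\<^sup>2 \<le> (norm (x - y))\<^sup>2" using r by (intro power_mono) (auto simp: norm_minus_commute)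
      then have "b * r\<^sup>2 \<le> b * ((x - y) \<bullet> (x - y))" using low(2) by (intro mult_left_mono) (auto simp: dot_square_norm)
      also have "\<dots> \<le> P (x - y) \<bullet> (x - y)" using x y S by (intro low(1)) (simp add: subspace_diff)
      finally have "?K t y \<le> ?e * ?K (2 * t) y" by (rule exp_split_bound[OF t])
      then have "s * ?K t y \<le> s * (?e * ?K (2 * t) y)" using s by (intro mult_left_mono) auto
      moreover have "0 \<le> g y * ?K t y" using g by simp
      ultimately show ?thesis by (simp add: mult.assoc)
    qed
  qed
  also have "\<dots> = heat P (density (lborel_on S) (\<lambda>y. ennreal (g y))) t x"
    by (rule heat_density[OF S g(1,2), symmetric])
  finally show ?thesis .
qed

lemma exp_neg_le_inverse: "x > 0 \<Longrightarrow> exp (- x) \<le> 1 / x" for x :: real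
proof -
  assume x: "x > 0"
  have "x \<le> exp x" using exp_ge_add_one_self[of x] by linarith
  then have "exp (- x) * x \<le> exp (- x) * exp x" by (intro mult_left_mono) auto
  then show ?thesis using x by (simp add: exp_minus field_simps)
qed

lemma heat_flow_density:
  assumes S: "subspace S" and P: "posdef_on S P" and f: "f \<in> borel_measurable borel"
    and fin: "(\<integral>\<^sup>+y. ennreal (f y) \<partial>lborel_on S) < \<infinity>" and pos: "0 < (\<integral>\<^sup>+y. ennreal (f y) \<partial>lborel_on S)"
  shows "heat_flow (density (lborel_on S) (\<lambda>y. ennreal (f y))) S P"
    "ennreal (measure (density (lborel_on S) (\<lambda>y. ennreal (f y))) S) = (\<integral>\<^sup>+y. ennreal (f y) \<partial>lborel_on S)"
proof -
  let ?N = "density (lborel_on S) (\<lambda>y. ennreal (f y))"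
  have [measurable]: "f \<in> borel_measurable (lborel_on S)" by (rule borel_measurable_lborel_on[OF f])
  have e: "emeasure ?N S = (\<integral>\<^sup>+y. ennreal (f y) \<partial>lborel_on S)"
  proof -
    have "emeasure ?N S = (\<integral>\<^sup>+y. ennreal (f y) * indicator (space (lborel_on S)) y \<partial>lborel_on S)"
      using sets.top[of "lborel_on S"] by (subst emeasure_density) auto
    also have "\<dots> = (\<integral>\<^sup>+y. ennreal (f y) \<partial>lborel_on S)"
      by (rule nn_integral_cong) simp
    finally show ?thesis .
  qed
  interpret finite_measure ?N
    by (rule finite_measureI) (use e fin in simp)
  show m: "ennreal (measure ?N S) = (\<integral>\<^sup>+y. ennreal (f y) \<partial>lborel_on S)"
    using e by (simp add: emeasure_eq_measure)
  show "heat_flow ?N S P"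
  proof
    show "0 < measure ?N S" using pos unfolding m[symmetric] by simp
  qed (simp_all add: S P sets_lborel_on)
qed

text \<open>Finite ranges make extreme values on balls attained and keep the positive values of the
  \<open>f i\<close> away from 0. The condition \<open>robust\<close> allows all arguments to be
  perturbed independently, as the heat kernel does at small times.\<close>

locale bl_nice = bl_datum k c E m d F B
  for k c and E :: "nat \<Rightarrow> 'a::euclidean_space set" and m d and F :: "nat \<Rightarrow> 'b::euclidean_space set" and B +
  fixes f :: "nat \<Rightarrow> 'a \<Rightarrow> real" and g :: "nat \<Rightarrow> 'b \<Rightarrow> real" and Nb r0 \<tau> :: real
  assumes f_meas: "i \<in> {1..k} \<Longrightarrow> f i \<in> borel_measurable borel" and f_nonneg: "i \<in> {1..k} \<Longrightarrow> 0 \<le> f i y"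
    and f_le: "i \<in> {1..k} \<Longrightarrow> f i y \<le> Nb" and f_fin: "i \<in> {1..k} \<Longrightarrow> finite (range (f i))"
    and f_supp: "i \<in> {1..k} \<Longrightarrow> r0 < norm y \<Longrightarrow> f i y = 0" and r0: "0 \<le> r0" and Nb: "0 < Nb"
    and f_pos: "i \<in> {1..k} \<Longrightarrow> 0 < (\<integral>\<^sup>+y. ennreal (f i y) \<partial>lborel_on (E i))"
    and g_meas: "j \<in> {1..m} \<Longrightarrow> g j \<in> borel_measurable borel" and g_nonneg: "j \<in> {1..m} \<Longrightarrow> 0 \<le> g j z"
    and g_le: "j \<in> {1..m} \<Longrightarrow> g j z \<le> Nb" and g_fin: "j \<in> {1..m} \<Longrightarrow> finite (range (g j))"
    and g_int: "j \<in> {1..m} \<Longrightarrow> (\<integral>\<^sup>+z. ennreal (g j z) \<partial>lborel_on (F j)) < \<infinity>"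
    and \<tau>: "0 < \<tau>"
    and robust: "X \<in> XE \<Longrightarrow> (\<And>i. i \<in> {1..k} \<Longrightarrow> Y i \<in> E i \<and> norm (Y i - X i) < \<tau>) \<Longrightarrow>
      (\<And>j. j \<in> {1..m} \<Longrightarrow> Z j \<in> F j \<and> norm (Z j - M j X) < \<tau>) \<Longrightarrow>
      (\<Prod>i=1..k. f i (Y i) powr c i) \<le> (\<Prod>j=1..m. g j (Z j) powr d j)"
begin

text \<open>A small Gaussian floor makes logarithms finite where \<open>g j\<close> vanishes and
  decays no faster than a fixed Gaussian. The exponent is written with
  \<open>2 * (z \<bullet> z)\<close> over 2 to match the integral formula with parameter 2.\<close>

definition fl :: "real \<Rightarrow> nat \<Rightarrow> 'b \<Rightarrow> real" where "fl \<epsilon> j z = g j z + \<epsilon> * exp (- (2 * (z \<bullet> z)) / 2)"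

abbreviation "NE \<equiv> \<lambda>i. density (lborel_on (E i)) (\<lambda>y. ennreal (f i y))"
abbreviation "NF \<equiv> \<lambda>\<epsilon> j. density (lborel_on (F j)) (\<lambda>y. ennreal (fl \<epsilon> j y))"

lemma fl_meas [measurable]: "j \<in> {1..m} \<Longrightarrow> fl \<epsilon> j \<in> borel_measurable borel"
  unfolding fl_def[abs_def] using g_meas by measurable

lemma fl_bounds:
  assumes "j \<in> {1..m}" "0 < \<epsilon>" "\<epsilon> \<le> 1"
  shows "g j z \<le> fl \<epsilon> j z" "0 < fl \<epsilon> j z" "fl \<epsilon> j z \<le> Nb + 1"
proof -
  have "\<epsilon> * exp (- (2 * (z \<bullet> z)) / 2) \<le> 1 * 1" using assms by (intro mult_mono) auto
  then show "fl \<epsilon> j z \<le> Nb + 1" unfolding fl_def using g_le[OF assms(1), of z] by linarith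
  have "0 < \<epsilon> * exp (- (2 * (z \<bullet> z)) / 2)" using assms by simp
  then show "g j z \<le> fl \<epsilon> j z" "0 < fl \<epsilon> j z" unfolding fl_def using g_nonneg[OF assms(1), of z] by linarith+
qed

definition G0 :: real where "G0 = 1 + (\<Sum>i=1..k. sqrt 2 ^ dim (E i)) + (\<Sum>j=1..m. sqrt 2 ^ dim (F j))"

lemma G0: "1 \<le> G0" "i \<in> {1..k} \<Longrightarrow> sqrt 2 ^ dim (E i) \<le> G0" "j \<in> {1..m} \<Longrightarrow> sqrt 2 ^ dim (F j) \<le> G0"
proof -
  have nn: "0 \<le> (\<Sum>i=1..k. sqrt 2 ^ dim (E i))" "0 \<le> (\<Sum>j=1..m. sqrt 2 ^ dim (F j))" by (auto intro!: sum_nonneg)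
  then show "1 \<le> G0" by (simp add: G0_def)
  show "sqrt 2 ^ dim (E i) \<le> G0" if "i \<in> {1..k}"
    using member_le_sum[of i "{1..k}" "\<lambda>i. sqrt 2 ^ dim (E i)"] that nn by (simp add: G0_def)
  show "sqrt 2 ^ dim (F j) \<le> G0" if "j \<in> {1..m}"
    using member_le_sum[of j "{1..m}" "\<lambda>j. sqrt 2 ^ dim (F j)"] that nn by (simp add: G0_def)
qed

text \<open>
  The time \<open>b / (4 * \<beta>)\<close> is a fixed multiple of the lower bound \<open>b\<close> of the forms; this matters because the
  approximately stationary forms may degenerate.
\<close>

lemma small_time_comparison:
  assumes \<epsilon>: "0 < \<epsilon>" "\<epsilon> \<le> 1" and \<epsilon>': "0 < \<epsilon>'"
  shows "\<exists>\<beta>>0. \<forall>b P R x. 0 < b \<longrightarrow>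
    (\<forall>i\<in>{1..k}. posdef_on (E i) (P i) \<and> (\<forall>x\<in>E i. b * (x \<bullet> x) \<le> P i x \<bullet> x)) \<longrightarrow>
    (\<forall>j\<in>{1..m}. posdef_on (F j) (R j) \<and> (\<forall>x\<in>F j. b * (x \<bullet> x) \<le> R j x \<bullet> x)) \<longrightarrow> x \<in> XE \<longrightarrow>
    (\<forall>i\<in>{1..k}. 0 < heat (P i) (NE i) (b / (4 * \<beta>)) (x i)) \<longrightarrow>
    (\<Sum>i=1..k. c i * ln (heat (P i) (NE i) (b / (4 * \<beta>)) (x i) / (sqrt (b / (4 * \<beta>)) ^ dim (E i) * Zg (E i) (P i))))
    \<le> (\<Sum>j=1..m. d j * ln (heat (R j) (NF \<epsilon> j) (b / (4 * \<beta>)) (M j x) / (sqrt (b / (4 * \<beta>)) ^ dim (F j) * Zg (F j) (R j)))) + \<epsilon>'"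
proof -
  define cs where "cs = (\<Sum>i=1..k. c i)"
  define ds where "ds = (\<Sum>j=1..m. d j)"
  have cs: "0 \<le> cs" and ds: "0 \<le> ds"
    unfolding cs_def ds_def using c_pos d_pos by (auto intro!: sum_nonneg simp: less_imp_le)
  obtain C where C: "C > 0" "\<And>j x. j \<in> {1..m} \<Longrightarrow> norm (M j x) \<le> C * (\<Sum>i=1..k. norm (x i))"
    using M_bound by blast
  define V where "V = {v. v > 0 \<and> v \<in> (\<Union>i\<in>{1..k}. range (f i))}"
  have Vfin: "finite V" unfolding V_def using f_fin by (auto intro: finite_subset[of _ "\<Union>i\<in>{1..k}. range (f i)"])
  \<comment> \<open>\<open>\<alpha>\<close> is at most every positive value of the
    \<open>f i\<close>, so that small additive errors in \<open>f i\<close> become small relative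
    errors.\<close>
  define \<alpha> where "\<alpha> = Min (insert 1 V)"
  have \<alpha>: "\<alpha> > 0" unfolding \<alpha>_def using Vfin by (auto simp: V_def)
  have \<alpha>_le: "\<alpha> \<le> f i y" if "i \<in> {1..k}" "0 < f i y" for i y
  proof -
    have "f i y \<in> V" using that unfolding V_def by blast
    then show ?thesis unfolding \<alpha>_def using Vfin by (intro Min_le) auto
  qed
  define cm where "cm = Min (insert 1 (c ` {1..k}))"
  have cm: "cm > 0" "\<And>i. i \<in> {1..k} \<Longrightarrow> cm \<le> c i"
    unfolding cm_def using c_pos by (auto simp del: Min_insert intro: Min_le)
  define \<eta> where "\<eta> = min (1/2) (\<epsilon>' / (cs * Nb / \<alpha> + 2 * ds + 1))"
  have den: "0 < cs * Nb / \<alpha> + 2 * ds + 1" using cs ds Nb \<alpha> by (auto intro!: add_nonneg_pos)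
  have \<eta>: "0 < \<eta>" "\<eta> \<le> 1/2" and \<eta>': "\<eta> * (cs * Nb / \<alpha> + 2 * ds) \<le> \<epsilon>'"
  proof -
    show "\<eta> \<le> 1/2" unfolding \<eta>_def by (rule min.cobounded1)
    show "0 < \<eta>" using \<epsilon>' den by (simp add: \<eta>_def)
    then have "\<eta> * (cs * Nb / \<alpha> + 2 * ds) \<le> \<eta> * (cs * Nb / \<alpha> + 2 * ds + 1)" by (intro mult_left_mono) auto
    also have "\<dots> \<le> (\<epsilon>' / (cs * Nb / \<alpha> + 2 * ds + 1)) * (cs * Nb / \<alpha> + 2 * ds + 1)"
      using den by (intro mult_right_mono) (auto simp: \<eta>_def)
    finally show "\<eta> * (cs * Nb / \<alpha> + 2 * ds) \<le> \<epsilon>'" using den by simp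
  qed
  define K2 where "K2 = ds * (2 * C\<^sup>2 * real k) * 2"
  define K1 where "K1 = \<bar>cs * ln (Nb * G0)\<bar> + \<bar>ds * (ln (\<epsilon> / 2) - 2)\<bar> + ds * (2 * C\<^sup>2 * real k) * (2 * real k * r0\<^sup>2)"
  have K2: "0 \<le> K2" and K1: "0 \<le> K1" using ds by (auto simp: K1_def K2_def intro!: add_nonneg_nonneg mult_nonneg_nonneg)
  \<comment> \<open>At time \<open>b / (4 * \<beta>)\<close> the tail factor beyond distance
    \<open>r\<close> is \<open>exp (- (\<beta> * r\<^sup>2))\<close>, independently of
    \<open>b\<close>. Besides \<open>1 \<le> \<beta>\<close>, the entries make the tail small at
    distance \<tau>, keep the loss at distance 1 below one half, and let the decay on the side of
    the \<open>f i\<close> beat that of the Gaussian floor.\<close>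
  define \<beta> where "\<beta> = Max {1, G0 / (\<eta> * \<tau>\<^sup>2), 2 * G0, (K2 + K1 / \<tau>\<^sup>2) / cm}"
  have \<beta>: "1 \<le> \<beta>" "G0 / (\<eta> * \<tau>\<^sup>2) \<le> \<beta>" "2 * G0 \<le> \<beta>" "(K2 + K1 / \<tau>\<^sup>2) / cm \<le> \<beta>"
    by (auto simp: \<beta>_def)
  have e1: "G0 * exp (- (\<beta> * \<tau>\<^sup>2)) \<le> \<eta>"
  proof -
    have p: "0 < \<beta> * \<tau>\<^sup>2" using \<beta>(1) \<tau> by simp
    have "G0 * exp (- (\<beta> * \<tau>\<^sup>2)) \<le> G0 * (1 / (\<beta> * \<tau>\<^sup>2))" using G0(1) by (intro mult_left_mono exp_neg_le_inverse p) auto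
    also have "G0 \<le> \<beta> * (\<eta> * \<tau>\<^sup>2)" using \<beta>(2) \<eta> \<tau> by (simp add: pos_divide_le_eq)
    then have "G0 * (1 / (\<beta> * \<tau>\<^sup>2)) \<le> \<eta>" using p by (simp add: pos_divide_le_eq mult_ac)
    finally show ?thesis .
  qed
  have e2: "G0 * exp (- \<beta>) \<le> 1 / 2"
  proof -
    have "G0 * exp (- \<beta>) \<le> G0 * (1 / \<beta>)" using G0(1) \<beta>(1) by (intro mult_left_mono exp_neg_le_inverse) auto
    also have "\<dots> \<le> 1 / 2" using \<beta>(1,3) by (simp add: field_simps)
    finally show ?thesis .
  qed
  show ?thesis
  proof (intro exI[of _ \<beta>] conjI allI impI)
    show "0 < \<beta>" using \<beta>(1) by simp
    fix b :: real and P R x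
    assume b: "0 < b" and PP: "\<forall>i\<in>{1..k}. posdef_on (E i) (P i) \<and> (\<forall>x\<in>E i. b * (x \<bullet> x) \<le> P i x \<bullet> x)"
      and RR: "\<forall>j\<in>{1..m}. posdef_on (F j) (R j) \<and> (\<forall>x\<in>F j. b * (x \<bullet> x) \<le> R j x \<bullet> x)"
      and x: "x \<in> XE" and hp: "\<forall>i\<in>{1..k}. 0 < heat (P i) (NE i) (b / (4 * \<beta>)) (x i)"
    define t where "t = b / (4 * \<beta>)"
    have t: "t > 0" using b \<beta>(1) by (simp add: t_def)
    have te: "(b * r\<^sup>2) / (4 * t) = \<beta> * r\<^sup>2" for r using b \<beta>(1) by (simp add: t_def field_simps)
    define u where "u i = heat (P i) (NE i) t (x i) / (sqrt t ^ dim (E i) * Zg (E i) (P i))" for i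
    define v where "v j = heat (R j) (NF \<epsilon> j) t (M j x) / (sqrt t ^ dim (F j) * Zg (F j) (R j))" for j
    have mE: "0 < sqrt t ^ dim (E i) * Zg (E i) (P i)" if "i \<in> {1..k}" for i
      using t Zg_pos[OF E_subspace[OF that]] PP that by simp
    have mF: "0 < sqrt t ^ dim (F j) * Zg (F j) (R j)" if "j \<in> {1..m}" for j
      using t Zg_pos[OF F_subspace[OF that]] RR that by simp
    have u0: "0 < u i" if "i \<in> {1..k}" for i
      unfolding u_def using hp that mE[OF that] by (simp add: t_def)
    have up: "u i \<le> s + Nb * (G0 * exp (- (\<beta> * r\<^sup>2)))"
      if i: "i \<in> {1..k}" and r: "0 \<le> r" and loc: "\<And>y. y \<in> E i \<Longrightarrow> norm (y - x i) < r \<Longrightarrow> f i y \<le> s" and s: "0 \<le> s" for i r s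
    proof -
      have "heat (P i) (NE i) t (x i) \<le> sqrt t ^ dim (E i) * Zg (E i) (P i) * (s + Nb * (sqrt 2 ^ dim (E i) * exp (- (b * r\<^sup>2) / (4 * t))))"
        by (rule heat_density_upper[OF E_subspace[OF i] _ _ _ f_meas[OF i] f_nonneg[OF i] f_le[OF i] XE_D[OF x i] t r loc s])
          (use PP i b in auto)
      then have "u i \<le> s + Nb * (sqrt 2 ^ dim (E i) * exp (- (b * r\<^sup>2) / (4 * t)))"
        unfolding u_def using mE[OF i] by (simp add: pos_divide_le_eq mult.commute)
      also have "exp (- (b * r\<^sup>2) / (4 * t)) = exp (- (\<beta> * r\<^sup>2))" using te[of r] by simp
      also have "s + Nb * (sqrt 2 ^ dim (E i) * exp (- (\<beta> * r\<^sup>2))) \<le> s + Nb * (G0 * exp (- (\<beta> * r\<^sup>2)))"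
        using Nb by (intro add_left_mono mult_left_mono mult_right_mono G0 i) auto
      finally show ?thesis .
    qed
    have lo: "s * (1 - G0 * exp (- (\<beta> * r\<^sup>2))) \<le> v j"
      if j: "j \<in> {1..m}" and r: "0 \<le> r" and loc: "\<And>y. y \<in> F j \<Longrightarrow> norm (y - M j x) < r \<Longrightarrow> s \<le> fl \<epsilon> j y" and s: "0 \<le> s" for j r s
    proof -
      have "sqrt t ^ dim (F j) * Zg (F j) (R j) * (s * (1 - sqrt 2 ^ dim (F j) * exp (- (b * r\<^sup>2) / (4 * t)))) \<le> heat (R j) (NF \<epsilon> j) t (M j x)"
        by (rule heat_density_lower[OF F_subspace[OF j] _ _ _ fl_meas[OF j] less_imp_le[OF fl_bounds(2)[OF j \<epsilon>]] fl_bounds(3)[OF j \<epsilon>] M_in[OF x j] t r loc s])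
          (use RR j b in auto)
      then have "s * (1 - sqrt 2 ^ dim (F j) * exp (- (b * r\<^sup>2) / (4 * t))) \<le> v j"
        unfolding v_def using mF[OF j] by (simp add: pos_le_divide_eq mult.commute)
      moreover have "exp (- (b * r\<^sup>2) / (4 * t)) = exp (- (\<beta> * r\<^sup>2))" using te[of r] by simp
      moreover have "s * (1 - G0 * exp (- (\<beta> * r\<^sup>2))) \<le> s * (1 - sqrt 2 ^ dim (F j) * exp (- (\<beta> * r\<^sup>2)))"
        using s by (intro mult_left_mono diff_left_mono mult_right_mono G0 j) auto
      ultimately show ?thesis by simp
    qed
    have "(\<Sum>i=1..k. c i * ln (u i)) \<le> (\<Sum>j=1..m. d j * ln (v j)) + \<epsilon>'"
    proof (cases "\<forall>i\<in>{1..k}. \<exists>y. y \<in> E i \<and> norm (y - x i) < \<tau> \<and> 0 < f i y")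
      \<comment> \<open>Every \<open>f i\<close> is positive somewhere near \<open>x i\<close>. The
        largest nearby values of the \<open>f i\<close> and the smallest nearby values of the
        \<open>g j\<close> are compared by \<open>robust\<close>.\<close>
      case True
      have "\<exists>y. y \<in> E i \<and> norm (y - x i) < \<tau> \<and> (\<forall>y'. y' \<in> E i \<longrightarrow> norm (y' - x i) < \<tau> \<longrightarrow> f i y' \<le> f i y)" if i: "i \<in> {1..k}" for i
      proof -
        let ?W = "f i ` {y. y \<in> E i \<and> norm (y - x i) < \<tau>}"
        have W: "finite ?W" "?W \<noteq> {}" using f_fin[OF i] True i by (auto intro: finite_subset[of _ "range (f i)"])
        obtain y where "y \<in> E i" "norm (y - x i) < \<tau>" "f i y = Max ?W" using Max_in[OF W] by auto
        then show ?thesis using Max_ge[OF W(1)] by (intro exI[of _ y]) auto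
      qed
      then obtain y where y: "\<And>i. i \<in> {1..k} \<Longrightarrow> y i \<in> E i \<and> norm (y i - x i) < \<tau>"
        and ymax: "\<And>i y'. i \<in> {1..k} \<Longrightarrow> y' \<in> E i \<Longrightarrow> norm (y' - x i) < \<tau> \<Longrightarrow> f i y' \<le> f i (y i)" by metis
      have "\<exists>z. z \<in> F j \<and> norm (z - M j x) < \<tau> \<and> (\<forall>z'. z' \<in> F j \<longrightarrow> norm (z' - M j x) < \<tau> \<longrightarrow> g j z \<le> g j z')" if j: "j \<in> {1..m}" for j
      proof -
        let ?W = "g j ` {z. z \<in> F j \<and> norm (z - M j x) < \<tau>}"
        have "M j x \<in> {z. z \<in> F j \<and> norm (z - M j x) < \<tau>}" using M_in[OF x j] \<tau> by simp
        then have W: "finite ?W" "?W \<noteq> {}" using g_fin[OF j] by (auto intro: finite_subset[of _ "range (g j)"])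
        obtain z where "z \<in> F j" "norm (z - M j x) < \<tau>" "g j z = Min ?W" using Min_in[OF W] by auto
        then show ?thesis using Min_le[OF W(1)] by (intro exI[of _ z]) auto
      qed
      then obtain z where z: "\<And>j. j \<in> {1..m} \<Longrightarrow> z j \<in> F j \<and> norm (z j - M j x) < \<tau>"
        and zmin: "\<And>j z'. j \<in> {1..m} \<Longrightarrow> z' \<in> F j \<Longrightarrow> norm (z' - M j x) < \<tau> \<Longrightarrow> g j (z j) \<le> g j z'" by metis
      have fy: "0 < f i (y i)" if "i \<in> {1..k}" for i using True ymax that by (meson less_le_trans)
      have prod: "(\<Prod>i=1..k. f i (y i) powr c i) \<le> (\<Prod>j=1..m. g j (z j) powr d j)"
        by (rule robust[OF x y z])
      have pf: "0 < (\<Prod>i=1..k. f i (y i) powr c i)" proof (rule prod_pos)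
      fix i assume i: "i \<in> {1..k}"
      show "0 < f i (y i) powr c i" using fy[OF i] by simp
    qed
      have gz: "0 < g j (z j)" if j: "j \<in> {1..m}" for j
      proof (rule ccontr)
        assume "\<not> ?thesis"
        then have "g j (z j) = 0" using g_nonneg[OF j] by (simp add: less_le)
        then have "(\<Prod>j=1..m. g j (z j) powr d j) = 0" using j by (auto simp: prod_zero_iff)
        then show False using order.strict_trans2[OF pf prod] by (simp only: less_irrefl)
      qed
      have fy0: "\<And>i. i \<in> {1..k} \<Longrightarrow> f i (y i) \<noteq> 0" and gz0: "\<And>j. j \<in> {1..m} \<Longrightarrow> g j (z j) \<noteq> 0"
        using order.strict_implies_not_eq[OF fy] order.strict_implies_not_eq[OF gz] by simp_all
      have "ln (\<Prod>i=1..k. f i (y i) powr c i) \<le> ln (\<Prod>j=1..m. g j (z j) powr d j)"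
        by (rule ln_mono[OF prod pf])
      moreover have "ln (\<Prod>i=1..k. f i (y i) powr c i) = (\<Sum>i=1..k. c i * ln (f i (y i)))"
      proof -
        have "ln (\<Prod>i=1..k. f i (y i) powr c i) = (\<Sum>i=1..k. ln (f i (y i) powr c i))"
          by (rule ln_prod) (use fy0 in simp_all)
        also have "\<dots> = (\<Sum>i=1..k. c i * ln (f i (y i)))" by (rule sum.cong) (simp_all add: ln_powr)
        finally show ?thesis .
      qed
      moreover have "ln (\<Prod>j=1..m. g j (z j) powr d j) = (\<Sum>j=1..m. d j * ln (g j (z j)))"
      proof -
        have "ln (\<Prod>j=1..m. g j (z j) powr d j) = (\<Sum>j=1..m. ln (g j (z j) powr d j))"
          by (rule ln_prod) (use gz0 in simp_all)
        also have "\<dots> = (\<Sum>j=1..m. d j * ln (g j (z j)))" by (rule sum.cong) (simp_all add: ln_powr)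
        finally show ?thesis .
      qed
      ultimately have base: "(\<Sum>i=1..k. c i * ln (f i (y i))) \<le> (\<Sum>j=1..m. d j * ln (g j (z j)))" by simp
      have "(\<Sum>i=1..k. c i * ln (u i)) \<le> (\<Sum>i=1..k. c i * (ln (f i (y i)) + Nb * \<eta> / \<alpha>))"
      proof (intro sum_mono mult_left_mono less_imp_le[OF c_pos])
        fix i assume i: "i \<in> {1..k}"
        have "u i \<le> f i (y i) + Nb * (G0 * exp (- (\<beta> * \<tau>\<^sup>2)))"
          by (rule up[OF i]) (use ymax[OF i] fy[OF i] \<tau> in auto)
        also have "\<dots> \<le> f i (y i) + Nb * \<eta>" using e1 Nb by simp
        also have "\<dots> = f i (y i) * (1 + Nb * \<eta> / f i (y i))" using fy[OF i] by (simp add: field_simps)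
        finally have "ln (u i) \<le> ln (f i (y i) * (1 + Nb * \<eta> / f i (y i)))" using u0[OF i] by (intro ln_mono) auto
        also have "\<dots> = ln (f i (y i)) + ln (1 + Nb * \<eta> / f i (y i))"
          using fy[OF i] Nb \<eta> by (intro ln_mult_pos) (auto intro!: add_pos_nonneg)
        also have "ln (1 + Nb * \<eta> / f i (y i)) \<le> Nb * \<eta> / f i (y i)"
          using fy[OF i] Nb \<eta> by (intro ln_add_one_self_le_self) auto
        also have "Nb * \<eta> / f i (y i) \<le> Nb * \<eta> / \<alpha>"
          using \<alpha>_le[OF i fy[OF i]] \<alpha> Nb \<eta> by (intro divide_left_mono) auto
        finally show "ln (u i) \<le> ln (f i (y i)) + Nb * \<eta> / \<alpha>" by simp
      qed
      also have "\<dots> = (\<Sum>i=1..k. c i * ln (f i (y i))) + \<eta> * (cs * Nb / \<alpha>)"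
        by (simp add: distrib_left sum.distrib cs_def sum_distrib_right[symmetric] sum_divide_distrib[symmetric])
      finally have 1: "(\<Sum>i=1..k. c i * ln (u i)) \<le> (\<Sum>i=1..k. c i * ln (f i (y i))) + \<eta> * (cs * Nb / \<alpha>)" .
      have "(\<Sum>j=1..m. d j * (ln (g j (z j)) - 2 * \<eta>)) \<le> (\<Sum>j=1..m. d j * ln (v j))"
      proof (intro sum_mono mult_left_mono less_imp_le[OF d_pos])
        fix j assume j: "j \<in> {1..m}"
        have "g j (z j) * (1 - \<eta>) \<le> g j (z j) * (1 - G0 * exp (- (\<beta> * \<tau>\<^sup>2)))"
          using e1 gz[OF j] by (intro mult_left_mono) auto
        also have "\<dots> \<le> v j"
          by (rule lo[OF j]) (use zmin[OF j] fl_bounds(1)[OF j \<epsilon>] gz[OF j] \<tau> in \<open>auto intro: order_trans\<close>)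
        finally have "ln (g j (z j) * (1 - \<eta>)) \<le> ln (v j)" using gz[OF j] \<eta> by (intro ln_mono) auto
        moreover have "ln (g j (z j) * (1 - \<eta>)) = ln (g j (z j)) + ln (1 - \<eta>)" using gz[OF j] \<eta> by (intro ln_mult_pos) auto
        moreover have "- 2 * \<eta> \<le> ln (1 - \<eta>)"
        proof -
          have "- \<eta> - 2 * \<eta>\<^sup>2 \<le> ln (1 - \<eta>)" using \<eta> by (intro ln_one_minus_pos_lower_bound) auto
          moreover have "\<eta> * \<eta> \<le> \<eta> * (1/2)" using \<eta> by (intro mult_left_mono) auto
          ultimately show ?thesis by (simp add: power2_eq_square)
        qed
        ultimately show "ln (g j (z j)) - 2 * \<eta> \<le> ln (v j)" by linarith
      qed
      moreover have "(\<Sum>j=1..m. d j * (ln (g j (z j)) - 2 * \<eta>)) = (\<Sum>j=1..m. d j * ln (g j (z j))) - \<eta> * (2 * ds)"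
        by (simp add: right_diff_distrib sum_subtractf ds_def sum_distrib_right[symmetric])
      ultimately show ?thesis using 1 base \<eta>' by (simp add: distrib_left)
    next
      \<comment> \<open>Some \<open>f i0\<close> vanishes near \<open>x i0\<close>. The left side
        then contains \<open>- cm * \<beta> * \<sigma>\<close>, while the floor in \<open>fl\<close>
        bounds the right side below by a multiple of \<open>- \<sigma>\<close> and a constant,
        neither of which involves \<beta>.\<close>
      case False
      then obtain i0 where i0: "i0 \<in> {1..k}" and z0: "\<And>y. y \<in> E i0 \<Longrightarrow> norm (y - x i0) < \<tau> \<Longrightarrow> f i0 y = 0"
        using f_nonneg by (metis less_le)
      \<comment> \<open>A radius around \<open>x i\<close> within which \<open>f i\<close> vanishes:
        the distance from \<open>x i\<close> to the ball of radius \<open>r0\<close>, and for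
        \<open>i0\<close> at least \<tau>.\<close>
      define \<rho> where "\<rho> i = (if i = i0 then max \<tau> (norm (x i) - r0) else max 0 (norm (x i) - r0))" for i
      have \<rho>0: "0 \<le> \<rho> i" and \<rho>x: "norm (x i) \<le> r0 + \<rho> i" for i using \<tau> by (auto simp: \<rho>_def)
      have vanish: "f i y \<le> 0" if i: "i \<in> {1..k}" and y: "y \<in> E i" "norm (y - x i) < \<rho> i" for i y
      proof (cases "norm (y - x i) < norm (x i) - r0")
        case True
        have "norm (x i) \<le> norm y + norm (y - x i)" by (metis norm_minus_commute norm_triangle_sub)
        then have "r0 < norm y" using True by linarith
        then show ?thesis using f_supp[OF i] by simp
      next
        case False
        then have "i = i0" "norm (y - x i) < \<tau>" using y(2) by (auto simp: \<rho>_def split: if_splits) (smt (verit) norm_ge_zero)+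
        then show ?thesis using z0 y(1) by simp
      qed
      define \<sigma> where "\<sigma> = (\<Sum>i=1..k. (\<rho> i)\<^sup>2)"
      have \<sigma>: "\<tau>\<^sup>2 \<le> \<sigma>"
      proof -
        have "\<tau>\<^sup>2 \<le> (\<rho> i0)\<^sup>2" using \<tau> by (intro power_mono) (auto simp: \<rho>_def)
        also have "\<dots> \<le> \<sigma>" unfolding \<sigma>_def using i0 by (intro member_le_sum) auto
        finally show ?thesis .
      qed
      have NG: "0 < Nb * G0" using Nb G0(1) by simp
      have "(\<Sum>i=1..k. c i * ln (u i)) \<le> (\<Sum>i=1..k. c i * ln (Nb * G0) - cm * \<beta> * (\<rho> i)\<^sup>2)"
      proof (rule sum_mono)
        fix i assume i: "i \<in> {1..k}"
        have "u i \<le> 0 + Nb * (G0 * exp (- (\<beta> * (\<rho> i)\<^sup>2)))"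
          by (rule up[OF i \<rho>0]) (use vanish[OF i] in auto)
        then have "ln (u i) \<le> ln ((Nb * G0) * exp (- (\<beta> * (\<rho> i)\<^sup>2)))" using u0[OF i] by (intro ln_mono) (auto simp: mult.assoc)
        also have "\<dots> = ln (Nb * G0) + ln (exp (- (\<beta> * (\<rho> i)\<^sup>2)))" using NG by (intro ln_mult_pos) auto
        finally have "c i * ln (u i) \<le> c i * (ln (Nb * G0) - \<beta> * (\<rho> i)\<^sup>2)" using c_pos[OF i] by (intro mult_left_mono) auto
        moreover have "cm * (\<beta> * (\<rho> i)\<^sup>2) \<le> c i * (\<beta> * (\<rho> i)\<^sup>2)" using cm(2)[OF i] \<beta>(1) by (intro mult_right_mono) auto
        ultimately show "c i * ln (u i) \<le> c i * ln (Nb * G0) - cm * \<beta> * (\<rho> i)\<^sup>2" by (simp add: right_diff_distrib mult.assoc)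
      qed
      also have "\<dots> = cs * ln (Nb * G0) - cm * \<beta> * \<sigma>"
        by (simp add: sum_subtractf cs_def \<sigma>_def sum_distrib_right sum_distrib_left)
      finally have 1: "(\<Sum>i=1..k. c i * ln (u i)) \<le> cs * ln (Nb * G0) - cm * \<beta> * \<sigma>" .
      have nx: "(\<Sum>i=1..k. norm (x i))\<^sup>2 \<le> real k * (2 * real k * r0\<^sup>2 + 2 * \<sigma>)"
      proof -
        have "(\<Sum>i=1..k. norm (x i))\<^sup>2 \<le> real k * (\<Sum>i=1..k. (norm (x i))\<^sup>2)"
          using sum_squared_le_sum_of_squares[of "\<lambda>i. norm (x i)" "{1..k}"] by (simp add: mult.commute)
        also have "(\<Sum>i=1..k. (norm (x i))\<^sup>2) \<le> (\<Sum>i=1..k. 2 * r0\<^sup>2 + 2 * (\<rho> i)\<^sup>2)"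
        proof (rule sum_mono)
          fix i
          have "(norm (x i))\<^sup>2 \<le> (r0 + \<rho> i)\<^sup>2" using \<rho>x by (intro power_mono) auto
          also have "\<dots> \<le> 2 * r0\<^sup>2 + 2 * (\<rho> i)\<^sup>2" using sum_squares_bound[of r0 "\<rho> i"] by (simp add: power2_sum)
          finally show "(norm (x i))\<^sup>2 \<le> 2 * r0\<^sup>2 + 2 * (\<rho> i)\<^sup>2" .
        qed
        also have "\<dots> = 2 * real k * r0\<^sup>2 + 2 * \<sigma>" by (simp add: sum.distrib \<sigma>_def sum_distrib_left)
        finally show ?thesis by (simp add: mult_left_mono)
      qed
      have "(\<Sum>j=1..m. d j * (ln (\<epsilon> / 2) - 2 - 2 * (C\<^sup>2 * (real k * (2 * real k * r0\<^sup>2 + 2 * \<sigma>))))) \<le> (\<Sum>j=1..m. d j * ln (v j))"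
      proof (intro sum_mono mult_left_mono less_imp_le[OF d_pos])
        fix j assume j: "j \<in> {1..m}"
        \<comment> \<open>A lower bound for the floor on the unit ball around \<open>M j x\<close>,
          from \<open>(norm (M j x) + 1)\<^sup>2 \<le> 2 + 2 * (norm (M j
          x))\<^sup>2\<close>.\<close>
        let ?s = "\<epsilon> * exp (- 2 - 2 * (norm (M j x))\<^sup>2)"
        have "?s \<le> fl \<epsilon> j y" if "norm (y - M j x) < 1" for y
        proof -
          have "norm y \<le> norm (M j x) + 1" using that norm_triangle_sub[of y "M j x"] by linarith
          then have "(norm y)\<^sup>2 \<le> (norm (M j x) + 1)\<^sup>2" by (intro power_mono) auto
          also have "\<dots> \<le> 2 + 2 * (norm (M j x))\<^sup>2" using sum_squares_bound[of "norm (M j x)" 1] by (simp add: power2_sum)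
          finally have "\<epsilon> * exp (- 2 - 2 * (norm (M j x))\<^sup>2) \<le> \<epsilon> * exp (- (2 * (y \<bullet> y)) / 2)"
            using \<epsilon> by (intro mult_left_mono) (auto simp: dot_square_norm)
          then show ?thesis using g_nonneg[OF j, of y] by (simp add: fl_def)
        qed
        then have "?s * (1 - G0 * exp (- (\<beta> * 1\<^sup>2))) \<le> v j"
          by (intro lo[OF j]) (use \<epsilon> in auto)
        moreover have "?s * (1 / 2) \<le> ?s * (1 - G0 * exp (- (\<beta> * 1\<^sup>2)))" using e2 \<epsilon> by (intro mult_left_mono) auto
        ultimately have "(\<epsilon> / 2) * exp (- 2 - 2 * (norm (M j x))\<^sup>2) \<le> v j" by simp
        then have "ln ((\<epsilon> / 2) * exp (- 2 - 2 * (norm (M j x))\<^sup>2)) \<le> ln (v j)" using \<epsilon> by (intro ln_mono) auto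
        moreover have "ln ((\<epsilon> / 2) * exp (- 2 - 2 * (norm (M j x))\<^sup>2)) = ln (\<epsilon> / 2) + ln (exp (- 2 - 2 * (norm (M j x))\<^sup>2))"
          using \<epsilon> by (intro ln_mult_pos) auto
        moreover have "(norm (M j x))\<^sup>2 \<le> C\<^sup>2 * (real k * (2 * real k * r0\<^sup>2 + 2 * \<sigma>))"
        proof -
          have "(norm (M j x))\<^sup>2 \<le> (C * (\<Sum>i=1..k. norm (x i)))\<^sup>2" using C(2)[OF j] by (intro power_mono) auto
          also have "\<dots> \<le> C\<^sup>2 * (real k * (2 * real k * r0\<^sup>2 + 2 * \<sigma>))"
            unfolding power_mult_distrib by (intro mult_left_mono nx) auto
          finally show ?thesis .
        qed
        ultimately show "ln (\<epsilon> / 2) - 2 - 2 * (C\<^sup>2 * (real k * (2 * real k * r0\<^sup>2 + 2 * \<sigma>))) \<le> ln (v j)" by simp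
      qed
      moreover have "(\<Sum>j=1..m. d j * (ln (\<epsilon> / 2) - 2 - 2 * (C\<^sup>2 * (real k * (2 * real k * r0\<^sup>2 + 2 * \<sigma>)))))
        = ds * (ln (\<epsilon> / 2) - 2) - ds * (2 * C\<^sup>2 * real k) * (2 * real k * r0\<^sup>2) - K2 * \<sigma>"
        unfolding sum_distrib_right[symmetric] ds_def[symmetric] by (simp add: K2_def algebra_simps)
      ultimately have 2: "- K1 + \<bar>cs * ln (Nb * G0)\<bar> - K2 * \<sigma> \<le> (\<Sum>j=1..m. d j * ln (v j))"
        unfolding K1_def by linarith
      have "K2 + K1 / \<tau>\<^sup>2 \<le> cm * \<beta>" using \<beta>(4) cm(1) by (simp add: pos_divide_le_eq mult.commute)
      then have "(K2 + K1 / \<tau>\<^sup>2) * \<sigma> \<le> cm * \<beta> * \<sigma>" using \<sigma> by (intro mult_right_mono) (auto intro: order_trans[OF zero_le_power2])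
      moreover have "K1 \<le> K1 / \<tau>\<^sup>2 * \<sigma>"
      proof -
        have "K1 / \<tau>\<^sup>2 * \<tau>\<^sup>2 \<le> K1 / \<tau>\<^sup>2 * \<sigma>" using K1 \<sigma> by (intro mult_left_mono) auto
        then show ?thesis using \<tau> by simp
      qed
      ultimately have "K1 + K2 * \<sigma> \<le> cm * \<beta> * \<sigma>" by (simp add: distrib_right)
      with 1 2 \<epsilon>' show ?thesis by linarith
    qed
    then show "(\<Sum>i=1..k. c i * ln (heat (P i) (NE i) (b / (4 * \<beta>)) (x i) / (sqrt (b / (4 * \<beta>)) ^ dim (E i) * Zg (E i) (P i))))
      \<le> (\<Sum>j=1..m. d j * ln (heat (R j) (NF \<epsilon> j) (b / (4 * \<beta>)) (M j x) / (sqrt (b / (4 * \<beta>)) ^ dim (F j) * Zg (F j) (R j)))) + \<epsilon>'"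
      unfolding u_def v_def t_def .
  qed
qed

lemma f_int: assumes i: "i \<in> {1..k}" shows "(\<integral>\<^sup>+y. ennreal (f i y) \<partial>lborel_on (E i)) < \<infinity>"
proof -
  have "f i y \<le> Nb * exp (r0\<^sup>2) * exp (- (2 * (y \<bullet> y)) / 2)" for y
  proof (cases "r0 < norm y")
    case True
    then show ?thesis using f_supp[OF i] Nb by simp
  next
    case False
    then have "(norm y)\<^sup>2 \<le> r0\<^sup>2" by (intro power_mono) auto
    then have "1 \<le> exp (r0\<^sup>2) * exp (- (2 * (y \<bullet> y)) / 2)" by (simp add: exp_add[symmetric] dot_square_norm)
    then have "Nb * 1 \<le> Nb * (exp (r0\<^sup>2) * exp (- (2 * (y \<bullet> y)) / 2))" using Nb by (intro mult_left_mono) auto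
    then show ?thesis using f_le[OF i, of y] by (simp add: mult.assoc)
  qed
  then have "(\<integral>\<^sup>+y. ennreal (f i y) \<partial>lborel_on (E i)) \<le> (\<integral>\<^sup>+y. ennreal (Nb * exp (r0\<^sup>2)) * ennreal (exp (- (2 * (y \<bullet> y)) / 2)) \<partial>lborel_on (E i))"
    using Nb by (intro nn_integral_mono) (simp add: ennreal_mult'[symmetric])
  also have "\<dots> = ennreal (Nb * exp (r0\<^sup>2)) * (\<integral>\<^sup>+y. ennreal (exp (- (2 * (y \<bullet> y)) / 2)) \<partial>lborel_on (E i))"
    by (rule nn_integral_cmult) measurable
  also have "\<dots> < \<infinity>"
    by (subst nn_integral_lborel_on_gaussian[OF E_subspace[OF i]]) (simp_all add: ennreal_mult_less_top)
  finally show ?thesis .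
qed

lemma fl_int:
  assumes j: "j \<in> {1..m}" and \<epsilon>: "0 < \<epsilon>"
  shows "(\<integral>\<^sup>+z. ennreal (fl \<epsilon> j z) \<partial>lborel_on (F j)) = (\<integral>\<^sup>+z. ennreal (g j z) \<partial>lborel_on (F j)) + ennreal (\<epsilon> * sqrt pi ^ dim (F j))"
proof -
  have [measurable]: "g j \<in> borel_measurable (lborel_on (F j))" by (rule borel_measurable_lborel_on[OF g_meas[OF j]])
  have "(\<integral>\<^sup>+z. ennreal (fl \<epsilon> j z) \<partial>lborel_on (F j)) = (\<integral>\<^sup>+z. ennreal (g j z) + ennreal \<epsilon> * ennreal (exp (- (2 * (z \<bullet> z)) / 2)) \<partial>lborel_on (F j))"
    unfolding fl_def using g_nonneg[OF j] \<epsilon> by (intro nn_integral_cong) (simp add: ennreal_mult)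
  also have "\<dots> = (\<integral>\<^sup>+z. ennreal (g j z) \<partial>lborel_on (F j)) + (\<integral>\<^sup>+z. ennreal \<epsilon> * ennreal (exp (- (2 * (z \<bullet> z)) / 2)) \<partial>lborel_on (F j))"
    by (rule nn_integral_add) measurable
  also have "(\<integral>\<^sup>+z. ennreal \<epsilon> * ennreal (exp (- (2 * (z \<bullet> z)) / 2)) \<partial>lborel_on (F j)) = ennreal \<epsilon> * ennreal (sqrt (2 * pi / 2) ^ dim (F j))"
    by (subst nn_integral_cmult, measurable) (subst nn_integral_lborel_on_gaussian[OF F_subspace[OF j]], auto)
  also have "\<dots> = ennreal (\<epsilon> * sqrt pi ^ dim (F j))" using \<epsilon> by (simp add: ennreal_mult)
  finally show ?thesis .
qed

text \<open>There are three losses of at most \<open>e\<close> each: in the comparison at the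
  starting time, in the defect accumulated along the flow, and in the comparison with total masses
  at time \<open>T\<close>. \<beta> and \<open>T\<close> are chosen before the forms, whose bound
  \<open>A\<close> then fixes the starting time.\<close>

lemma log_inequality:
  assumes adm: "\<forall>P R. formsD P R \<longrightarrow> Phi P R \<le> D" and \<epsilon>: "0 < \<epsilon>" "\<epsilon> \<le> 1"
  shows "(\<Sum>i=1..k. c i * ln (measure (NE i) (E i))) \<le> D + (\<Sum>j=1..m. d j * ln (measure (NF \<epsilon> j) (F j)))"
proof (rule field_le_epsilon)
  fix e0 :: real assume e0: "0 < e0"
  define e where "e = e0 / 3"
  have e: "e > 0" using e0 by (simp add: e_def)
  define cs where "cs = (\<Sum>i=1..k. c i)"
  have cs: "0 \<le> cs" unfolding cs_def using c_pos by (intro sum_nonneg) (auto simp: less_imp_le)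
  obtain \<beta> where \<beta>: "\<beta> > 0" and small: "\<And>b P R x. 0 < b \<Longrightarrow>
    (\<forall>i\<in>{1..k}. posdef_on (E i) (P i) \<and> (\<forall>x\<in>E i. b * (x \<bullet> x) \<le> P i x \<bullet> x)) \<Longrightarrow>
    (\<forall>j\<in>{1..m}. posdef_on (F j) (R j) \<and> (\<forall>x\<in>F j. b * (x \<bullet> x) \<le> R j x \<bullet> x)) \<Longrightarrow> x \<in> XE \<Longrightarrow>
    (\<forall>i\<in>{1..k}. 0 < heat (P i) (NE i) (b / (4 * \<beta>)) (x i)) \<Longrightarrow>
    (\<Sum>i=1..k. c i * ln (heat (P i) (NE i) (b / (4 * \<beta>)) (x i) / (sqrt (b / (4 * \<beta>)) ^ dim (E i) * Zg (E i) (P i))))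
    \<le> (\<Sum>j=1..m. d j * ln (heat (R j) (NF \<epsilon> j) (b / (4 * \<beta>)) (M j x) / (sqrt (b / (4 * \<beta>)) ^ dim (F j) * Zg (F j) (R j)))) + e"
    using small_time_comparison[OF \<epsilon> e] by blast
  \<comment> \<open>Large enough that the kernel loses at most \<open>e\<close> over the supports of
    the \<open>f i\<close>, and that the starting time precedes \<open>T\<close> whatever
    \<open>A \<ge> 0\<close> will be.\<close>
  define T where "T = 1 / (4 * \<beta>) + cs * r0\<^sup>2 / (2 * e) + 1"
  have Tparts: "0 < 1 / (4 * \<beta>)" "0 \<le> cs * r0\<^sup>2 / (2 * e)" using \<beta> cs e by auto
  then have T: "0 < T" "1 / (4 * \<beta>) \<le> T" "cs * r0\<^sup>2 / (2 * e) \<le> T" unfolding T_def by linarith+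
  have Tr: "cs * (r0\<^sup>2 / (2 * T)) \<le> e"
    using T(1,3) e by (simp add: field_simps)
  define l where "l = \<bar>ln (4 * \<beta> * T)\<bar>"
  have l: "0 \<le> l" by (simp add: l_def)
  \<comment> \<open>Since \<open>ln (T / t0)\<close> is at most \<open>l + A\<close>, a defect whose
    product with \<open>1 + A\<close> is at most \<open>e2\<close> accumulates to less than
    \<open>e\<close>.\<close>
  define e2 where "e2 = e / (1 + l)"
  have e2: "e2 > 0" using e l by (simp add: e2_def)
  obtain P R \<xi> A where D: "formsD P R" and A: "0 \<le> A" and
     lowQ: "\<And>x. x \<in> XE \<Longrightarrow> exp (- A) * nX x \<le> Q P R x x" and
     lowP: "\<forall>i\<in>{1..k}. \<forall>x\<in>E i. exp (- A) * (x \<bullet> x) \<le> P i x \<bullet> x" and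
     lowR: "\<forall>j\<in>{1..m}. \<forall>y\<in>F j. exp (- A) * (y \<bullet> y) \<le> R j y \<bullet> y" and
     \<xi>: "\<And>l. l \<in> IX \<Longrightarrow> \<xi> l \<in> XE" and
     KE: "\<And>i y. i \<in> {1..k} \<Longrightarrow> y \<in> E i \<Longrightarrow> P i y \<bullet> y \<le> (\<Sum>l\<in>IX. (P i y \<bullet> \<xi> l i)\<^sup>2)" and
     KF: "\<And>j y. j \<in> {1..m} \<Longrightarrow> y \<in> F j \<Longrightarrow> (\<Sum>l\<in>IX. (R j y \<bullet> M j (\<xi> l))\<^sup>2) \<le> R j y \<bullet> y" and
     \<delta>: "0 \<le> (\<Sum>l\<in>IX. Q P R (\<xi> l) (\<xi> l))" "(\<Sum>l\<in>IX. Q P R (\<xi> l) (\<xi> l)) * (1 + A) \<le> e2"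
    using approximate_stationary_point[OF adm e2] by (elim exE conjE) blast
  define t0 where "t0 = exp (- A) / (4 * \<beta>)"
  have t0: "0 < t0" using \<beta> by (simp add: t0_def)
  have t0T: "t0 \<le> T"
  proof -
    have "t0 \<le> 1 / (4 * \<beta>)" unfolding t0_def using A \<beta> by (intro divide_right_mono) auto
    then show ?thesis using T(2) by linarith
  qed
  have hE: "heat_flow (NE i) (E i) (P i)" if i: "i \<in> {1..k}" for i
    by (rule heat_flow_density(1)[OF E_subspace[OF i] formsD_D(1)[OF D i] f_meas[OF i] f_int[OF i] f_pos[OF i]])
  have hF: "heat_flow (NF \<epsilon> j) (F j) (R j)" if j: "j \<in> {1..m}" for j
    by (rule heat_flow_density(1)[OF F_subspace[OF j] formsD_D(3)[OF D j] fl_meas[OF j]])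
      (use g_int[OF j] \<epsilon> in \<open>auto simp: fl_int[OF j \<epsilon>(1)] add_pos_nonneg intro!: add_nonneg_pos\<close>)
  interpret H: bl_heat k c E m d F B P R NE "NF \<epsilon>" "exp (- A)" r0
  proof (intro bl_heat.intro bl_heat_axioms.intro)
    show "bl_datum k c E m d F B" by (rule bl_datum_axioms)
    show "AE y in NE i. norm y \<le> r0" if i: "i \<in> {1..k}" for i
    proof -
      have "(\<lambda>y. ennreal (f i y)) \<in> borel_measurable (lborel_on (E i))"
        using borel_measurable_lborel_on[OF f_meas[OF i]] by measurable
      moreover have "norm y \<le> r0" if "0 < f i y" for y using f_supp[OF i, of y] that by (cases "r0 < norm y") auto
      ultimately show ?thesis by (subst AE_density) auto
    qed
    show "exp (- A) * (\<Sum>i=1..k. x i \<bullet> x i) \<le> Q P R x x" if "x \<in> XE" for x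
      using lowQ[OF that] by (simp only: nX_def)
    show "heat_flow (NE i) (E i) (P i)" if "i \<in> {1..k}" for i by (rule hE[OF that])
    show "heat_flow (NF \<epsilon> j) (F j) (R j)" if "j \<in> {1..m}" for j by (rule hF[OF that])
  qed simp
  \<comment> \<open>When the kernels are normalized, the powers of \<open>t0\<close> cancel by
    \<open>dims\<close>, and the Gaussian integrals that remain make up
    \<open>Phi P R\<close>.\<close>
  have init: "- (e + Phi P R) \<le> H.h t0 x" if x: "x \<in> XE" for x
  proof -
    have hp: "0 < heat (P i) (NE i) t0 (x i)" if "i \<in> {1..k}" for i
      by (rule heat_flow.heat_pos[OF hE[OF that] XE_D[OF x that] t0])
    have hq: "0 < heat (R j) (NF \<epsilon> j) t0 (M j x)" if "j \<in> {1..m}" for j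
      by (rule heat_flow.heat_pos[OF hF[OF that] M_in[OF x that] t0])
    have "(\<Sum>i=1..k. c i * ln (heat (P i) (NE i) t0 (x i) / (sqrt t0 ^ dim (E i) * Zg (E i) (P i))))
      \<le> (\<Sum>j=1..m. d j * ln (heat (R j) (NF \<epsilon> j) t0 (M j x) / (sqrt t0 ^ dim (F j) * Zg (F j) (R j)))) + e"
      unfolding t0_def
      by (rule small[OF _ _ _ x]) (use formsD_D[OF D] lowP lowR hp in \<open>auto simp: t0_def\<close>)
    moreover have "(\<Sum>i=1..k. c i * ln (heat (P i) (NE i) t0 (x i) / (sqrt t0 ^ dim (E i) * Zg (E i) (P i))))
      = (\<Sum>i=1..k. c i * ln (heat (P i) (NE i) t0 (x i)) - (c i * real (dim (E i))) * (ln t0 / 2) - c i * ln (Zg (E i) (P i)))"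
    proof (rule sum.cong)
      fix i assume i: "i \<in> {1..k}"
      have z: "0 < Zg (E i) (P i)" by (rule Zg_pos[OF E_subspace[OF i] formsD_D(1)[OF D i]])
      show "c i * ln (heat (P i) (NE i) t0 (x i) / (sqrt t0 ^ dim (E i) * Zg (E i) (P i)))
        = c i * ln (heat (P i) (NE i) t0 (x i)) - (c i * real (dim (E i))) * (ln t0 / 2) - c i * ln (Zg (E i) (P i))"
        using hp[OF i] z t0 by (simp add: ln_div ln_mult_pos ln_sqrt_power algebra_simps)
    qed simp
    moreover have "(\<Sum>j=1..m. d j * ln (heat (R j) (NF \<epsilon> j) t0 (M j x) / (sqrt t0 ^ dim (F j) * Zg (F j) (R j))))
      = (\<Sum>j=1..m. d j * ln (heat (R j) (NF \<epsilon> j) t0 (M j x)) - (d j * real (dim (F j))) * (ln t0 / 2) - d j * ln (Zg (F j) (R j)))"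
    proof (rule sum.cong)
      fix j assume j: "j \<in> {1..m}"
      have z: "0 < Zg (F j) (R j)" by (rule Zg_pos[OF F_subspace[OF j] formsD_D(3)[OF D j]])
      show "d j * ln (heat (R j) (NF \<epsilon> j) t0 (M j x) / (sqrt t0 ^ dim (F j) * Zg (F j) (R j)))
        = d j * ln (heat (R j) (NF \<epsilon> j) t0 (M j x)) - (d j * real (dim (F j))) * (ln t0 / 2) - d j * ln (Zg (F j) (R j))"
        using hq[OF j] z t0 by (simp add: ln_div ln_mult_pos ln_sqrt_power algebra_simps)
    qed simp
    moreover have "(\<Sum>i=1..k. (c i * real (dim (E i))) * (ln t0 / 2)) = (\<Sum>j=1..m. (d j * real (dim (F j))) * (ln t0 / 2))"
      by (simp only: sum_distrib_right[symmetric] dims)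
    ultimately show ?thesis
      unfolding H.h_def Phi_def sum_subtractf by linarith
  qed
  have zX: "(\<lambda>_. 0) \<in> XE" using E_subspace by (auto simp: XE_def subspace_0)
  have M0: "M j (\<lambda>_. 0) = 0" if "j \<in> {1..m}" for j using M_scale[OF that, of 0 "\<lambda>_. 0"] by simp
  have "- (e + Phi P R) - (\<Sum>l\<in>IX. Q P R (\<xi> l) (\<xi> l)) / 2 * ln (T / t0) \<le> H.h T (\<lambda>_. 0)"
    by (rule H.h_comparison[OF t0 t0T finite_IX \<xi> KE KF init zX])
  moreover have "(\<Sum>l\<in>IX. Q P R (\<xi> l) (\<xi> l)) / 2 * ln (T / t0) \<le> e"
  proof -
    have "T / t0 = (4 * \<beta> * T) * exp A" using \<beta> by (simp add: t0_def exp_minus field_simps)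
    then have "ln (T / t0) = ln (4 * \<beta> * T) + A" using \<beta> T(1) by (simp add: ln_mult_pos)
    also have "\<dots> \<le> l + A" by (simp add: l_def)
    also have "\<dots> \<le> (1 + l) * (1 + A)" using l A by (simp add: algebra_simps)
    finally have "(\<Sum>l\<in>IX. Q P R (\<xi> l) (\<xi> l)) / 2 * ln (T / t0) \<le> (\<Sum>l\<in>IX. Q P R (\<xi> l) (\<xi> l)) / 2 * ((1 + l) * (1 + A))"
      using \<delta>(1) by (intro mult_left_mono) auto
    also have "\<dots> = ((\<Sum>l\<in>IX. Q P R (\<xi> l) (\<xi> l)) * (1 + A)) * ((1 + l) / 2)" by (simp add: field_simps)
    also have "\<dots> \<le> e2 * ((1 + l) / 2)" using \<delta>(2) l by (intro mult_right_mono) auto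
    also have "\<dots> = e / 2" using l by (simp add: e2_def field_simps)
    finally show ?thesis using e by simp
  qed
  moreover have "Phi P R \<le> D" using adm D by blast
  \<comment> \<open>At the origin the flow of \<open>f i\<close> is close to its total mass, because
    \<open>P i\<close> is bounded by the identity and the support is bounded; the flow of
    \<open>fl\<close> never exceeds its total mass.\<close>
  moreover have "H.h T (\<lambda>_. 0) \<le> (\<Sum>j=1..m. d j * ln (measure (NF \<epsilon> j) (F j))) - ((\<Sum>i=1..k. c i * ln (measure (NE i) (E i))) - e)"
  proof -
    have "(\<Sum>j=1..m. d j * ln (heat (R j) (NF \<epsilon> j) T (M j (\<lambda>_. 0)))) \<le> (\<Sum>j=1..m. d j * ln (measure (NF \<epsilon> j) (F j)))"
    proof (intro sum_mono mult_left_mono less_imp_le[OF d_pos] ln_mono)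
      fix j assume j: "j \<in> {1..m}"
      interpret hf: heat_flow "NF \<epsilon> j" "F j" "R j" by (rule hF[OF j])
      have z: "0 \<in> F j" by (rule subspace_0[OF F_subspace[OF j]])
      show "0 < heat (R j) (NF \<epsilon> j) T (M j (\<lambda>_. 0))" unfolding M0[OF j] by (rule hf.heat_pos[OF z T(1)])
      have "heat (R j) (NF \<epsilon> j) T 0 \<le> (\<integral>y. 1 \<partial>NF \<epsilon> j)"
        unfolding heat_def by (rule integral_mono[OF hf.integrable_K[OF z T(1)]]) (use hf.K_le_1[OF z _ T(1)] in auto)
      then show "heat (R j) (NF \<epsilon> j) T (M j (\<lambda>_. 0)) \<le> measure (NF \<epsilon> j) (F j)"
        by (simp add: M0[OF j] hf.space_N)
    qed
    moreover have "(\<Sum>i=1..k. c i * (ln (measure (NE i) (E i)) - r0\<^sup>2 / (2 * T))) \<le> (\<Sum>i=1..k. c i * ln (heat (P i) (NE i) T 0))"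
    proof (intro sum_mono mult_left_mono less_imp_le[OF c_pos])
      fix i assume i: "i \<in> {1..k}"
      interpret hf: heat_flow "NE i" "E i" "P i" by (rule hE[OF i])
      have z: "0 \<in> E i" by (rule subspace_0[OF E_subspace[OF i]])
      have "(\<integral>y. exp (- (r0\<^sup>2) / (2 * T)) \<partial>NE i) \<le> heat (P i) (NE i) T 0"
        unfolding heat_def
      proof (rule integral_mono_AE[OF _ hf.integrable_K[OF z T(1)]])
        have "AE y in NE i. y \<in> space (NE i) \<and> norm y \<le> r0" using H.N_supp[OF i] by auto
        then show "AE y in NE i. exp (- (r0\<^sup>2) / (2 * T)) \<le> exp (- (P i (0 - y) \<bullet> (0 - y)) / (2 * T))"
        proof eventually_elim
          case (elim y)
          have "P i (0 - y) \<bullet> (0 - y) \<le> (0 - y) \<bullet> (0 - y)"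
            by (rule formsD_D(2)[OF D i hf.diff_in[OF z]]) (use elim in auto)
          also have "\<dots> \<le> r0\<^sup>2" using elim by (simp add: dot_square_norm power_mono)
          finally have "- (r0\<^sup>2) / (2 * T) \<le> - (P i (0 - y) \<bullet> (0 - y)) / (2 * T)" using T(1) by (intro divide_right_mono) auto
          then show ?case by (simp only: exp_le_cancel_iff)
        qed
      qed simp
      then have "measure (NE i) (E i) * exp (- (r0\<^sup>2) / (2 * T)) \<le> heat (P i) (NE i) T 0" by (simp add: hf.space_N)
      then have "ln (measure (NE i) (E i) * exp (- (r0\<^sup>2) / (2 * T))) \<le> ln (heat (P i) (NE i) T 0)"
        using hf.N_pos by (intro ln_mono) auto
      then show "ln (measure (NE i) (E i)) - r0\<^sup>2 / (2 * T) \<le> ln (heat (P i) (NE i) T 0)"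
        using hf.N_pos by (simp add: ln_mult_pos)
    qed
    moreover have "(\<Sum>i=1..k. c i * (ln (measure (NE i) (E i)) - r0\<^sup>2 / (2 * T))) = (\<Sum>i=1..k. c i * ln (measure (NE i) (E i))) - cs * (r0\<^sup>2 / (2 * T))"
      by (simp only: right_diff_distrib sum_subtractf cs_def sum_distrib_right)
    ultimately show ?thesis using Tr unfolding H.h_def by linarith
  qed
  ultimately show "(\<Sum>i=1..k. c i * ln (measure (NE i) (E i))) \<le> D + (\<Sum>j=1..m. d j * ln (measure (NF \<epsilon> j) (F j))) + e0"
    by (simp add: e_def)
qed

end

subsection \<open>Semicontinuous approximation\<close>

lemma Int_in_sets_lborel_on:
  assumes S: "subspace S" and X: "X \<in> sets borel"
  shows "X \<inter> S \<in> sets (lborel_on S)"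
  using X by (simp add: sets_lborel_on sets_restrict_space) blast

lemma lborel_on_sets_borel:
  assumes S: "subspace S" and X: "X \<in> sets (lborel_on S)"
  shows "X \<in> sets borel" "X \<subseteq> S"
proof -
  have "S \<in> sets borel" by (rule borel_closed[OF closed_subspace[OF S]])
  then show "X \<in> sets borel" using X by (auto simp: sets_lborel_on sets_restrict_space)
  show "X \<subseteq> S" using sets.sets_into_space[OF X] by simp
qed

lemma lborel_on_cball_finite:
  assumes S: "subspace S"
  shows "emeasure (lborel_on S) (cball 0 r \<inter> S) < \<infinity>"
proof -
  have C: "cball 0 r \<inter> S \<in> sets (lborel_on S)" by (rule Int_in_sets_lborel_on[OF S]) auto
  have "emeasure (lborel_on S) (cball 0 r \<inter> S) = (\<integral>\<^sup>+x. indicator (cball 0 r \<inter> S) x \<partial>lborel_on S)"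
    using C by simp
  also have "\<dots> \<le> (\<integral>\<^sup>+x. ennreal (exp (r\<^sup>2)) * ennreal (exp (- (2 * (x \<bullet> x)) / 2)) \<partial>lborel_on S)"
  proof (rule nn_integral_mono)
    fix x
    show "indicator (cball 0 r \<inter> S) x \<le> ennreal (exp (r\<^sup>2)) * ennreal (exp (- (2 * (x \<bullet> x)) / 2))"
    proof (cases "x \<in> cball 0 r")
      case True
      then have "(norm x)\<^sup>2 \<le> r\<^sup>2" by (intro power_mono) auto
      then have "1 \<le> exp (r\<^sup>2) * exp (- (2 * (x \<bullet> x)) / 2)" by (simp add: exp_add[symmetric] dot_square_norm)
      then have "ennreal 1 \<le> ennreal (exp (r\<^sup>2) * exp (- (2 * (x \<bullet> x)) / 2))" by (rule ennreal_leI)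
      then show ?thesis by (simp add: ennreal_mult[symmetric] indicator_def)
    qed simp
  qed
  also have "\<dots> = ennreal (exp (r\<^sup>2)) * (\<integral>\<^sup>+x. ennreal (exp (- (2 * (x \<bullet> x)) / 2)) \<partial>lborel_on S)"
    by (rule nn_integral_cmult) measurable
  also have "\<dots> < \<infinity>"
    by (subst nn_integral_lborel_on_gaussian[OF S]) (simp_all add: ennreal_mult_less_top)
  finally show ?thesis .
qed

text \<open>Cutting to a ball and extending by zero gives a finite Borel measure on the ambient
  type, to which inner and outer regularity apply.\<close>

lemma lborel_on_truncate:
  fixes S :: "'a::euclidean_space set"
  assumes S: "subspace S"
  obtains \<nu> :: "'a measure" where "sets \<nu> = sets borel" "emeasure \<nu> (space \<nu>) \<noteq> \<infinity>"
    "\<And>X. X \<in> sets borel \<Longrightarrow> emeasure \<nu> X = emeasure (lborel_on S) (X \<inter> (cball 0 r \<inter> S))"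
proof
  let ?L = "lborel_on S" and ?C = "cball 0 r \<inter> S"
  let ?\<nu> = "distr (density ?L (indicator ?C)) borel (\<lambda>x. x)"
  have C: "?C \<in> sets ?L" by (rule Int_in_sets_lborel_on[OF S]) auto
  show "sets ?\<nu> = sets borel" by simp
  show em: "emeasure ?\<nu> X = emeasure ?L (X \<inter> ?C)" if X: "X \<in> sets borel" for X
  proof -
    have XS: "X \<inter> S \<in> sets ?L" by (rule Int_in_sets_lborel_on[OF S X])
    have "(\<lambda>x. x) \<in> borel_measurable (density ?L (indicator ?C))"
      using borel_measurable_lborel_on[of "\<lambda>x. x" S] by simp
    then have "emeasure ?\<nu> X = emeasure (density ?L (indicator ?C)) (X \<inter> S)"
      using X by (subst emeasure_distr) (auto simp: vimage_def Int_def)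
    also have "\<dots> = (\<integral>\<^sup>+x. indicator ?C x * indicator (X \<inter> S) x \<partial>?L)"
      using C XS by (intro emeasure_density) auto
    also have "\<dots> = (\<integral>\<^sup>+x. indicator (X \<inter> S \<inter> ?C) x \<partial>?L)"
      by (intro nn_integral_cong) (auto simp: indicator_def)
    also have "\<dots> = emeasure ?L (X \<inter> S \<inter> ?C)" using C XS by (intro nn_integral_indicator) auto
    also have "X \<inter> S \<inter> ?C = X \<inter> ?C" by auto
    finally show ?thesis .
  qed
  show "emeasure ?\<nu> (space ?\<nu>) \<noteq> \<infinity>"
    using em[of UNIV] lborel_on_cball_finite[OF S, of r] by simp
qed

text \<open>The completion is dealt with by passing to the main part of \<open>A\<close>, and
  infinite measure by exhausting with balls; regularity of the truncated measure then yields the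
  compact set.\<close>

lemma lebesgue_measure_on_inner_regular:
  assumes S: "subspace S" and A: "A \<in> sets (lebesgue_measure_on S)" and a: "a < emeasure (lebesgue_measure_on S) A"
  shows "\<exists>K. compact K \<and> K \<subseteq> A \<and> a < emeasure (lborel_on S) K"
proof -
  let ?L = "lborel_on S"
  define A0 where "A0 = main_part ?L A"
  have A': "A \<in> sets (completion ?L)" using A by (simp add: lebesgue_measure_on_def)
  have A0: "A0 \<in> sets ?L" "A0 \<subseteq> A" "a < emeasure ?L A0"
    using main_part_sets[OF A'] main_part_null_part_Un[OF A'] emeasure_completion[OF A'] a
    by (auto simp: A0_def lebesgue_measure_on_def)
  note B0 = lborel_on_sets_borel[OF S A0(1)]
  have "emeasure ?L A0 = (SUP n::nat. emeasure ?L (A0 \<inter> (cball 0 (real n) \<inter> S)))"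
  proof -
    have "(\<Union>n::nat. A0 \<inter> (cball 0 (real n) \<inter> S)) = A0" using B0 real_arch_simple by auto
    moreover have "range (\<lambda>n::nat. A0 \<inter> (cball 0 (real n) \<inter> S)) \<subseteq> sets ?L"
      using A0 Int_in_sets_lborel_on[OF S, OF borel_closed[OF closed_cball]] by blast
    moreover have "incseq (\<lambda>n::nat. A0 \<inter> (cball 0 (real n) \<inter> S))" by (auto simp: incseq_def)
    ultimately show ?thesis by (simp add: SUP_emeasure_incseq)
  qed
  with A0(3) obtain n :: nat where n: "a < emeasure ?L (A0 \<inter> (cball 0 (real n) \<inter> S))"
    by (auto simp: less_SUP_iff)
  obtain \<nu> :: "'a measure" where \<nu>: "sets \<nu> = sets borel" "emeasure \<nu> (space \<nu>) \<noteq> \<infinity>"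
    "\<And>X. X \<in> sets borel \<Longrightarrow> emeasure \<nu> X = emeasure ?L (X \<inter> (cball 0 (real n) \<inter> S))"
    using lborel_on_truncate[OF S] by blast
  have "a < emeasure \<nu> A0" using n \<nu>(3)[OF B0(1)] by simp
  then obtain K where K: "K \<subseteq> A0" "compact K" "a < emeasure \<nu> K"
    unfolding inner_regular[OF \<nu>(1,2) B0(1)] by (auto simp: less_SUP_iff)
  have "a < emeasure ?L (K \<inter> (cball 0 (real n) \<inter> S))" using K \<nu>(3)[of K] by (simp add: compact_imp_closed)
  moreover have "compact (K \<inter> (cball 0 (real n) \<inter> S))"
    using K closed_subspace[OF S] by (intro compact_Int_closed) auto
  ultimately show ?thesis using K A0 by (intro exI[of _ "K \<inter> (cball 0 (real n) \<inter> S)"]) auto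
qed

text \<open>A null set of \<open>lborel_on S\<close> covers the null part of \<open>A\<close>.
  Truncation at radius \<open>r + 1\<close> leaves room for an open neighbourhood of
  \<open>A\<close>, which is cut to the open ball and hence bounded.\<close>

lemma lebesgue_measure_on_outer_regular:
  assumes S: "subspace S" and A: "A \<in> sets (lebesgue_measure_on S)" and r: "A \<subseteq> cball 0 r" and e: "0 < e"
  shows "\<exists>U. open U \<and> A \<subseteq> U \<and> bounded U \<and> emeasure (lborel_on S) (U \<inter> S) \<le> emeasure (lebesgue_measure_on S) A + ennreal e"
proof -
  let ?L = "lborel_on S"
  have A': "A \<in> sets (completion ?L)" using A by (simp add: lebesgue_measure_on_def)
  obtain N where N: "N \<in> null_sets ?L" "null_part ?L A \<subseteq> N" using null_part[OF A'] by auto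
  define A1 where "A1 = (main_part ?L A \<union> N) \<inter> cball 0 r"
  have MN: "main_part ?L A \<union> N \<in> sets ?L" using main_part_sets[OF A'] N by auto
  have A1: "A1 \<in> sets borel" using lborel_on_sets_borel(1)[OF S MN] by (auto simp: A1_def)
  have AA1: "A \<subseteq> A1" using main_part_null_part_Un[OF A'] N r by (auto simp: A1_def)
  obtain \<nu> :: "'a measure" where \<nu>: "sets \<nu> = sets borel" "emeasure \<nu> (space \<nu>) \<noteq> \<infinity>"
    "\<And>X. X \<in> sets borel \<Longrightarrow> emeasure \<nu> X = emeasure ?L (X \<inter> (cball 0 (r + 1) \<inter> S))"
    using lborel_on_truncate[OF S] by blast
  have "emeasure \<nu> A1 \<le> emeasure ?L (main_part ?L A \<union> N)"
    unfolding \<nu>(3)[OF A1] by (rule emeasure_mono[OF _ MN]) (auto simp: A1_def)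
  also have "\<dots> = emeasure (lebesgue_measure_on S) A"
    using emeasure_Un_null_set[OF main_part_sets[OF A'] N(1)] emeasure_completion[OF A'] by (simp add: lebesgue_measure_on_def)
  finally have le: "emeasure \<nu> A1 \<le> emeasure (lebesgue_measure_on S) A" .
  have "emeasure \<nu> A1 \<noteq> \<infinity>"
    using \<nu>(2) emeasure_space[of \<nu> A1] by (auto simp: top_unique)
  then have "emeasure \<nu> A1 < emeasure \<nu> A1 + ennreal e" using e by simp
  then obtain U where U: "A1 \<subseteq> U" "open U" "emeasure \<nu> U < emeasure \<nu> A1 + ennreal e"
    unfolding outer_regular[OF \<nu>(1,2) A1] by (auto simp: INF_less_iff)
  have "emeasure ?L (U \<inter> ball 0 (r + 1) \<inter> S) \<le> emeasure ?L (U \<inter> (cball 0 (r + 1) \<inter> S))"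
  proof (rule emeasure_mono)
    show "U \<inter> (cball 0 (r + 1) \<inter> S) \<in> sets ?L"
      using Int_in_sets_lborel_on[OF S, of "U \<inter> cball 0 (r + 1)"] U by (simp add: Int_assoc)
  qed auto
  also have "\<dots> = emeasure \<nu> U" using U by (simp add: \<nu>(3))
  also have "\<dots> \<le> emeasure (lebesgue_measure_on S) A + ennreal e"
    using U(3) le by (meson add_right_mono less_imp_le order_trans)
  finally have "emeasure ?L (U \<inter> ball 0 (r + 1) \<inter> S) \<le> emeasure (lebesgue_measure_on S) A + ennreal e" .
  moreover have "A \<subseteq> U \<inter> ball 0 (r + 1)" using AA1 U r by (force simp: subset_iff)
  ultimately show ?thesis using U by (intro exI[of _ "U \<inter> ball 0 (r + 1)"]) auto
qed

definition simple_bounded :: "real \<Rightarrow> ('a::euclidean_space \<Rightarrow> real) \<Rightarrow> bool" where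
  "simple_bounded r f \<longleftrightarrow> f \<in> borel_measurable borel \<and> (\<forall>x. 0 \<le> f x) \<and> finite (range f) \<and> (\<forall>x. r < norm x \<longrightarrow> f x = 0)"

lemma simple_bounded_weighted_indicators:
  fixes K :: "'v \<Rightarrow> 'a::euclidean_space set"
  assumes V: "finite V" and w: "\<And>v. v \<in> V \<Longrightarrow> 0 \<le> w v" and K: "\<And>v. v \<in> V \<Longrightarrow> K v \<in> sets borel \<and> bounded (K v)"
  shows "\<exists>r>0. simple_bounded r (\<lambda>x. \<Sum>v\<in>V. w v * indicator (K v) x)"
    and "(\<integral>\<^sup>+x. ennreal (\<Sum>v\<in>V. w v * indicator (K v) x) \<partial>lborel_on S) = (\<Sum>v\<in>V. ennreal (w v) * emeasure (lborel_on S) (K v \<inter> S))"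
proof -
  let ?f = "\<lambda>x. \<Sum>v\<in>V. w v * indicator (K v) x"
  have "bounded (\<Union>v\<in>V. K v)" using V K by (intro bounded_UN) auto
  then obtain r where r: "r > 0" "\<And>x. x \<in> (\<Union>v\<in>V. K v) \<Longrightarrow> norm x \<le> r" unfolding bounded_pos by auto
  have "?f x = sum w {v\<in>V. x \<in> K v}" for x
    unfolding sum.inter_filter[OF V] by (rule sum.cong) (auto simp: indicator_def)
  then have "range ?f \<subseteq> sum w ` Pow V" by auto
  then have "finite (range ?f)" using V by (rule finite_subset[OF _ finite_imageI[OF finite_Pow_iff[THEN iffD2]]])
  moreover have "?f \<in> borel_measurable borel" using K by (intro borel_measurable_sum borel_measurable_times borel_measurable_indicator) auto
  moreover have "?f x = 0" if "r < norm x" for x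
    using r(2)[of x] that by (intro sum.neutral) (auto simp: indicator_def)
  ultimately have "simple_bounded r ?f" using w by (auto simp: simple_bounded_def intro!: sum_nonneg)
  then show "\<exists>r>0. simple_bounded r ?f" using r(1) by blast
  have KS: "K v \<inter> S \<in> sets (lborel_on S)" if "v \<in> V" for v
    using K[OF that] by (simp add: sets_lborel_on sets_restrict_space) blast
  have "(\<integral>\<^sup>+x. ennreal (?f x) \<partial>lborel_on S) = (\<integral>\<^sup>+x. (\<Sum>v\<in>V. ennreal (w v) * indicator (K v \<inter> S) x) \<partial>lborel_on S)"
    using w by (intro nn_integral_cong) (auto simp: sum_ennreal[symmetric] ennreal_mult indicator_def intro!: sum.cong)
  also have "\<dots> = (\<Sum>v\<in>V. (\<integral>\<^sup>+x. ennreal (w v) * indicator (K v \<inter> S) x \<partial>lborel_on S))"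
    using KS by (intro nn_integral_sum) auto
  also have "\<dots> = (\<Sum>v\<in>V. ennreal (w v) * emeasure (lborel_on S) (K v \<inter> S))"
    using KS by (intro sum.cong nn_integral_cmult_indicator) auto
  finally show "(\<integral>\<^sup>+x. ennreal (?f x) \<partial>lborel_on S) = (\<Sum>v\<in>V. ennreal (w v) * emeasure (lborel_on S) (K v \<inter> S))" .
qed

text \<open>The level sets of a simple function below \<open>f\<close> are shrunk to compact sets of
  almost the same measure. Sums of indicators of compact sets with nonnegative weights are upper
  semicontinuous, because points outside such a set stay outside under small perturbations.\<close>

lemma approximation_from_below:
  assumes S: "subspace S" and f: "f \<in> borel_measurable (lebesgue_measure_on S)" "\<And>x. x \<in> S \<Longrightarrow> 0 \<le> f x"
    and a: "a < (\<integral>\<^sup>+x. ennreal (f x) \<partial>lebesgue_measure_on S)"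
  shows "\<exists>h r. 0 < r \<and> simple_bounded r h \<and> (\<forall>x\<in>S. h x \<le> f x) \<and> (\<forall>x. \<forall>\<^sub>F y in nhds x. h y \<le> h x) \<and>
    a < (\<integral>\<^sup>+x. ennreal (h x) \<partial>lborel_on S)"
proof -
  let ?L = "lborel_on S" and ?M = "lebesgue_measure_on S"
  obtain g where g: "simple_function ?M g" "g \<le> (\<lambda>x. ennreal (f x))" "\<forall>x. g x < top" "a < integral\<^sup>S ?M g"
    using a unfolding nn_integral_def_finite by (auto simp: less_SUP_iff)
  define V where "V = g ` S"
  define A where "A v = g -` {v} \<inter> S" for v
  have V: "finite V" "\<And>v. v \<in> V \<Longrightarrow> v < top" using g by (auto simp: V_def simple_function_def)
  have A: "A v \<in> sets ?M" for v using simple_functionD(2)[OF g(1), of "{v}"] by (simp add: A_def)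
  \<comment> \<open>Approximating sequences rather than single compact sets, because a level set may
    have infinite measure; the weighted sum is treated by a limit.\<close>
  have "\<exists>K::nat \<Rightarrow> _. (\<forall>n. compact (K n) \<and> K n \<subseteq> A v) \<and> (\<lambda>n. emeasure ?L (K n)) \<longlonglongrightarrow> emeasure ?M (A v)" for v
  proof -
    let ?W = "{emeasure ?L K | K. compact K \<and> K \<subseteq> A v}"
    have "Sup ?W = emeasure ?M (A v)"
    proof (rule antisym)
      show "Sup ?W \<le> emeasure ?M (A v)"
      proof (rule Sup_least)
        fix y assume "y \<in> ?W"
        then obtain K where K: "compact K" "K \<subseteq> A v" "y = emeasure ?L K" by auto
        have "K \<inter> S \<in> sets ?L" using K by (intro Int_in_sets_lborel_on[OF S]) (auto simp: compact_imp_closed)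
        moreover have "K \<inter> S = K" using K by (auto simp: A_def)
        ultimately have KL: "K \<in> sets ?L" by simp
        then have "emeasure ?L K = emeasure ?M K" by (simp add: lebesgue_measure_on_def)
        also have "\<dots> \<le> emeasure ?M (A v)" by (rule emeasure_mono[OF K(2) A])
        finally show "y \<le> emeasure ?M (A v)" using K by simp
      qed
      show "emeasure ?M (A v) \<le> Sup ?W"
      proof (rule ccontr)
        assume "\<not> ?thesis"
        then have "Sup ?W < emeasure ?M (A v)" by simp
        from lebesgue_measure_on_inner_regular[OF S A this]
        obtain K where "compact K" "K \<subseteq> A v" "Sup ?W < emeasure ?L K" by auto
        moreover from this have "emeasure ?L K \<le> Sup ?W" by (intro Sup_upper) auto
        ultimately show False by simp
      qed
    qed
    moreover have "?W \<noteq> {}" by (auto intro: exI[of _ "{}"])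
    ultimately obtain F :: "nat \<Rightarrow> ennreal" where F: "incseq F" "range F \<subseteq> ?W" "emeasure ?M (A v) = (SUP n. F n)"
      using ennreal_Sup_countable_SUP[of ?W] by auto
    have "\<forall>n. \<exists>K. compact K \<and> K \<subseteq> A v \<and> F n = emeasure ?L K" using F(2) by auto
    then obtain K where K: "\<And>n. compact (K n) \<and> K n \<subseteq> A v \<and> F n = emeasure ?L (K n)" by metis
    have "F \<longlonglongrightarrow> emeasure ?M (A v)" unfolding F(3) by (rule LIMSEQ_SUP[OF F(1)])
    moreover have "F = (\<lambda>n. emeasure ?L (K n))" using K by auto
    ultimately show ?thesis using K by auto
  qed
  then obtain K :: "ennreal \<Rightarrow> nat \<Rightarrow> _" where K: "\<And>v n. compact (K v n)" "\<And>v n. K v n \<subseteq> A v"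
    "\<And>v. (\<lambda>n. emeasure ?L (K v n)) \<longlonglongrightarrow> emeasure ?M (A v)" by metis
  have "(\<lambda>n. \<Sum>v\<in>V. v * emeasure ?L (K v n)) \<longlonglongrightarrow> (\<Sum>v\<in>V. v * emeasure ?M (A v))"
    using V K(3) by (intro tendsto_sum ennreal_tendsto_cmult) auto
  moreover have "a < (\<Sum>v\<in>V. v * emeasure ?M (A v))" using g(4) by (simp add: simple_integral_def V_def A_def)
  ultimately have "\<forall>\<^sub>F n in sequentially. a < (\<Sum>v\<in>V. v * emeasure ?L (K v n))" by (rule order_tendstoD(1))
  then obtain n where n: "a < (\<Sum>v\<in>V. v * emeasure ?L (K v n))" by (auto simp: eventually_sequentially)
  let ?h = "\<lambda>x. \<Sum>v\<in>V. enn2real v * indicator (K v n) x"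
  have KB: "K v n \<in> sets borel \<and> bounded (K v n)" for v using K(1) by (simp add: compact_imp_closed compact_imp_bounded)
  note wi = simple_bounded_weighted_indicators[OF V(1), of enn2real "\<lambda>v. K v n"]
  obtain r where r: "r > 0" "simple_bounded r ?h" using wi(1) KB by auto
  moreover have "?h x \<le> f x" if x: "x \<in> S" for x
  proof -
    have "?h x \<le> (\<Sum>v\<in>V. if v = g x then enn2real v else 0)"
      using K(2)[of _ n] by (intro sum_mono) (auto simp: indicator_def A_def)
    also have "\<dots> \<le> enn2real (g x)" using V by (simp add: sum.delta)
    also have "\<dots> \<le> f x" using g(2,3) f(2)[OF x] by (intro enn2real_leI) (auto simp: le_fun_def)
    finally show ?thesis .
  qed
  moreover have "\<forall>\<^sub>F y in nhds x. ?h y \<le> ?h x" for x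
  proof -
    have "\<forall>\<^sub>F y in nhds x. \<forall>v\<in>V. x \<notin> K v n \<longrightarrow> y \<notin> K v n"
    proof (intro eventually_ball_finite V(1) ballI)
      fix v
      show "\<forall>\<^sub>F y in nhds x. x \<notin> K v n \<longrightarrow> y \<notin> K v n"
      proof (cases "x \<in> K v n")
        case False
        then have "\<forall>\<^sub>F y in nhds x. y \<in> - K v n"
          using K(1) by (intro eventually_nhds_in_open) (auto simp: open_Compl compact_imp_closed)
        then show ?thesis by (rule eventually_mono) auto
      qed simp
    qed
    then show ?thesis
      by (rule eventually_mono) (auto intro!: sum_mono simp: indicator_def)
  qed
  moreover have "a < (\<integral>\<^sup>+x. ennreal (?h x) \<partial>?L)"
  proof -
    have "(\<integral>\<^sup>+x. ennreal (?h x) \<partial>?L) = (\<Sum>v\<in>V. ennreal (enn2real v) * emeasure ?L (K v n \<inter> S))"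
      by (rule wi(2)) (use KB in auto)
    also have "\<dots> = (\<Sum>v\<in>V. v * emeasure ?L (K v n))"
    proof (rule sum.cong)
      fix v assume v: "v \<in> V"
      have "K v n \<inter> S = K v n" using K(2)[of v n] by (auto simp: A_def)
      then show "ennreal (enn2real v) * emeasure ?L (K v n \<inter> S) = v * emeasure ?L (K v n)" using V(2)[OF v] by simp
    qed simp
    finally show ?thesis using n by simp
  qed
  ultimately show ?thesis by (intro exI[of _ ?h] exI[of _ r]) blast
qed

text \<open>A layer-cake approximation with step \<eta>: indicators of open sets around the
  superlevel sets of \<open>g\<close> in the ball add up to a lower semicontinuous function, and the
  lowest layer is a floor of height \<eta>. The step does not depend on the cutoff \<open>N\<close>,
  since \<open>inequality_with_error\<close> chooses \<open>N\<close> in terms of the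
  floors.\<close>

lemma approximation_from_above:
  assumes S: "subspace S" and g: "g \<in> borel_measurable (lebesgue_measure_on S)" "\<And>x. x \<in> S \<Longrightarrow> 0 \<le> g x"
    and e: "0 < e"
  shows "\<exists>\<eta>>0. \<forall>N. \<exists>h r'. 0 < r' \<and> simple_bounded r' h \<and> (\<forall>x\<in>S. norm x \<le> r \<longrightarrow> min (g x) N \<le> h x \<and> \<eta> \<le> h x) \<and>
    (\<forall>x. \<forall>\<^sub>F y in nhds x. h x \<le> h y) \<and>
    (\<integral>\<^sup>+x. ennreal (h x) \<partial>lborel_on S) \<le> (\<integral>\<^sup>+x. ennreal (g x) \<partial>lebesgue_measure_on S) + ennreal e"
proof -
  let ?L = "lborel_on S" and ?M = "lebesgue_measure_on S"
  define b where "b = measure ?L (cball 0 r \<inter> S)"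
  have b: "emeasure ?L (cball 0 r \<inter> S) = ennreal b" "0 \<le> b"
    using lborel_on_cball_finite[OF S, of r] by (auto simp: b_def emeasure_eq_ennreal_measure)
  \<comment> \<open>Half of \<open>e\<close> pays for the lowest layer, which covers the whole
    ball.\<close>
  define \<eta> where "\<eta> = e / (2 * (b + 1))"
  have \<eta>: "\<eta> > 0" "\<eta> * b \<le> e / 2" using e b(2) by (auto simp: \<eta>_def field_simps)
  have "\<exists>h r'. 0 < r' \<and> simple_bounded r' h \<and> (\<forall>x\<in>S. norm x \<le> r \<longrightarrow> min (g x) N \<le> h x \<and> \<eta> \<le> h x) \<and>
    (\<forall>x. \<forall>\<^sub>F y in nhds x. h x \<le> h y) \<and> (\<integral>\<^sup>+x. ennreal (h x) \<partial>?L) \<le> (\<integral>\<^sup>+x. ennreal (g x) \<partial>?M) + ennreal e" for N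
  proof -
    define K where "K = nat \<lceil>N / \<eta>\<rceil>"
    have K: "N \<le> \<eta> * real K" 
    proof -
      have "N / \<eta> \<le> real K" unfolding K_def by (rule real_nat_ceiling_ge)
      then show ?thesis using \<eta> by (simp add: pos_divide_le_eq mult.commute)
    qed
    define A where "A l = {z \<in> S. norm z \<le> r \<and> \<eta> * real l \<le> g z}" for l :: nat
    have CS: "cball 0 r \<inter> S \<in> sets ?L" by (rule Int_in_sets_lborel_on[OF S]) auto
    have A: "A l \<in> sets ?M" for l
    proof -
      have "{z \<in> space ?M. \<eta> * real l \<le> g z} \<in> sets ?M" using g(1) by measurable
      moreover have "cball 0 r \<inter> S \<in> sets ?M" using CS by (simp add: lebesgue_measure_on_def)
      ultimately have "{z \<in> space ?M. \<eta> * real l \<le> g z} \<inter> (cball 0 r \<inter> S) \<in> sets ?M" by (rule sets.Int)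
      moreover have "{z \<in> space ?M. \<eta> * real l \<le> g z} \<inter> (cball 0 r \<inter> S) = A l" by (auto simp: A_def)
      ultimately show ?thesis by simp
    qed
    \<comment> \<open>The other half of \<open>e\<close> is shared by the open enlargements of the
      \<open>K + 1\<close> layers.\<close>
    define e' where "e' = e / (2 * \<eta> * real (Suc K))"
    have e': "e' > 0" "\<eta> * (real (Suc K) * e') = e / 2" using e \<eta> by (simp_all add: e'_def del: of_nat_Suc)
    have "\<forall>l. \<exists>U. open U \<and> A l \<subseteq> U \<and> bounded U \<and> emeasure ?L (U \<inter> S) \<le> emeasure ?M (A l) + ennreal e'"
      by (intro allI lebesgue_measure_on_outer_regular[OF S A _ e'(1), of _ r]) (auto simp: A_def)
    then obtain U where U: "\<And>l. open (U l)" "\<And>l. A l \<subseteq> U l" "\<And>l. bounded (U l)"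
      "\<And>l. emeasure ?L (U l \<inter> S) \<le> emeasure ?M (A l) + ennreal e'" by metis
    let ?h = "\<lambda>x. \<Sum>l\<le>K. \<eta> * indicator (U l) x"
    note wi = simple_bounded_weighted_indicators[of "{..K}" "\<lambda>_. \<eta>" U]
    obtain r' where "r' > 0" "simple_bounded r' ?h" using wi(1) \<eta> U by auto
    moreover have "min (g x) N \<le> ?h x" "\<eta> \<le> ?h x" if x: "x \<in> S" "norm x \<le> r" for x
    proof -
      define n where "n = nat \<lfloor>g x / \<eta>\<rfloor>"
      have fl: "0 \<le> \<lfloor>g x / \<eta>\<rfloor>" using g(2)[OF x(1)] \<eta> by simp
      then have "real n = of_int \<lfloor>g x / \<eta>\<rfloor>" by (simp add: n_def)
      then have n: "real n \<le> g x / \<eta>" "g x / \<eta> < real n + 1" by linarith+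
      then have n: "\<eta> * real n \<le> g x" "g x < \<eta> * (real n + 1)" using \<eta> by (auto simp: field_simps)
      have mem: "x \<in> U l" if "l \<le> n" for l
      proof -
        have "\<eta> * real l \<le> \<eta> * real n" using that \<eta> by (intro mult_left_mono) auto
        then show ?thesis using U(2)[of l] x n by (auto simp: A_def)
      qed
      have "(\<Sum>l\<le>min n K. \<eta>) \<le> (\<Sum>l\<le>min n K. \<eta> * indicator (U l) x)" using mem by (intro sum_mono) simp
      also have "\<dots> \<le> ?h x" using \<eta> by (intro sum_mono2) auto
      finally have *: "\<eta> * (real (min n K) + 1) \<le> ?h x" by (simp add: algebra_simps)
      moreover have "\<eta> * 1 \<le> \<eta> * (real (min n K) + 1)" using \<eta> by (intro mult_left_mono) auto
      ultimately show "\<eta> \<le> ?h x" by linarith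
      show "min (g x) N \<le> ?h x"
      proof (cases "n \<le> K")
        case True
        then show ?thesis using * n by (simp add: min_def split: if_splits)
      next
        case False
        then have "\<eta> * (real K + 1) \<le> ?h x" using * by (simp add: min_def)
        then show ?thesis using K \<eta> by (simp add: distrib_left)
      qed
    qed
    moreover have "\<forall>\<^sub>F y in nhds x. ?h x \<le> ?h y" for x
    proof -
      have "\<forall>\<^sub>F y in nhds x. \<forall>l\<in>{..K}. x \<in> U l \<longrightarrow> y \<in> U l"
      proof (intro eventually_ball_finite ballI)
        fix l
        show "\<forall>\<^sub>F y in nhds x. x \<in> U l \<longrightarrow> y \<in> U l"
          using U(1) by (cases "x \<in> U l") (auto intro: eventually_nhds_in_open)
      qed simp
      then show ?thesis
      proof eventually_elim
        case (elim y)
        then show ?case using \<eta> by (intro sum_mono mult_left_mono) (auto simp: indicator_def)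
      qed
    qed
    moreover have "(\<integral>\<^sup>+x. ennreal (?h x) \<partial>?L) \<le> (\<integral>\<^sup>+x. ennreal (g x) \<partial>?M) + ennreal e"
    proof -
      have "(\<integral>\<^sup>+x. ennreal (?h x) \<partial>?L) = (\<Sum>l\<le>K. ennreal \<eta> * emeasure ?L (U l \<inter> S))"
        by (rule wi(2)) (use \<eta> U in auto)
      also have "\<dots> \<le> (\<Sum>l\<le>K. ennreal \<eta> * emeasure ?M (A l) + ennreal (\<eta> * e'))"
        using U(4) \<eta> e' by (intro sum_mono) (simp add: ennreal_mult distrib_left[symmetric] mult_left_mono)
      also have "\<dots> = (\<Sum>l\<le>K. ennreal \<eta> * emeasure ?M (A l)) + ennreal (\<eta> * (real (Suc K) * e'))"
        using \<eta> e' by (simp add: sum.distrib ennreal_of_nat_eq_real_of_nat ennreal_mult[symmetric] mult_ac del: of_nat_Suc)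
      also have "(\<Sum>l\<le>K. ennreal \<eta> * emeasure ?M (A l)) = ennreal \<eta> * emeasure ?M (A 0) + (\<Sum>l=1..K. ennreal \<eta> * emeasure ?M (A l))"
        by (subst sum.atMost_shift) (simp add: sum.atLeast1_atMost_eq lessThan_atLeast0)
      also have "ennreal \<eta> * emeasure ?M (A 0) \<le> ennreal (e / 2)"
      proof -
        have "emeasure ?M (A 0) \<le> emeasure ?M (cball 0 r \<inter> S)"
          by (rule emeasure_mono) (use CS in \<open>auto simp: A_def lebesgue_measure_on_def\<close>)
        also have "\<dots> = ennreal b" using CS b by (simp add: lebesgue_measure_on_def)
        finally have "ennreal \<eta> * emeasure ?M (A 0) \<le> ennreal \<eta> * ennreal b" by (rule mult_left_mono) simp
        also have "\<dots> \<le> ennreal (e / 2)" using \<eta> b by (simp add: ennreal_mult[symmetric] ennreal_leI)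
        finally show ?thesis .
      qed
      also have "(\<Sum>l=1..K. ennreal \<eta> * emeasure ?M (A l)) = (\<integral>\<^sup>+x. (\<Sum>l=1..K. ennreal \<eta> * indicator (A l) x) \<partial>?M)"
        using A by (subst nn_integral_sum) (auto simp: nn_integral_cmult_indicator)
      also have "\<dots> \<le> (\<integral>\<^sup>+x. ennreal (g x) \<partial>?M)"
      proof (rule nn_integral_mono)
        fix x assume "x \<in> space ?M"
        then have x: "x \<in> S" by simp
        have "real (card {l\<in>{1..K}. x \<in> A l}) \<le> g x / \<eta>"
        proof -
          have "{l\<in>{1..K}. x \<in> A l} \<subseteq> {1..nat \<lfloor>g x / \<eta>\<rfloor>}"
          proof
            fix l assume l: "l \<in> {l\<in>{1..K}. x \<in> A l}"
            then have "real l \<le> g x / \<eta>" using \<eta> by (auto simp: A_def field_simps)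
            then have "int l \<le> \<lfloor>g x / \<eta>\<rfloor>" by (simp add: le_floor_iff)
            then show "l \<in> {1..nat \<lfloor>g x / \<eta>\<rfloor>}" using l by auto
          qed
          from card_mono[OF _ this] have "card {l\<in>{1..K}. x \<in> A l} \<le> nat \<lfloor>g x / \<eta>\<rfloor>" by simp
          then have "real (card {l\<in>{1..K}. x \<in> A l}) \<le> real (nat \<lfloor>g x / \<eta>\<rfloor>)" by simp
          also have "\<dots> \<le> g x / \<eta>" using g(2)[OF x] \<eta> by simp
          finally show ?thesis .
        qed
        then have "\<eta> * real (card {l\<in>{1..K}. x \<in> A l}) \<le> g x" using \<eta> by (simp add: field_simps)
        moreover have "(\<Sum>l=1..K. ennreal \<eta> * indicator (A l) x) = ennreal (\<Sum>l=1..K. \<eta> * indicator (A l) x)"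
        proof -
          have "(\<Sum>l=1..K. ennreal \<eta> * indicator (A l) x) = (\<Sum>l=1..K. ennreal (\<eta> * indicator (A l) x))"
            by (rule sum.cong) (auto simp: indicator_def)
          also have "\<dots> = ennreal (\<Sum>l=1..K. \<eta> * indicator (A l) x)" by (rule sum_ennreal) (use \<eta> in auto)
          finally show ?thesis .
        qed
        moreover have "(\<Sum>l=1..K. \<eta> * indicator (A l) x) = \<eta> * real (card {l\<in>{1..K}. x \<in> A l})"
        proof -
          have "(\<Sum>l=1..K. \<eta> * indicator (A l) x) = (\<Sum>l\<in>{l\<in>{1..K}. x \<in> A l}. \<eta>)"
            unfolding sum.inter_filter[OF finite_atLeastAtMost] by (rule sum.cong) (auto simp: indicator_def)
          then show ?thesis by simp
        qed
        ultimately show "(\<Sum>l=1..K. ennreal \<eta> * indicator (A l) x) \<le> ennreal (g x)" by (simp only: ennreal_leI)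
      qed
      finally have "(\<integral>\<^sup>+x. ennreal (?h x) \<partial>?L) \<le> ennreal (e / 2) + (\<integral>\<^sup>+x. ennreal (g x) \<partial>?M) + ennreal (\<eta> * (real (Suc K) * e'))"
        by (simp add: add_mono)
      also have "\<dots> = (\<integral>\<^sup>+x. ennreal (g x) \<partial>?M) + (ennreal (e / 2) + ennreal (e / 2))"
        unfolding e'(2) by (simp only: ac_simps)
      also have "ennreal (e / 2) + ennreal (e / 2) = ennreal e" using e by (simp add: ennreal_plus[symmetric] del: ennreal_plus)
      finally show ?thesis .
    qed
    ultimately show ?thesis by (intro exI[of _ ?h] exI[of _ r']) blast
  qed
  with \<eta>(1) show ?thesis by blast
qed

lemma simple_bounded_mono: "simple_bounded r f \<Longrightarrow> r \<le> r' \<Longrightarrow> simple_bounded r' f"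
  by (auto simp: simple_bounded_def)

lemma simple_bounded_D:
  assumes "simple_bounded r f"
  shows "f \<in> borel_measurable borel" "0 \<le> f x" "finite (range f)" "r < norm x \<Longrightarrow> f x = 0"
  using assms by (auto simp: simple_bounded_def)

lemma simple_bounded_common_bound:
  assumes "finite I" "\<And>i. i \<in> I \<Longrightarrow> simple_bounded (r i) (f i)"
  obtains b where "0 < b" "\<And>i x. i \<in> I \<Longrightarrow> f i x \<le> b"
proof
  let ?R = "insert 1 (\<Union>i\<in>I. range (f i))"
  have fin: "finite ?R" using assms simple_bounded_D(3) by blast
  have "1 \<le> Max ?R" by (rule Max_ge[OF fin]) simp
  then show "0 < Max ?R" by (rule less_le_trans[OF zero_less_one])
  show "f i x \<le> Max ?R" if "i \<in> I" for i x by (rule Max_ge[OF fin]) (use that in auto)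
qed

lemma common_upper_bound:
  fixes r :: "nat \<Rightarrow> real"
  obtains b where "0 < b" "\<And>i. i \<in> {1..k} \<Longrightarrow> r i \<le> b"
proof
  let ?R = "insert 1 (r ` {1..k})"
  have "1 \<le> Max ?R" by (rule Max_ge) auto
  then show "0 < Max ?R" by (rule less_le_trans[OF zero_less_one])
  show "r i \<le> Max ?R" if "i \<in> {1..k}" for i by (rule Max_ge) (use that in auto)
qed

lemma powr_exceeds:
  fixes a x :: real
  assumes "0 < a"
  shows "\<exists>t>0. x \<le> t powr a"
proof (intro exI conjI)
  show "0 < (max 1 x) powr (1 / a)" by simp
  show "x \<le> ((max 1 x) powr (1 / a)) powr a" using assms by (simp add: powr_powr)
qed

subsection \<open>The inequality for measurable functions\<close>

context bl_datum
begin

text \<open>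
  Upper semicontinuous \<open>f\<close> with compact support and lower semicontinuous \<open>g\<close> make the pointwise hypothesis
  stable under small perturbations of all arguments.
\<close>

lemma robust_inequality:
  assumes f: "\<And>i. i \<in> {1..k} \<Longrightarrow> simple_bounded r (f i)" "\<And>i x. i \<in> {1..k} \<Longrightarrow> \<forall>\<^sub>F y in nhds x. f i y \<le> f i x"
    and g: "\<And>j z. j \<in> {1..m} \<Longrightarrow> 0 \<le> g j z" "\<And>j x. j \<in> {1..m} \<Longrightarrow> \<forall>\<^sub>F y in nhds x. g j x \<le> g j y"
    and le: "\<And>x. x \<in> XE \<Longrightarrow> (\<Prod>i=1..k. f i (x i) powr c i) \<le> (\<Prod>j=1..m. g j (M j x) powr d j)"
  shows "\<exists>\<tau>>0. \<forall>X Y Z. X \<in> XE \<longrightarrow> (\<forall>i\<in>{1..k}. Y i \<in> E i \<and> norm (Y i - X i) < \<tau>) \<longrightarrow>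
    (\<forall>j\<in>{1..m}. Z j \<in> F j \<and> norm (Z j - M j X) < \<tau>) \<longrightarrow>
    (\<Prod>i=1..k. f i (Y i) powr c i) \<le> (\<Prod>j=1..m. g j (Z j) powr d j)"
proof (rule ccontr)
  assume neg: "\<not> ?thesis"
  define W where "W n X Y Z \<longleftrightarrow> X \<in> XE \<and> (\<forall>i\<in>{1..k}. Y i \<in> E i \<and> norm (Y i - X i) < 1 / real (Suc n)) \<and>
    (\<forall>j\<in>{1..m}. Z j \<in> F j \<and> norm (Z j - M j X) < 1 / real (Suc n)) \<and>
    \<not> (\<Prod>i=1..k. f i (Y i) powr c i) \<le> (\<Prod>j=1..m. g j (Z j) powr d j)" for n X Y Z
  have "\<exists>X Y Z. W n X Y Z" for n
  proof -
    have "0 < 1 / real (Suc n)" by simp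
    with neg show ?thesis unfolding W_def by blast
  qed
  then obtain X Y Z where W: "\<And>n. W n (X n) (Y n) (Z n)" by metis
  have X: "X n \<in> XE" and Y: "i \<in> {1..k} \<Longrightarrow> Y n i \<in> E i" "i \<in> {1..k} \<Longrightarrow> norm (Y n i - X n i) < 1 / real (Suc n)"
    and Z: "j \<in> {1..m} \<Longrightarrow> norm (Z n j - M j (X n)) < 1 / real (Suc n)"
    and bad: "\<not> (\<Prod>i=1..k. f i (Y n i) powr c i) \<le> (\<Prod>j=1..m. g j (Z n j) powr d j)" for n i j
    using W[of n] unfolding W_def by blast+
  \<comment> \<open>In a violation the left product is positive, so all the points
    \<open>Y n i\<close> lie in the bounded supports; this provides a convergent
    subsequence.\<close>
  have Yr: "norm (Y n i) \<le> r" if i: "i \<in> {1..k}" for n i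
  proof (rule ccontr)
    assume "\<not> ?thesis"
    then have "f i (Y n i) = 0" using simple_bounded_D(4)[OF f(1)[OF i]] by simp
    then have "(\<Prod>i=1..k. f i (Y n i) powr c i) = 0" using i by (intro prod_zero) auto
    moreover have "0 \<le> (\<Prod>j=1..m. g j (Z n j) powr d j)" by (intro prod_nonneg) simp
    ultimately show False using bad[of n] by linarith
  qed
  define Y' where "Y' n i = (if i \<in> {1..k} then Y n i else 0)" for n i
  let ?K = "\<lambda>i. if i \<in> {1..k} then E i \<inter> cball 0 r else {0}"
  have "compact {x. \<forall>i. x i \<in> ?K i}"
    by (rule compact_coordinates) (use closed_subspace[OF E_subspace] in \<open>auto simp: closed_Int_compact\<close>)
  moreover have "\<forall>n. Y' n \<in> {x. \<forall>i. x i \<in> ?K i}" using Y(1) Yr by (auto simp: Y'_def)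
  ultimately obtain l s where l: "l \<in> {x. \<forall>i. x i \<in> ?K i}" and s: "strict_mono (s :: nat \<Rightarrow> nat)" and lim: "(Y' \<circ> s) \<longlonglongrightarrow> l"
    unfolding compact_def by blast
  have lX: "l \<in> XE" unfolding XE_def
  proof (intro CollectI ballI)
    fix i assume i: "i \<in> {1..k}"
    have "l i \<in> ?K i" using l by blast
    then show "l i \<in> E i" using i by simp
  qed
  have small: "(\<lambda>n. 1 / real (Suc (s n))) \<longlonglongrightarrow> 0"
    using LIMSEQ_subseq_LIMSEQ[OF LIMSEQ_inverse_real_of_nat s] by (simp add: o_def inverse_eq_divide)
  have Yl: "(\<lambda>n. Y (s n) i) \<longlonglongrightarrow> l i" if i: "i \<in> {1..k}" for i
  proof -
    have "(\<lambda>n. (Y' \<circ> s) n i) \<longlonglongrightarrow> l i"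
      by (rule continuous_on_tendsto_compose[OF continuous_on_product_coordinates[where i = i] lim]) auto
    then show ?thesis using i by (simp add: Y'_def)
  qed
  have Xl: "(\<lambda>n. X (s n) i) \<longlonglongrightarrow> l i" if i: "i \<in> {1..k}" for i
  proof -
    have "(\<lambda>n. Y (s n) i - X (s n) i) \<longlonglongrightarrow> 0"
      by (rule Lim_null_comparison[OF _ small]) (use Y(2)[OF i] in \<open>auto intro!: always_eventually less_imp_le\<close>)
    from tendsto_diff[OF Yl[OF i] this] show ?thesis by simp
  qed
  have Zl: "(\<lambda>n. Z (s n) j) \<longlonglongrightarrow> M j l" if j: "j \<in> {1..m}" for j
  proof -
    have MX: "(\<lambda>n. M j (X (s n))) \<longlonglongrightarrow> M j l"
      unfolding bl_map_def
    proof (intro tendsto_sum tendsto_scaleR tendsto_const)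
      fix i assume i: "i \<in> {1..k}"
      have "bounded_linear (B i j)" using B_linear[OF i j] by (simp add: linear_conv_bounded_linear)
      then show "(\<lambda>n. B i j (X (s n) i)) \<longlonglongrightarrow> B i j (l i)" by (rule bounded_linear.tendsto[OF _ Xl[OF i]])
    qed
    have "(\<lambda>n. Z (s n) j - M j (X (s n))) \<longlonglongrightarrow> 0"
      by (rule Lim_null_comparison[OF _ small]) (use Z[OF j] in \<open>auto intro!: always_eventually less_imp_le\<close>)
    from tendsto_add[OF this MX] show ?thesis by simp
  qed
  have "\<forall>\<^sub>F n in sequentially. \<forall>i\<in>{1..k}. f i (Y (s n) i) \<le> f i (l i)"
    by (intro eventually_ball_finite ballI eventually_compose_filterlim[OF f(2) Yl]) auto
  moreover have "\<forall>\<^sub>F n in sequentially. \<forall>j\<in>{1..m}. g j (M j l) \<le> g j (Z (s n) j)"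
    by (intro eventually_ball_finite ballI eventually_compose_filterlim[OF g(2) Zl]) auto
  ultimately have "\<forall>\<^sub>F n in sequentially. (\<forall>i\<in>{1..k}. f i (Y (s n) i) \<le> f i (l i)) \<and> (\<forall>j\<in>{1..m}. g j (M j l) \<le> g j (Z (s n) j))"
    by (rule eventually_conj)
  then obtain n where n: "\<And>i. i \<in> {1..k} \<Longrightarrow> f i (Y (s n) i) \<le> f i (l i)" "\<And>j. j \<in> {1..m} \<Longrightarrow> g j (M j l) \<le> g j (Z (s n) j)"
    using eventually_happens'[OF sequentially_bot] by blast
  have "(\<Prod>i=1..k. f i (Y (s n) i) powr c i) \<le> (\<Prod>i=1..k. f i (l i) powr c i)"
    using n(1) simple_bounded_D(2)[OF f(1)] c_pos by (intro prod_mono) (auto intro!: powr_mono2 simp: less_imp_le)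
  also have "\<dots> \<le> (\<Prod>j=1..m. g j (M j l) powr d j)" by (rule le[OF lX])
  also have "\<dots> \<le> (\<Prod>j=1..m. g j (Z (s n) j) powr d j)"
    using n(2) g(1) d_pos by (intro prod_mono) (auto intro!: powr_mono2 simp: less_imp_le)
  finally show False using bad by blast
qed

text \<open>The term \<open>\<epsilon> * sqrt pi ^ dim (F j)\<close> is the mass of the Gaussian
  floor that \<open>fl\<close> adds to \<open>g j\<close>.\<close>

lemma simple_inequality:
  assumes adm: "\<forall>P R. formsD P R \<longrightarrow> Phi P R \<le> D" and \<epsilon>: "0 < \<epsilon>" "\<epsilon> \<le> 1"
    and f: "\<And>i. i \<in> {1..k} \<Longrightarrow> simple_bounded r (f i)" "\<And>i x. i \<in> {1..k} \<Longrightarrow> \<forall>\<^sub>F y in nhds x. f i y \<le> f i x"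
    and g: "\<And>j. j \<in> {1..m} \<Longrightarrow> simple_bounded r (g j)" "\<And>j x. j \<in> {1..m} \<Longrightarrow> \<forall>\<^sub>F y in nhds x. g j x \<le> g j y"
    and le: "\<And>x. x \<in> XE \<Longrightarrow> (\<Prod>i=1..k. f i (x i) powr c i) \<le> (\<Prod>j=1..m. g j (M j x) powr d j)"
    and a: "\<And>i. i \<in> {1..k} \<Longrightarrow> 0 < a i \<and> ennreal (a i) < (\<integral>\<^sup>+x. ennreal (f i x) \<partial>lborel_on (E i))"
    and b: "\<And>j. j \<in> {1..m} \<Longrightarrow> 0 \<le> b j \<and> (\<integral>\<^sup>+x. ennreal (g j x) \<partial>lborel_on (F j)) \<le> ennreal (b j)"
  shows "(\<Prod>i=1..k. a i powr c i) \<le> exp D * (\<Prod>j=1..m. (b j + \<epsilon> * sqrt pi ^ dim (F j)) powr d j)"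
proof -
  obtain \<tau> where \<tau>: "\<tau> > 0" and rob: "\<And>X Y Z. X \<in> XE \<Longrightarrow> (\<forall>i\<in>{1..k}. Y i \<in> E i \<and> norm (Y i - X i) < \<tau>) \<Longrightarrow>
    (\<forall>j\<in>{1..m}. Z j \<in> F j \<and> norm (Z j - M j X) < \<tau>) \<Longrightarrow>
    (\<Prod>i=1..k. f i (Y i) powr c i) \<le> (\<Prod>j=1..m. g j (Z j) powr d j)"
    using robust_inequality[OF f simple_bounded_D(2)[OF g(1)] g(2) le] by blast
  obtain b1 where b1: "0 < b1" "\<And>i x. i \<in> {1..k} \<Longrightarrow> f i x \<le> b1"
    using simple_bounded_common_bound[of "{1..k}" "\<lambda>_. r" f] f(1) by auto
  obtain b2 where b2: "0 < b2" "\<And>i x. i \<in> {1..m} \<Longrightarrow> g i x \<le> b2"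
    using simple_bounded_common_bound[of "{1..m}" "\<lambda>_. r" g] g(1) by auto
  interpret N: bl_nice k c E m d F B f g "max b1 b2" "max 0 r" \<tau>
  proof (intro bl_nice.intro bl_nice_axioms.intro)
    show "bl_datum k c E m d F B" by (rule bl_datum_axioms)
    show "f i \<in> borel_measurable borel" "0 \<le> f i y" "finite (range (f i))" "f i y \<le> max b1 b2" if "i \<in> {1..k}" for i y
      using simple_bounded_D[OF f(1)[OF that]] b1(2)[OF that, of y] by (auto simp: le_max_iff_disj)
    show "f i y = 0" if "i \<in> {1..k}" "max 0 r < norm y" for i y
      using simple_bounded_D(4)[OF f(1)[OF that(1)]] that(2) by simp
    show "g j \<in> borel_measurable borel" "0 \<le> g j y" "finite (range (g j))" "g j y \<le> max b1 b2" if "j \<in> {1..m}" for j y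
      using simple_bounded_D[OF g(1)[OF that]] b2(2)[OF that, of y] by (auto simp: le_max_iff_disj)
    show "0 < (\<integral>\<^sup>+y. ennreal (f i y) \<partial>lborel_on (E i))" if "i \<in> {1..k}" for i
      using a[OF that] by (meson le_less_trans zero_le)
    show "(\<integral>\<^sup>+z. ennreal (g j z) \<partial>lborel_on (F j)) < \<infinity>" if "j \<in> {1..m}" for j
      unfolding infinity_ennreal_def by (rule order.strict_trans1[OF conjunct2[OF b[OF that]] ennreal_less_top])
    show "0 < \<tau>" by (rule \<tau>)
    show "0 < max b1 b2" using b1 by simp
    show "(\<Prod>i=1..k. f i (Y i) powr c i) \<le> (\<Prod>j=1..m. g j (Z j) powr d j)"
      if "X \<in> XE" "\<And>i. i \<in> {1..k} \<Longrightarrow> Y i \<in> E i \<and> norm (Y i - X i) < \<tau>" "\<And>j. j \<in> {1..m} \<Longrightarrow> Z j \<in> F j \<and> norm (Z j - M j X) < \<tau>" for X Y Z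
      using rob that by blast
  qed simp
  have pd: "posdef_on S id_blinfun" for S :: "'c::euclidean_space set" by (simp add: posdef_on_def selfadj_def)
  have mE: "a i \<le> measure (N.NE i) (E i)" if i: "i \<in> {1..k}" for i
  proof -
    have "ennreal (a i) < ennreal (measure (N.NE i) (E i))"
      using a[OF i] heat_flow_density(2)[OF E_subspace[OF i] pd N.f_meas[OF i] N.f_int[OF i] N.f_pos[OF i]] by simp
    then show ?thesis using a[OF i] by (auto simp: ennreal_less_iff)
  qed
  have mF: "measure (N.NF \<epsilon> j) (F j) \<le> b j + \<epsilon> * sqrt pi ^ dim (F j)" "0 < measure (N.NF \<epsilon> j) (F j)" if j: "j \<in> {1..m}" for j
  proof -
    have p: "0 < \<epsilon> * sqrt pi ^ dim (F j)" using \<epsilon> by simp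
    have fin: "(\<integral>\<^sup>+z. ennreal (N.fl \<epsilon> j z) \<partial>lborel_on (F j)) < \<infinity>"
      using N.g_int[OF j] by (simp add: N.fl_int[OF j \<epsilon>(1)])
    have pos: "0 < (\<integral>\<^sup>+z. ennreal (N.fl \<epsilon> j z) \<partial>lborel_on (F j))"
      using p by (simp add: N.fl_int[OF j \<epsilon>(1)] add_nonneg_pos)
    note hd = heat_flow_density(2)[OF F_subspace[OF j] pd N.fl_meas[OF j] fin pos]
    have "ennreal (measure (N.NF \<epsilon> j) (F j)) \<le> ennreal (b j) + ennreal (\<epsilon> * sqrt pi ^ dim (F j))"
      unfolding hd N.fl_int[OF j \<epsilon>(1)] using b[OF j] by (intro add_right_mono) auto
    also have "\<dots> = ennreal (b j + \<epsilon> * sqrt pi ^ dim (F j))" using b[OF j] p by (intro ennreal_plus[symmetric]) auto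
    finally show "measure (N.NF \<epsilon> j) (F j) \<le> b j + \<epsilon> * sqrt pi ^ dim (F j)" using b[OF j] p by (subst (asm) ennreal_le_iff) auto
    show "0 < measure (N.NF \<epsilon> j) (F j)" using pos unfolding hd[symmetric] by simp
  qed
  have "(\<Prod>i=1..k. a i powr c i) = exp (\<Sum>i=1..k. c i * ln (a i))"
  proof -
    have "exp (\<Sum>i=1..k. c i * ln (a i)) = (\<Prod>i=1..k. exp (c i * ln (a i)))" by (rule exp_sum) simp
    also have "\<dots> = (\<Prod>i=1..k. a i powr c i)"
    proof (rule prod.cong)
      fix i assume "i \<in> {1..k}"
      then show "exp (c i * ln (a i)) = a i powr c i" using a[of i] by (simp add: powr_def)
    qed simp
    finally show ?thesis by simp
  qed
  also have "\<dots> \<le> exp (D + (\<Sum>j=1..m. d j * ln (b j + \<epsilon> * sqrt pi ^ dim (F j))))"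
  proof -
    have "(\<Sum>i=1..k. c i * ln (a i)) \<le> (\<Sum>i=1..k. c i * ln (measure (N.NE i) (E i)))"
      using mE a by (intro sum_mono mult_left_mono less_imp_le[OF c_pos] ln_mono) auto
    also have "\<dots> \<le> D + (\<Sum>j=1..m. d j * ln (measure (N.NF \<epsilon> j) (F j)))" by (rule N.log_inequality[OF adm \<epsilon>])
    also have "(\<Sum>j=1..m. d j * ln (measure (N.NF \<epsilon> j) (F j))) \<le> (\<Sum>j=1..m. d j * ln (b j + \<epsilon> * sqrt pi ^ dim (F j)))"
      using mF by (intro sum_mono mult_left_mono less_imp_le[OF d_pos] ln_mono) auto
    finally show ?thesis by simp
  qed
  also have "\<dots> = exp D * (\<Prod>j=1..m. (b j + \<epsilon> * sqrt pi ^ dim (F j)) powr d j)"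
  proof -
    have "exp (\<Sum>j=1..m. d j * ln (b j + \<epsilon> * sqrt pi ^ dim (F j))) = (\<Prod>j=1..m. exp (d j * ln (b j + \<epsilon> * sqrt pi ^ dim (F j))))"
      by (rule exp_sum) simp
    also have "\<dots> = (\<Prod>j=1..m. (b j + \<epsilon> * sqrt pi ^ dim (F j)) powr d j)"
    proof (rule prod.cong)
      fix j assume "j \<in> {1..m}"
      then have "0 < b j + \<epsilon> * sqrt pi ^ dim (F j)" using mF[of j] by linarith
      then show "exp (d j * ln (b j + \<epsilon> * sqrt pi ^ dim (F j))) = (b j + \<epsilon> * sqrt pi ^ dim (F j)) powr d j" by (simp add: powr_def)
    qed simp
    finally show ?thesis by (simp add: exp_add)
  qed
  finally show ?thesis .
qed

text \<open>The \<open>f i\<close> are approximated from below and the \<open>g j\<close> from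
  above. The cutoff at height \<open>N\<close> could destroy the hypothesis where some
  \<open>g j\<close> exceeds \<open>N\<close>; there the floors \<eta> of the other factors ensure
  that a large \<open>N\<close> still dominates the bounded product of the
  \<open>f' i\<close>.\<close>

lemma inequality_with_error:
  assumes adm: "\<forall>P R. formsD P R \<longrightarrow> Phi P R \<le> D" and \<epsilon>: "0 < \<epsilon>" "\<epsilon> \<le> 1"
    and f: "\<And>i. i \<in> {1..k} \<Longrightarrow> nonneg_measurable_on (E i) (f i)"
    and g: "\<And>j. j \<in> {1..m} \<Longrightarrow> nonneg_measurable_on (F j) (g j)"
    and le: "\<And>x. x \<in> XE \<Longrightarrow> (\<Prod>i=1..k. f i (x i) powr c i) \<le> (\<Prod>j=1..m. g j (M j x) powr d j)"
    and a: "\<And>i. i \<in> {1..k} \<Longrightarrow> 0 < a i \<and> ennreal (a i) < (\<integral>\<^sup>+x. ennreal (f i x) \<partial>lebesgue_measure_on (E i))"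
    and b: "\<And>j. j \<in> {1..m} \<Longrightarrow> 0 \<le> b j \<and> (\<integral>\<^sup>+x. ennreal (g j x) \<partial>lebesgue_measure_on (F j)) \<le> ennreal (b j)"
  shows "(\<Prod>i=1..k. a i powr c i) \<le> exp D * (\<Prod>j=1..m. (b j + \<epsilon> + \<epsilon> * sqrt pi ^ dim (F j)) powr d j)"
proof -
  have "\<exists>h r. 0 < r \<and> simple_bounded r h \<and> (\<forall>x\<in>E i. h x \<le> f i x) \<and> (\<forall>x. \<forall>\<^sub>F y in nhds x. h y \<le> h x) \<and>
    ennreal (a i) < (\<integral>\<^sup>+x. ennreal (h x) \<partial>lborel_on (E i))" if i: "i \<in> {1..k}" for i
    by (rule approximation_from_below[OF E_subspace[OF i]]) (use f[OF i] a[OF i] in \<open>auto simp: nonneg_measurable_on_def\<close>)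
  then obtain f' r1 where f': "\<And>i. i \<in> {1..k} \<Longrightarrow> simple_bounded (r1 i) (f' i)"
    "\<And>i x. i \<in> {1..k} \<Longrightarrow> x \<in> E i \<Longrightarrow> f' i x \<le> f i x"
    "\<And>i x. i \<in> {1..k} \<Longrightarrow> \<forall>\<^sub>F y in nhds x. f' i y \<le> f' i x"
    "\<And>i. i \<in> {1..k} \<Longrightarrow> ennreal (a i) < (\<integral>\<^sup>+x. ennreal (f' i x) \<partial>lborel_on (E i))" by metis
  obtain r where r: "0 < r" "\<And>i. i \<in> {1..k} \<Longrightarrow> r1 i \<le> r" using common_upper_bound[of k r1] by blast
  have f'r: "simple_bounded r (f' i)" if "i \<in> {1..k}" for i by (rule simple_bounded_mono[OF f'(1) r(2)]) (rule that)+
  obtain b1 where b1: "0 < b1" "\<And>i x. i \<in> {1..k} \<Longrightarrow> f' i x \<le> b1"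
    using simple_bounded_common_bound[of "{1..k}" "\<lambda>_. r" f'] f'r by auto
  obtain C where C: "C > 0" "\<And>j x. j \<in> {1..m} \<Longrightarrow> norm (M j x) \<le> C * (\<Sum>i=1..k. norm (x i))" using M_bound by blast
  \<comment> \<open>\<open>M j\<close> maps tuples from the supports of the \<open>f' i\<close> into
    the ball of this radius, the only region where the \<open>g j\<close> have to be
    majorized.\<close>
  define r2 where "r2 = C * (real k * r)"
  define G where "G \<eta> N j h \<rho> \<longleftrightarrow> simple_bounded \<rho> h \<and> (\<forall>x\<in>F j. norm x \<le> r2 \<longrightarrow> min (g j x) N \<le> h x \<and> \<eta> \<le> h x) \<and>
    (\<forall>x. \<forall>\<^sub>F y in nhds x. h x \<le> h y) \<and>
    (\<integral>\<^sup>+x. ennreal (h x) \<partial>lborel_on (F j)) \<le> (\<integral>\<^sup>+x. ennreal (g j x) \<partial>lebesgue_measure_on (F j)) + ennreal \<epsilon>" for \<eta> N j h \<rho>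
  have "\<exists>\<eta>>0. \<forall>N. \<exists>h \<rho>. G \<eta> N j h \<rho>" if j: "j \<in> {1..m}" for j
  proof -
    have "g j \<in> borel_measurable (lebesgue_measure_on (F j))" "\<And>x. x \<in> F j \<Longrightarrow> 0 \<le> g j x"
      using g[OF j] by (auto simp: nonneg_measurable_on_def)
    from approximation_from_above[OF F_subspace[OF j] this \<epsilon>(1), of r2] show ?thesis unfolding G_def by blast
  qed
  then obtain \<eta> where \<eta>: "\<And>j. j \<in> {1..m} \<Longrightarrow> 0 < \<eta> j"
    "\<And>j N. j \<in> {1..m} \<Longrightarrow> \<exists>h \<rho>. G (\<eta> j) N j h \<rho>" by metis
  \<comment> \<open>A height at which the \<open>j\<close>-th factor, with only the floors in the
    other factors, reaches the largest possible left-hand side.\<close>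
  have "\<exists>t>0. (\<Prod>i=1..k. b1 powr c i) / (\<Prod>j\<in>{1..m}-{j}. \<eta> j powr d j) \<le> t powr d j" if "j \<in> {1..m}" for j
    by (rule powr_exceeds[OF d_pos[OF that]])
  then obtain t where t: "\<And>j. j \<in> {1..m} \<Longrightarrow> 0 < t j"
    "\<And>j. j \<in> {1..m} \<Longrightarrow> (\<Prod>i=1..k. b1 powr c i) / (\<Prod>j\<in>{1..m}-{j}. \<eta> j powr d j) \<le> t j powr d j" by metis
  obtain N where N: "0 < N" "\<And>j. j \<in> {1..m} \<Longrightarrow> t j \<le> N" using common_upper_bound[of m t] by blast
  obtain g' r3 where G: "\<And>j. j \<in> {1..m} \<Longrightarrow> G (\<eta> j) N j (g' j) (r3 j)" using \<eta>(2)[of _ N] by metis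
  have g': "simple_bounded (r3 j) (g' j)"
    "x \<in> F j \<Longrightarrow> norm x \<le> r2 \<Longrightarrow> min (g j x) N \<le> g' j x"
    "x \<in> F j \<Longrightarrow> norm x \<le> r2 \<Longrightarrow> \<eta> j \<le> g' j x"
    "\<forall>\<^sub>F y in nhds x. g' j x \<le> g' j y"
    "(\<integral>\<^sup>+x. ennreal (g' j x) \<partial>lborel_on (F j)) \<le> (\<integral>\<^sup>+x. ennreal (g j x) \<partial>lebesgue_measure_on (F j)) + ennreal \<epsilon>"
    if "j \<in> {1..m}" for j x
    using G[OF that] unfolding G_def by blast+
  obtain r4 where r4: "0 < r4" "\<And>j. j \<in> {1..m} \<Longrightarrow> r3 j \<le> r4" using common_upper_bound[of m r3] by blast
  define r' where "r' = max r r4"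
  have le': "(\<Prod>i=1..k. f' i (x i) powr c i) \<le> (\<Prod>j=1..m. g' j (M j x) powr d j)" if x: "x \<in> XE" for x
  proof (cases "\<exists>i\<in>{1..k}. f' i (x i) = 0")
    case True
    then have 0: "(\<Prod>i=1..k. f' i (x i) powr c i) = 0" by (intro prod_zero) auto
    show ?thesis unfolding 0 by (intro prod_nonneg) simp
  next
    case False
    then have xr: "norm (x i) \<le> r" if "i \<in> {1..k}" for i
      using simple_bounded_D(4)[OF f'r[OF that], of "x i"] that by (cases "r < norm (x i)") auto
    have Mr: "norm (M j x) \<le> r2" if "j \<in> {1..m}" for j
    proof -
      have "(\<Sum>i=1..k. norm (x i)) \<le> real k * r" using sum_bounded_above[of "{1..k}" "\<lambda>i. norm (x i)" r] xr by simp
      then have "C * (\<Sum>i=1..k. norm (x i)) \<le> r2" unfolding r2_def using C(1) by (intro mult_left_mono) auto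
      then show ?thesis using C(2)[OF that, of x] by linarith
    qed
    note g2 = g'(2)[OF _ M_in[OF x] Mr] and g3 = g'(3)[OF _ M_in[OF x] Mr]
    show ?thesis
    proof (cases "\<exists>j\<in>{1..m}. N < g j (M j x)")
      case True
      then obtain j where j: "j \<in> {1..m}" "N < g j (M j x)" by blast
      have pe: "0 < (\<Prod>j\<in>{1..m}-{j}. \<eta> j powr d j)"
      proof (rule prod_pos)
        fix i assume "i \<in> {1..m} - {j}"
        then show "0 < \<eta> i powr d i" using \<eta>(1)[of i] by simp
      qed
      have "(\<Prod>i=1..k. f' i (x i) powr c i) \<le> (\<Prod>i=1..k. b1 powr c i)"
        using b1 simple_bounded_D(2)[OF f'r] c_pos by (intro prod_mono) (auto intro!: powr_mono2 simp: less_imp_le)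
      also have "\<dots> \<le> t j powr d j * (\<Prod>j\<in>{1..m}-{j}. \<eta> j powr d j)"
        using t(2)[OF j(1)] pe by (simp add: pos_divide_le_eq)
      also have "\<dots> \<le> g' j (M j x) powr d j * (\<Prod>j\<in>{1..m}-{j}. g' j (M j x) powr d j)"
      proof (intro mult_mono powr_mono2 prod_mono prod_nonneg)
        show "t j \<le> g' j (M j x)" using g2[OF j(1)] j(2) N(2)[OF j(1)] j by auto
        fix i assume i: "i \<in> {1..m} - {j}"
        then have "0 < \<eta> i" "0 < d i" "\<eta> i \<le> g' i (M i x)" using \<eta>(1) d_pos g3 by auto
        then show "0 \<le> \<eta> i powr d i \<and> \<eta> i powr d i \<le> g' i (M i x) powr d i" by (auto intro: powr_mono2)
      qed (use t(1)[OF j(1)] d_pos[OF j(1)] in auto)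
      also have "\<dots> = (\<Prod>j=1..m. g' j (M j x) powr d j)"
        using prod.remove[of "{1..m}" j "\<lambda>j. g' j (M j x) powr d j"] j(1) by simp
      finally show ?thesis .
    next
      case False
      have "(\<Prod>i=1..k. f' i (x i) powr c i) \<le> (\<Prod>i=1..k. f i (x i) powr c i)"
      proof (rule prod_mono)
        fix i assume i: "i \<in> {1..k}"
        show "0 \<le> f' i (x i) powr c i \<and> f' i (x i) powr c i \<le> f i (x i) powr c i"
          using f'(2)[OF i XE_D[OF x i]] simple_bounded_D(2)[OF f'r[OF i]] c_pos[OF i] by (auto intro!: powr_mono2)
      qed
      also have "\<dots> \<le> (\<Prod>j=1..m. g j (M j x) powr d j)" by (rule le[OF x])
      also have "\<dots> \<le> (\<Prod>j=1..m. g' j (M j x) powr d j)"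
      proof (rule prod_mono)
        fix j assume j: "j \<in> {1..m}"
        have "g j (M j x) \<le> g' j (M j x)" using g2[OF j] j False by (auto simp: not_less)
        moreover have "0 \<le> g j (M j x)" using g[OF j] M_in[OF x j] by (auto simp: nonneg_measurable_on_def)
        ultimately show "0 \<le> g j (M j x) powr d j \<and> g j (M j x) powr d j \<le> g' j (M j x) powr d j"
          using d_pos[OF j] by (auto intro!: powr_mono2)
      qed
      finally show ?thesis .
    qed
  qed
  show ?thesis
  proof (rule simple_inequality[OF adm \<epsilon> _ f'(3) _ g'(4) le'])
    show "simple_bounded r' (f' i)" if "i \<in> {1..k}" for i by (rule simple_bounded_mono[OF f'r[OF that]]) (simp add: r'_def)
    show "simple_bounded r' (g' j)" if "j \<in> {1..m}" for j
      by (rule simple_bounded_mono[OF g'(1)[OF that]]) (use r4(2)[OF that] in \<open>simp add: r'_def\<close>)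
    show "0 < a i \<and> ennreal (a i) < (\<integral>\<^sup>+x. ennreal (f' i x) \<partial>lborel_on (E i))" if "i \<in> {1..k}" for i
      using a[OF that] f'(4)[OF that] by blast
    show "0 \<le> b j + \<epsilon> \<and> (\<integral>\<^sup>+x. ennreal (g' j x) \<partial>lborel_on (F j)) \<le> ennreal (b j + \<epsilon>)" if j: "j \<in> {1..m}" for j
    proof
      show "0 \<le> b j + \<epsilon>" using b[OF j] \<epsilon> by simp
      have "(\<integral>\<^sup>+x. ennreal (g' j x) \<partial>lborel_on (F j)) \<le> ennreal (b j) + ennreal \<epsilon>"
        using g'(5)[OF j] b[OF j] by (meson add_right_mono order_trans)
      then show "(\<integral>\<^sup>+x. ennreal (g' j x) \<partial>lborel_on (F j)) \<le> ennreal (b j + \<epsilon>)" using b[OF j] \<epsilon> by (simp add: ennreal_plus)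
    qed
  qed
qed

lemma inequality_finite:
  assumes adm: "\<forall>P R. formsD P R \<longrightarrow> Phi P R \<le> D"
    and f: "\<And>i. i \<in> {1..k} \<Longrightarrow> nonneg_measurable_on (E i) (f i)"
    and g: "\<And>j. j \<in> {1..m} \<Longrightarrow> nonneg_measurable_on (F j) (g j)"
    and le: "\<And>x. x \<in> XE \<Longrightarrow> (\<Prod>i=1..k. f i (x i) powr c i) \<le> (\<Prod>j=1..m. g j (M j x) powr d j)"
    and a: "\<And>i. i \<in> {1..k} \<Longrightarrow> 0 < a i \<and> ennreal (a i) < (\<integral>\<^sup>+x. ennreal (f i x) \<partial>lebesgue_measure_on (E i))"
    and b: "\<And>j. j \<in> {1..m} \<Longrightarrow> 0 \<le> b j \<and> (\<integral>\<^sup>+x. ennreal (g j x) \<partial>lebesgue_measure_on (F j)) \<le> ennreal (b j)"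
  shows "(\<Prod>i=1..k. a i powr c i) \<le> exp D * (\<Prod>j=1..m. b j powr d j)"
proof (rule tendsto_lowerbound)
  show "((\<lambda>\<epsilon>. exp D * (\<Prod>j=1..m. (b j + \<epsilon> + \<epsilon> * sqrt pi ^ dim (F j)) powr d j)) \<longlongrightarrow> exp D * (\<Prod>j=1..m. b j powr d j)) (at_right 0)"
  proof (intro tendsto_mult tendsto_prod tendsto_const)
    fix j assume j: "j \<in> {1..m}"
    show "((\<lambda>\<epsilon>. (b j + \<epsilon> + \<epsilon> * sqrt pi ^ dim (F j)) powr d j) \<longlongrightarrow> b j powr d j) (at_right 0)"
    proof (rule tendsto_powr'[OF _ tendsto_const])
      have "((\<lambda>\<epsilon>. b j + \<epsilon> + \<epsilon> * sqrt pi ^ dim (F j)) \<longlongrightarrow> b j + 0 + 0 * sqrt pi ^ dim (F j)) (at_right 0)"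
        by (intro tendsto_intros)
      then show "((\<lambda>\<epsilon>. b j + \<epsilon> + \<epsilon> * sqrt pi ^ dim (F j)) \<longlongrightarrow> b j) (at_right 0)" by simp
      have "\<forall>\<^sub>F \<epsilon> in at_right 0. 0 \<le> b j + \<epsilon> + \<epsilon> * sqrt pi ^ dim (F j)"
        using eventually_at_right_less[of 0] by (rule eventually_mono) (use b[OF j] in auto)
      then show "b j \<noteq> 0 \<or> 0 < d j \<and> (\<forall>\<^sub>F \<epsilon> in at_right 0. 0 \<le> b j + \<epsilon> + \<epsilon> * sqrt pi ^ dim (F j))" using d_pos[OF j] by simp
    qed
  qed
  show "\<forall>\<^sub>F \<epsilon> in at_right 0. (\<Prod>i=1..k. a i powr c i) \<le> exp D * (\<Prod>j=1..m. (b j + \<epsilon> + \<epsilon> * sqrt pi ^ dim (F j)) powr d j)"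
  proof -
    have "\<forall>\<^sub>F \<epsilon> in at_right (0::real). \<epsilon> \<in> {0<..<1}" by (rule eventually_at_right_real) simp
    then show ?thesis by (rule eventually_mono) (use inequality_with_error[OF adm _ _ f g le a b] in auto)
  qed
qed simp

end

section \<open>Zero and infinite integrals\<close>

lemma nn_integral_lebesgue_measure_on:
  "(\<integral>\<^sup>+x. f x \<partial>lebesgue_measure_on S) = (\<integral>\<^sup>+x. f x \<partial>lborel_on S)"
  by (simp add: lebesgue_measure_on_def nn_integral_completion)

lemma borel_measurable_lebesgue_measure_on:
  "f \<in> borel_measurable borel \<Longrightarrow> f \<in> borel_measurable (lebesgue_measure_on S)"
  unfolding lebesgue_measure_on_def by (intro measurable_completion borel_measurable_lborel_on)

lemma ennreal_powr_ennreal: "0 \<le> x \<Longrightarrow> ennreal_powr (ennreal x) a = ennreal (x powr a)"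
  by (simp add: ennreal_powr_def)

lemma ennreal_powr_eq_0: "0 < a \<Longrightarrow> ennreal_powr x a = 0 \<longleftrightarrow> x = 0"
  by (cases x) (auto simp: ennreal_powr_def)

lemma ennreal_positive_below:
  assumes "0 < (x :: ennreal)"
  shows "\<exists>a::real. 0 < a \<and> ennreal a < x"
proof -
  obtain y where y: "0 < y" "y < x" using dense[OF assms] by auto
  then show ?thesis by (cases y) auto
qed

context bl_datum
begin

text \<open>
  If some other \<open>g j\<close> has infinite integral, then the right-hand side of the inequality is \<open>\<infinity> * 0 = 0\<close>, so that
  the left-hand side has to vanish as well.
\<close>

lemma inequality_zero_integral:
  assumes adm: "\<forall>P R. formsD P R \<longrightarrow> Phi P R \<le> D"
    and f: "\<And>i. i \<in> {1..k} \<Longrightarrow> nonneg_measurable_on (E i) (f i)"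
    and g: "\<And>j. j \<in> {1..m} \<Longrightarrow> nonneg_measurable_on (F j) (g j)"
    and le: "\<And>x. x \<in> XE \<Longrightarrow> (\<Prod>i=1..k. f i (x i) powr c i) \<le> (\<Prod>j=1..m. g j (M j x) powr d j)"
    and zero: "j1 \<in> {1..m}" "(\<integral>\<^sup>+x. ennreal (g j1 x) \<partial>lebesgue_measure_on (F j1)) = 0"
  shows "\<exists>i\<in>{1..k}. (\<integral>\<^sup>+x. ennreal (f i x) \<partial>lebesgue_measure_on (E i)) = 0"
proof (rule ccontr)
  assume neg: "\<not> ?thesis"
  have "\<exists>a::real. 0 < a \<and> ennreal a < (\<integral>\<^sup>+x. ennreal (f i x) \<partial>lebesgue_measure_on (E i))" if "i \<in> {1..k}" for i
    by (rule ennreal_positive_below) (use neg that in \<open>auto simp: zero_less_iff_neq_zero\<close>)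
  then obtain a :: "nat \<Rightarrow> real" where a: "\<And>i. i \<in> {1..k} \<Longrightarrow> 0 < a i \<and> ennreal (a i) < (\<integral>\<^sup>+x. ennreal (f i x) \<partial>lebesgue_measure_on (E i))"
    by metis
  define G where "G i h r \<longleftrightarrow> simple_bounded r h \<and> (\<forall>x\<in>E i. h x \<le> f i x) \<and>
    ennreal (a i) < (\<integral>\<^sup>+x. ennreal (h x) \<partial>lborel_on (E i))" for i h r
  have "\<exists>h r. G i h r" if i: "i \<in> {1..k}" for i
  proof -
    have "f i \<in> borel_measurable (lebesgue_measure_on (E i))" "\<And>x. x \<in> E i \<Longrightarrow> 0 \<le> f i x"
      using f[OF i] by (auto simp: nonneg_measurable_on_def)
    from approximation_from_below[OF E_subspace[OF i] this conjunct2[OF a[OF i]]] show ?thesis unfolding G_def by blast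
  qed
  then obtain h r1 where "\<And>i. i \<in> {1..k} \<Longrightarrow> G i (h i) (r1 i)" by metis
  then have h: "simple_bounded (r1 i) (h i)" "x \<in> E i \<Longrightarrow> h i x \<le> f i x"
    "ennreal (a i) < (\<integral>\<^sup>+x. ennreal (h i x) \<partial>lborel_on (E i))" if "i \<in> {1..k}" for i x
    using that unfolding G_def by blast+
  obtain r where r: "0 < r" "\<And>i. i \<in> {1..k} \<Longrightarrow> r1 i \<le> r" using common_upper_bound[of k r1] by blast
  have hr: "simple_bounded r (h i)" if "i \<in> {1..k}" for i by (rule simple_bounded_mono[OF h(1) r(2)]) (rule that)+
  obtain b1 where b1: "0 < b1" "\<And>i x. i \<in> {1..k} \<Longrightarrow> h i x \<le> b1"
    using simple_bounded_common_bound[of "{1..k}" "\<lambda>_. r" h] hr by auto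
  obtain C where C: "C > 0" "\<And>j x. j \<in> {1..m} \<Longrightarrow> norm (M j x) \<le> C * (\<Sum>i=1..k. norm (x i))" using M_bound by blast
  define r2 where "r2 = C * (real k * r)"
  obtain t where t: "0 < t" "(\<Prod>i=1..k. b1 powr c i) \<le> t powr d j1" using powr_exceeds[OF d_pos[OF zero(1)]] by blast
  define N where "N = max 1 t"
  have N: "1 \<le> N" "t \<le> N" by (auto simp: N_def)
  \<comment> \<open>One constant in place of all positive values, on a large ball only: the
    integrals become finite, the one for \<open>j1\<close> stays zero, and the product still
    dominates that of the bounded functions \<open>h\<close>.\<close>
  define g' where "g' j z = (if 0 < g j z \<and> norm z \<le> r2 then N else 0)" for j z
  define b where "b j = enn2real (\<integral>\<^sup>+x. ennreal (g' j x) \<partial>lebesgue_measure_on (F j))" for j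
  have g'm: "nonneg_measurable_on (F j) (g' j)" if j: "j \<in> {1..m}" for j
  proof -
    have [measurable]: "g j \<in> borel_measurable (lebesgue_measure_on (F j))" using g[OF j] by (simp add: nonneg_measurable_on_def)
    have [measurable]: "(\<lambda>x. norm x) \<in> borel_measurable (lebesgue_measure_on (F j))"
      by (rule borel_measurable_lebesgue_measure_on) measurable
    show ?thesis using N by (simp add: nonneg_measurable_on_def g'_def[abs_def])
  qed
  have bfin: "(\<integral>\<^sup>+x. ennreal (g' j x) \<partial>lebesgue_measure_on (F j)) < \<infinity>" if j: "j \<in> {1..m}" for j
  proof -
    have CS: "cball 0 r2 \<inter> F j \<in> sets (lborel_on (F j))" by (rule Int_in_sets_lborel_on[OF F_subspace[OF j]]) auto
    have "(\<integral>\<^sup>+x. ennreal (g' j x) \<partial>lebesgue_measure_on (F j)) \<le> (\<integral>\<^sup>+x. ennreal N * indicator (cball 0 r2 \<inter> F j) x \<partial>lebesgue_measure_on (F j))"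
      by (rule nn_integral_mono) (auto simp: g'_def indicator_def)
    also have "\<dots> = ennreal N * emeasure (lborel_on (F j)) (cball 0 r2 \<inter> F j)"
      using CS by (subst nn_integral_cmult_indicator) (auto simp: lebesgue_measure_on_def)
    also have "\<dots> < \<infinity>" using lborel_on_cball_finite[OF F_subspace[OF j], of r2] by (simp add: ennreal_mult_less_top)
    finally show ?thesis .
  qed
  have b0: "b j1 = 0"
  proof -
    have gm: "g j1 \<in> borel_measurable (lebesgue_measure_on (F j1))" using g[OF zero(1)] by (simp add: nonneg_measurable_on_def)
    have "AE x in lebesgue_measure_on (F j1). ennreal (g j1 x) = 0"
      using zero(2) gm by (subst (asm) nn_integral_0_iff_AE) auto
    then have "AE x in lebesgue_measure_on (F j1). ennreal (g' j1 x) = 0"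
      by eventually_elim (auto simp: g'_def)
    then have "(\<integral>\<^sup>+x. ennreal (g' j1 x) \<partial>lebesgue_measure_on (F j1)) = (\<integral>\<^sup>+x. 0 \<partial>lebesgue_measure_on (F j1))"
      by (rule nn_integral_cong_AE)
    then show ?thesis by (simp add: b_def)
  qed
  have le': "(\<Prod>i=1..k. h i (x i) powr c i) \<le> (\<Prod>j=1..m. g' j (M j x) powr d j)" if x: "x \<in> XE" for x
  proof (cases "\<exists>i\<in>{1..k}. h i (x i) = 0")
    case True
    then have 0: "(\<Prod>i=1..k. h i (x i) powr c i) = 0" by (intro prod_zero) auto
    show ?thesis unfolding 0 by (intro prod_nonneg) simp
  next
    case False
    then have xr: "norm (x i) \<le> r" if "i \<in> {1..k}" for i
      using simple_bounded_D(4)[OF hr[OF that], of "x i"] that by (cases "r < norm (x i)") auto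
    have Mr: "norm (M j x) \<le> r2" if "j \<in> {1..m}" for j
    proof -
      have "(\<Sum>i=1..k. norm (x i)) \<le> real k * r" using sum_bounded_above[of "{1..k}" "\<lambda>i. norm (x i)" r] xr by simp
      then have "C * (\<Sum>i=1..k. norm (x i)) \<le> r2" unfolding r2_def using C(1) by (intro mult_left_mono) auto
      then show ?thesis using C(2)[OF that, of x] by linarith
    qed
    have fp: "0 < (\<Prod>i=1..k. f i (x i) powr c i)"
    proof (rule prod_pos)
      fix i assume i: "i \<in> {1..k}"
      have "0 < h i (x i)" using simple_bounded_D(2)[OF hr[OF i], of "x i"] False i by (auto simp: less_le)
      then have "0 < f i (x i)" using h(2)[OF i XE_D[OF x i]] by linarith
      then show "0 < f i (x i) powr c i" by simp
    qed
    have gp: "g' j (M j x) = N" if j: "j \<in> {1..m}" for j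
    proof -
      have "g j (M j x) \<noteq> 0"
      proof
        assume "g j (M j x) = 0"
        then have "(\<Prod>j=1..m. g j (M j x) powr d j) = 0" using j by (intro prod_zero) auto
        then show False using fp le[OF x] by linarith
      qed
      moreover have "0 \<le> g j (M j x)" using g[OF j] M_in[OF x j] by (simp add: nonneg_measurable_on_def)
      ultimately show ?thesis using Mr[OF j] by (simp add: g'_def less_le)
    qed
    have "(\<Prod>i=1..k. h i (x i) powr c i) \<le> (\<Prod>i=1..k. b1 powr c i)"
      using b1 simple_bounded_D(2)[OF hr] c_pos by (intro prod_mono) (auto intro!: powr_mono2 simp: less_imp_le)
    also have "\<dots> \<le> t powr d j1 * 1" using t by simp
    also have "\<dots> \<le> N powr d j1 * (\<Prod>j\<in>{1..m}-{j1}. N powr d j)"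
    proof (intro mult_mono prod_ge_1)
      show "t powr d j1 \<le> N powr d j1" using t N d_pos[OF zero(1)] by (intro powr_mono2) auto
      show "1 \<le> N powr d j" if "j \<in> {1..m} - {j1}" for j
        using N d_pos[of j] that by (intro ge_one_powr_ge_zero) auto
    qed auto
    also have "\<dots> = (\<Prod>j=1..m. N powr d j)"
      using prod.remove[of "{1..m}" j1 "\<lambda>j. N powr d j"] zero(1) by simp
    also have "\<dots> = (\<Prod>j=1..m. g' j (M j x) powr d j)" using gp by (intro prod.cong) auto
    finally show ?thesis .
  qed
  have "(\<Prod>i=1..k. a i powr c i) \<le> exp D * (\<Prod>j=1..m. b j powr d j)"
  proof (rule inequality_finite[OF adm _ g'm le'])
    show "nonneg_measurable_on (E i) (h i)" if "i \<in> {1..k}" for i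
      using simple_bounded_D[OF hr[OF that]] by (simp add: nonneg_measurable_on_def borel_measurable_lebesgue_measure_on)
    show "0 < a i \<and> ennreal (a i) < (\<integral>\<^sup>+x. ennreal (h i x) \<partial>lebesgue_measure_on (E i))" if "i \<in> {1..k}" for i
      using a[OF that] h(3)[OF that] simple_bounded_D(1)[OF hr[OF that]] by (simp add: nn_integral_lebesgue_measure_on)
    show "0 \<le> b j \<and> (\<integral>\<^sup>+x. ennreal (g' j x) \<partial>lebesgue_measure_on (F j)) \<le> ennreal (b j)" if "j \<in> {1..m}" for j
      using bfin[OF that] by (simp add: b_def)
  qed
  also have "(\<Prod>j=1..m. b j powr d j) = 0" using zero(1) b0 by (intro prod_zero) auto
  finally have "(\<Prod>i=1..k. a i powr c i) \<le> 0" by simp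
  moreover have "0 < (\<Prod>i=1..k. a i powr c i)"
  proof (rule prod_pos)
    fix i assume "i \<in> {1..k}"
    then show "0 < a i powr c i" using a[of i] by simp
  qed
  ultimately show False by linarith
qed

text \<open>Beyond \<open>inequality_finite\<close> only limits and the values 0 and \<infinity>
  remain. The numbers \<open>a i\<close> are pushed up to the integrals of the \<open>f i\<close>;
  if one of these were infinite, arbitrarily large \<open>a i\<close> would contradict the finite
  right-hand side.\<close>

theorem functional_inequality:
  assumes adm: "\<forall>P R. formsD P R \<longrightarrow> Phi P R \<le> D"
    and f: "\<And>i. i \<in> {1..k} \<Longrightarrow> nonneg_measurable_on (E i) (f i)"
    and g: "\<And>j. j \<in> {1..m} \<Longrightarrow> nonneg_measurable_on (F j) (g j)"
    and le: "\<And>x. x \<in> XE \<Longrightarrow> (\<Prod>i=1..k. f i (x i) powr c i) \<le> (\<Prod>j=1..m. g j (M j x) powr d j)"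
  shows "(\<Prod>i=1..k. ennreal_powr (\<integral>\<^sup>+x. ennreal (f i x) \<partial>lebesgue_measure_on (E i)) (c i))
    \<le> ennreal (exp D) * (\<Prod>j=1..m. ennreal_powr (\<integral>\<^sup>+y. ennreal (g j y) \<partial>lebesgue_measure_on (F j)) (d j))"
proof -
  define If where "If i = (\<integral>\<^sup>+x. ennreal (f i x) \<partial>lebesgue_measure_on (E i))" for i
  define Ig where "Ig j = (\<integral>\<^sup>+y. ennreal (g j y) \<partial>lebesgue_measure_on (F j))" for j
  have "(\<Prod>i=1..k. ennreal_powr (If i) (c i)) \<le> ennreal (exp D) * (\<Prod>j=1..m. ennreal_powr (Ig j) (d j))"
  proof (cases "\<exists>i\<in>{1..k}. If i = 0")
    case True
    then have "(\<Prod>i=1..k. ennreal_powr (If i) (c i)) = 0"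
      using c_pos by (intro prod_zero) (auto simp: ennreal_powr_eq_0)
    then show ?thesis by (simp only: zero_le)
  next
    case False
    then have If0: "0 < If i" if "i \<in> {1..k}" for i using that by (auto simp: zero_less_iff_neq_zero)
    have Ig0: "Ig j \<noteq> 0" if "j \<in> {1..m}" for j
      using inequality_zero_integral[OF adm f g le that] False unfolding If_def Ig_def by blast
    show ?thesis
    proof (cases "\<exists>j\<in>{1..m}. Ig j = \<infinity>")
      case True
      have "(\<Prod>j=1..m. ennreal_powr (Ig j) (d j)) = top"
        using True Ig0 d_pos unfolding ennreal_prod_eq_top by (auto simp: ennreal_powr_eq_0 ennreal_powr_def enn2real_eq_0_iff)
      then have "ennreal (exp D) * (\<Prod>j=1..m. ennreal_powr (Ig j) (d j)) = top" by (simp add: ennreal_mult_top)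
      then show ?thesis by (simp only: top_greatest)
    next
      case False
      define b where "b j = enn2real (Ig j)" for j
      have b: "Ig j = ennreal (b j)" "0 \<le> b j" if "j \<in> {1..m}" for j using False that by (auto simp: b_def less_top)
      define \<rho> where "\<rho> = exp D * (\<Prod>j=1..m. b j powr d j)"
      have main: "(\<Prod>i=1..k. a i powr c i) \<le> \<rho>" if a: "\<And>i. i \<in> {1..k} \<Longrightarrow> 0 < a i \<and> ennreal (a i) < If i" for a :: "nat \<Rightarrow> real"
        unfolding \<rho>_def
        by (rule inequality_finite[OF adm f g le]) (use a b in \<open>auto simp: If_def Ig_def\<close>)
      have "\<exists>a::real. 0 < a \<and> ennreal a < If i" if "i \<in> {1..k}" for i
        by (rule ennreal_positive_below[OF If0[OF that]])
      then obtain a :: "nat \<Rightarrow> real" where a: "\<And>i. i \<in> {1..k} \<Longrightarrow> 0 < a i \<and> ennreal (a i) < If i" by metis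
      have fin: "If i \<noteq> \<infinity>" if i: "i \<in> {1..k}" for i
      proof
        assume inf: "If i = \<infinity>"
        define K where "K = (\<Prod>i\<in>{1..k}-{i}. a i powr c i)"
        have K: "0 < K" unfolding K_def
        proof (rule prod_pos)
          fix l assume "l \<in> {1..k} - {i}"
          then show "0 < a l powr c l" using a[of l] by simp
        qed
        obtain t where t: "0 < t" "(\<rho> + 1) / K \<le> t powr c i" using powr_exceeds[OF c_pos[OF i]] by blast
        have "(\<Prod>l=1..k. (a(i := t)) l powr c l) \<le> \<rho>"
          by (rule main) (use a t inf in auto)
        moreover have "(\<Prod>l=1..k. (a(i := t)) l powr c l) = t powr c i * K"
          using prod.remove[of "{1..k}" i "\<lambda>l. (a(i := t)) l powr c l"] i by (simp add: K_def)
        moreover have "\<rho> + 1 \<le> t powr c i * K" using t(2) K by (simp add: pos_divide_le_eq)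
        ultimately show False by linarith
      qed
      define u where "u i = enn2real (If i)" for i
      have u: "If i = ennreal (u i)" "0 < u i" if "i \<in> {1..k}" for i
        using fin[OF that] If0[OF that] by (auto simp: u_def less_top enn2real_positive_iff)
      have "(\<Prod>i=1..k. u i powr c i) \<le> \<rho>"
      proof (rule tendsto_upperbound)
        show "((\<lambda>s. \<Prod>i=1..k. (s * u i) powr c i) \<longlongrightarrow> (\<Prod>i=1..k. u i powr c i)) (at_left 1)"
        proof (intro tendsto_prod)
          fix i assume i: "i \<in> {1..k}"
          have "((\<lambda>s. (s * u i) powr c i) \<longlongrightarrow> (1 * u i) powr c i) (at_left 1)"
            by (intro tendsto_powr tendsto_mult tendsto_const tendsto_ident_at) (use u[OF i] in simp)
          then show "((\<lambda>s. (s * u i) powr c i) \<longlongrightarrow> u i powr c i) (at_left 1)" by simp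
        qed
        have "\<forall>\<^sub>F s in at_left (1::real). s \<in> {0<..<1}" by (rule eventually_at_left_real) simp
        then show "\<forall>\<^sub>F s in at_left 1. (\<Prod>i=1..k. (s * u i) powr c i) \<le> \<rho>"
        proof (rule eventually_mono)
          fix s :: real assume s: "s \<in> {0<..<1}"
          show "(\<Prod>i=1..k. (s * u i) powr c i) \<le> \<rho>"
          proof (rule main)
            fix i assume i: "i \<in> {1..k}"
            have "s * u i < 1 * u i" using s u(2)[OF i] by (intro mult_strict_right_mono) auto
            then show "0 < s * u i \<and> ennreal (s * u i) < If i" using s u[OF i] by (simp add: ennreal_less_iff)
          qed
        qed
      qed simp
      moreover have "(\<Prod>i=1..k. ennreal_powr (If i) (c i)) = ennreal (\<Prod>i=1..k. u i powr c i)"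
      proof -
        have "(\<Prod>i=1..k. ennreal_powr (If i) (c i)) = (\<Prod>i=1..k. ennreal (u i powr c i))"
          using u by (intro prod.cong) (auto simp: ennreal_powr_ennreal less_imp_le)
        then show ?thesis by (simp add: prod_ennreal)
      qed
      moreover have "ennreal (exp D) * (\<Prod>j=1..m. ennreal_powr (Ig j) (d j)) = ennreal \<rho>"
      proof -
        have "(\<Prod>j=1..m. ennreal_powr (Ig j) (d j)) = (\<Prod>j=1..m. ennreal (b j powr d j))"
          using b by (intro prod.cong) (auto simp: ennreal_powr_ennreal)
        then show ?thesis by (simp add: prod_ennreal \<rho>_def ennreal_mult prod_nonneg)
      qed
      ultimately show ?thesis by (simp add: ennreal_leI)
    qed
  qed
  then show ?thesis unfolding If_def Ig_def .
qed

end

subsection \<open>Gaussian constants and duality\<close>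

text \<open>Keeps the values of the form on \<open>S\<close> and makes the operator map into
  \<open>S\<close>, so that it can be inverted there.\<close>

definition compress :: "'a::euclidean_space set \<Rightarrow> ('a \<Rightarrow>\<^sub>L 'a) \<Rightarrow> ('a \<Rightarrow>\<^sub>L 'a)" where
  "compress S P = proj_on S o\<^sub>L P o\<^sub>L proj_on S"

lemma compress_in: "subspace S \<Longrightarrow> compress S P x \<in> S"
  by (simp add: compress_def proj_on_in)

lemma compress_form:
  fixes P :: "'a::euclidean_space \<Rightarrow>\<^sub>L 'a"
  assumes "subspace S" "x \<in> S" "y \<in> S"
  shows "compress S P x \<bullet> y = P x \<bullet> y"
  using selfadjD[OF selfadj_proj_on, of S "P x" y] assms by (simp add: compress_def proj_on_id inner_commute)

lemma compress_posdef_on: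
  fixes P :: "'a::euclidean_space \<Rightarrow>\<^sub>L 'a"
  assumes S: "subspace S" and sym: "\<And>x y. x \<in> S \<Longrightarrow> y \<in> S \<Longrightarrow> P x \<bullet> y = x \<bullet> P y"
    and pos: "\<And>x. x \<in> S \<Longrightarrow> x \<noteq> 0 \<Longrightarrow> 0 < P x \<bullet> x"
  shows "posdef_on S (compress S P)"
proof -
  have pr: "proj_on S u \<bullet> v = u \<bullet> proj_on S v" for u v
    using selfadj_proj_on[of S] unfolding selfadj_def by blast
  have "selfadj (compress S P)"
    unfolding selfadj_def
  proof (intro allI)
    fix x y
    have "compress S P x \<bullet> y = P (proj_on S x) \<bullet> proj_on S y" by (simp add: compress_def pr)
    also have "\<dots> = proj_on S x \<bullet> P (proj_on S y)" by (rule sym) (rule proj_on_in[OF S])+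
    also have "\<dots> = x \<bullet> compress S P y" by (simp add: compress_def pr)
    finally show "compress S P x \<bullet> y = x \<bullet> compress S P y" .
  qed
  then show ?thesis using pos by (auto simp: posdef_on_def compress_form[OF S])
qed

lemma posdef_on_inverse_compress:
  assumes S: "subspace S" and P: "posdef_on S P"
  obtains A where "posdef_on S (compress S P)" "inverse_on S (compress S P) A" "posdef_on S A" "Zg S (compress S P) = Zg S P"
proof -
  have c: "posdef_on S (compress S P)"
    by (rule compress_posdef_on[OF S]) (use P in \<open>auto simp: posdef_on_def selfadj_def\<close>)
  moreover obtain A where "inverse_on S (compress S P) A" "posdef_on S A"
    using posdef_inverse[OF S c compress_in[OF S]] by blast
  moreover have "Zg S (compress S P) = Zg S P" by (rule Zg_cong) (simp add: compress_form[OF S])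
  ultimately show thesis using that by blast
qed

lemma ln_Zg_inverse:
  assumes "subspace S" "posdef_on S P" "posdef_on S A" "inverse_on S P A"
  shows "ln (Zg S A) = real (dim S) * ln (2 * pi) - ln (Zg S P)"
proof -
  have "ln (Zg S P * Zg S A) = ln ((2 * pi) ^ dim S)" using Zg_inverse[OF assms] by simp
  then show ?thesis using Zg_pos[OF assms(1,2)] Zg_pos[OF assms(1,3)] by (simp add: ln_mult_pos ln_realpow distrib_left)
qed

lemma inv_into_inverse_on:
  assumes inv: "inverse_on S P A" and x: "x \<in> S"
  shows "inv_into S A x = P x"
proof (rule inv_into_f_eq)
  show "inj_on A S" using inv by (intro inj_on_inverseI[of S P]) (auto simp: inverse_on_def)
qed (use inv x in \<open>auto simp: inverse_on_def\<close>)

text \<open>Centered Gaussians are defined through the covariance, whereas the proof works with its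
  inverse; inverting the compressed form recovers a covariance within \<open>S\<close>.\<close>

lemma centered_gaussian_on_posdef:
  assumes S: "subspace S" and P: "posdef_on S P"
  shows "centered_gaussian_on S (\<lambda>x. exp (- (P x \<bullet> x) / 2))"
proof -
  obtain A where A: "inverse_on S (compress S P) A" "posdef_on S A"
    using posdef_on_inverse_compress[OF S P] by blast
  show ?thesis unfolding centered_gaussian_on_def
  proof (intro exI[of _ "blinfun_apply A"] conjI ballI impI)
    show "linear (blinfun_apply A)" using blinfun.bounded_linear_right by (rule bounded_linear.linear)
    show "blinfun_apply A ` S \<subseteq> S" using A(1) by (auto simp: inverse_on_def)
    show "A x \<bullet> y = x \<bullet> A y" for x y using posdef_onD(1)[OF A(2)] by (simp add: selfadj_def)
    show "0 < A x \<bullet> x" if "x \<in> S" "x \<noteq> 0" for x by (rule posdef_onD(2)[OF A(2) that])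
    show "exp (- (P x \<bullet> x) / 2) = exp (- (1 / 2) * (inv_into S A x \<bullet> x))" if "x \<in> S" for x
      unfolding inv_into_inverse_on[OF A(1) that] compress_form[OF S that that] by simp
  qed
qed

lemma centered_gaussian_on_nonneg_measurable_on:
  assumes S: "subspace S" and f: "centered_gaussian_on S f"
  shows "nonneg_measurable_on S f"
proof -
  obtain A where A: "linear A" "A ` S \<subseteq> S" "\<forall>x\<in>S. \<forall>y\<in>S. A x \<bullet> y = x \<bullet> A y" "\<forall>x\<in>S. x \<noteq> 0 \<longrightarrow> 0 < A x \<bullet> x"
    and fA: "\<forall>x\<in>S. f x = exp (- (1/2) * (inv_into S A x \<bullet> x))"
    using f unfolding centered_gaussian_on_def by blast
  have bl: "blinfun_apply (Blinfun A) = A"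
    using A(1) by (intro bounded_linear_Blinfun_apply) (simp add: linear_conv_bounded_linear)
  let ?A = "compress S (Blinfun A)"
  have AS: "?A x = A x" if "x \<in> S" for x
    using that A(2) by (auto simp: compress_def bl proj_on_id[OF S])
  have pd: "posdef_on S ?A" by (rule compress_posdef_on[OF S]) (use A in \<open>auto simp: bl\<close>)
  obtain P where P: "inverse_on S ?A P" using posdef_inverse[OF S pd compress_in[OF S]] by blast
  have "inv_into S A x = P x" if x: "x \<in> S" for x
  proof (rule inv_into_f_eq)
    show "inj_on A S" using P AS by (intro inj_on_inverseI[of S P]) (auto simp: inverse_on_def)
  qed (use P x AS in \<open>auto simp: inverse_on_def\<close>)
  then have fP: "f x = exp (- (1/2) * (P x \<bullet> x))" if "x \<in> S" for x using fA that by simp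
  have "(\<lambda>x. exp (- (1/2) * (P x \<bullet> x))) \<in> borel_measurable (lebesgue_measure_on S)"
    by (rule borel_measurable_lebesgue_measure_on) measurable
  then have "f \<in> borel_measurable (lebesgue_measure_on S)"
    by (rule measurable_cong[THEN iffD2, rotated]) (simp add: fP)
  then show ?thesis using fP by (simp add: nonneg_measurable_on_def)
qed

lemma nn_integral_gaussian_Zg:
  assumes S: "subspace S" and P: "posdef_on S P"
  shows "(\<integral>\<^sup>+x. ennreal (exp (- (P x \<bullet> x) / 2)) \<partial>lebesgue_measure_on S) = ennreal (Zg S P)"
  using gint_Zg[OF S P] by (simp add: nn_integral_lebesgue_measure_on gint_def)

context bl_datum
begin

text \<open>Unlike in \<open>formsD\<close>, the forms are not normalized and \<open>Q\<close> may
  degenerate: this is the condition that testing with all centered Gaussians yields, and the one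
  that duality preserves.\<close>

definition gauss_bound :: "real \<Rightarrow> bool" where
  "gauss_bound D \<longleftrightarrow> (\<forall>P R. (\<forall>i\<in>{1..k}. posdef_on (E i) (P i)) \<longrightarrow> (\<forall>j\<in>{1..m}. posdef_on (F j) (R j)) \<longrightarrow>
     (\<forall>x\<in>XE. 0 \<le> Q P R x x) \<longrightarrow> Phi P R \<le> D)"

lemma formsD_Q_nonneg:
  assumes "formsD P R" "x \<in> XE"
  shows "0 \<le> Q P R x x"
proof (cases "0 < nX x")
  case True
  then show ?thesis using formsD_D(5)[OF assms(1)] assms(2) by (auto simp: Qpos_def less_imp_le)
next
  case False
  have "(\<Sum>i=1..k. x i \<bullet> x i) = 0"
    using False sum_nonneg[of "{1..k}" "\<lambda>i. x i \<bullet> x i"] unfolding nX_def by simp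
  then have x0: "x i = 0" if "i \<in> {1..k}" for i using that by (subst (asm) sum_nonneg_eq_0_iff) auto
  have "M j x = 0" if "j \<in> {1..m}" for j
    unfolding bl_map_def using x0 linear_0[OF B_linear[OF _ that]] by (intro sum.neutral) auto
  then show ?thesis using x0 by (simp add: bl_form_def)
qed

lemma gauss_bound_formsD: "gauss_bound D \<Longrightarrow> formsD P R \<Longrightarrow> Phi P R \<le> D"
  using formsD_D(1,3) formsD_Q_nonneg unfolding gauss_bound_def by blast

definition admissible_for ::
  "('a set \<Rightarrow> ('a \<Rightarrow> real) \<Rightarrow> bool) \<Rightarrow> ('b set \<Rightarrow> ('b \<Rightarrow> real) \<Rightarrow> bool) \<Rightarrow> real \<Rightarrow> bool" where
  "admissible_for U V D \<longleftrightarrow> (\<forall>f g.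
       (\<forall>i\<in>{1..k}. U (E i) (f i)) \<longrightarrow>
       (\<forall>j\<in>{1..m}. V (F j) (g j)) \<longrightarrow>
       (\<forall>x\<in>XE. (\<Prod>i=1..k. f i (x i) powr c i) \<le> (\<Prod>j=1..m. g j (M j x) powr d j)) \<longrightarrow>
       (\<Prod>i=1..k. ennreal_powr (\<integral>\<^sup>+ x. ennreal (f i x) \<partial>lebesgue_measure_on (E i)) (c i))
         \<le> ennreal (exp D) *
           (\<Prod>j=1..m. ennreal_powr (\<integral>\<^sup>+ y. ennreal (g j y) \<partial>lebesgue_measure_on (F j)) (d j)))"

lemma brascamp_lieb_const_eq: "brascamp_lieb_const U V k c E m d F B = Inf {ereal D | D. admissible_for U V D}"
  unfolding brascamp_lieb_const_def admissible_for_def XE_def bl_map_def by simp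

lemma gauss_bound_imp_admissible: "gauss_bound D \<Longrightarrow> admissible_for nonneg_measurable_on nonneg_measurable_on D"
  unfolding admissible_for_def using functional_inequality gauss_bound_formsD by blast

lemma admissible_gaussian:
  "admissible_for nonneg_measurable_on nonneg_measurable_on D \<Longrightarrow> admissible_for centered_gaussian_on centered_gaussian_on D"
  unfolding admissible_for_def
proof (intro allI impI)
  fix f g
  assume adm: "\<forall>f g. (\<forall>i\<in>{1..k}. nonneg_measurable_on (E i) (f i)) \<longrightarrow> (\<forall>j\<in>{1..m}. nonneg_measurable_on (F j) (g j)) \<longrightarrow>
      (\<forall>x\<in>XE. (\<Prod>i=1..k. f i (x i) powr c i) \<le> (\<Prod>j=1..m. g j (M j x) powr d j)) \<longrightarrow>
      (\<Prod>i=1..k. ennreal_powr (\<integral>\<^sup>+ x. ennreal (f i x) \<partial>lebesgue_measure_on (E i)) (c i))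
        \<le> ennreal (exp D) * (\<Prod>j=1..m. ennreal_powr (\<integral>\<^sup>+ y. ennreal (g j y) \<partial>lebesgue_measure_on (F j)) (d j))"
    and f: "\<forall>i\<in>{1..k}. centered_gaussian_on (E i) (f i)" and g: "\<forall>j\<in>{1..m}. centered_gaussian_on (F j) (g j)"
    and le: "\<forall>x\<in>XE. (\<Prod>i=1..k. f i (x i) powr c i) \<le> (\<Prod>j=1..m. g j (M j x) powr d j)"
  have fg: "\<forall>i\<in>{1..k}. nonneg_measurable_on (E i) (f i)" "\<forall>j\<in>{1..m}. nonneg_measurable_on (F j) (g j)"
    using f g E_subspace F_subspace centered_gaussian_on_nonneg_measurable_on by blast+
  show "(\<Prod>i=1..k. ennreal_powr (\<integral>\<^sup>+ x. ennreal (f i x) \<partial>lebesgue_measure_on (E i)) (c i))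
    \<le> ennreal (exp D) * (\<Prod>j=1..m. ennreal_powr (\<integral>\<^sup>+ y. ennreal (g j y) \<partial>lebesgue_measure_on (F j)) (d j))"
    by (rule adm[THEN spec, THEN spec, THEN mp, THEN mp, THEN mp, OF fg le])
qed

lemma gaussian_prod:
  fixes z a :: "nat \<Rightarrow> real"
  assumes "\<And>i. i \<in> {1..n} \<Longrightarrow> 0 < z i"
  shows "(\<Prod>i=1..n. ennreal_powr (ennreal (z i)) (a i)) = ennreal (exp (\<Sum>i=1..n. a i * ln (z i)))"
proof -
  have "(\<Prod>i=1..n. ennreal_powr (ennreal (z i)) (a i)) = (\<Prod>i=1..n. ennreal (exp (a i * ln (z i))))"
  proof (rule prod.cong)
    fix i assume "i \<in> {1..n}"
    then show "ennreal_powr (ennreal (z i)) (a i) = ennreal (exp (a i * ln (z i)))"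
      using assms[of i] by (subst ennreal_powr_ennreal) (auto simp: powr_def)
  qed simp
  also have "\<dots> = ennreal (\<Prod>i=1..n. exp (a i * ln (z i)))" by (rule prod_ennreal) simp
  also have "(\<Prod>i=1..n. exp (a i * ln (z i))) = exp (\<Sum>i=1..n. a i * ln (z i))" by (rule exp_sum[symmetric]) simp
  finally show ?thesis .
qed

lemma admissible_gaussian_imp_gauss_bound:
  assumes "admissible_for centered_gaussian_on centered_gaussian_on D"
  shows "gauss_bound D"
  unfolding gauss_bound_def
proof (intro allI impI)
  fix P :: "nat \<Rightarrow> 'a \<Rightarrow>\<^sub>L 'a" and R :: "nat \<Rightarrow> 'b \<Rightarrow>\<^sub>L 'b"
  assume P: "\<forall>i\<in>{1..k}. posdef_on (E i) (P i)" and R: "\<forall>j\<in>{1..m}. posdef_on (F j) (R j)"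
    and Q: "\<forall>x\<in>XE. 0 \<le> Q P R x x"
  have pt: "(\<Prod>i=1..n. exp (- q i / 2) powr a i) = exp (- (\<Sum>i=1..n. a i * q i) / 2)" for q a :: "nat \<Rightarrow> real" and n
    by (simp add: powr_def exp_sum[symmetric] sum_negf sum_divide_distrib)
  let ?f = "\<lambda>i x. exp (- (P i x \<bullet> x) / 2)" and ?g = "\<lambda>j y. exp (- (R j y \<bullet> y) / 2)"
  have "(\<Prod>i=1..k. ennreal_powr (\<integral>\<^sup>+ x. ennreal (?f i x) \<partial>lebesgue_measure_on (E i)) (c i))
         \<le> ennreal (exp D) * (\<Prod>j=1..m. ennreal_powr (\<integral>\<^sup>+ y. ennreal (?g j y) \<partial>lebesgue_measure_on (F j)) (d j))"
  proof (rule assms[unfolded admissible_for_def, rule_format])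
    show "centered_gaussian_on (E i) (?f i)" if "i \<in> {1..k}" for i
      using P that by (intro centered_gaussian_on_posdef E_subspace) auto
    show "centered_gaussian_on (F j) (?g j)" if "j \<in> {1..m}" for j
      using R that by (intro centered_gaussian_on_posdef F_subspace) auto
    fix x assume "x \<in> XE"
    then have "0 \<le> Q P R x x" using Q by blast
    then show "(\<Prod>i=1..k. ?f i (x i) powr c i) \<le> (\<Prod>j=1..m. ?g j (M j x) powr d j)"
      unfolding pt by (simp add: bl_form_def)
  qed
  moreover have "(\<Prod>i=1..k. ennreal_powr (\<integral>\<^sup>+ x. ennreal (?f i x) \<partial>lebesgue_measure_on (E i)) (c i))
    = (\<Prod>i=1..k. ennreal_powr (ennreal (Zg (E i) (P i))) (c i))"
    using P E_subspace by (intro prod.cong refl arg_cong2[where f = ennreal_powr] nn_integral_gaussian_Zg) auto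
  moreover have "(\<Prod>j=1..m. ennreal_powr (\<integral>\<^sup>+ y. ennreal (?g j y) \<partial>lebesgue_measure_on (F j)) (d j))
    = (\<Prod>j=1..m. ennreal_powr (ennreal (Zg (F j) (R j))) (d j))"
    using R F_subspace by (intro prod.cong refl arg_cong2[where f = ennreal_powr] nn_integral_gaussian_Zg) auto
  moreover have "(\<Prod>i=1..k. ennreal_powr (ennreal (Zg (E i) (P i))) (c i)) = ennreal (exp (\<Sum>i=1..k. c i * ln (Zg (E i) (P i))))"
    using P E_subspace by (intro gaussian_prod Zg_pos) auto
  moreover have "(\<Prod>j=1..m. ennreal_powr (ennreal (Zg (F j) (R j))) (d j)) = ennreal (exp (\<Sum>j=1..m. d j * ln (Zg (F j) (R j))))"
    using R F_subspace by (intro gaussian_prod Zg_pos) auto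
  ultimately have "ennreal (exp (\<Sum>i=1..k. c i * ln (Zg (E i) (P i)))) \<le> ennreal (exp (D + (\<Sum>j=1..m. d j * ln (Zg (F j) (R j)))))"
    by (simp add: exp_add ennreal_mult)
  then show "Phi P R \<le> D" by (simp add: Phi_def algebra_simps)
qed

text \<open>The circle closes: a Gaussian bound gives the functional inequality, which contains its
  Gaussian case, which returns the Gaussian bound. Both constants are therefore infima of the same
  set.\<close>

lemma admissible_iff:
  "admissible_for nonneg_measurable_on nonneg_measurable_on D \<longleftrightarrow> gauss_bound D"
  "admissible_for centered_gaussian_on centered_gaussian_on D \<longleftrightarrow> gauss_bound D"
  using gauss_bound_imp_admissible admissible_gaussian admissible_gaussian_imp_gauss_bound by blast+

lemma bl_D_eq: "bl_D k c E m d F B = Inf {ereal D | D. gauss_bound D}"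
  and bl_Dg_eq: "bl_Dg k c E m d F B = Inf {ereal D | D. gauss_bound D}"
  unfolding bl_D_def bl_Dg_def brascamp_lieb_const_eq admissible_iff by (rule refl)+

text \<open>The value of \<open>Phi\<close> at any single admissible tuple lies below every bound,
  and \<open>Dom_nonempty\<close> provides such a tuple.\<close>

lemma gauss_bounds_bounded_below: "- \<infinity> < Inf {ereal D | D. gauss_bound D}"
proof -
  obtain P R where "formsD P R" using Dom_nonempty by (auto simp: Dom_def)
  then have "ereal (Phi P R) \<le> Inf {ereal D | D. gauss_bound D}"
    by (intro Inf_greatest) (auto intro: gauss_bound_formsD)
  then show ?thesis by (rule less_le_trans[rotated]) simp
qed

end

text \<open>\<open>B'\<close> is any family in duality with \<open>B\<close> on the given subspaces
  rather than \<open>dual_maps E B\<close> itself, so that the locale can be instantiated again with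
  the two data exchanged.\<close>

locale bl_dual_pair = bl_datum k c E m d F B + dual: bl_datum m d F k c E B'
  for k c and E :: "nat \<Rightarrow> 'a::euclidean_space set" and m d and F :: "nat \<Rightarrow> 'b::euclidean_space set" and B B' +
  assumes pairing: "i \<in> {1..k} \<Longrightarrow> j \<in> {1..m} \<Longrightarrow> x \<in> E i \<Longrightarrow> y \<in> F j \<Longrightarrow> B i j x \<bullet> y = x \<bullet> B' j i y"
begin

lemma bl_map_pairing:
  assumes x: "x \<in> XE" and y: "y \<in> dual.XE"
  shows "(\<Sum>j=1..m. d j * (y j \<bullet> M j x)) = (\<Sum>i=1..k. c i * (x i \<bullet> dual.M i y))"
proof -
  have "(\<Sum>j=1..m. d j * (y j \<bullet> M j x)) = (\<Sum>j=1..m. \<Sum>i=1..k. d j * (c i * (B i j (x i) \<bullet> y j)))"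
    by (simp add: bl_map_def inner_sum_right sum_distrib_left inner_commute)
  also have "\<dots> = (\<Sum>i=1..k. \<Sum>j=1..m. d j * (c i * (B i j (x i) \<bullet> y j)))" by (rule sum.swap)
  also have "\<dots> = (\<Sum>i=1..k. \<Sum>j=1..m. c i * (d j * (x i \<bullet> B' j i (y j))))"
  proof (intro sum.cong refl)
    fix i j assume "i \<in> {1..k}" "j \<in> {1..m}"
    then show "d j * (c i * (B i j (x i) \<bullet> y j)) = c i * (d j * (x i \<bullet> B' j i (y j)))"
      using pairing XE_D[OF x] dual.XE_D[OF y] by simp
  qed
  also have "\<dots> = (\<Sum>i=1..k. c i * (x i \<bullet> dual.M i y))"
    by (simp add: bl_map_def inner_sum_right sum_distrib_left)
  finally show ?thesis .
qed

text \<open>With \<open>y j\<close> the image of \<open>M j x\<close> under \<open>S j\<close>, the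
  subtracted part \<open>N\<close> equals the pairing of \<open>x\<close> with the dual image of
  \<open>y\<close>. Completing the square bounds \<open>2 * N\<close> by the \<open>A\<close>-part
  at \<open>x\<close> plus the \<open>P\<close>-part at that image, and the hypothesis bounds the
  latter by \<open>N\<close> again.\<close>

lemma dual_form_nonneg:
  assumes P: "\<And>i. i \<in> {1..k} \<Longrightarrow> posdef_on (E i) (P i)" "\<And>i. i \<in> {1..k} \<Longrightarrow> inverse_on (E i) (P i) (A i)"
    and R: "\<And>j. j \<in> {1..m} \<Longrightarrow> inverse_on (F j) (R j) (S j)"
    and Q: "\<And>y. y \<in> dual.XE \<Longrightarrow> 0 \<le> dual.Q R P y y" and x: "x \<in> XE"
  shows "0 \<le> Q A S x x"
proof -
  define y where "y j = S j (M j x)" for j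
  have yF: "y j \<in> F j" "R j (y j) = M j x" if "j \<in> {1..m}" for j
    using R[OF that] M_in[OF x that] by (auto simp: y_def inverse_on_def)
  have y: "y \<in> dual.XE" using yF by (auto simp: dual.XE_def)
  define N where "N = (\<Sum>j=1..m. d j * (S j (M j x) \<bullet> M j x))"
  have N: "N = (\<Sum>i=1..k. c i * (x i \<bullet> dual.M i y))"
    unfolding N_def bl_map_pairing[OF x y, symmetric] by (simp add: y_def)
  have "2 * (\<Sum>i=1..k. c i * (x i \<bullet> dual.M i y)) \<le> (\<Sum>i=1..k. c i * (A i (x i) \<bullet> x i)) + (\<Sum>i=1..k. c i * (P i (dual.M i y) \<bullet> dual.M i y))"
    unfolding sum_distrib_left sum.distrib[symmetric]
  proof (rule sum_mono)
    fix i assume i: "i \<in> {1..k}"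
    let ?w = "dual.M i y"
    have w: "?w \<in> E i" by (rule dual.M_in[OF y i])
    have Ax: "A i (x i) \<in> E i" "P i (A i (x i)) = x i" using P(2)[OF i] XE_D[OF x i] by (auto simp: inverse_on_def)
    have "0 \<le> P i (?w - A i (x i)) \<bullet> (?w - A i (x i))"
      by (rule posdef_on_nonneg[OF P(1)[OF i]]) (rule subspace_diff[OF E_subspace[OF i] w Ax(1)])
    also have "\<dots> = P i ?w \<bullet> ?w - P i ?w \<bullet> A i (x i) - x i \<bullet> ?w + A i (x i) \<bullet> x i"
      by (simp add: blinfun.diff_right inner_diff_left inner_diff_right Ax(2) inner_commute[of "x i" "A i (x i)"])
    also have "P i ?w \<bullet> A i (x i) = x i \<bullet> ?w"
      using posdef_onD(1)[OF P(1)[OF i]] Ax(2) by (metis inner_commute selfadj_def)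
    finally have "2 * (x i \<bullet> ?w) \<le> A i (x i) \<bullet> x i + P i ?w \<bullet> ?w" by simp
    then have "c i * (2 * (x i \<bullet> ?w)) \<le> c i * (A i (x i) \<bullet> x i + P i ?w \<bullet> ?w)"
      using c_pos[OF i] by (intro mult_left_mono) auto
    then show "2 * (c i * (x i \<bullet> ?w)) \<le> c i * (A i (x i) \<bullet> x i) + c i * (P i ?w \<bullet> ?w)" by (simp add: algebra_simps)
  qed
  moreover have "(\<Sum>i=1..k. c i * (P i (dual.M i y) \<bullet> dual.M i y)) \<le> N"
  proof -
    have "(\<Sum>j=1..m. d j * (R j (y j) \<bullet> y j)) = N"
      unfolding N_def using yF(2) by (intro sum.cong refl) (simp add: y_def inner_commute)
    then show ?thesis using Q[OF y] by (simp add: bl_form_def)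
  qed
  ultimately have "N \<le> (\<Sum>i=1..k. c i * (A i (x i) \<bullet> x i))" unfolding N[symmetric] by linarith
  then show ?thesis by (simp add: bl_form_def N_def)
qed

lemma dual_gauss_bound:
  assumes D: "gauss_bound D"
  shows "dual.gauss_bound D"
  unfolding dual.gauss_bound_def
proof (intro allI impI)
  fix R :: "nat \<Rightarrow> 'b \<Rightarrow>\<^sub>L 'b" and P :: "nat \<Rightarrow> 'a \<Rightarrow>\<^sub>L 'a"
  assume R: "\<forall>j\<in>{1..m}. posdef_on (F j) (R j)" and P: "\<forall>i\<in>{1..k}. posdef_on (E i) (P i)"
    and Q: "\<forall>y\<in>dual.XE. 0 \<le> dual.Q R P y y"
  \<comment> \<open>Inverses require operators that preserve the subspaces, which
    \<open>posdef_on\<close> does not provide; compression changes neither the forms there nor the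
    Gaussian integrals.\<close>
  let ?P = "\<lambda>i. compress (E i) (P i)" and ?R = "\<lambda>j. compress (F j) (R j)"
  have "\<exists>A. posdef_on (E i) (?P i) \<and> inverse_on (E i) (?P i) A \<and> posdef_on (E i) A \<and> Zg (E i) (?P i) = Zg (E i) (P i)"
    if i: "i \<in> {1..k}" for i using posdef_on_inverse_compress[OF E_subspace[OF i], of "P i"] P i by blast
  then obtain A where A: "\<And>i. i \<in> {1..k} \<Longrightarrow> posdef_on (E i) (?P i)" "\<And>i. i \<in> {1..k} \<Longrightarrow> inverse_on (E i) (?P i) (A i)"
    "\<And>i. i \<in> {1..k} \<Longrightarrow> posdef_on (E i) (A i)" "\<And>i. i \<in> {1..k} \<Longrightarrow> Zg (E i) (?P i) = Zg (E i) (P i)" by metis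
  have "\<exists>A. posdef_on (F j) (?R j) \<and> inverse_on (F j) (?R j) A \<and> posdef_on (F j) A \<and> Zg (F j) (?R j) = Zg (F j) (R j)"
    if j: "j \<in> {1..m}" for j using posdef_on_inverse_compress[OF F_subspace[OF j], of "R j"] R j by blast
  then obtain S where S: "\<And>j. j \<in> {1..m} \<Longrightarrow> posdef_on (F j) (?R j)" "\<And>j. j \<in> {1..m} \<Longrightarrow> inverse_on (F j) (?R j) (S j)"
    "\<And>j. j \<in> {1..m} \<Longrightarrow> posdef_on (F j) (S j)" "\<And>j. j \<in> {1..m} \<Longrightarrow> Zg (F j) (?R j) = Zg (F j) (R j)" by metis
  have "0 \<le> Q A S x x" if "x \<in> XE" for x
  proof (rule dual_form_nonneg[OF A(1,2) S(2) _ that])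
    fix y assume y: "y \<in> dual.XE"
    have "dual.Q ?R ?P y y = dual.Q R P y y"
      unfolding bl_form_def
    proof (intro arg_cong2[where f = "(-)"] sum.cong refl)
      show "d j * (?R j (y j) \<bullet> y j) = d j * (R j (y j) \<bullet> y j)" if "j \<in> {1..m}" for j
        using compress_form[OF F_subspace[OF that]] dual.XE_D[OF y that] by simp
      show "c i * (?P i (dual.M i y) \<bullet> dual.M i y) = c i * (P i (dual.M i y) \<bullet> dual.M i y)" if "i \<in> {1..k}" for i
        using compress_form[OF E_subspace[OF that]] dual.M_in[OF y that] by simp
    qed
    then show "0 \<le> dual.Q ?R ?P y y" using Q y by simp
  qed
  then have "Phi A S \<le> D" using D A(3) S(3) unfolding gauss_bound_def by blast
  moreover have "Phi A S = dual.Phi R P"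
  proof -
    have "(\<Sum>i=1..k. c i * ln (Zg (E i) (A i))) = (\<Sum>i=1..k. (c i * real (dim (E i))) * ln (2 * pi)) - (\<Sum>i=1..k. c i * ln (Zg (E i) (P i)))"
      unfolding sum_subtractf[symmetric]
    proof (intro sum.cong refl)
      fix i assume i: "i \<in> {1..k}"
      show "c i * ln (Zg (E i) (A i)) = (c i * real (dim (E i))) * ln (2 * pi) - c i * ln (Zg (E i) (P i))"
        unfolding ln_Zg_inverse[OF E_subspace[OF i] A(1)[OF i] A(3)[OF i] A(2)[OF i]] A(4)[OF i] by (simp add: right_diff_distrib)
    qed
    moreover have "(\<Sum>j=1..m. d j * ln (Zg (F j) (S j))) = (\<Sum>j=1..m. (d j * real (dim (F j))) * ln (2 * pi)) - (\<Sum>j=1..m. d j * ln (Zg (F j) (R j)))"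
      unfolding sum_subtractf[symmetric]
    proof (intro sum.cong refl)
      fix j assume j: "j \<in> {1..m}"
      show "d j * ln (Zg (F j) (S j)) = (d j * real (dim (F j))) * ln (2 * pi) - d j * ln (Zg (F j) (R j))"
        unfolding ln_Zg_inverse[OF F_subspace[OF j] S(1)[OF j] S(3)[OF j] S(2)[OF j]] S(4)[OF j] by (simp add: right_diff_distrib)
    qed
    moreover have "(\<Sum>i=1..k. (c i * real (dim (E i))) * ln (2 * pi)) = (\<Sum>j=1..m. (d j * real (dim (F j))) * ln (2 * pi))"
      unfolding sum_distrib_right[symmetric] dims ..
    ultimately show ?thesis unfolding Phi_def dual.Phi_def by linarith
  qed
  ultimately show "dual.Phi R P \<le> D" by simp
qed

end

lemma linear_adjoint_on:
  assumes S: "subspace S" and B: "linear B"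
  shows "linear (adjoint_on S B)"
proof (rule linearI)
  note w = adjoint_on_works[OF S B]
  have eqI: "u = v" if uv: "u \<in> S" "v \<in> S" "\<And>x. x \<in> S \<Longrightarrow> x \<bullet> u = x \<bullet> v" for u v
  proof -
    have "(u - v) \<bullet> (u - v) = 0" using uv(3)[OF subspace_diff[OF S uv(1,2)]] by (simp add: inner_diff_right)
    then show ?thesis by simp
  qed
  show "adjoint_on S B (x + y) = adjoint_on S B x + adjoint_on S B y" for x y
  proof (rule eqI)
    fix z assume z: "z \<in> S"
    have "z \<bullet> adjoint_on S B v = B z \<bullet> v" for v using w[of v] z by simp
    then show "z \<bullet> adjoint_on S B (x + y) = z \<bullet> (adjoint_on S B x + adjoint_on S B y)" by (simp add: inner_add_right)
  qed (use w S in \<open>auto simp: subspace_add\<close>)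
  show "adjoint_on S B (r *\<^sub>R x) = r *\<^sub>R adjoint_on S B x" for r x
  proof (rule eqI)
    fix z assume z: "z \<in> S"
    have "z \<bullet> adjoint_on S B v = B z \<bullet> v" for v using w[of v] z by simp
    then show "z \<bullet> adjoint_on S B (r *\<^sub>R x) = z \<bullet> (r *\<^sub>R adjoint_on S B x)" by simp
  qed (use w S in \<open>auto simp: subspace_scale\<close>)
qed

lemma brascamp_lieb_datum_dual:
  assumes "brascamp_lieb_datum k c E m d F B"
  shows "brascamp_lieb_datum m d F k c E (dual_maps E B)"
proof -
  interpret bl_datum k c E m d F B by (rule bl_datum.intro[OF assms])
  show ?thesis
    unfolding brascamp_lieb_datum_def dual_maps_def
  proof (intro conjI ballI image_subsetI)
    show "linear (adjoint_on (E i) (B i j))" if "j \<in> {1..m}" "i \<in> {1..k}" for i j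
      by (rule linear_adjoint_on[OF E_subspace B_linear]) (use that in auto)
    show "adjoint_on (E i) (B i j) y \<in> E i" if "j \<in> {1..m}" "i \<in> {1..k}" for i j y
      by (rule conjunct1[OF adjoint_on_works[OF E_subspace B_linear]]) (use that in auto)
    show "(\<Sum>i=1..m. d i * real (dim (F i))) = (\<Sum>j=1..k. c j * real (dim (E j)))" by (rule dims[symmetric])
  qed (rule E_subspace F_subspace c_pos d_pos, assumption)+
qed

theorem theorem1p3:
  fixes k m :: nat and c d :: "nat \<Rightarrow> real"
    and E :: "nat \<Rightarrow> 'a::euclidean_space set"
    and F :: "nat \<Rightarrow> 'b::euclidean_space set"
    and B :: "nat \<Rightarrow> nat \<Rightarrow> 'a \<Rightarrow> 'b"
  assumes "brascamp_lieb_datum k c E m d F B"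
  shows "bl_D k c E m d F B = bl_Dg k c E m d F B \<and>
         bl_D m d F k c E (dual_maps E B) = bl_Dg m d F k c E (dual_maps E B) \<and>
         bl_D k c E m d F B = bl_D m d F k c E (dual_maps E B) \<and>
         - \<infinity> < bl_D k c E m d F B"
proof -
  interpret P: bl_datum k c E m d F B by (rule bl_datum.intro[OF assms])
  interpret D: bl_datum m d F k c E "dual_maps E B" by (rule bl_datum.intro[OF brascamp_lieb_datum_dual[OF assms]])
  have pair: "B i j x \<bullet> y = x \<bullet> dual_maps E B j i y" if "i \<in> {1..k}" "j \<in> {1..m}" "x \<in> E i" for i j x y
    using adjoint_on_works[OF P.E_subspace P.B_linear] that by (simp add: dual_maps_def)
  have 1: "bl_dual_pair k c E m d F B (dual_maps E B)"
  proof (rule bl_dual_pair.intro[OF P.bl_datum_axioms D.bl_datum_axioms bl_dual_pair_axioms.intro])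
    show "B i j x \<bullet> y = x \<bullet> dual_maps E B j i y" if "i \<in> {1..k}" "j \<in> {1..m}" "x \<in> E i" for i j x y
      by (rule pair[OF that])
  qed
  \<comment> \<open>The exchanged instance yields the converse implication between the two Gaussian
    bounds.\<close>
  have 2: "bl_dual_pair m d F k c E (dual_maps E B) B"
  proof (rule bl_dual_pair.intro[OF D.bl_datum_axioms P.bl_datum_axioms bl_dual_pair_axioms.intro])
    show "dual_maps E B j i y \<bullet> x = y \<bullet> B i j x" if "j \<in> {1..m}" "i \<in> {1..k}" "x \<in> E i" for i j x y
      unfolding inner_commute[of _ x] inner_commute[of y] by (rule pair[OF that(2,1,3), symmetric])
  qed
  have "P.gauss_bound D \<longleftrightarrow> D.gauss_bound D" for D
    using bl_dual_pair.dual_gauss_bound[OF 1] bl_dual_pair.dual_gauss_bound[OF 2] by blast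
  then show ?thesis
    using P.gauss_bounds_bounded_below unfolding P.bl_D_eq P.bl_Dg_eq D.bl_D_eq D.bl_Dg_eq by simp
qed

end
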